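(* Let $(S,\mathfrak n,l)$ be a local ring, and let $M$ and $N$ be finitely generated $S$-modules such that $\operatorname{pd}_S(N)$ is infinite. Let $m$ and $n$ be integers with $m\geq 1$, and assume that there is an exact sequence of $S$-module homomorphisms $0\to l^{n}\to M\xrightarrow{\tau} l^{m}\to 0$ and that $\operatorname{Tor}_{i}^{S}(N,M)=0$ for all $i\geq 1$. Set $r=n/m$. (a) If $M\cong\operatorname{Hom}_S(N,N\otimes_SM)$, then $\beta^S_1(N)<\beta^S_0(N)r$. (b) Assume that $\operatorname{Ext}^1_S(N,N\otimes_SM)=0$ and $\operatorname{length}_S(\operatorname{Hom}_S(N,N\otimes_SM))=\operatorname{length}_S(M)$. Then (for one of the two choices of sign) $$\beta^S_1(N)=\tfrac{1}{2}\left[\beta^S_0(N)(r+1)\pm\sqrt{\beta^S_0(N)^2(r+1)^2-4(\beta^S_0(N)^2-1)(r+1)}\right]=\tfrac{1}{2}\left[\beta^S_0(N)(r+1)\pm\sqrt{(r+1)[\beta^S_0(N)^2(r-3)+4]}\right].$$ In particular, the integer $\beta^S_0(N)^2(r+1)^2-4(\beta^S_0(N)^2-1)(r+1)=(r+1)[\beta^S_0(N)^2(r-3)+4]$ is a perfect square. (c) If $S$ is Cohen-Macaulay with canonical module $\omega_S$, $N=\omega_S\ncong S$ and $M\in\mathcal{A}(S)$, then $$\beta^S_1(\omega_S)=\beta^S_0(\omega_S)(r^2-1)/r \qquad\text{and}\qquad r=\frac{\beta^S_1(\omega_S)+\sqrt{\beta^S_1(\omega_S)^2+4\beta^S_0(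\omega_S)^2}}{2\beta^S_0(\omega_S)}.$$
   Context: All local rings are commutative and noetherian; $(S,\mathfrak n,l)$ denotes a local ring with maximal ideal $\mathfrak n$ and residue field $l$. For a finitely generated $S$-module $N$, $\beta_i^S(N)=\dim_l\operatorname{Tor}_i^S(N,l)$ is the $i$th Betti number, and $\operatorname{pd}_S(N)$ is the projective dimension. A finitely generated $S$-module $\omega_S$ is a canonical module for $S$ if $\operatorname{Ext}^i_S(l,\omega_S)\cong l$ for $i=\dim(S)$ and $\operatorname{Ext}^i_S(l,\omega_S)=0$ for $i\neq\dim(S)$. For a Cohen-Macaulay local ring $S$ with canonical module $\omega_S$, the Auslander class $\mathcal A(S)$ consists of all $S$-modules $M$ such that (i) the natural map $M\to\operatorname{Hom}_S(\omega_S,\omega_S\otimes_SM)$, $x\mapsto(w\mapsto w\otimes x)$, is an isomorphism, and (ii) $\operatorname{Tor}^S_i(\omega_S,M)=0=\operatorname{Ext}^i_S(\omega_S,\omega_S\otimes_SM)$ for all $i\geq 1$. *)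

theory Defs
  imports Complex_Main "HOL-Library.Extended_Nat" "HOL-Algebra.Module" "HOL-Algebra.QuotRing"
    "HOL-Algebra.Ring_Divisibility"
begin

section \<open>Modules\<close>

text \<open>
  The record \<^typ>\<open>('a, 'b) module\<close> extends \<^typ>\<open>'b ring\<close>; its fields
  \<open>mult\<close> and \<open>one\<close> have no meaning for a module and are left \<^const>\<open>undefined\<close>.
\<close>

definition zero_module :: "('a, 'b, 'm) module_scheme \<Rightarrow> bool"
  where "zero_module M \<longleftrightarrow> carrier M = {\<zero>\<^bsub>M\<^esub>}"

definition lin_hom ::
    "('a, 'r) ring_scheme \<Rightarrow> ('a, 'b, 'm) module_scheme \<Rightarrow> ('a, 'c, 'n) module_scheme \<Rightarrow> ('b \<Rightarrow> 'c) set"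
  where "lin_hom R M N =
    {f \<in> carrier M \<rightarrow> carrier N.
      (\<forall>x \<in> carrier M. \<forall>y \<in> carrier M. f (x \<oplus>\<^bsub>M\<^esub> y) = f x \<oplus>\<^bsub>N\<^esub> f y) \<and>
      (\<forall>a \<in> carrier R. \<forall>x \<in> carrier M. f (a \<odot>\<^bsub>M\<^esub> x) = a \<odot>\<^bsub>N\<^esub> f x)}"

definition lin_isomorphic ::
    "('a, 'r) ring_scheme \<Rightarrow> ('a, 'b, 'm) module_scheme \<Rightarrow> ('a, 'c, 'n) module_scheme \<Rightarrow> bool"
  where "lin_isomorphic R M N \<longleftrightarrow> (\<exists>f \<in> lin_hom R M N. bij_betw f (carrier M) (carrier N))"

definition lin_kernel :: "('a, 'b, 'm) module_scheme \<Rightarrow> ('a, 'c, 'n) module_scheme \<Rightarrow> ('b \<Rightarrow> 'c) \<Rightarrow> 'b set"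
  where "lin_kernel M N f = {x \<in> carrier M. f x = \<zero>\<^bsub>N\<^esub>}"

definition short_exact ::
    "('a, 'r) ring_scheme \<Rightarrow> ('a, 'b, 'm) module_scheme \<Rightarrow> ('b \<Rightarrow> 'c) \<Rightarrow> ('a, 'c, 'n) module_scheme
      \<Rightarrow> ('c \<Rightarrow> 'd) \<Rightarrow> ('a, 'd, 'k) module_scheme \<Rightarrow> bool"
  where "short_exact R A f B g C \<longleftrightarrow>
    f \<in> lin_hom R A B \<and> g \<in> lin_hom R B C \<and>
    inj_on f (carrier A) \<and> f ` carrier A = lin_kernel B C g \<and> g ` carrier B = carrier C"

definition gen_submodule ::
    "('a, 'r) ring_scheme \<Rightarrow> ('a, 'b, 'm) module_scheme \<Rightarrow> 'b set \<Rightarrow> 'b set"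
  where "gen_submodule R M A = \<Inter>{U. submodule U R M \<and> A \<subseteq> U}"

definition fg_module :: "('a, 'r) ring_scheme \<Rightarrow> ('a, 'b, 'm) module_scheme \<Rightarrow> bool"
  where "fg_module R M \<longleftrightarrow> Module.module R M \<and>
    (\<exists>A. finite A \<and> A \<subseteq> carrier M \<and> gen_submodule R M A = carrier M)"

definition module_length :: "('a, 'r) ring_scheme \<Rightarrow> ('a, 'b, 'm) module_scheme \<Rightarrow> enat"
  where "module_length R M =
    Sup {enat k |k. \<exists>U. (\<forall>i\<le>k. submodule (U i) R M) \<and> (\<forall>i<k. U i \<subset> U (Suc i))}"

definition ring_module :: "('a, 'r) ring_scheme \<Rightarrow> ('a, 'a) module"
  where "ring_module R =
    \<lparr>carrier = carrier R,
     monoid.mult = undefined, monoid.one = undefined,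
     ring.zero = \<zero>\<^bsub>R\<^esub>, ring.add = ring.add R,
     smult = (\<otimes>\<^bsub>R\<^esub>)\<rparr>"

text \<open>The elements of the quotient module are the cosets; the union below is over representatives.\<close>

definition quot_module :: "('a, 'b, 'm) module_scheme \<Rightarrow> 'b set \<Rightarrow> ('a, 'b set) module"
  where "quot_module M U =
    \<lparr>carrier = a_rcosets\<^bsub>M\<^esub> U,
     monoid.mult = undefined, monoid.one = undefined,
     ring.zero = U, ring.add = set_add M,
     smult = (\<lambda>a X. \<Union>x\<in>X. U +>\<^bsub>M\<^esub> (a \<odot>\<^bsub>M\<^esub> x))\<rparr>"

definition direct_power :: "('a, 'b, 'm) module_scheme \<Rightarrow> nat \<Rightarrow> ('a, nat \<Rightarrow> 'b) module"
  where "direct_power M k =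
    \<lparr>carrier = {..<k} \<rightarrow>\<^sub>E carrier M,
     monoid.mult = undefined, monoid.one = undefined,
     ring.zero = (\<lambda>i\<in>{..<k}. \<zero>\<^bsub>M\<^esub>), ring.add = (\<lambda>f g. \<lambda>i\<in>{..<k}. f i \<oplus>\<^bsub>M\<^esub> g i),
     smult = (\<lambda>a f. \<lambda>i\<in>{..<k}. a \<odot>\<^bsub>M\<^esub> f i)\<rparr>"

definition free_module :: "('a, 'r) ring_scheme \<Rightarrow> 'x set \<Rightarrow> ('a, 'x \<Rightarrow> 'a) module"
  where "free_module R X =
    \<lparr>carrier = {f \<in> X \<rightarrow>\<^sub>E carrier R. finite {x \<in> X. f x \<noteq> \<zero>\<^bsub>R\<^esub>}},
     monoid.mult = undefined, monoid.one = undefined,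
     ring.zero = (\<lambda>x\<in>X. \<zero>\<^bsub>R\<^esub>), ring.add = (\<lambda>f g. \<lambda>x\<in>X. f x \<oplus>\<^bsub>R\<^esub> g x),
     smult = (\<lambda>a f. \<lambda>x\<in>X. a \<otimes>\<^bsub>R\<^esub> f x)\<rparr>"

definition free_gen :: "('a, 'r) ring_scheme \<Rightarrow> 'x set \<Rightarrow> 'x \<Rightarrow> ('x \<Rightarrow> 'a)"
  where "free_gen R X x = (\<lambda>y\<in>X. if y = x then \<one>\<^bsub>R\<^esub> else \<zero>\<^bsub>R\<^esub>)"

text \<open>Homomorphisms are made extensional so that they are determined by their values on \<open>M\<close>.\<close>

definition Hom_module ::
    "('a, 'r) ring_scheme \<Rightarrow> ('a, 'b, 'm) module_scheme \<Rightarrow> ('a, 'c, 'n) module_scheme \<Rightarrow> ('a, 'b \<Rightarrow> 'c) module"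
  where "Hom_module R M N =
    \<lparr>carrier = lin_hom R M N \<inter> extensional (carrier M),
     monoid.mult = undefined, monoid.one = undefined,
     ring.zero = (\<lambda>x\<in>carrier M. \<zero>\<^bsub>N\<^esub>), ring.add = (\<lambda>f g. \<lambda>x\<in>carrier M. f x \<oplus>\<^bsub>N\<^esub> g x),
     smult = (\<lambda>a f. \<lambda>x\<in>carrier M. a \<odot>\<^bsub>N\<^esub> f x)\<rparr>"

subsection \<open>Tensor products\<close>

definition tensor_rels ::
    "('a, 'r) ring_scheme \<Rightarrow> ('a, 'b, 'm) module_scheme \<Rightarrow> ('a, 'c, 'n) module_scheme \<Rightarrow> ('b \<times> 'c \<Rightarrow> 'a) set"
  where "tensor_rels R M N =
    (let X = carrier M \<times> carrier N; F = free_module R X; e = free_gen R X in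
      {e (x \<oplus>\<^bsub>M\<^esub> x', y) \<ominus>\<^bsub>F\<^esub> (e (x, y) \<oplus>\<^bsub>F\<^esub> e (x', y)) |x x' y.
          x \<in> carrier M \<and> x' \<in> carrier M \<and> y \<in> carrier N} \<union>
      {e (x, y \<oplus>\<^bsub>N\<^esub> y') \<ominus>\<^bsub>F\<^esub> (e (x, y) \<oplus>\<^bsub>F\<^esub> e (x, y')) |x y y'.
          x \<in> carrier M \<and> y \<in> carrier N \<and> y' \<in> carrier N} \<union>
      {e (a \<odot>\<^bsub>M\<^esub> x, y) \<ominus>\<^bsub>F\<^esub> (a \<odot>\<^bsub>F\<^esub> e (x, y)) |a x y.
          a \<in> carrier R \<and> x \<in> carrier M \<and> y \<in> carrier N} \<union>
      {e (x, a \<odot>\<^bsub>N\<^esub> y) \<ominus>\<^bsub>F\<^esub> (a \<odot>\<^bsub>F\<^esub> e (x, y)) |a x y.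
          a \<in> carrier R \<and> x \<in> carrier M \<and> y \<in> carrier N})"

definition tensor_kernel ::
    "('a, 'r) ring_scheme \<Rightarrow> ('a, 'b, 'm) module_scheme \<Rightarrow> ('a, 'c, 'n) module_scheme \<Rightarrow> ('b \<times> 'c \<Rightarrow> 'a) set"
  where "tensor_kernel R M N =
    gen_submodule R (free_module R (carrier M \<times> carrier N)) (tensor_rels R M N)"

definition tensor ::
    "('a, 'r) ring_scheme \<Rightarrow> ('a, 'b, 'm) module_scheme \<Rightarrow> ('a, 'c, 'n) module_scheme
      \<Rightarrow> ('a, ('b \<times> 'c \<Rightarrow> 'a) set) module"
  where "tensor R M N =
    quot_module (free_module R (carrier M \<times> carrier N)) (tensor_kernel R M N)"

definition pure_tensor ::
    "('a, 'r) ring_scheme \<Rightarrow> ('a, 'b, 'm) module_scheme \<Rightarrow> ('a, 'c, 'n) module_scheme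
      \<Rightarrow> 'b \<Rightarrow> 'c \<Rightarrow> ('b \<times> 'c \<Rightarrow> 'a) set"
  where "pure_tensor R M N x y =
    (let X = carrier M \<times> carrier N
     in tensor_kernel R M N +>\<^bsub>free_module R X\<^esub> free_gen R X (x, y))"

text \<open>
  For linear \<open>f : M \<rightarrow> M'\<close> this is \<open>f \<otimes> id : M \<otimes> N \<rightarrow> M' \<otimes> N\<close>; it is unique because the pure
  tensors generate \<open>M \<otimes> N\<close> and the function is extensional.
\<close>

definition tensor_map ::
    "('a, 'r) ring_scheme \<Rightarrow> ('a, 'b, 'm) module_scheme \<Rightarrow> ('a, 'd, 'k) module_scheme
      \<Rightarrow> ('a, 'c, 'n) module_scheme \<Rightarrow> ('b \<Rightarrow> 'd)
      \<Rightarrow> ('b \<times> 'c \<Rightarrow> 'a) set \<Rightarrow> ('d \<times> 'c \<Rightarrow> 'a) set"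
  where "tensor_map R M M' N f =
    (THE h. h \<in> carrier (Hom_module R (tensor R M N) (tensor R M' N)) \<and>
      (\<forall>x \<in> carrier M. \<forall>y \<in> carrier N.
        h (pure_tensor R M N x y) = pure_tensor R M' N (f x) y))"


section \<open>Resolutions, Tor and Ext\<close>

text \<open>\<open>\<dots> \<rightarrow> P\<^sub>2 \<rightarrow> P\<^sub>1 \<rightarrow> P\<^sub>0 \<rightarrow> N \<rightarrow> 0\<close> is exact, with \<open>d i : P (i + 1) \<rightarrow> P i\<close> and \<open>\<epsilon> : P 0 \<rightarrow> N\<close>.\<close>

definition resolution ::
    "('a, 'r) ring_scheme \<Rightarrow> (nat \<Rightarrow> ('a, 'p) module) \<Rightarrow> (nat \<Rightarrow> 'p \<Rightarrow> 'p) \<Rightarrow> ('p \<Rightarrow> 'b)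
      \<Rightarrow> ('a, 'b, 'm) module_scheme \<Rightarrow> bool"
  where "resolution R P d \<epsilon> N \<longleftrightarrow>
    (\<forall>i. Module.module R (P i)) \<and>
    (\<forall>i. d i \<in> lin_hom R (P (Suc i)) (P i)) \<and>
    \<epsilon> \<in> lin_hom R (P 0) N \<and>
    \<epsilon> ` carrier (P 0) = carrier N \<and>
    d 0 ` carrier (P 1) = lin_kernel (P 0) N \<epsilon> \<and>
    (\<forall>i. d (Suc i) ` carrier (P (Suc (Suc i))) = lin_kernel (P (Suc i)) (P i) (d i))"

text \<open>
  A module is projective iff it is a direct summand of a free module.  Indexing the free modules
  by subsets of the type of \<open>P\<close> loses nothing: a projective module is a summand of the free
  module on its own elements.
\<close>

definition projective_module :: "('a, 'r) ring_scheme \<Rightarrow> ('a, 'p, 'm) module_scheme \<Rightarrow> bool"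
  where "projective_module R P \<longleftrightarrow> Module.module R P \<and>
    (\<exists>(X :: 'p set) s t. s \<in> lin_hom R P (free_module R X) \<and> t \<in> lin_hom R (free_module R X) P \<and>
      (\<forall>x \<in> carrier P. t (s x) = x))"

text \<open>
  Intended for a finitely generated module \<open>N\<close> over a noetherian ring \<open>R\<close>.  Then, by Schanuel's
  lemma, a finite projective resolution may be replaced by one of the same length whose terms are
  finitely generated, and every finitely generated projective module has an isomorphic copy inside
  some \<open>R\<^sup>k\<close>, that is, with elements of type \<^typ>\<open>nat \<Rightarrow> 'a\<close>.
  The infimum of the empty set is \<^term>\<open>\<infinity> :: enat\<close>.  The zero module gets dimension \<open>0\<close>.
\<close>

definition proj_dim :: "('a, 'r) ring_scheme \<Rightarrow> ('a, 'b, 'm) module_scheme \<Rightarrow> enat"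
  where "proj_dim R N =
    Inf {enat k |k. \<exists>(P :: nat \<Rightarrow> ('a, nat \<Rightarrow> 'a) module) d \<epsilon>.
      resolution R P d \<epsilon> N \<and> (\<forall>i. projective_module R (P i)) \<and> (\<forall>i>k. zero_module (P i))}"

text \<open>
  Tor and Ext are computed from a chosen resolution of the first argument by finitely generated
  free modules.  Such a resolution exists whenever the first argument is finitely generated and
  the ring is noetherian; the second argument is arbitrary.
\<close>

definition fg_free_resolution ::
    "('a, 'r) ring_scheme \<Rightarrow> ('a, 'b, 'm) module_scheme
      \<Rightarrow> (nat \<Rightarrow> nat) \<times> (nat \<Rightarrow> (nat \<Rightarrow> 'a) \<Rightarrow> (nat \<Rightarrow> 'a))"
  where "fg_free_resolution R N =
    (SOME (b, d). \<exists>\<epsilon>. resolution R (\<lambda>i. free_module R {..<b i}) d \<epsilon> N)"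

definition res_module ::
    "('a, 'r) ring_scheme \<Rightarrow> ('a, 'b, 'm) module_scheme \<Rightarrow> nat \<Rightarrow> ('a, nat \<Rightarrow> 'a) module"
  where "res_module R N i = free_module R {..<fst (fg_free_resolution R N) i}"

definition res_diff ::
    "('a, 'r) ring_scheme \<Rightarrow> ('a, 'b, 'm) module_scheme \<Rightarrow> nat \<Rightarrow> (nat \<Rightarrow> 'a) \<Rightarrow> (nat \<Rightarrow> 'a)"
  where "res_diff R N i = snd (fg_free_resolution R N) i"

text \<open>
  Homology of a chain complex with \<open>d i : C (i + 1) \<rightarrow> C i\<close>, and cohomology of a cochain complex
  with \<open>d i : C i \<rightarrow> C (i + 1)\<close>; a zero module is understood in degree \<open>-1\<close>.
\<close>

definition homology :: "(nat \<Rightarrow> ('a, 'p) module) \<Rightarrow> (nat \<Rightarrow> 'p \<Rightarrow> 'p) \<Rightarrow> nat \<Rightarrow> ('a, 'p set) module"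
  where "homology C d i =
    quot_module
      ((C i)\<lparr>carrier :=
        (case i of 0 \<Rightarrow> carrier (C 0) | Suc j \<Rightarrow> lin_kernel (C (Suc j)) (C j) (d j))\<rparr>)
      (d i ` carrier (C (Suc i)))"

definition cohomology :: "(nat \<Rightarrow> ('a, 'p) module) \<Rightarrow> (nat \<Rightarrow> 'p \<Rightarrow> 'p) \<Rightarrow> nat \<Rightarrow> ('a, 'p set) module"
  where "cohomology C d i =
    quot_module
      ((C i)\<lparr>carrier := lin_kernel (C i) (C (Suc i)) (d i)\<rparr>)
      (case i of 0 \<Rightarrow> {\<zero>\<^bsub>C 0\<^esub>} | Suc j \<Rightarrow> d j ` carrier (C j))"

definition Tor ::
    "('a, 'r) ring_scheme \<Rightarrow> nat \<Rightarrow> ('a, 'b, 'm) module_scheme \<Rightarrow> ('a, 'c, 'n) module_scheme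
      \<Rightarrow> ('a, ((nat \<Rightarrow> 'a) \<times> 'c \<Rightarrow> 'a) set set) module"
  where "Tor R i N M =
    homology
      (\<lambda>j. tensor R (res_module R N j) M)
      (\<lambda>j. tensor_map R (res_module R N (Suc j)) (res_module R N j) M (res_diff R N j)) i"

definition Ext ::
    "('a, 'r) ring_scheme \<Rightarrow> nat \<Rightarrow> ('a, 'b, 'm) module_scheme \<Rightarrow> ('a, 'c, 'n) module_scheme
      \<Rightarrow> ('a, ((nat \<Rightarrow> 'a) \<Rightarrow> 'c) set) module"
  where "Ext R i N M =
    cohomology
      (\<lambda>j. Hom_module R (res_module R N j) M)
      (\<lambda>j f. compose (carrier (res_module R N (Suc j))) f (res_diff R N j)) i"


section \<open>Local rings\<close>

locale noetherian_local_ring = cring R + noetherian_ring R + maximalideal \<nn> R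
  for R :: "('a, 'r) ring_scheme" (structure) and \<nn> :: "'a set" +
  assumes maximal_unique: "maximalideal J R \<Longrightarrow> J = \<nn>"

definition residue_module :: "('a, 'r) ring_scheme \<Rightarrow> 'a set \<Rightarrow> ('a, 'a set) module"
  where "residue_module R \<nn> = quot_module (ring_module R) \<nn>"

text \<open>
  An \<open>R\<close>-module annihilated by \<open>\<nn>\<close>, regarded as a vector space over the residue field: all
  representatives of a residue class act in the same way.
\<close>

definition residue_space :: "('a, 'b, 'm) module_scheme \<Rightarrow> ('a set, 'b) module"
  where "residue_space V =
    \<lparr>carrier = carrier V,
     monoid.mult = undefined, monoid.one = undefined,
     ring.zero = \<zero>\<^bsub>V\<^esub>, ring.add = ring.add V,
     smult = (\<lambda>A v. THE w. \<forall>a\<in>A. w = a \<odot>\<^bsub>V\<^esub> v)\<rparr>"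

definition finite_basis :: "('k, 'r) ring_scheme \<Rightarrow> ('k, 'v, 'm) module_scheme \<Rightarrow> 'v set \<Rightarrow> bool"
  where "finite_basis K V B \<longleftrightarrow> finite B \<and> B \<subseteq> carrier V \<and>
    (\<forall>v \<in> carrier V. \<exists>!c. c \<in> B \<rightarrow>\<^sub>E carrier K \<and> v = (\<Oplus>\<^bsub>V\<^esub>b\<in>B. c b \<odot>\<^bsub>V\<^esub> b))"

text \<open>Meaningful for finite-dimensional \<open>V\<close> only.\<close>

definition vdim :: "('k, 'r) ring_scheme \<Rightarrow> ('k, 'v, 'm) module_scheme \<Rightarrow> nat"
  where "vdim K V = (THE k. \<exists>B. finite_basis K V B \<and> card B = k)"

definition betti :: "('a, 'r) ring_scheme \<Rightarrow> 'a set \<Rightarrow> ('a, 'b, 'm) module_scheme \<Rightarrow> nat \<Rightarrow> nat"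
  where "betti R \<nn> N i = vdim (R Quot \<nn>) (residue_space (Tor R i N (residue_module R \<nn>)))"

definition krull_dim :: "('a, 'r) ring_scheme \<Rightarrow> enat"
  where "krull_dim R =
    Sup {enat k |k. \<exists>P. (\<forall>i\<le>k. primeideal (P i) R) \<and> (\<forall>i<k. P i \<subset> P (Suc i))}"

definition regular_sequence :: "('a, 'r) ring_scheme \<Rightarrow> 'a list \<Rightarrow> bool"
  where "regular_sequence R xs \<longleftrightarrow> set xs \<subseteq> carrier R \<and>
    (\<forall>i < length xs. \<forall>y \<in> carrier R.
      xs ! i \<otimes>\<^bsub>R\<^esub> y \<in> Idl\<^bsub>R\<^esub> (set (take i xs)) \<longrightarrow> y \<in> Idl\<^bsub>R\<^esub> (set (take i xs))) \<and>
    Idl\<^bsub>R\<^esub> (set xs) \<noteq> carrier R"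

definition depth :: "('a, 'r) ring_scheme \<Rightarrow> 'a set \<Rightarrow> enat"
  where "depth R \<nn> = Sup {enat (length xs) |xs. set xs \<subseteq> \<nn> \<and> regular_sequence R xs}"

definition cohen_macaulay :: "('a, 'r) ring_scheme \<Rightarrow> 'a set \<Rightarrow> bool"
  where "cohen_macaulay R \<nn> \<longleftrightarrow> depth R \<nn> = krull_dim R"

definition canonical_module ::
    "('a, 'r) ring_scheme \<Rightarrow> 'a set \<Rightarrow> ('a, 'w, 'm) module_scheme \<Rightarrow> bool"
  where "canonical_module R \<nn> \<omega> \<longleftrightarrow> fg_module R \<omega> \<and>
    (\<forall>i. (enat i = krull_dim R \<longrightarrow>
            lin_isomorphic R (Ext R i (residue_module R \<nn>) \<omega>) (residue_module R \<nn>)) \<and>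
         (enat i \<noteq> krull_dim R \<longrightarrow> zero_module (Ext R i (residue_module R \<nn>) \<omega>)))"

definition auslander_map ::
    "('a, 'r) ring_scheme \<Rightarrow> ('a, 'w, 'm) module_scheme \<Rightarrow> ('a, 'b, 'n) module_scheme
      \<Rightarrow> 'b \<Rightarrow> 'w \<Rightarrow> ('w \<times> 'b \<Rightarrow> 'a) set"
  where "auslander_map R \<omega> M = (\<lambda>x. \<lambda>w \<in> carrier \<omega>. pure_tensor R \<omega> M w x)"

definition in_auslander_class ::
    "('a, 'r) ring_scheme \<Rightarrow> ('a, 'w, 'm) module_scheme \<Rightarrow> ('a, 'b, 'n) module_scheme \<Rightarrow> bool"
  where "in_auslander_class R \<omega> M \<longleftrightarrow> Module.module R M \<and>
    auslander_map R \<omega> M \<in> lin_hom R M (Hom_module R \<omega> (tensor R \<omega> M)) \<and>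
    bij_betw (auslander_map R \<omega> M) (carrier M) (carrier (Hom_module R \<omega> (tensor R \<omega> M))) \<and>
    (\<forall>i\<ge>1. zero_module (Tor R i \<omega> M) \<and> zero_module (Ext R i \<omega> (tensor R \<omega> M)))"

end

theory Submission
  imports Defs
begin

text \<open>
  All relations between the Betti numbers of \<open>N\<close> come from counting lengths.  Let \<open>F\<close> be the chosen
  free resolution of \<open>N\<close>, with \<open>F\<^sub>i = R\<^sup>p\<^sup>i\<close>, and let \<open>l\<close> be the residue field.  A complex of finitely
  generated free modules is a sequence of matrices, and these act on the powers of every module \<open>X\<close>:
  in this way \<open>F \<otimes> X\<close> and \<open>Hom(F, X)\<close> become complexes of powers of \<open>X\<close>, with the matrices and with
  their transposes.  The \<open>i\<close>-th matrix has a rank \<open>\<rho>\<^sub>i\<close> over \<open>l\<close>, and \<open>\<beta>\<^sub>0 = p\<^sub>0 - \<rho>\<^sub>0\<close>,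
  \<open>\<beta>\<^sub>i\<^sub>+\<^sub>1 = p\<^sub>i\<^sub>+\<^sub>1 - \<rho>\<^sub>i - \<rho>\<^sub>i\<^sub>+\<^sub>1\<close>.  If \<open>X\<close> is killed by the maximal ideal, then \<open>F \<otimes> X\<close> has homology of
  length \<open>\<beta>\<^sub>i \<cdot> length X\<close>, and so has \<open>Hom(F, X)\<close>.

  The module \<open>M\<close> is an extension of \<open>Q = l\<^sup>m\<close> by \<open>P = l\<^sup>n\<close>.  As \<open>Tor\<^sub>i(N, M) = 0\<close> for \<open>i \<ge> 1\<close>, the
  connecting maps \<open>Tor\<^sub>i\<^sub>+\<^sub>1(N, Q) \<rightarrow> Tor\<^sub>i(N, P)\<close> are bijective for \<open>i \<ge> 1\<close>, whence \<open>m \<beta>\<^sub>i\<^sub>+\<^sub>1 = n \<beta>\<^sub>i\<close>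
  (\<open>shift_length\<close>, \<open>betti_step\<close>).  In degree \<open>0\<close>, the module \<open>V = N \<otimes> M\<close> is an extension of
  \<open>V/K = N \<otimes> Q\<close>, of length \<open>m \<beta>\<^sub>0\<close>, by the image \<open>K\<close> of \<open>N \<otimes> P\<close>, of length \<open>k = n \<beta>\<^sub>0 - m \<beta>\<^sub>1\<close>; the
  maximal ideal kills both (\<open>KV_length\<close>, \<open>WV_length\<close>).  Infinite projective dimension gives
  \<open>\<beta>\<^sub>1 \<noteq> 0\<close>, by Nakayama's lemma (\<open>proj_dim_le_one_if_residue_exact\<close>).

  For (a), the claim is \<open>k > 0\<close>.  If \<open>k = 0\<close>, the maximal ideal kills \<open>V\<close>, hence \<open>Hom(N, V)\<close>, hence
  \<open>M\<close>; then \<open>Tor\<^sub>1(N, M)\<close> has length \<open>\<beta>\<^sub>1 (m + n) \<noteq> 0\<close>, which is absurd.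

  For (b), \<open>Ext\<^sup>1(N, V) = 0\<close> gives \<open>length Hom(N, V) = m \<beta>\<^sub>0\<^sup>2 + k (\<beta>\<^sub>0 - \<beta>\<^sub>1)\<close> (\<open>hom_length\<close>).  Equating this
  with \<open>length M = m + n\<close> and dividing by \<open>m\<close> yields a quadratic equation for \<open>\<beta>\<^sub>1\<close>.  Its discriminant
  is the square of an integer because \<open>r\<close> is an integer: \<open>n\<^sup>j \<beta>\<^sub>1 = m\<^sup>j \<beta>\<^sub>j\<^sub>+\<^sub>1\<close> for all \<open>j\<close>
  (\<open>dvd_if_geometric\<close>).

  For (c), membership in the Auslander class gives \<open>Ext\<^sup>i(N, V) = 0\<close> for \<open>i \<ge> 1\<close>, and the shift
  argument, now for \<open>Hom(F, -)\<close> and the extension \<open>V\<close> of \<open>V/K\<close> by \<open>K\<close>, gives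
  \<open>k \<beta>\<^sub>2 = m \<beta>\<^sub>0 \<beta>\<^sub>1\<close>.  Together with \<open>m \<beta>\<^sub>2 = n \<beta>\<^sub>1\<close> this is \<open>k n = m\<^sup>2 \<beta>\<^sub>0\<close>, that is,
  \<open>\<beta>\<^sub>0 r\<^sup>2 - \<beta>\<^sub>1 r - \<beta>\<^sub>0 = 0\<close>.
\<close>

section \<open>Linear maps and submodules\<close>

context cring
begin

lemma lin_homI:
  assumes "\<And>x. x \<in> carrier X \<Longrightarrow> f x \<in> carrier Y"
    and "\<And>x y. x \<in> carrier X \<Longrightarrow> y \<in> carrier X \<Longrightarrow> f (x \<oplus>\<^bsub>X\<^esub> y) = f x \<oplus>\<^bsub>Y\<^esub> f y"
    and "\<And>a x. a \<in> carrier R \<Longrightarrow> x \<in> carrier X \<Longrightarrow> f (a \<odot>\<^bsub>X\<^esub> x) = a \<odot>\<^bsub>Y\<^esub> f x"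
  shows "f \<in> lin_hom R X Y"
  using assms by (auto simp: lin_hom_def)

lemma lin_hom_closed: "f \<in> lin_hom R X Y \<Longrightarrow> x \<in> carrier X \<Longrightarrow> f x \<in> carrier Y"
  by (auto simp: lin_hom_def)

lemma lin_hom_add:
  "f \<in> lin_hom R X Y \<Longrightarrow> x \<in> carrier X \<Longrightarrow> y \<in> carrier X \<Longrightarrow> f (x \<oplus>\<^bsub>X\<^esub> y) = f x \<oplus>\<^bsub>Y\<^esub> f y"
  by (auto simp: lin_hom_def)

lemma lin_hom_smult:
  "f \<in> lin_hom R X Y \<Longrightarrow> a \<in> carrier R \<Longrightarrow> x \<in> carrier X \<Longrightarrow> f (a \<odot>\<^bsub>X\<^esub> x) = a \<odot>\<^bsub>Y\<^esub> f x"
  by (auto simp: lin_hom_def)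

lemma lin_hom_zero:
  assumes "Module.module R X" "Module.module R Y" "f \<in> lin_hom R X Y"
  shows "f \<zero>\<^bsub>X\<^esub> = \<zero>\<^bsub>Y\<^esub>"
proof -
  interpret X: Module.module R X by fact
  interpret Y: Module.module R Y by fact
  have "f \<zero>\<^bsub>X\<^esub> = f (\<zero> \<odot>\<^bsub>X\<^esub> \<zero>\<^bsub>X\<^esub>)" by simp
  also have "\<dots> = \<zero> \<odot>\<^bsub>Y\<^esub> f \<zero>\<^bsub>X\<^esub>" using assms(3) by (intro lin_hom_smult) auto
  finally show ?thesis using lin_hom_closed[OF assms(3)] by simp
qed

lemma lin_hom_uminus:
  assumes "Module.module R X" "Module.module R Y" "f \<in> lin_hom R X Y" "x \<in> carrier X"
  shows "f (\<ominus>\<^bsub>X\<^esub> x) = \<ominus>\<^bsub>Y\<^esub> f x"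
proof -
  interpret X: Module.module R X by fact
  interpret Y: Module.module R Y by fact
  have "\<ominus>\<^bsub>X\<^esub> x = (\<ominus> \<one>) \<odot>\<^bsub>X\<^esub> x" using assms(4) by (simp add: X.smult_l_minus)
  then show ?thesis
    using lin_hom_smult[OF assms(3), of "\<ominus> \<one>" x] assms(4) lin_hom_closed[OF assms(3,4)]
    by (simp add: Y.smult_l_minus)
qed

lemma lin_hom_minus:
  assumes "Module.module R X" "Module.module R Y" "f \<in> lin_hom R X Y" "x \<in> carrier X" "y \<in> carrier X"
  shows "f (x \<ominus>\<^bsub>X\<^esub> y) = f x \<ominus>\<^bsub>Y\<^esub> f y"
proof -
  interpret X: Module.module R X by fact
  show ?thesis
    using assms by (simp add: a_minus_def lin_hom_add lin_hom_uminus)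
qed

lemma lin_hom_finsum:
  assumes "Module.module R X" "Module.module R Y" "f \<in> lin_hom R X Y"
    and "finite I" "g \<in> I \<rightarrow> carrier X"
  shows "f (\<Oplus>\<^bsub>X\<^esub>i\<in>I. g i) = (\<Oplus>\<^bsub>Y\<^esub>i\<in>I. f (g i))"
proof -
  interpret X: Module.module R X by fact
  interpret Y: Module.module R Y by fact
  show ?thesis
    using assms(4,5)
  proof (induction I rule: finite_induct)
    case empty
    then show ?case using lin_hom_zero assms by simp
  next
    case (insert i I)
    then have "(\<lambda>i. f (g i)) \<in> I \<rightarrow> carrier Y" "f (g i) \<in> carrier Y"
      using lin_hom_closed[OF assms(3)] by (auto simp: Pi_iff)
    moreover have "g \<in> I \<rightarrow> carrier X" "g i \<in> carrier X" using insert by auto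
    ultimately show ?case
      using insert lin_hom_add[OF assms(3)] by (simp add: X.finsum_closed)
  qed
qed

lemma lin_hom_comp:
  assumes "f \<in> lin_hom R X Y" "g \<in> lin_hom R Y Z"
  shows "(\<lambda>x. g (f x)) \<in> lin_hom R X Z"
  using assms by (auto simp: lin_hom_def Pi_iff)

lemma lin_hom_cong:
  assumes "Module.module R X" "f \<in> lin_hom R X Y" "\<And>x. x \<in> carrier X \<Longrightarrow> f x = g x"
  shows "g \<in> lin_hom R X Y"
proof -
  interpret X: Module.module R X by fact
  show ?thesis using assms(2,3) by (auto simp: lin_hom_def Pi_iff)
qed

lemma id_lin_hom: "(\<lambda>x. x) \<in> lin_hom R X X"
  by (auto simp: lin_hom_def)

lemma submodule_iff:
  assumes "Module.module R X"
  shows "submodule H R X \<longleftrightarrow> H \<subseteq> carrier X \<and> \<zero>\<^bsub>X\<^esub> \<in> H \<and>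
    (\<forall>x\<in>H. \<forall>y\<in>H. x \<oplus>\<^bsub>X\<^esub> y \<in> H) \<and> (\<forall>a\<in>carrier R. \<forall>x\<in>H. a \<odot>\<^bsub>X\<^esub> x \<in> H)"
proof -
  interpret X: Module.module R X by fact
  show ?thesis
  proof
    assume H: "submodule H R X"
    then have "\<zero>\<^bsub>X\<^esub> \<in> H"
      using subgroup.one_closed[OF submodule.axioms(1)[OF H]] by simp
    then show "H \<subseteq> carrier X \<and> \<zero>\<^bsub>X\<^esub> \<in> H \<and>
      (\<forall>x\<in>H. \<forall>y\<in>H. x \<oplus>\<^bsub>X\<^esub> y \<in> H) \<and> (\<forall>a\<in>carrier R. \<forall>x\<in>H. a \<odot>\<^bsub>X\<^esub> x \<in> H)"
      using X.submoduleE[OF H] by blast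
  next
    assume H: "H \<subseteq> carrier X \<and> \<zero>\<^bsub>X\<^esub> \<in> H \<and>
      (\<forall>x\<in>H. \<forall>y\<in>H. x \<oplus>\<^bsub>X\<^esub> y \<in> H) \<and> (\<forall>a\<in>carrier R. \<forall>x\<in>H. a \<odot>\<^bsub>X\<^esub> x \<in> H)"
    have "\<ominus>\<^bsub>X\<^esub> x \<in> H" if "x \<in> H" for x
    proof -
      have "\<ominus>\<^bsub>X\<^esub> x = (\<ominus> \<one>) \<odot>\<^bsub>X\<^esub> x" using that H by (auto simp: X.smult_l_minus)
      then show ?thesis using H that by simp
    qed
    then show "submodule H R X" using H by (intro X.submoduleI) auto
  qed
qed

lemma submoduleD:
  assumes "Module.module R X" "submodule H R X"
  shows submodule_sub: "H \<subseteq> carrier X"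
    and submodule_carrierD: "x \<in> H \<Longrightarrow> x \<in> carrier X"
    and submodule_zero: "\<zero>\<^bsub>X\<^esub> \<in> H"
    and submodule_add: "x \<in> H \<Longrightarrow> y \<in> H \<Longrightarrow> x \<oplus>\<^bsub>X\<^esub> y \<in> H"
    and submodule_smult: "a \<in> carrier R \<Longrightarrow> x \<in> H \<Longrightarrow> a \<odot>\<^bsub>X\<^esub> x \<in> H"
proof -
  note H = iffD1[OF submodule_iff[OF assms(1)] assms(2)]
  show "H \<subseteq> carrier X" "x \<in> H \<Longrightarrow> x \<in> carrier X" "\<zero>\<^bsub>X\<^esub> \<in> H"
    "x \<in> H \<Longrightarrow> y \<in> H \<Longrightarrow> x \<oplus>\<^bsub>X\<^esub> y \<in> H"
    "a \<in> carrier R \<Longrightarrow> x \<in> H \<Longrightarrow> a \<odot>\<^bsub>X\<^esub> x \<in> H"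
    using H by auto
qed

lemma submodule_uminus:
  "Module.module R X \<Longrightarrow> submodule H R X \<Longrightarrow> x \<in> H \<Longrightarrow> \<ominus>\<^bsub>X\<^esub> x \<in> H"
  by (rule Module.module.submoduleE(3))

lemma submodule_minus:
  "Module.module R X \<Longrightarrow> submodule H R X \<Longrightarrow> x \<in> H \<Longrightarrow> y \<in> H \<Longrightarrow> x \<ominus>\<^bsub>X\<^esub> y \<in> H"
  by (simp add: a_minus_def submodule_add submodule_uminus)

lemma submodule_finsum:
  assumes "Module.module R X" "submodule H R X" "finite I" "\<And>i. i \<in> I \<Longrightarrow> g i \<in> H"
  shows "(\<Oplus>\<^bsub>X\<^esub>i\<in>I. g i) \<in> H"
proof -
  interpret X: Module.module R X by fact
  have H: "x \<in> carrier X" if "x \<in> H" for x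
    using that assms(1,2) by (rule submodule_carrierD[rotated 2])
  show ?thesis
    using assms(3,4)
  proof (induction I rule: finite_induct)
    case empty
    then show ?case using submodule_zero[OF assms(1,2)] by simp
  next
    case (insert i I)
    then have "(\<Oplus>\<^bsub>X\<^esub>i\<in>insert i I. g i) = g i \<oplus>\<^bsub>X\<^esub> (\<Oplus>\<^bsub>X\<^esub>i\<in>I. g i)"
      using H by (intro X.finsum_insert) auto
    then show ?case using insert submodule_add[OF assms(1,2)] by simp
  qed
qed

lemma submodule_carrier: "Module.module R X \<Longrightarrow> submodule (carrier X) R X"
  by (rule module.carrier_is_submodule)

lemma submodule_zero_set: "Module.module R X \<Longrightarrow> submodule {\<zero>\<^bsub>X\<^esub>} R X"
proof -
  assume X: "Module.module R X"
  interpret X: Module.module R X by fact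
  show ?thesis by (simp add: submodule_iff[OF X])
qed

lemma submodule_Int:
  "Module.module R X \<Longrightarrow> submodule H R X \<Longrightarrow> submodule K R X \<Longrightarrow> submodule (H \<inter> K) R X"
  unfolding submodule_iff by blast

lemma set_addI: "h \<in> H \<Longrightarrow> k \<in> K \<Longrightarrow> x = h \<oplus>\<^bsub>X\<^esub> k \<Longrightarrow> x \<in> H <+>\<^bsub>X\<^esub> K"
  by (auto simp: set_add_def')

lemma set_addE:
  assumes "x \<in> H <+>\<^bsub>X\<^esub> K"
  obtains h k where "h \<in> H" "k \<in> K" "x = h \<oplus>\<^bsub>X\<^esub> k"
  using assms by (auto simp: set_add_def')

lemma submodule_set_add:
  assumes "Module.module R X" "submodule H R X" "submodule K R X"
  shows "submodule (H <+>\<^bsub>X\<^esub> K) R X"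
proof -
  interpret X: Module.module R X by fact
  have H: "x \<in> carrier X" if "x \<in> H \<or> x \<in> K" for x
    using that assms by (auto dest: submodule_carrierD)
  show ?thesis
    unfolding submodule_iff[OF assms(1)]
  proof (intro conjI ballI)
    show "H <+>\<^bsub>X\<^esub> K \<subseteq> carrier X" using H by (auto elim!: set_addE)
    show "\<zero>\<^bsub>X\<^esub> \<in> H <+>\<^bsub>X\<^esub> K"
      by (rule set_addI[OF submodule_zero[OF assms(1,2)] submodule_zero[OF assms(1,3)]]) simp
  next
    fix x y assume "x \<in> H <+>\<^bsub>X\<^esub> K" "y \<in> H <+>\<^bsub>X\<^esub> K"
    then obtain h k h' k' where *: "h \<in> H" "k \<in> K" "h' \<in> H" "k' \<in> K"
      "x = h \<oplus>\<^bsub>X\<^esub> k" "y = h' \<oplus>\<^bsub>X\<^esub> k'"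
      by (elim set_addE) blast
    have "x \<oplus>\<^bsub>X\<^esub> y = (h \<oplus>\<^bsub>X\<^esub> h') \<oplus>\<^bsub>X\<^esub> (k \<oplus>\<^bsub>X\<^esub> k')"
      using * H by (simp add: X.a_ac)
    then show "x \<oplus>\<^bsub>X\<^esub> y \<in> H <+>\<^bsub>X\<^esub> K"
      using * by (intro set_addI[OF submodule_add[OF assms(1,2)] submodule_add[OF assms(1,3)]])
  next
    fix a x assume "a \<in> carrier R" "x \<in> H <+>\<^bsub>X\<^esub> K"
    then obtain h k where *: "a \<in> carrier R" "h \<in> H" "k \<in> K" "x = h \<oplus>\<^bsub>X\<^esub> k"
      by (elim set_addE) blast
    then have "a \<odot>\<^bsub>X\<^esub> x = a \<odot>\<^bsub>X\<^esub> h \<oplus>\<^bsub>X\<^esub> a \<odot>\<^bsub>X\<^esub> k"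
      using H by (simp add: X.smult_r_distr)
    then show "a \<odot>\<^bsub>X\<^esub> x \<in> H <+>\<^bsub>X\<^esub> K"
      using * by (intro set_addI[OF submodule_smult[OF assms(1,2)] submodule_smult[OF assms(1,3)]])
  qed
qed

lemma set_add_upper:
  assumes "Module.module R X" "submodule H R X" "submodule K R X"
  shows "H \<subseteq> H <+>\<^bsub>X\<^esub> K" "K \<subseteq> H <+>\<^bsub>X\<^esub> K"
proof -
  interpret X: Module.module R X by fact
  have H: "x \<in> carrier X" if "x \<in> H \<or> x \<in> K" for x
    using that assms by (auto dest: submodule_carrierD)
  have z: "\<zero>\<^bsub>X\<^esub> \<in> H" "\<zero>\<^bsub>X\<^esub> \<in> K" using assms by (auto simp: submodule_zero)
  show "H \<subseteq> H <+>\<^bsub>X\<^esub> K"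
  proof
    fix h assume "h \<in> H"
    then show "h \<in> H <+>\<^bsub>X\<^esub> K"
      using z(2) H[of h] by (auto intro: set_addI)
  qed
  show "K \<subseteq> H <+>\<^bsub>X\<^esub> K"
  proof
    fix k assume "k \<in> K"
    then show "k \<in> H <+>\<^bsub>X\<^esub> K"
      using z(1) H[of k] by (auto intro: set_addI)
  qed
qed

lemma set_add_least:
  assumes "Module.module R X" "submodule L R X" "H \<subseteq> L" "K \<subseteq> L"
  shows "H <+>\<^bsub>X\<^esub> K \<subseteq> L"
  using assms(3,4) submodule_add[OF assms(1,2)] by (auto elim!: set_addE)

lemma submodule_image:
  assumes "Module.module R X" "Module.module R Y" "f \<in> lin_hom R X Y" "submodule H R X"
  shows "submodule (f ` H) R Y"
  unfolding submodule_iff[OF assms(2)]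
proof (intro conjI ballI)
  note H = submodule_carrierD[OF assms(1,4)]
  show "f ` H \<subseteq> carrier Y" using H lin_hom_closed[OF assms(3)] by auto
  have "\<zero>\<^bsub>Y\<^esub> = f \<zero>\<^bsub>X\<^esub>" using lin_hom_zero[OF assms(1-3)] by simp
  then show "\<zero>\<^bsub>Y\<^esub> \<in> f ` H" using submodule_zero[OF assms(1,4)] by (rule image_eqI)
next
  fix u v assume "u \<in> f ` H" "v \<in> f ` H"
  then obtain x y where *: "x \<in> H" "y \<in> H" "u = f x" "v = f y" by blast
  then have "u \<oplus>\<^bsub>Y\<^esub> v = f (x \<oplus>\<^bsub>X\<^esub> y)"
    using lin_hom_add[OF assms(3)] submodule_carrierD[OF assms(1,4)] by simp
  then show "u \<oplus>\<^bsub>Y\<^esub> v \<in> f ` H" using * submodule_add[OF assms(1,4)] by simp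
next
  fix a u assume "a \<in> carrier R" "u \<in> f ` H"
  then obtain x where *: "a \<in> carrier R" "x \<in> H" "u = f x" by blast
  then have "a \<odot>\<^bsub>Y\<^esub> u = f (a \<odot>\<^bsub>X\<^esub> x)"
    using lin_hom_smult[OF assms(3)] submodule_carrierD[OF assms(1,4)] by simp
  then show "a \<odot>\<^bsub>Y\<^esub> u \<in> f ` H" using * submodule_smult[OF assms(1,4)] by simp
qed

lemma submodule_preimage:
  assumes "Module.module R X" "Module.module R Y" "f \<in> lin_hom R X Y" "submodule H R Y"
  shows "submodule {x \<in> carrier X. f x \<in> H} R X"
proof -
  interpret X: Module.module R X by fact
  have "f \<zero>\<^bsub>X\<^esub> = \<zero>\<^bsub>Y\<^esub>" by (rule lin_hom_zero[OF assms(1-3)])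
  then show ?thesis
    using lin_hom_add[OF assms(3)] lin_hom_smult[OF assms(3)] assms(4)
    unfolding submodule_iff[OF assms(1)] submodule_iff[OF assms(2)]
    by auto
qed

lemma submodule_lin_kernel:
  assumes "Module.module R X" "Module.module R Y" "f \<in> lin_hom R X Y"
  shows "submodule (lin_kernel X Y f) R X"
  using submodule_preimage[OF assms submodule_zero_set[OF assms(2)]]
  by (simp add: lin_kernel_def)

lemma lin_kernel_eqI:
  assumes "Module.module R X" "Module.module R Y" "f \<in> lin_hom R X Y"
    and "x \<in> carrier X" "y \<in> carrier X" "f x = f y"
  shows "x \<ominus>\<^bsub>X\<^esub> y \<in> lin_kernel X Y f"
proof -
  interpret X: Module.module R X by fact
  interpret Y: Module.module R Y by fact
  have "x \<ominus>\<^bsub>X\<^esub> y \<in> carrier X" using assms by simp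
  moreover have "f (x \<ominus>\<^bsub>X\<^esub> y) = f y \<ominus>\<^bsub>Y\<^esub> f y" using assms by (simp add: lin_hom_minus[OF assms(1-3)])
  ultimately show ?thesis using lin_hom_closed[OF assms(3,5)]
    by (simp add: lin_kernel_def a_minus_def Y.r_neg)
qed

section \<open>Length\<close>

definition strict_chain :: "('a, 'c, 'm) module_scheme \<Rightarrow> 'c set \<Rightarrow> 'c set \<Rightarrow> nat \<Rightarrow> (nat \<Rightarrow> 'c set) \<Rightarrow> bool"
  where "strict_chain X A B k U \<longleftrightarrow>
    (\<forall>i\<le>k. submodule (U i) R X \<and> A \<subseteq> U i \<and> U i \<subseteq> B) \<and> (\<forall>i<k. U i \<subset> U (Suc i))"

text \<open>
  \<open>slen X A B\<close> is the length of the subquotient \<open>B/A\<close> of \<open>X\<close>, read off from the lattice of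
  submodules of \<open>X\<close>, so that homology can be measured without forming quotients.
\<close>

definition slen :: "('a, 'c, 'm) module_scheme \<Rightarrow> 'c set \<Rightarrow> 'c set \<Rightarrow> enat"
  where "slen X A B = Sup {enat k |k. \<exists>U. strict_chain X A B k U}"

lemma strict_chainD:
  assumes "strict_chain X A B k U" "i \<le> k"
  shows "submodule (U i) R X" "A \<subseteq> U i" "U i \<subseteq> B"
  using assms by (auto simp: strict_chain_def)

lemma strict_chain_step: "strict_chain X A B k U \<Longrightarrow> i < k \<Longrightarrow> U i \<subset> U (Suc i)"
  by (simp add: strict_chain_def)

lemma slenI: "strict_chain X A B k U \<Longrightarrow> enat k \<le> slen X A B"
  unfolding slen_def by (rule Sup_upper) blast

lemma slen_leI: "(\<And>k U. strict_chain X A B k U \<Longrightarrow> enat k \<le> z) \<Longrightarrow> slen X A B \<le> z"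
  unfolding slen_def by (rule Sup_least) blast

lemma slen_attained:
  assumes "submodule A R X" "A \<subseteq> B" "slen X A B = enat k"
  obtains U where "strict_chain X A B k U"
proof -
  let ?S = "{enat k |k. \<exists>U. strict_chain X A B k U}"
  have "strict_chain X A B 0 (\<lambda>_. A)" using assms by (simp add: strict_chain_def)
  then have "?S \<noteq> {}" by blast
  moreover have "y \<le> enat k" if "y \<in> ?S" for y
    using Sup_upper[OF that] assms(3) unfolding slen_def by simp
  then have "finite ?S" by (intro finite_enat_bounded[of _ k]) blast
  ultimately have "Sup ?S \<in> ?S" using Max_in unfolding Sup_enat_def by auto
  then show ?thesis using that assms(3) unfolding slen_def by auto
qed

lemma slen_refl: "slen X A A = 0"
proof -
  have "k = 0" if "strict_chain X A A k U" for k U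
  proof (rule ccontr)
    assume "k \<noteq> 0"
    then have "U 0 \<subset> U (Suc 0)" "U 0 = A" "U (Suc 0) = A"
      using that unfolding strict_chain_def by (metis Suc_leI le0 neq0_conv subset_antisym)+
    then show False by blast
  qed
  then have "slen X A A \<le> 0" by (intro slen_leI) (simp add: zero_enat_def)
  then show ?thesis by simp
qed

lemma slen_mono: "A' \<subseteq> A \<Longrightarrow> B \<subseteq> B' \<Longrightarrow> slen X A B \<le> slen X A' B'"
proof (intro slen_leI slenI)
  fix k U assume *: "A' \<subseteq> A" "B \<subseteq> B'" "strict_chain X A B k U"
  have "A' \<subseteq> U i \<and> U i \<subseteq> B'" if "i \<le> k" for i
    using * that unfolding strict_chain_def by (meson subset_trans)
  then show "strict_chain X A' B' k U" using *(3) unfolding strict_chain_def by simp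
qed

lemma slen_pos:
  assumes "submodule A R X" "submodule B R X" "A \<subset> B"
  shows "slen X A B \<ge> 1"
proof -
  have "strict_chain X A B 1 (\<lambda>i. if i = 0 then A else B)"
    using assms by (auto simp: strict_chain_def)
  then show ?thesis using slenI by (metis one_enat_def)
qed

lemma slen_zero_iff:
  assumes "submodule A R X" "submodule B R X" "A \<subseteq> B"
  shows "slen X A B = 0 \<longleftrightarrow> A = B"
  using slen_pos[OF assms(1,2)] assms(3) slen_refl[of X B] by fastforce

text \<open>
  The strict chain behind the bound is obtained by dropping the repetitions.
\<close>

lemma weak_chain_le:
  assumes "\<forall>i\<le>k. submodule (V i) R X \<and> A \<subseteq> V i \<and> V i \<subseteq> B" "\<forall>i<k. V i \<subseteq> V (Suc i)"
  shows "enat (card {i. i < k \<and> V i \<noteq> V (Suc i)}) \<le> slen X A B"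
proof -
  define N where "N k = card {i. i < k \<and> V i \<noteq> V (Suc i)}" for k
  have NS: "N (Suc k) = (if V k \<noteq> V (Suc k) then Suc (N k) else N k)" for k
  proof -
    have "{i. i < Suc k \<and> V i \<noteq> V (Suc i)} =
      (if V k \<noteq> V (Suc k) then insert k {i. i < k \<and> V i \<noteq> V (Suc i)} else {i. i < k \<and> V i \<noteq> V (Suc i)})"
      by (auto simp: less_Suc_eq)
    then show ?thesis by (simp add: N_def)
  qed
  have "\<exists>U. strict_chain X A B (N k) U \<and> U (N k) = V k"
    using assms
  proof (induction k)
    case 0
    then have "strict_chain X A B 0 V" by (simp add: strict_chain_def)
    moreover have "N 0 = 0" by (simp add: N_def)
    ultimately show ?case by auto
  next
    case (Suc k)
    then obtain U where U: "strict_chain X A B (N k) U" "U (N k) = V k" by auto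
    show ?case
    proof (cases "V k = V (Suc k)")
      case True
      then show ?thesis using U NS by auto
    next
      case False
      let ?U = "\<lambda>i. if i \<le> N k then U i else V (Suc k)"
      have "strict_chain X A B (Suc (N k)) ?U"
        using U False Suc.prems unfolding strict_chain_def
        by (auto simp: less_Suc_eq le_Suc_eq)
      then show ?thesis using NS False by (intro exI[of _ ?U]) auto
    qed
  qed
  then show ?thesis using slenI unfolding N_def by blast
qed

text \<open>
  Concatenating chains gives one inequality.  For the other, a chain between \<open>A\<close> and \<open>C\<close> is cut
  with \<open>B\<close> and summed with \<open>B\<close>; by the modular law no step can become an equality on both sides.
\<close>

lemma slen_add:
  assumes X: "Module.module R X"
    and sub: "submodule A R X" "submodule B R X" "submodule C R X" and le: "A \<subseteq> B" "B \<subseteq> C"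
  shows "slen X A C = slen X A B + slen X B C"
proof (rule antisym)
  interpret X: Module.module R X by fact
  show "slen X A C \<le> slen X A B + slen X B C"
  proof (rule slen_leI)
    fix k U assume U: "strict_chain X A C k U"
    let ?V = "\<lambda>i. U i \<inter> B" and ?W = "\<lambda>i. U i <+>\<^bsub>X\<^esub> B"
    have subU: "submodule (U i) R X" "A \<subseteq> U i" "U i \<subseteq> C" if "i \<le> k" for i
      using U that by (auto simp: strict_chain_def)
    have mono: "U i \<subseteq> U (Suc i)" if "i < k" for i using U that by (auto simp: strict_chain_def)
    have V: "enat (card {i. i < k \<and> ?V i \<noteq> ?V (Suc i)}) \<le> slen X A B"
    proof (intro weak_chain_le allI impI conjI)
      fix i assume i: "i \<le> k"
      show "submodule (?V i) R X" by (intro submodule_Int X sub subU i)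
      show "A \<subseteq> ?V i" using subU(2)[OF i] le by auto
      show "?V i \<subseteq> B" by auto
    next
      fix i assume "i < k"
      then show "?V i \<subseteq> ?V (Suc i)" using mono[of i] by auto
    qed
    have W: "enat (card {i. i < k \<and> ?W i \<noteq> ?W (Suc i)}) \<le> slen X B C"
    proof (intro weak_chain_le allI impI conjI)
      fix i assume i: "i \<le> k"
      show "submodule (?W i) R X" by (intro submodule_set_add X sub subU i)
      show "B \<subseteq> ?W i" by (intro set_add_upper(2) X sub subU i)
      show "?W i \<subseteq> C" by (intro set_add_least X sub subU i le)
    next
      fix i assume i: "i < k"
      show "?W i \<subseteq> ?W (Suc i)"
        using mono[OF i] by (auto elim!: set_addE intro: set_addI)
    qed
    have "?V i \<noteq> ?V (Suc i) \<or> ?W i \<noteq> ?W (Suc i)" if i: "i < k" for i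
    proof (rule ccontr)
      assume "\<not> ?thesis"
      then have eq: "?V i = ?V (Suc i)" "?W i = ?W (Suc i)" by auto
      have "U (Suc i) \<subseteq> U i"
      proof
        fix x assume x: "x \<in> U (Suc i)"
        have xc: "x \<in> carrier X" using x submodule_carrierD[OF X subU(1)[of "Suc i"]] i by simp
        have "x \<in> ?W i" unfolding eq(2) using set_add_upper(1)[OF X subU(1) sub(2), of "Suc i"] x i by auto
        then obtain u b where ub: "u \<in> U i" "b \<in> B" "x = u \<oplus>\<^bsub>X\<^esub> b" by (elim set_addE)
        have uc: "u \<in> carrier X" using ub submodule_carrierD[OF X subU(1)[of i]] i by simp
        have bc: "b \<in> carrier X" using ub submodule_carrierD[OF X sub(2)] by simp
        have "x = b \<oplus>\<^bsub>X\<^esub> u" using ub uc bc by (simp add: X.a_comm)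
        then have "b = x \<ominus>\<^bsub>X\<^esub> u" using uc bc
          by (simp add: a_minus_def X.a_assoc X.r_neg)
        moreover have "u \<in> U (Suc i)" using ub mono[OF i] by auto
        ultimately have "b \<in> U (Suc i)" using x i submodule_minus[OF X subU(1)[of "Suc i"]] by simp
        then have "b \<in> U i" using ub eq(1) by auto
        then show "x \<in> U i" using ub i submodule_add[OF X subU(1)[of i]] by simp
      qed
      then show False using U i by (auto simp: strict_chain_def)
    qed
    then have "{..<k} = {i. i < k \<and> ?V i \<noteq> ?V (Suc i)} \<union> {i. i < k \<and> ?W i \<noteq> ?W (Suc i)}" by auto
    then have "k \<le> card {i. i < k \<and> ?V i \<noteq> ?V (Suc i)} + card {i. i < k \<and> ?W i \<noteq> ?W (Suc i)}"
      using card_Un_le[of "{i. i < k \<and> ?V i \<noteq> ?V (Suc i)}" "{i. i < k \<and> ?W i \<noteq> ?W (Suc i)}"]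
        card_lessThan[of k] by simp
    then have "enat k \<le> enat (card {i. i < k \<and> ?V i \<noteq> ?V (Suc i)}) + enat (card {i. i < k \<and> ?W i \<noteq> ?W (Suc i)})"
      by simp
    also have "\<dots> \<le> slen X A B + slen X B C" by (intro add_mono V W)
    finally show "enat k \<le> slen X A B + slen X B C" .
  qed
next
  show "slen X A B + slen X B C \<le> slen X A C"
  proof (cases "slen X A C")
    case (enat n)
    have "slen X A B \<le> enat n" "slen X B C \<le> enat n"
      using slen_mono[of A A B C X] slen_mono[of A B C C X] le enat by auto
    then obtain j k where jk: "slen X A B = enat j" "slen X B C = enat k"
      by (metis enat_ile)
    obtain U where U: "strict_chain X A B j U" using slen_attained[OF sub(1) le(1) jk(1)] .
    obtain W where W: "strict_chain X B C k W" using slen_attained[OF sub(2) le(2) jk(2)] .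
    let ?Z = "\<lambda>i. if i \<le> j then U i else W (i - j)"
    have "strict_chain X A C (j + k) ?Z"
      unfolding strict_chain_def
    proof (intro conjI allI impI)
      fix i assume "i \<le> j + k"
      then have "i - j \<le> k" by simp
      note UW = strict_chainD[OF U, of i] strict_chainD[OF W this]
      show "submodule (?Z i) R X" using UW by simp
      show "A \<subseteq> ?Z i" using UW(2,5) le by (auto dest: subsetD)
      show "?Z i \<subseteq> C" using UW(3,6) le by (auto dest: subsetD)
    next
      fix i assume i: "i < j + k"
      consider "i < j" | "i = j" | "i > j" by linarith
      then show "?Z i \<subset> ?Z (Suc i)"
      proof cases
        case 1
        then show ?thesis using U unfolding strict_chain_def by auto
      next
        case 2
        then have "U j \<subseteq> B" "B \<subseteq> W 0" "W 0 \<subset> W (Suc 0)"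
          using i U W unfolding strict_chain_def by auto
        then show ?thesis using 2 by auto
      next
        case 3
        then have "W (i - j) \<subset> W (Suc (i - j))"
          using i W unfolding strict_chain_def by auto
        then show ?thesis using 3 by (auto simp: Suc_diff_le)
      qed
    qed
    then show ?thesis using jk slenI by fastforce
  qed simp
qed

text \<open>
  As \<open>A\<close> contains the kernel of \<open>f\<close> on \<open>B\<close>, images and preimages under \<open>f\<close> are inverse bijections
  between the submodules from \<open>A\<close> to \<open>B\<close> and those from \<open>f(A)\<close> to \<open>f(B)\<close>.
\<close>

lemma slen_image:
  assumes X: "Module.module R X" and Y: "Module.module R Y" and f: "f \<in> lin_hom R X Y"
    and sub: "submodule A R X" "submodule B R X" and "A \<subseteq> B"
    and ker: "\<And>x. x \<in> B \<Longrightarrow> f x = \<zero>\<^bsub>Y\<^esub> \<Longrightarrow> x \<in> A"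
  shows "slen Y (f ` A) (f ` B) = slen X A B"
proof (rule antisym)
  interpret X: Module.module R X by fact
  interpret Y: Module.module R Y by fact
  show "slen Y (f ` A) (f ` B) \<le> slen X A B"
  proof (intro slen_leI)
    fix k U assume U: "strict_chain Y (f ` A) (f ` B) k U"
    let ?V = "\<lambda>i. B \<inter> {x \<in> carrier X. f x \<in> U i}"
    have "strict_chain X A B k ?V"
      unfolding strict_chain_def
    proof (intro conjI allI impI)
      fix i assume i: "i \<le> k"
      note Ui = strict_chainD[OF U i]
      show "submodule (?V i) R X" by (intro submodule_Int submodule_preimage[OF X Y f] X sub Ui)
      show "A \<subseteq> ?V i" using Ui \<open>A \<subseteq> B\<close> submodule_sub[OF X sub(1)] by auto
      show "?V i \<subseteq> B" by auto
    next
      fix i assume i: "i < k"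
      then obtain y where y: "y \<in> U (Suc i)" "y \<notin> U i" "U i \<subseteq> U (Suc i)"
        using strict_chain_step[OF U i] by auto
      then have "y \<in> f ` B" using strict_chainD(3)[OF U, of "Suc i"] i by auto
      then obtain x where x: "x \<in> B" "y = f x" by auto
      have "?V i \<subseteq> ?V (Suc i)" "x \<in> ?V (Suc i)" "x \<notin> ?V i"
        using x y submodule_carrierD[OF X sub(2)] by auto
      then show "?V i \<subset> ?V (Suc i)" by auto
    qed
    then show "enat k \<le> slen X A B" by (rule slenI)
  qed
  show "slen X A B \<le> slen Y (f ` A) (f ` B)"
  proof (intro slen_leI)
    fix k U assume U: "strict_chain X A B k U"
    have "strict_chain Y (f ` A) (f ` B) k (\<lambda>i. f ` U i)"
      unfolding strict_chain_def
    proof (intro conjI allI impI)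
      fix i assume "i \<le> k"
      then show "submodule (f ` U i) R Y" "f ` A \<subseteq> f ` U i" "f ` U i \<subseteq> f ` B"
        using U unfolding strict_chain_def by (auto intro!: submodule_image X Y f)
    next
      fix i assume i: "i < k"
      have U': "submodule (U i) R X" "submodule (U (Suc i)) R X" "U i \<subset> U (Suc i)" "A \<subseteq> U i" "U (Suc i) \<subseteq> B"
        using U i unfolding strict_chain_def by auto
      have "U (Suc i) \<subseteq> U i" if eq: "f ` U i = f ` U (Suc i)"
      proof
        fix x assume x: "x \<in> U (Suc i)"
        then obtain u where u: "u \<in> U i" "f x = f u" using eq by (metis imageE imageI)
        have c: "x \<in> carrier X" "u \<in> carrier X" using x u U' by (auto dest: submodule_carrierD[OF X])
        have "f (x \<ominus>\<^bsub>X\<^esub> u) = \<zero>\<^bsub>Y\<^esub>"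
          using lin_kernel_eqI[OF X Y f c u(2)] by (simp add: lin_kernel_def)
        moreover have "x \<ominus>\<^bsub>X\<^esub> u \<in> B"
          using U' x u by (intro submodule_minus[OF X sub(2)]) auto
        ultimately have "x \<ominus>\<^bsub>X\<^esub> u \<in> U i" using ker U' by auto
        then have "x \<ominus>\<^bsub>X\<^esub> u \<oplus>\<^bsub>X\<^esub> u \<in> U i" using submodule_add[OF X U'(1)] u by simp
        then show "x \<in> U i" using c by (simp add: a_minus_def X.a_assoc X.l_neg)
      qed
      then show "f ` U i \<subset> f ` U (Suc i)" using U' by blast
    qed
    then show "enat k \<le> slen Y (f ` A) (f ` B)" by (rule slenI)
  qed
qed

lemma slen_rank_nullity:
  assumes X: "Module.module R X" and Y: "Module.module R Y" and f: "f \<in> lin_hom R X Y"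
    and B: "submodule B R X"
  shows "slen X {\<zero>\<^bsub>X\<^esub>} B = slen X {\<zero>\<^bsub>X\<^esub>} {x \<in> B. f x = \<zero>\<^bsub>Y\<^esub>} + slen Y {\<zero>\<^bsub>Y\<^esub>} (f ` B)"
proof -
  let ?K = "{x \<in> B. f x = \<zero>\<^bsub>Y\<^esub>}"
  have K: "?K = B \<inter> lin_kernel X Y f"
    using submodule_carrierD[OF X B] by (auto simp: lin_kernel_def)
  have subK: "submodule ?K R X"
    unfolding K by (intro submodule_Int submodule_lin_kernel X Y f B)
  have "f ` ?K = {\<zero>\<^bsub>Y\<^esub>}"
    using submodule_zero[OF X B] lin_hom_zero[OF X Y f] by force
  moreover have "slen Y (f ` ?K) (f ` B) = slen X ?K B"
    by (rule slen_image[OF X Y f subK B]) auto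
  moreover have "slen X {\<zero>\<^bsub>X\<^esub>} B = slen X {\<zero>\<^bsub>X\<^esub>} ?K + slen X ?K B"
    using submodule_zero[OF X subK]
    by (intro slen_add X submodule_zero_set subK B) auto
  ultimately show ?thesis by simp
qed

lemma module_length_slen:
  assumes X: "Module.module R X"
  shows "module_length R X = slen X {\<zero>\<^bsub>X\<^esub>} (carrier X)"
proof -
  have "strict_chain X {\<zero>\<^bsub>X\<^esub>} (carrier X) k U \<longleftrightarrow>
      (\<forall>i\<le>k. submodule (U i) R X) \<and> (\<forall>i<k. U i \<subset> U (Suc i))" for k U
  proof -
    have "submodule (U i) R X \<and> {\<zero>\<^bsub>X\<^esub>} \<subseteq> U i \<and> U i \<subseteq> carrier X \<longleftrightarrow> submodule (U i) R X" for i
      using submodule_sub[OF X, of "U i"] submodule_zero[OF X, of "U i"] by auto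
    then show ?thesis unfolding strict_chain_def by simp
  qed
  then have "\<And>k. Ex (strict_chain X {\<zero>\<^bsub>X\<^esub>} (carrier X) k) \<longleftrightarrow>
      (\<exists>U. (\<forall>i\<le>k. submodule (U i) R X) \<and> (\<forall>i<k. U i \<subset> U (Suc i)))" by metis
  then show ?thesis unfolding slen_def module_length_def by simp
qed

section \<open>Modules of functions and quotient modules\<close>

lemma moduleI_neg:
  assumes closed: "\<And>x y. x \<in> carrier X \<Longrightarrow> y \<in> carrier X \<Longrightarrow> x \<oplus>\<^bsub>X\<^esub> y \<in> carrier X"
    and zero: "\<zero>\<^bsub>X\<^esub> \<in> carrier X"
    and assoc: "\<And>x y z. x \<in> carrier X \<Longrightarrow> y \<in> carrier X \<Longrightarrow> z \<in> carrier X \<Longrightarrow>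
        x \<oplus>\<^bsub>X\<^esub> y \<oplus>\<^bsub>X\<^esub> z = x \<oplus>\<^bsub>X\<^esub> (y \<oplus>\<^bsub>X\<^esub> z)"
    and comm: "\<And>x y. x \<in> carrier X \<Longrightarrow> y \<in> carrier X \<Longrightarrow> x \<oplus>\<^bsub>X\<^esub> y = y \<oplus>\<^bsub>X\<^esub> x"
    and lzero: "\<And>x. x \<in> carrier X \<Longrightarrow> \<zero>\<^bsub>X\<^esub> \<oplus>\<^bsub>X\<^esub> x = x"
    and lneg: "\<And>x. x \<in> carrier X \<Longrightarrow> (\<ominus> \<one>) \<odot>\<^bsub>X\<^esub> x \<oplus>\<^bsub>X\<^esub> x = \<zero>\<^bsub>X\<^esub>"
    and smult: "\<And>a x. a \<in> carrier R \<Longrightarrow> x \<in> carrier X \<Longrightarrow> a \<odot>\<^bsub>X\<^esub> x \<in> carrier X"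
    and "\<And>a b x. a \<in> carrier R \<Longrightarrow> b \<in> carrier R \<Longrightarrow> x \<in> carrier X \<Longrightarrow>
        (a \<oplus> b) \<odot>\<^bsub>X\<^esub> x = a \<odot>\<^bsub>X\<^esub> x \<oplus>\<^bsub>X\<^esub> b \<odot>\<^bsub>X\<^esub> x"
    and "\<And>a x y. a \<in> carrier R \<Longrightarrow> x \<in> carrier X \<Longrightarrow> y \<in> carrier X \<Longrightarrow>
        a \<odot>\<^bsub>X\<^esub> (x \<oplus>\<^bsub>X\<^esub> y) = a \<odot>\<^bsub>X\<^esub> x \<oplus>\<^bsub>X\<^esub> a \<odot>\<^bsub>X\<^esub> y"
    and "\<And>a b x. a \<in> carrier R \<Longrightarrow> b \<in> carrier R \<Longrightarrow> x \<in> carrier X \<Longrightarrow>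
        (a \<otimes> b) \<odot>\<^bsub>X\<^esub> x = a \<odot>\<^bsub>X\<^esub> (b \<odot>\<^bsub>X\<^esub> x)"
    and "\<And>x. x \<in> carrier X \<Longrightarrow> \<one> \<odot>\<^bsub>X\<^esub> x = x"
  shows "Module.module R X"
proof (rule Module.moduleI)
  have "\<exists>y\<in>carrier X. y \<oplus>\<^bsub>X\<^esub> x = \<zero>\<^bsub>X\<^esub>" if "x \<in> carrier X" for x
    using lneg[OF that] smult[of "\<ominus> \<one>" x] that by auto
  then show "abelian_group X" by (intro abelian_groupI assms(1-5))
qed (use assms is_cring in auto)

text \<open>
  Powers, finitely generated free modules and modules of homomorphisms are all modules of
  extensional functions with pointwise operations.
\<close>

lemma module_of_functions:
  assumes M: "Module.module R M"
    and sub: "carrier X \<subseteq> I \<rightarrow>\<^sub>E carrier M"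
    and zero: "\<zero>\<^bsub>X\<^esub> = (\<lambda>i\<in>I. \<zero>\<^bsub>M\<^esub>)" "\<zero>\<^bsub>X\<^esub> \<in> carrier X"
    and add: "\<And>f g. f \<in> carrier X \<Longrightarrow> g \<in> carrier X \<Longrightarrow> f \<oplus>\<^bsub>X\<^esub> g = (\<lambda>i\<in>I. f i \<oplus>\<^bsub>M\<^esub> g i)"
      "\<And>f g. f \<in> carrier X \<Longrightarrow> g \<in> carrier X \<Longrightarrow> f \<oplus>\<^bsub>X\<^esub> g \<in> carrier X"
    and smult: "\<And>a f. a \<in> carrier R \<Longrightarrow> f \<in> carrier X \<Longrightarrow> a \<odot>\<^bsub>X\<^esub> f = (\<lambda>i\<in>I. a \<odot>\<^bsub>M\<^esub> f i)"
      "\<And>a f. a \<in> carrier R \<Longrightarrow> f \<in> carrier X \<Longrightarrow> a \<odot>\<^bsub>X\<^esub> f \<in> carrier X"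
  shows "Module.module R X"
proof -
  interpret M: Module.module R M by fact
  have c: "f i \<in> carrier M" if "f \<in> carrier X" "i \<in> I" for f i using that sub by auto
  have eqI: "f = g" if "f \<in> carrier X" "g \<in> carrier X" "\<And>i. i \<in> I \<Longrightarrow> f i = g i" for f g
    using that sub by (intro PiE_ext[of f I _ g]) auto
  have zero_nth: "\<zero>\<^bsub>X\<^esub> i = \<zero>\<^bsub>M\<^esub>" if "i \<in> I" for i
    using that by (simp add: zero)
  have add_nth: "(f \<oplus>\<^bsub>X\<^esub> g) i = f i \<oplus>\<^bsub>M\<^esub> g i" if "f \<in> carrier X" "g \<in> carrier X" "i \<in> I" for f g i
    unfolding add(1)[OF that(1,2)] using that(3) by simp
  have smult_nth: "(a \<odot>\<^bsub>X\<^esub> f) i = a \<odot>\<^bsub>M\<^esub> f i" if "a \<in> carrier R" "f \<in> carrier X" "i \<in> I" for a f i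
    unfolding smult(1)[OF that(1,2)] using that(3) by simp
  note nth = c zero_nth add_nth smult_nth zero(2) add(2) smult(2)
  show ?thesis
    by (rule moduleI_neg; (intro eqI)?)
      (simp_all add: nth M.smult_l_distr M.smult_r_distr M.smult_assoc1 M.smult_l_minus
        M.r_neg M.a_ac)
qed

lemma ring_module_simps [simp]:
  "carrier (ring_module R) = carrier R" "\<zero>\<^bsub>ring_module R\<^esub> = \<zero>"
  "x \<oplus>\<^bsub>ring_module R\<^esub> y = x \<oplus> y" "a \<odot>\<^bsub>ring_module R\<^esub> x = a \<otimes> x"
  by (simp_all add: ring_module_def)

lemma ring_module: "Module.module R (ring_module R)"
  by (rule moduleI_neg) (auto simp: a_ac m_assoc l_distr r_distr l_minus l_neg r_neg)

lemma direct_power_simps [simp]: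
  "carrier (direct_power M k) = {..<k} \<rightarrow>\<^sub>E carrier M"
  "\<zero>\<^bsub>direct_power M k\<^esub> = (\<lambda>i\<in>{..<k}. \<zero>\<^bsub>M\<^esub>)"
  "f \<oplus>\<^bsub>direct_power M k\<^esub> g = (\<lambda>i\<in>{..<k}. f i \<oplus>\<^bsub>M\<^esub> g i)"
  "a \<odot>\<^bsub>direct_power M k\<^esub> f = (\<lambda>i\<in>{..<k}. a \<odot>\<^bsub>M\<^esub> f i)"
  by (simp_all add: direct_power_def)

lemma direct_power_module: "Module.module R M \<Longrightarrow> Module.module R (direct_power M k)"
proof -
  assume M: "Module.module R M"
  interpret M: Module.module R M by fact
  show ?thesis by (rule module_of_functions[OF M, of _ "{..<k}"]) (auto simp: PiE_mem)
qed

lemma free_module_simps: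
  "\<zero>\<^bsub>free_module R X\<^esub> = (\<lambda>x\<in>X. \<zero>)"
  "f \<oplus>\<^bsub>free_module R X\<^esub> g = (\<lambda>x\<in>X. f x \<oplus> g x)"
  "a \<odot>\<^bsub>free_module R X\<^esub> f = (\<lambda>x\<in>X. a \<otimes> f x)"
  by (simp_all add: free_module_def)

lemma free_module_carrier:
  "f \<in> carrier (free_module R X) \<longleftrightarrow> f \<in> X \<rightarrow>\<^sub>E carrier R \<and> finite {x \<in> X. f x \<noteq> \<zero>}"
  by (simp add: free_module_def)

lemma free_module_direct_power: "free_module R {..<k} = direct_power (ring_module R) k"
  by (simp add: free_module_def direct_power_def ring_module_def)

lemma free_module_module: "Module.module R (free_module R X)"
proof (rule module_of_functions[OF ring_module, of _ X])
  fix f g assume fg: "f \<in> carrier (free_module R X)" "g \<in> carrier (free_module R X)"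
  have "{x \<in> X. (\<lambda>x\<in>X. f x \<oplus> g x) x \<noteq> \<zero>} \<subseteq> {x \<in> X. f x \<noteq> \<zero>} \<union> {x \<in> X. g x \<noteq> \<zero>}"
    by auto
  then have "finite {x \<in> X. (\<lambda>x\<in>X. f x \<oplus> g x) x \<noteq> \<zero>}"
    by (rule finite_subset) (use fg in \<open>simp add: free_module_carrier\<close>)
  then show "f \<oplus>\<^bsub>free_module R X\<^esub> g \<in> carrier (free_module R X)"
    using fg unfolding free_module_carrier free_module_simps by (auto simp: PiE_mem)
next
  fix a f assume af: "a \<in> carrier R" "f \<in> carrier (free_module R X)"
  have "{x \<in> X. (\<lambda>x\<in>X. a \<otimes> f x) x \<noteq> \<zero>} \<subseteq> {x \<in> X. f x \<noteq> \<zero>}"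
    using af by auto
  then have "finite {x \<in> X. (\<lambda>x\<in>X. a \<otimes> f x) x \<noteq> \<zero>}"
    by (rule finite_subset) (use af in \<open>simp add: free_module_carrier\<close>)
  then show "a \<odot>\<^bsub>free_module R X\<^esub> f \<in> carrier (free_module R X)"
    using af unfolding free_module_carrier free_module_simps by (auto simp: PiE_mem)
qed (auto simp: free_module_carrier free_module_simps)

lemma free_gen_closed: "x \<in> X \<Longrightarrow> free_gen R X x \<in> carrier (free_module R X)"
proof -
  assume "x \<in> X"
  have "{y \<in> X. free_gen R X x y \<noteq> \<zero>} \<subseteq> {x}" by (auto simp: free_gen_def)
  then have "finite {y \<in> X. free_gen R X x y \<noteq> \<zero>}" by (rule finite_subset) simp
  then show ?thesis by (auto simp: free_module_carrier free_gen_def)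
qed

lemma Hom_module_simps:
  "carrier (Hom_module R M N) = lin_hom R M N \<inter> extensional (carrier M)"
  "\<zero>\<^bsub>Hom_module R M N\<^esub> = (\<lambda>x\<in>carrier M. \<zero>\<^bsub>N\<^esub>)"
  "f \<oplus>\<^bsub>Hom_module R M N\<^esub> g = (\<lambda>x\<in>carrier M. f x \<oplus>\<^bsub>N\<^esub> g x)"
  "a \<odot>\<^bsub>Hom_module R M N\<^esub> f = (\<lambda>x\<in>carrier M. a \<odot>\<^bsub>N\<^esub> f x)"
  by (simp_all add: Hom_module_def)

lemma Hom_module_module:
  assumes M: "Module.module R M" and N: "Module.module R N"
  shows "Module.module R (Hom_module R M N)"
proof -
  interpret M: Module.module R M by fact
  interpret N: Module.module R N by fact
  show ?thesis
  proof (rule module_of_functions[OF N, of _ "carrier M"])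
    show "carrier (Hom_module R M N) \<subseteq> carrier M \<rightarrow>\<^sub>E carrier N"
      by (auto simp: Hom_module_simps lin_hom_def PiE_def)
    show "\<zero>\<^bsub>Hom_module R M N\<^esub> \<in> carrier (Hom_module R M N)"
      by (auto simp: Hom_module_simps lin_hom_def)
  next
    fix f g assume "f \<in> carrier (Hom_module R M N)" "g \<in> carrier (Hom_module R M N)"
    then have f: "f \<in> lin_hom R M N" and g: "g \<in> lin_hom R M N" by (auto simp: Hom_module_simps)
    note fc = lin_hom_closed[OF f] and gc = lin_hom_closed[OF g]
    have "(\<lambda>x\<in>carrier M. f x \<oplus>\<^bsub>N\<^esub> g x) \<in> lin_hom R M N"
      by (rule lin_homI)
        (simp_all add: lin_hom_add[OF f] lin_hom_add[OF g] lin_hom_smult[OF f] lin_hom_smult[OF g]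
          fc gc N.a_ac N.smult_r_distr)
    then show "f \<oplus>\<^bsub>Hom_module R M N\<^esub> g \<in> carrier (Hom_module R M N)"
      by (simp add: Hom_module_simps)
  next
    fix a f assume a: "a \<in> carrier R" and "f \<in> carrier (Hom_module R M N)"
    then have f: "f \<in> lin_hom R M N" by (auto simp: Hom_module_simps)
    note fc = lin_hom_closed[OF f]
    have "(\<lambda>x\<in>carrier M. a \<odot>\<^bsub>N\<^esub> f x) \<in> lin_hom R M N"
      by (rule lin_homI)
        (simp_all add: a lin_hom_add[OF f] lin_hom_smult[OF f] fc N.smult_r_distr
          N.smult_assoc1[symmetric] m_comm)
    then show "a \<odot>\<^bsub>Hom_module R M N\<^esub> f \<in> carrier (Hom_module R M N)"
      by (simp add: Hom_module_simps)
  qed (simp_all add: Hom_module_simps)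
qed

text \<open>For quotient modules: the axioms are checked on representatives.\<close>

lemma module_surj_image:
  assumes X: "Module.module R X" and q: "q ` carrier X = carrier Y"
    and zero: "q \<zero>\<^bsub>X\<^esub> = \<zero>\<^bsub>Y\<^esub>"
    and add: "\<And>x y. x \<in> carrier X \<Longrightarrow> y \<in> carrier X \<Longrightarrow> q (x \<oplus>\<^bsub>X\<^esub> y) = q x \<oplus>\<^bsub>Y\<^esub> q y"
    and smult: "\<And>a x. a \<in> carrier R \<Longrightarrow> x \<in> carrier X \<Longrightarrow> q (a \<odot>\<^bsub>X\<^esub> x) = a \<odot>\<^bsub>Y\<^esub> q x"
  shows "Module.module R Y"
proof -
  interpret X: Module.module R X by fact
  have q_closed: "q x \<in> carrier Y" if "x \<in> carrier X" for x using q that by auto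
  have lift: "\<exists>x\<in>carrier X. y = q x" if "y \<in> carrier Y" for y using q that by auto
  show ?thesis
  proof (rule moduleI_neg)
    fix x y assume "x \<in> carrier Y" "y \<in> carrier Y"
    then obtain u v where [simp]: "u \<in> carrier X" "v \<in> carrier X" and xy: "x = q u" "y = q v"
      using lift by metis
    show "x \<oplus>\<^bsub>Y\<^esub> y \<in> carrier Y" using q_closed[of "u \<oplus>\<^bsub>X\<^esub> v"] by (simp add: xy add)
    show "x \<oplus>\<^bsub>Y\<^esub> y = y \<oplus>\<^bsub>Y\<^esub> x" by (simp add: xy add[symmetric] X.a_comm)
  next
    show "\<zero>\<^bsub>Y\<^esub> \<in> carrier Y" using q_closed[of "\<zero>\<^bsub>X\<^esub>"] zero by simp
  next
    fix x y z assume "x \<in> carrier Y" "y \<in> carrier Y" "z \<in> carrier Y"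
    then obtain u v w where [simp]: "u \<in> carrier X" "v \<in> carrier X" "w \<in> carrier X"
      and xy: "x = q u" "y = q v" "z = q w"
      using lift by metis
    show "x \<oplus>\<^bsub>Y\<^esub> y \<oplus>\<^bsub>Y\<^esub> z = x \<oplus>\<^bsub>Y\<^esub> (y \<oplus>\<^bsub>Y\<^esub> z)"
      by (simp add: xy add[symmetric] X.a_assoc)
  next
    fix x assume "x \<in> carrier Y"
    then obtain u where [simp]: "u \<in> carrier X" and xy: "x = q u" using lift by metis
    show "\<zero>\<^bsub>Y\<^esub> \<oplus>\<^bsub>Y\<^esub> x = x" by (simp add: xy zero[symmetric] add[symmetric])
    show "\<ominus> \<one> \<odot>\<^bsub>Y\<^esub> x \<oplus>\<^bsub>Y\<^esub> x = \<zero>\<^bsub>Y\<^esub>"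
      by (simp add: xy zero[symmetric] add[symmetric] smult[symmetric] X.smult_l_minus X.l_neg)
    show "\<one> \<odot>\<^bsub>Y\<^esub> x = x" by (simp add: xy smult[symmetric])
  next
    fix a x assume a: "a \<in> carrier R" and "x \<in> carrier Y"
    then obtain u where [simp]: "u \<in> carrier X" and xy: "x = q u" using lift by metis
    show "a \<odot>\<^bsub>Y\<^esub> x \<in> carrier Y" using a q_closed[of "a \<odot>\<^bsub>X\<^esub> u"] by (simp add: xy smult)
  next
    fix a b x assume [simp]: "a \<in> carrier R" "b \<in> carrier R" and "x \<in> carrier Y"
    then obtain u where [simp]: "u \<in> carrier X" and xy: "x = q u" using lift by metis
    show "(a \<oplus> b) \<odot>\<^bsub>Y\<^esub> x = a \<odot>\<^bsub>Y\<^esub> x \<oplus>\<^bsub>Y\<^esub> b \<odot>\<^bsub>Y\<^esub> x"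
      by (simp add: xy add[symmetric] smult[symmetric] X.smult_l_distr)
    show "(a \<otimes> b) \<odot>\<^bsub>Y\<^esub> x = a \<odot>\<^bsub>Y\<^esub> (b \<odot>\<^bsub>Y\<^esub> x)"
      by (simp add: xy smult[symmetric] X.smult_assoc1)
  next
    fix a x y assume [simp]: "a \<in> carrier R" and "x \<in> carrier Y" "y \<in> carrier Y"
    then obtain u v where [simp]: "u \<in> carrier X" "v \<in> carrier X" and xy: "x = q u" "y = q v"
      using lift by metis
    show "a \<odot>\<^bsub>Y\<^esub> (x \<oplus>\<^bsub>Y\<^esub> y) = a \<odot>\<^bsub>Y\<^esub> x \<oplus>\<^bsub>Y\<^esub> a \<odot>\<^bsub>Y\<^esub> y"
      by (simp add: xy add[symmetric] smult[symmetric] X.smult_r_distr)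
  qed
qed

lemma
  assumes X: "Module.module R X" and U: "submodule U R X"
  shows quot_map_add: "x \<in> carrier X \<Longrightarrow> y \<in> carrier X \<Longrightarrow>
      U +>\<^bsub>X\<^esub> (x \<oplus>\<^bsub>X\<^esub> y) = (U +>\<^bsub>X\<^esub> x) \<oplus>\<^bsub>quot_module X U\<^esub> (U +>\<^bsub>X\<^esub> y)"
    and quot_map_smult: "a \<in> carrier R \<Longrightarrow> x \<in> carrier X \<Longrightarrow>
      U +>\<^bsub>X\<^esub> (a \<odot>\<^bsub>X\<^esub> x) = a \<odot>\<^bsub>quot_module X U\<^esub> (U +>\<^bsub>X\<^esub> x)"
    and quot_map_zero: "U +>\<^bsub>X\<^esub> \<zero>\<^bsub>X\<^esub> = \<zero>\<^bsub>quot_module X U\<^esub>"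
    and quot_map_surj: "(\<lambda>x. U +>\<^bsub>X\<^esub> x) ` carrier X = carrier (quot_module X U)"
    and quot_map_eq_iff: "x \<in> carrier X \<Longrightarrow> y \<in> carrier X \<Longrightarrow>
      U +>\<^bsub>X\<^esub> x = U +>\<^bsub>X\<^esub> y \<longleftrightarrow> x \<ominus>\<^bsub>X\<^esub> y \<in> U"
proof -
  interpret X: Module.module R X by fact
  have sub: "additive_subgroup U X"
    using submodule.axioms(1)[OF U] by (simp add: additive_subgroup_def)
  interpret U: abelian_subgroup U X
    by (intro abelian_subgroupI3 sub X.abelian_group_axioms)
  show add: "U +>\<^bsub>X\<^esub> (x \<oplus>\<^bsub>X\<^esub> y) = (U +>\<^bsub>X\<^esub> x) \<oplus>\<^bsub>quot_module X U\<^esub> (U +>\<^bsub>X\<^esub> y)"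
    if "x \<in> carrier X" "y \<in> carrier X" for x y
    using that by (simp add: quot_module_def U.a_rcos_sum)
  show eq: "U +>\<^bsub>X\<^esub> x = U +>\<^bsub>X\<^esub> y \<longleftrightarrow> x \<ominus>\<^bsub>X\<^esub> y \<in> U"
    if "x \<in> carrier X" "y \<in> carrier X" for x y
    using that U.a_repr_independence'[of x y] U.a_rcos_self[of x] U.a_rcos_module[of y x]
    by (auto simp: a_minus_def)
  show "U +>\<^bsub>X\<^esub> \<zero>\<^bsub>X\<^esub> = \<zero>\<^bsub>quot_module X U\<^esub>"
    using U.a_subset by (simp add: quot_module_def)
  show "(\<lambda>x. U +>\<^bsub>X\<^esub> x) ` carrier X = carrier (quot_module X U)"
    by (auto simp: quot_module_def A_RCOSETS_def')
  show "U +>\<^bsub>X\<^esub> (a \<odot>\<^bsub>X\<^esub> x) = a \<odot>\<^bsub>quot_module X U\<^esub> (U +>\<^bsub>X\<^esub> x)"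
    if a: "a \<in> carrier R" and x: "x \<in> carrier X"
  proof -
    have "U +>\<^bsub>X\<^esub> (a \<odot>\<^bsub>X\<^esub> y) = U +>\<^bsub>X\<^esub> (a \<odot>\<^bsub>X\<^esub> x)" if y: "y \<in> U +>\<^bsub>X\<^esub> x" for y
    proof -
      obtain u where u: "u \<in> U" "y = u \<oplus>\<^bsub>X\<^esub> x" using y by (auto simp: a_r_coset_def')
      have uc: "u \<in> carrier X" using u(1) by (rule submodule_carrierD[OF X U])
      have "a \<odot>\<^bsub>X\<^esub> y \<ominus>\<^bsub>X\<^esub> a \<odot>\<^bsub>X\<^esub> x = a \<odot>\<^bsub>X\<^esub> u"
        using u uc a x by (simp add: X.smult_r_distr a_minus_def X.a_assoc X.r_neg)
      then show ?thesis using u uc a x submodule_smult[OF X U] by (subst eq) auto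
    qed
    moreover have "U +>\<^bsub>X\<^esub> x \<noteq> {}" using U.a_rcos_self[OF x] by auto
    ultimately have "(\<Union>y\<in>U +>\<^bsub>X\<^esub> x. U +>\<^bsub>X\<^esub> (a \<odot>\<^bsub>X\<^esub> y)) = U +>\<^bsub>X\<^esub> (a \<odot>\<^bsub>X\<^esub> x)"
      by (intro SUP_eq_const)
    then show ?thesis by (simp add: quot_module_def)
  qed
qed

lemma quot_module_module:
  assumes X: "Module.module R X" and U: "submodule U R X"
  shows "Module.module R (quot_module X U)"
  by (rule module_surj_image[OF X quot_map_surj quot_map_zero quot_map_add quot_map_smult]) (rule X U | assumption)+

lemma quot_map_lin_hom:
  assumes X: "Module.module R X" and U: "submodule U R X"
  shows "(\<lambda>x. U +>\<^bsub>X\<^esub> x) \<in> lin_hom R X (quot_module X U)"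
  using quot_map_surj[OF X U] by (intro lin_homI quot_map_add quot_map_smult X U) auto

lemma quot_map_zero_iff:
  assumes X: "Module.module R X" and U: "submodule U R X" and x: "x \<in> carrier X"
  shows "U +>\<^bsub>X\<^esub> x = \<zero>\<^bsub>quot_module X U\<^esub> \<longleftrightarrow> x \<in> U"
proof -
  interpret X: Module.module R X by fact
  have "\<ominus>\<^bsub>X\<^esub> \<zero>\<^bsub>X\<^esub> = \<zero>\<^bsub>X\<^esub>" using X.r_neg[OF X.zero_closed] by simp
  then have "x \<ominus>\<^bsub>X\<^esub> \<zero>\<^bsub>X\<^esub> = x" unfolding a_minus_def by (simp only: X.r_zero[OF x])
  then show ?thesis
    using quot_map_eq_iff[OF X U x X.zero_closed] by (simp only: quot_map_zero[OF X U])
qed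

lemma slen_quot_module:
  assumes X: "Module.module R X" and U: "submodule U R X"
  shows "slen (quot_module X U) {\<zero>\<^bsub>quot_module X U\<^esub>} (carrier (quot_module X U)) = slen X U (carrier X)"
proof -
  let ?q = "\<lambda>x. U +>\<^bsub>X\<^esub> x"
  have q0: "?q x = \<zero>\<^bsub>quot_module X U\<^esub> \<longleftrightarrow> x \<in> U" if "x \<in> carrier X" for x
    using quot_map_zero_iff[OF X U that] .
  have "?q ` U = {\<zero>\<^bsub>quot_module X U\<^esub>}"
    using q0 submodule_sub[OF X U] submodule_zero[OF X U] by auto
  then show ?thesis
    using slen_image[OF X quot_module_module[OF X U] quot_map_lin_hom[OF X U] U submodule_carrier[OF X]]
      q0 submodule_sub[OF X U] quot_map_surj[OF X U] by auto
qed

end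

lemma (in abelian_monoid) finsum_swap:
  assumes "finite I" "finite J" "\<And>i j. i \<in> I \<Longrightarrow> j \<in> J \<Longrightarrow> g i j \<in> carrier G"
  shows "(\<Oplus>i\<in>I. \<Oplus>j\<in>J. g i j) = (\<Oplus>j\<in>J. \<Oplus>i\<in>I. g i j)"
  using assms(1,3)
proof (induction I rule: finite_induct)
  case empty
  then show ?case by (simp add: finsum_zero)
next
  case (insert a I)
  have "(\<Oplus>j\<in>J. \<Oplus>i\<in>insert a I. g i j) = (\<Oplus>j\<in>J. g a j \<oplus> (\<Oplus>i\<in>I. g i j))"
    using insert by (intro finsum_cong' refl) (auto simp: Pi_def intro!: finsum_closed)
  also have "\<dots> = (\<Oplus>j\<in>J. g a j) \<oplus> (\<Oplus>j\<in>J. \<Oplus>i\<in>I. g i j)"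
    using insert by (intro finsum_addf) (auto intro!: finsum_closed)
  also have "\<dots> = (\<Oplus>j\<in>J. g a j) \<oplus> (\<Oplus>i\<in>I. \<Oplus>j\<in>J. g i j)" using insert by simp
  also have "\<dots> = (\<Oplus>i\<in>insert a I. \<Oplus>j\<in>J. g i j)"
    using insert by (intro finsum_insert[symmetric]) (auto intro!: finsum_closed)
  finally show ?case ..
qed

context cring
begin

section \<open>Submodules of powers\<close>

lemma submodule_PiE:
  assumes X: "Module.module R X" and H: "\<And>i. i < k \<Longrightarrow> submodule (H i) R X"
  shows "submodule (\<Pi>\<^sub>E i\<in>{..<k}. H i) R (direct_power X k)"
proof -
  interpret X: Module.module R X by fact
  have sub: "H i \<subseteq> carrier X" if "i < k" for i using submodule_sub[OF X H[OF that]] .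
  show ?thesis
    unfolding submodule_iff[OF direct_power_module[OF X]]
  proof (intro conjI ballI)
    show "(\<Pi>\<^sub>E i\<in>{..<k}. H i) \<subseteq> carrier (direct_power X k)"
      using sub by (auto intro!: PiE_mono)
    show "\<zero>\<^bsub>direct_power X k\<^esub> \<in> (\<Pi>\<^sub>E i\<in>{..<k}. H i)"
      using submodule_zero[OF X H] by auto
  next
    fix x y assume "x \<in> (\<Pi>\<^sub>E i\<in>{..<k}. H i)" "y \<in> (\<Pi>\<^sub>E i\<in>{..<k}. H i)"
    then show "x \<oplus>\<^bsub>direct_power X k\<^esub> y \<in> (\<Pi>\<^sub>E i\<in>{..<k}. H i)"
      using submodule_add[OF X H] by (auto simp: PiE_mem)
  next
    fix a x assume "a \<in> carrier R" "x \<in> (\<Pi>\<^sub>E i\<in>{..<k}. H i)"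
    then show "a \<odot>\<^bsub>direct_power X k\<^esub> x \<in> (\<Pi>\<^sub>E i\<in>{..<k}. H i)"
      using submodule_smult[OF X H] by (auto simp: PiE_mem)
  qed
qed

lemma submodule_power:
  "Module.module R X \<Longrightarrow> submodule H R X \<Longrightarrow> submodule ({..<k} \<rightarrow>\<^sub>E H) R (direct_power X k)"
  by (rule submodule_PiE)

lemma proj_lin_hom: "i < k \<Longrightarrow> (\<lambda>x. x i) \<in> lin_hom R (direct_power X k) X"
  by (rule lin_homI) auto

text \<open>Replacing \<open>A\<close> by \<open>B\<close> one coordinate at a time increases the length by that of \<open>B/A\<close>.\<close>

lemma slen_power:
  assumes X: "Module.module R X" and A: "submodule A R X" and B: "submodule B R X" and le: "A \<subseteq> B"
  shows "slen (direct_power X k) ({..<k} \<rightarrow>\<^sub>E A) ({..<k} \<rightarrow>\<^sub>E B) = enat k * slen X A B"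
proof -
  define D where "D j = (\<Pi>\<^sub>E i\<in>{..<k}. if i < j then B else A)" for j
  have sub: "submodule (D j) R (direct_power X k)" for j
    unfolding D_def using A B by (intro submodule_PiE X) auto
  have mono: "D i \<subseteq> D j" if "i \<le> j" for i j
    unfolding D_def using le that by (intro PiE_mono) auto
  have ext: "\<exists>x\<in>D j. x i = b" if "i < k" "b \<in> (if i < j then B else A)" for i j b
  proof
    show "(\<lambda>l\<in>{..<k}. if l = i then b else \<zero>\<^bsub>X\<^esub>) \<in> D j"
      using that submodule_zero[OF X A] submodule_zero[OF X B] by (auto simp: D_def)
  qed (use that in simp)
  have img: "(\<lambda>x. x i) ` D j = (if i < j then B else A)" if "i < k" for i j
  proof
    show "(\<lambda>x. x i) ` D j \<subseteq> (if i < j then B else A)"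
      using that by (auto simp: D_def PiE_def Pi_def split: if_splits)
    show "(if i < j then B else A) \<subseteq> (\<lambda>x. x i) ` D j"
      using ext[OF that, of _ j] by blast
  qed
  have step: "slen (direct_power X k) (D j) (D (Suc j)) = slen X A B" if j: "j < k" for j
  proof -
    have "slen X ((\<lambda>x. x j) ` D j) ((\<lambda>x. x j) ` D (Suc j)) = slen (direct_power X k) (D j) (D (Suc j))"
    proof (rule slen_image[OF direct_power_module[OF X] X proj_lin_hom[OF j] sub sub])
      fix x assume x: "x \<in> D (Suc j)" "x j = \<zero>\<^bsub>X\<^esub>"
      have "x i \<in> (if i < j then B else A)" if "i < k" for i
      proof (cases "i = j")
        case True
        then show ?thesis using x submodule_zero[OF X A] by simp
      next
        case False
        then show ?thesis using PiE_mem[OF x(1)[unfolded D_def], of i] that by (auto split: if_splits)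
      qed
      then show "x \<in> D j" using x(1) unfolding D_def by (auto simp: PiE_def)
    qed (simp add: mono)
    then show ?thesis using img[OF j] by simp
  qed
  have "slen (direct_power X k) (D 0) (D j) = enat j * slen X A B" if "j \<le> k" for j
    using that
  proof (induction j)
    case 0
    then show ?case by (simp add: slen_refl zero_enat_def[symmetric])
  next
    case (Suc j)
    then have "slen (direct_power X k) (D 0) (D (Suc j)) = enat j * slen X A B + slen X A B"
      using slen_add[OF direct_power_module[OF X] sub sub sub, of 0 j "Suc j"] mono step[of j] by simp
    also have "\<dots> = (enat j + 1) * slen X A B" by (simp add: distrib_right)
    also have "enat j + 1 = enat (Suc j)" by (simp add: one_enat_def)
    finally show ?case .
  qed
  moreover have "D 0 = {..<k} \<rightarrow>\<^sub>E A" "D k = {..<k} \<rightarrow>\<^sub>E B"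
    unfolding D_def by (auto intro!: PiE_cong)
  ultimately show ?thesis by (metis order_refl)
qed

lemma PiE_zero_power: "{..<k} \<rightarrow>\<^sub>E {\<zero>\<^bsub>X\<^esub>} = {\<zero>\<^bsub>direct_power X k\<^esub>}"
  by (auto simp: PiE_eq_singleton fun_eq_iff PiE_def extensional_def Pi_def)

lemma slen_power_zero:
  assumes X: "Module.module R X" and B: "submodule B R X"
  shows "slen (direct_power X k) {\<zero>\<^bsub>direct_power X k\<^esub>} ({..<k} \<rightarrow>\<^sub>E B) = enat k * slen X {\<zero>\<^bsub>X\<^esub>} B"
  using slen_power[OF X submodule_zero_set[OF X] B, of k] submodule_zero[OF X B]
  by (simp add: PiE_zero_power)

section \<open>Matrices acting on powers of a module\<close>

text \<open>
  A matrix over \<open>R\<close> acts on the powers of every module at once, so that a complex of finitely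
  generated free modules, and its dual, can be evaluated at any module.
\<close>

definition mat :: "nat \<Rightarrow> nat \<Rightarrow> (nat \<Rightarrow> nat \<Rightarrow> 'a) \<Rightarrow> bool"
  where "mat q p A \<longleftrightarrow> (\<forall>i<q. \<forall>j<p. A i j \<in> carrier R)"

definition act :: "('a, 'c, 'm) module_scheme \<Rightarrow> nat \<Rightarrow> nat \<Rightarrow> (nat \<Rightarrow> nat \<Rightarrow> 'a) \<Rightarrow> (nat \<Rightarrow> 'c) \<Rightarrow> nat \<Rightarrow> 'c"
  where "act X q p A x = (\<lambda>i\<in>{..<q}. \<Oplus>\<^bsub>X\<^esub>j\<in>{..<p}. A i j \<odot>\<^bsub>X\<^esub> x j)"

definition mmult :: "nat \<Rightarrow> (nat \<Rightarrow> nat \<Rightarrow> 'a) \<Rightarrow> (nat \<Rightarrow> nat \<Rightarrow> 'a) \<Rightarrow> nat \<Rightarrow> nat \<Rightarrow> 'a"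
  where "mmult p A B i k = (\<Oplus>j\<in>{..<p}. A i j \<otimes> B j k)"

definition mid :: "nat \<Rightarrow> nat \<Rightarrow> 'a"
  where "mid i j = (if i = j then \<one> else \<zero>)"

definition mtransp :: "(nat \<Rightarrow> nat \<Rightarrow> 'a) \<Rightarrow> nat \<Rightarrow> nat \<Rightarrow> 'a"
  where mtransp_nth: "mtransp A i j = A j i"

lemma matD: "mat q p A \<Longrightarrow> i < q \<Longrightarrow> j < p \<Longrightarrow> A i j \<in> carrier R"
  unfolding mat_def by blast

lemma mat_transp: "mat q p A \<Longrightarrow> mat p q (mtransp A)"
  by (simp add: mat_def mtransp_nth)

lemma mat_mid: "mat p p mid"
  by (simp add: mat_def mid_def)

lemma mat_mmult: "mat q p A \<Longrightarrow> mat p s B \<Longrightarrow> mat q s (mmult p A B)"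
  unfolding mmult_def by (auto simp: mat_def intro!: finsum_closed)

lemma transp_mmult:
  assumes "mat q p A" "mat p s B" "i < s" "k < q"
  shows "mmult p A B k i = mmult p (mtransp B) (mtransp A) i k"
  unfolding mmult_def using assms by (intro finsum_cong') (auto simp: mat_def mtransp_nth m_comm)

lemma finsum_single:
  assumes "Module.module R X" "finite I" "i \<in> I" "x \<in> carrier X"
  shows "(\<Oplus>\<^bsub>X\<^esub>j\<in>I. if j = i then x else \<zero>\<^bsub>X\<^esub>) = x"
proof -
  interpret X: Module.module R X by fact
  show ?thesis using X.finsum_singleton[OF assms(3,2), of "\<lambda>_. x"] assms(4) by (simp add: eq_commute)
qed

lemma act_nth: "i < q \<Longrightarrow> act X q p A x i = (\<Oplus>\<^bsub>X\<^esub>j\<in>{..<p}. A i j \<odot>\<^bsub>X\<^esub> x j)"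
  by (simp add: act_def)

lemma act_mem:
  assumes X: "Module.module R X" and H: "submodule H R X" and A: "mat q p A" and x: "x \<in> {..<p} \<rightarrow>\<^sub>E H"
  shows "act X q p A x \<in> {..<q} \<rightarrow>\<^sub>E H"
  unfolding act_def using x
  by (auto intro!: submodule_finsum[OF X H] submodule_smult[OF X H] matD[OF A])

lemma act_closed:
  assumes X: "Module.module R X" and A: "mat q p A" and x: "x \<in> {..<p} \<rightarrow>\<^sub>E carrier X"
  shows "act X q p A x \<in> {..<q} \<rightarrow>\<^sub>E carrier X"
  by (rule act_mem[OF X submodule_carrier[OF X] A x])

lemma act_lin_hom:
  assumes X: "Module.module R X" and A: "mat q p A"
  shows "act X q p A \<in> lin_hom R (direct_power X p) (direct_power X q)"
proof -
  interpret X: Module.module R X by fact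
  have A': "A i j \<odot>\<^bsub>X\<^esub> x j \<in> carrier X" if "i < q" "j < p" "x \<in> {..<p} \<rightarrow>\<^sub>E carrier X" for x i j
    using matD[OF A that(1,2)] that by (auto simp: PiE_mem)
  show ?thesis
  proof (rule lin_homI)
    fix x assume "x \<in> carrier (direct_power X p)"
    then show "act X q p A x \<in> carrier (direct_power X q)" using act_closed[OF X A] by simp
  next
    fix x y assume xy: "x \<in> carrier (direct_power X p)" "y \<in> carrier (direct_power X p)"
    have xc: "x i \<in> carrier X" "y i \<in> carrier X" if "i < p" for i
      using xy that by (auto simp: PiE_mem)
    have "(\<Oplus>\<^bsub>X\<^esub>j\<in>{..<p}. A i j \<odot>\<^bsub>X\<^esub> (\<lambda>i\<in>{..<p}. x i \<oplus>\<^bsub>X\<^esub> y i) j) =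
      (\<Oplus>\<^bsub>X\<^esub>j\<in>{..<p}. A i j \<odot>\<^bsub>X\<^esub> x j) \<oplus>\<^bsub>X\<^esub> (\<Oplus>\<^bsub>X\<^esub>j\<in>{..<p}. A i j \<odot>\<^bsub>X\<^esub> y j)" if i: "i < q" for i
    proof -
      have "(\<Oplus>\<^bsub>X\<^esub>j\<in>{..<p}. A i j \<odot>\<^bsub>X\<^esub> (\<lambda>i\<in>{..<p}. x i \<oplus>\<^bsub>X\<^esub> y i) j) =
        (\<Oplus>\<^bsub>X\<^esub>j\<in>{..<p}. A i j \<odot>\<^bsub>X\<^esub> x j \<oplus>\<^bsub>X\<^esub> A i j \<odot>\<^bsub>X\<^esub> y j)"
        using xc i matD[OF A] by (intro X.finsum_cong' refl) (simp_all add: X.smult_r_distr)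
      then show ?thesis using xy i A' by (simp add: X.finsum_addf)
    qed
    then show "act X q p A (x \<oplus>\<^bsub>direct_power X p\<^esub> y) = act X q p A x \<oplus>\<^bsub>direct_power X q\<^esub> act X q p A y"
      by (auto simp: act_def)
  next
    fix a x assume a: "a \<in> carrier R" and x: "x \<in> carrier (direct_power X p)"
    have xc: "x i \<in> carrier X" if "i < p" for i
      using x that by (auto simp: PiE_mem)
    have "(\<Oplus>\<^bsub>X\<^esub>j\<in>{..<p}. A i j \<odot>\<^bsub>X\<^esub> (\<lambda>i\<in>{..<p}. a \<odot>\<^bsub>X\<^esub> x i) j) =
      a \<odot>\<^bsub>X\<^esub> (\<Oplus>\<^bsub>X\<^esub>j\<in>{..<p}. A i j \<odot>\<^bsub>X\<^esub> x j)" if i: "i < q" for i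
    proof -
      have "(\<Oplus>\<^bsub>X\<^esub>j\<in>{..<p}. A i j \<odot>\<^bsub>X\<^esub> (\<lambda>i\<in>{..<p}. a \<odot>\<^bsub>X\<^esub> x i) j) =
        (\<Oplus>\<^bsub>X\<^esub>j\<in>{..<p}. a \<odot>\<^bsub>X\<^esub> (A i j \<odot>\<^bsub>X\<^esub> x j))"
        using xc a i matD[OF A]
        by (intro X.finsum_cong' refl) (simp_all add: X.smult_assoc1[symmetric] m_comm)
      then show ?thesis using x a i A' by (simp add: X.finsum_smult_ldistr)
    qed
    then show "act X q p A (a \<odot>\<^bsub>direct_power X p\<^esub> x) = a \<odot>\<^bsub>direct_power X q\<^esub> act X q p A x"
      by (auto simp: act_def)
  qed
qed

lemma finsum_ring_module: "finsum (ring_module R) f I = finsum R f I"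
  by (simp add: finsum_def finprod_def ring_module_def)

lemma finsum_smult_rdistr:
  assumes X: "Module.module R X" and "finite I" "f \<in> I \<rightarrow> carrier R" "x \<in> carrier X"
  shows "(\<Oplus>i\<in>I. f i) \<odot>\<^bsub>X\<^esub> x = (\<Oplus>\<^bsub>X\<^esub>i\<in>I. f i \<odot>\<^bsub>X\<^esub> x)"
proof -
  interpret X: Module.module R X by fact
  have "(\<lambda>a. a \<odot>\<^bsub>X\<^esub> x) \<in> lin_hom R (ring_module R) X"
    using assms(4) by (intro lin_homI) (auto simp: X.smult_l_distr X.smult_assoc1)
  from lin_hom_finsum[OF ring_module X this assms(2), of f] assms(3)
  show ?thesis by (simp add: finsum_ring_module)
qed

lemma act_mmult:
  assumes X: "Module.module R X" and A: "mat q p A" and B: "mat p s B" and x: "x \<in> {..<s} \<rightarrow>\<^sub>E carrier X"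
  shows "act X q p A (act X p s B x) = act X q s (mmult p A B) x"
proof -
  interpret X: Module.module R X by fact
  have xc: "x k \<in> carrier X" if "k < s" for k using x that by auto
  have "(\<Oplus>\<^bsub>X\<^esub>j\<in>{..<p}. A i j \<odot>\<^bsub>X\<^esub> act X p s B x j) = (\<Oplus>\<^bsub>X\<^esub>k\<in>{..<s}. mmult p A B i k \<odot>\<^bsub>X\<^esub> x k)"
    if i: "i < q" for i
  proof -
    have "(\<Oplus>\<^bsub>X\<^esub>j\<in>{..<p}. A i j \<odot>\<^bsub>X\<^esub> act X p s B x j)
        = (\<Oplus>\<^bsub>X\<^esub>j\<in>{..<p}. \<Oplus>\<^bsub>X\<^esub>k\<in>{..<s}. (A i j \<otimes> B j k) \<odot>\<^bsub>X\<^esub> x k)"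
    proof (rule X.finsum_cong'[OF refl])
      show "(\<lambda>j. \<Oplus>\<^bsub>X\<^esub>k\<in>{..<s}. (A i j \<otimes> B j k) \<odot>\<^bsub>X\<^esub> x k) \<in> {..<p} \<rightarrow> carrier X"
        using i matD[OF A] matD[OF B] xc by (auto intro!: X.finsum_closed)
      fix j assume j: "j \<in> {..<p}"
      then have "A i j \<odot>\<^bsub>X\<^esub> act X p s B x j = (\<Oplus>\<^bsub>X\<^esub>k\<in>{..<s}. A i j \<odot>\<^bsub>X\<^esub> (B j k \<odot>\<^bsub>X\<^esub> x k))"
        using i matD[OF A] matD[OF B] xc by (simp add: act_nth) (intro X.finsum_smult_ldistr; auto)
      also have "\<dots> = (\<Oplus>\<^bsub>X\<^esub>k\<in>{..<s}. (A i j \<otimes> B j k) \<odot>\<^bsub>X\<^esub> x k)"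
        using i j matD[OF A] matD[OF B] xc by (intro X.finsum_cong' refl) (auto simp: X.smult_assoc1)
      finally show "A i j \<odot>\<^bsub>X\<^esub> act X p s B x j = (\<Oplus>\<^bsub>X\<^esub>k\<in>{..<s}. (A i j \<otimes> B j k) \<odot>\<^bsub>X\<^esub> x k)" .
    qed
    also have "\<dots> = (\<Oplus>\<^bsub>X\<^esub>k\<in>{..<s}. \<Oplus>\<^bsub>X\<^esub>j\<in>{..<p}. (A i j \<otimes> B j k) \<odot>\<^bsub>X\<^esub> x k)"
      using i matD[OF A] matD[OF B] xc by (intro X.finsum_swap) auto
    also have "\<dots> = (\<Oplus>\<^bsub>X\<^esub>k\<in>{..<s}. mmult p A B i k \<odot>\<^bsub>X\<^esub> x k)"
    proof (rule X.finsum_cong'[OF refl])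
      show "(\<lambda>k. mmult p A B i k \<odot>\<^bsub>X\<^esub> x k) \<in> {..<s} \<rightarrow> carrier X"
        using i matD[OF mat_mmult[OF A B]] xc by auto
      fix k assume k: "k \<in> {..<s}"
      then show "(\<Oplus>\<^bsub>X\<^esub>j\<in>{..<p}. (A i j \<otimes> B j k) \<odot>\<^bsub>X\<^esub> x k) = mmult p A B i k \<odot>\<^bsub>X\<^esub> x k"
        unfolding mmult_def using i matD[OF A] matD[OF B] xc
        by (intro finsum_smult_rdistr[OF X, symmetric]) auto
    qed
    finally show ?thesis .
  qed
  then show ?thesis by (auto simp: act_def)
qed

lemma act_mid:
  assumes X: "Module.module R X" and x: "x \<in> {..<p} \<rightarrow>\<^sub>E carrier X"
  shows "act X p p mid x = x"
proof -
  interpret X: Module.module R X by fact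
  have xc: "x k \<in> carrier X" if "k < p" for k using x that by (auto simp: PiE_mem)
  have "(\<Oplus>\<^bsub>X\<^esub>j\<in>{..<p}. mid i j \<odot>\<^bsub>X\<^esub> x j) = x i" if i: "i < p" for i
  proof -
    have "(\<Oplus>\<^bsub>X\<^esub>j\<in>{..<p}. mid i j \<odot>\<^bsub>X\<^esub> x j) = (\<Oplus>\<^bsub>X\<^esub>j\<in>{..<p}. if j = i then x i else \<zero>\<^bsub>X\<^esub>)"
      using xc i by (intro X.finsum_cong' refl) (simp_all add: mid_def Pi_def)
    then show ?thesis using finsum_single[OF X, of "{..<p}" i "x i"] xc i by simp
  qed
  then show ?thesis using x by (auto simp: act_def PiE_def intro!: extensionalityI[of _ "{..<p}"])
qed

lemma act_natural:
  assumes X: "Module.module R X" and Y: "Module.module R Y" and f: "f \<in> lin_hom R X Y"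
    and A: "mat q p A" and x: "x \<in> {..<p} \<rightarrow>\<^sub>E carrier X"
  shows "act Y q p A (compose {..<p} f x) = compose {..<q} f (act X q p A x)"
proof -
  interpret X: Module.module R X by fact
  interpret Y: Module.module R Y by fact
  have "(\<Oplus>\<^bsub>Y\<^esub>j\<in>{..<p}. A i j \<odot>\<^bsub>Y\<^esub> compose {..<p} f x j) = f (\<Oplus>\<^bsub>X\<^esub>j\<in>{..<p}. A i j \<odot>\<^bsub>X\<^esub> x j)"
    if i: "i < q" for i
  proof -
    have xc: "x j \<in> carrier X" if "j < p" for j using x that by (auto simp: PiE_mem)
    have "f (\<Oplus>\<^bsub>X\<^esub>j\<in>{..<p}. A i j \<odot>\<^bsub>X\<^esub> x j) = (\<Oplus>\<^bsub>Y\<^esub>j\<in>{..<p}. f (A i j \<odot>\<^bsub>X\<^esub> x j))"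
      using i xc matD[OF A] by (intro lin_hom_finsum[OF X Y f]) simp_all
    also have "\<dots> = (\<Oplus>\<^bsub>Y\<^esub>j\<in>{..<p}. A i j \<odot>\<^bsub>Y\<^esub> compose {..<p} f x j)"
      using i xc matD[OF A] lin_hom_closed[OF f]
      by (intro Y.finsum_cong' refl) (simp_all add: compose_def lin_hom_smult[OF f])
    finally show ?thesis ..
  qed
  then show ?thesis by (auto simp: act_def compose_def)
qed

lemma compose_lin_hom:
  assumes f: "f \<in> lin_hom R X Y" and X: "Module.module R X"
  shows "compose {..<k} f \<in> lin_hom R (direct_power X k) (direct_power Y k)"
proof -
  interpret X: Module.module R X by fact
  have c: "x i \<in> carrier X" if "x \<in> {..<k} \<rightarrow>\<^sub>E carrier X" "i < k" for x i
    using that by (auto simp: PiE_mem)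
  show ?thesis
    by (rule lin_homI)
      (simp_all add: compose_def c lin_hom_add[OF f] lin_hom_smult[OF f] lin_hom_closed[OF f] cong: restrict_cong)
qed

lemma compose_image_PiE: "compose {..<k} f ` ({..<k} \<rightarrow>\<^sub>E A) = {..<k} \<rightarrow>\<^sub>E f ` A"
proof
  show "compose {..<k} f ` ({..<k} \<rightarrow>\<^sub>E A) \<subseteq> {..<k} \<rightarrow>\<^sub>E f ` A" by (auto simp: compose_def)
  show "{..<k} \<rightarrow>\<^sub>E f ` A \<subseteq> compose {..<k} f ` ({..<k} \<rightarrow>\<^sub>E A)"
  proof
    fix y assume y: "y \<in> {..<k} \<rightarrow>\<^sub>E f ` A"
    then have "\<forall>i\<in>{..<k}. \<exists>a\<in>A. y i = f a" by auto
    then obtain g where g: "\<forall>i\<in>{..<k}. g i \<in> A \<and> y i = f (g i)" by (metis)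
    have "y = compose {..<k} f (restrict g {..<k})"
      using y g by (auto simp: compose_def PiE_def intro!: extensionalityI[of _ "{..<k}"])
    moreover have "restrict g {..<k} \<in> {..<k} \<rightarrow>\<^sub>E A" using g by auto
    ultimately show "y \<in> compose {..<k} f ` ({..<k} \<rightarrow>\<^sub>E A)" by blast
  qed
qed

abbreviation unit_vec :: "nat \<Rightarrow> nat \<Rightarrow> nat \<Rightarrow> 'a"
  where "unit_vec k \<equiv> free_gen R {..<k}"

lemma unit_vec_closed: "j < k \<Longrightarrow> unit_vec k j \<in> {..<k} \<rightarrow>\<^sub>E carrier R"
  by (auto simp: free_gen_def)

lemma lin_combination_nth:
  assumes X: "Module.module R X" and "finite J" "\<And>j. j \<in> J \<Longrightarrow> g j \<in> {..<k} \<rightarrow>\<^sub>E carrier X" "i < k"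
  shows "(\<Oplus>\<^bsub>direct_power X k\<^esub>j\<in>J. g j) i = (\<Oplus>\<^bsub>X\<^esub>j\<in>J. g j i)"
  using lin_hom_finsum[OF direct_power_module[OF X] X proj_lin_hom[OF assms(4)] assms(2), of g] assms(3)
  by simp

lemma vec_eq_sum:
  assumes x: "x \<in> {..<k} \<rightarrow>\<^sub>E carrier R"
  shows "x = (\<Oplus>\<^bsub>direct_power (ring_module R) k\<^esub>j\<in>{..<k}. x j \<odot>\<^bsub>direct_power (ring_module R) k\<^esub> unit_vec k j)"
    (is "x = finsum ?F ?g _")
proof -
  interpret F: Module.module R ?F by (intro direct_power_module ring_module)
  have xc: "x i \<in> carrier R" if "i < k" for i using x that by (auto simp: PiE_mem)
  have g: "?g j \<in> {..<k} \<rightarrow>\<^sub>E carrier R" if "j < k" for j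
    using xc[OF that] by (simp add: free_gen_def)
  have sum: "finsum ?F ?g {..<k} \<in> {..<k} \<rightarrow>\<^sub>E carrier R"
    using F.finsum_closed[of ?g "{..<k}"] g by (auto simp del: direct_power_simps(4))
  have "finsum ?F ?g {..<k} i = x i" if i: "i < k" for i
  proof -
    interpret RM: Module.module R "ring_module R" by (rule ring_module)
    have "finsum ?F ?g {..<k} i = (\<Oplus>\<^bsub>ring_module R\<^esub>j\<in>{..<k}. ?g j i)"
      using g by (intro lin_combination_nth ring_module i) auto
    also have "\<dots> = (\<Oplus>\<^bsub>ring_module R\<^esub>j\<in>{..<k}. if j = i then x i else \<zero>\<^bsub>ring_module R\<^esub>)"
      using i xc by (intro RM.finsum_cong' refl) (simp_all add: free_gen_def)
    also have "\<dots> = x i" using i xc by (intro finsum_single ring_module) simp_all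
    finally show ?thesis .
  qed
  then show ?thesis using x sum by (auto simp: PiE_def intro!: extensionalityI[of _ "{..<k}"])
qed

lemma lin_hom_vec:
  assumes Y: "Module.module R Y" and f: "f \<in> lin_hom R (direct_power (ring_module R) k) Y"
    and x: "x \<in> {..<k} \<rightarrow>\<^sub>E carrier R"
  shows "f x = (\<Oplus>\<^bsub>Y\<^esub>j\<in>{..<k}. x j \<odot>\<^bsub>Y\<^esub> f (unit_vec k j))"
proof -
  let ?F = "direct_power (ring_module R) k"
  interpret F: Module.module R ?F by (intro direct_power_module ring_module)
  interpret Y: Module.module R Y by fact
  have xc: "x i \<in> carrier R" if "i < k" for i using x that by (auto simp: PiE_mem)
  have uc: "unit_vec k j \<in> carrier ?F" if "j < k" for j using unit_vec_closed[OF that] by simp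
  have g: "x j \<odot>\<^bsub>?F\<^esub> unit_vec k j \<in> carrier ?F" if "j < k" for j
    by (intro F.smult_closed xc uc that)
  have "f x = f (\<Oplus>\<^bsub>?F\<^esub>j\<in>{..<k}. x j \<odot>\<^bsub>?F\<^esub> unit_vec k j)" by (simp only: vec_eq_sum[OF x, symmetric])
  also have "\<dots> = (\<Oplus>\<^bsub>Y\<^esub>j\<in>{..<k}. f (x j \<odot>\<^bsub>?F\<^esub> unit_vec k j))"
    using g by (intro lin_hom_finsum[OF F.module_axioms Y f]) (simp_all only: finite_lessThan Pi_iff lessThan_iff, simp)
  also have "\<dots> = (\<Oplus>\<^bsub>Y\<^esub>j\<in>{..<k}. x j \<odot>\<^bsub>Y\<^esub> f (unit_vec k j))"
    using xc uc by (intro Y.finsum_cong' refl)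
      (simp_all only: Pi_iff lessThan_iff lin_hom_smult[OF f], simp add: lin_hom_closed[OF f] del: direct_power_simps)
  finally show ?thesis .
qed

lemma lin_hom_matrix:
  assumes f: "f \<in> lin_hom R (direct_power (ring_module R) p) (direct_power (ring_module R) q)"
  shows "mat q p (\<lambda>i j. f (unit_vec p j) i)"
    and "x \<in> {..<p} \<rightarrow>\<^sub>E carrier R \<Longrightarrow> f x = act (ring_module R) q p (\<lambda>i j. f (unit_vec p j) i) x"
proof -
  let ?F = "direct_power (ring_module R) q"
  interpret F: Module.module R ?F by (intro direct_power_module ring_module)
  interpret RM: Module.module R "ring_module R" by (rule ring_module)
  have fc: "f (unit_vec p j) \<in> {..<q} \<rightarrow>\<^sub>E carrier R" if "j < p" for j
    using lin_hom_closed[OF f] unit_vec_closed[OF that] by simp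
  then have fcn: "f (unit_vec p j) i \<in> carrier R" if "j < p" "i < q" for i j
    using that by (auto dest: PiE_mem)
  then show "mat q p (\<lambda>i j. f (unit_vec p j) i)" by (simp add: mat_def)
  assume x: "x \<in> {..<p} \<rightarrow>\<^sub>E carrier R"
  have xc: "x i \<in> carrier R" if "i < p" for i using x that by (auto simp: PiE_mem)
  have "f x i = act (ring_module R) q p (\<lambda>i j. f (unit_vec p j) i) x i" if i: "i < q" for i
  proof -
    have "f x i = (\<Oplus>\<^bsub>?F\<^esub>j\<in>{..<p}. x j \<odot>\<^bsub>?F\<^esub> f (unit_vec p j)) i"
      by (simp only: lin_hom_vec[OF F.module_axioms f x])
    also have "\<dots> = (\<Oplus>\<^bsub>ring_module R\<^esub>j\<in>{..<p}. (x j \<odot>\<^bsub>?F\<^esub> f (unit_vec p j)) i)"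
      using xc fcn i by (intro lin_combination_nth ring_module) simp_all
    also have "\<dots> = (\<Oplus>\<^bsub>ring_module R\<^esub>j\<in>{..<p}. f (unit_vec p j) i \<odot>\<^bsub>ring_module R\<^esub> x j)"
      using xc fcn i by (intro RM.finsum_cong' refl) (simp_all add: m_comm)
    finally show ?thesis using i by (simp add: act_nth)
  qed
  then show "f x = act (ring_module R) q p (\<lambda>i j. f (unit_vec p j) i) x"
    using lin_hom_closed[OF f, of x] x by (intro extensionalityI[of _ "{..<q}"]) (simp_all add: act_def PiE_def)
qed

lemma act_unit_vec:
  assumes "mat q p A" "j < p"
  shows "act (ring_module R) q p A (unit_vec p j) = (\<lambda>i\<in>{..<q}. A i j)"
proof -
  interpret RM: Module.module R "ring_module R" by (rule ring_module)
  have "(\<Oplus>\<^bsub>ring_module R\<^esub>l\<in>{..<p}. A i l \<odot>\<^bsub>ring_module R\<^esub> unit_vec p j l) = A i j" if i: "i < q" for i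
  proof -
    have "(\<Oplus>\<^bsub>ring_module R\<^esub>l\<in>{..<p}. A i l \<odot>\<^bsub>ring_module R\<^esub> unit_vec p j l) =
      (\<Oplus>\<^bsub>ring_module R\<^esub>l\<in>{..<p}. if l = j then A i j else \<zero>\<^bsub>ring_module R\<^esub>)"
      using assms i by (intro RM.finsum_cong' refl) (simp_all add: free_gen_def mat_def)
    then show ?thesis using assms i by (subst (asm) finsum_single[OF ring_module]) (auto simp: mat_def)
  qed
  then show ?thesis by (auto simp: act_def)
qed

section \<open>Tensor products\<close>

lemma gen_submodule_least: "submodule U R X \<Longrightarrow> A \<subseteq> U \<Longrightarrow> gen_submodule R X A \<subseteq> U"
  by (auto simp: gen_submodule_def)

lemma gen_submodule_upper: "A \<subseteq> gen_submodule R X A"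
  by (auto simp: gen_submodule_def)

lemma gen_submodule_submodule:
  assumes X: "Module.module R X" and A: "A \<subseteq> carrier X"
  shows "submodule (gen_submodule R X A) R X"
  unfolding submodule_iff[OF X]
proof (intro conjI ballI)
  show "gen_submodule R X A \<subseteq> carrier X"
    by (rule gen_submodule_least[OF submodule_carrier[OF X] A])
  show "\<zero>\<^bsub>X\<^esub> \<in> gen_submodule R X A"
    by (simp add: gen_submodule_def submodule_zero[OF X])
next
  fix x y assume "x \<in> gen_submodule R X A" "y \<in> gen_submodule R X A"
  then show "x \<oplus>\<^bsub>X\<^esub> y \<in> gen_submodule R X A"
    by (simp add: gen_submodule_def submodule_add[OF X])
next
  fix a x assume "a \<in> carrier R" "x \<in> gen_submodule R X A"
  then show "a \<odot>\<^bsub>X\<^esub> x \<in> gen_submodule R X A"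
    by (simp add: gen_submodule_def submodule_smult[OF X])
qed

lemma module_minus_eq_zero:
  assumes X: "Module.module R X" and "x \<in> carrier X" "y \<in> carrier X" "x \<ominus>\<^bsub>X\<^esub> y = \<zero>\<^bsub>X\<^esub>"
  shows "x = y"
proof -
  interpret X: Module.module R X by fact
  have "x = x \<ominus>\<^bsub>X\<^esub> y \<oplus>\<^bsub>X\<^esub> y" using assms(2,3) by (simp add: a_minus_def X.a_assoc X.l_neg)
  also have "\<dots> = y" using assms(3) by (simp add: assms(4))
  finally show ?thesis .
qed

text \<open>
  The linear extension of \<open>g\<close> from the generators of the free module; the sum runs over the support
  of \<open>f\<close>, which is finite although \<open>X\<close> may be infinite.
\<close>

definition free_lift :: "('a, 'c, 'm) module_scheme \<Rightarrow> 'x set \<Rightarrow> ('x \<Rightarrow> 'c) \<Rightarrow> ('x \<Rightarrow> 'a) \<Rightarrow> 'c"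
  where "free_lift Y X g f = (\<Oplus>\<^bsub>Y\<^esub>x\<in>{x \<in> X. f x \<noteq> \<zero>}. f x \<odot>\<^bsub>Y\<^esub> g x)"

lemma free_lift_superset:
  assumes Y: "Module.module R Y" and g: "\<And>x. x \<in> X \<Longrightarrow> g x \<in> carrier Y"
    and f: "\<And>x. x \<in> X \<Longrightarrow> f x \<in> carrier R"
    and Z: "finite Z" "Z \<subseteq> X" "{x \<in> X. f x \<noteq> \<zero>} \<subseteq> Z"
  shows "free_lift Y X g f = (\<Oplus>\<^bsub>Y\<^esub>x\<in>Z. f x \<odot>\<^bsub>Y\<^esub> g x)"
proof -
  interpret Y: Module.module R Y by fact
  show ?thesis
    unfolding free_lift_def
  proof (rule Y.add.finprod_mono_neutral_cong_left[OF Z(1,3)])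
    fix x assume "x \<in> Z - {x \<in> X. f x \<noteq> \<zero>}"
    then show "f x \<odot>\<^bsub>Y\<^esub> g x = \<zero>\<^bsub>Y\<^esub>" using Z(2) g[of x] by auto
  next
    show "(\<lambda>x. f x \<odot>\<^bsub>Y\<^esub> g x) \<in> Z \<rightarrow> carrier Y"
      using Z(2) f g by (auto simp: subset_iff)
  qed simp
qed

lemma free_lift_lin_hom:
  assumes Y: "Module.module R Y" and g: "\<And>x. x \<in> X \<Longrightarrow> g x \<in> carrier Y"
  shows "free_lift Y X g \<in> lin_hom R (free_module R X) Y"
proof -
  interpret Y: Module.module R Y by fact
  have c: "f x \<in> carrier R" if "f \<in> carrier (free_module R X)" "x \<in> X" for f x
    using that by (auto simp: free_module_carrier)
  have fin: "finite {x \<in> X. f x \<noteq> \<zero>}" if "f \<in> carrier (free_module R X)" for f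
    using that by (simp add: free_module_carrier)
  show ?thesis
  proof (rule lin_homI)
    fix f assume "f \<in> carrier (free_module R X)"
    then show "free_lift Y X g f \<in> carrier Y"
      unfolding free_lift_def using c g by (intro Y.finsum_closed) (simp add: Pi_def)
  next
    fix f h assume fh: "f \<in> carrier (free_module R X)" "h \<in> carrier (free_module R X)"
    let ?Z = "{x \<in> X. f x \<noteq> \<zero>} \<union> {x \<in> X. h x \<noteq> \<zero>}"
    have Z: "finite ?Z" "?Z \<subseteq> X" using fin[OF fh(1)] fin[OF fh(2)] by auto
    have cc: "f x \<in> carrier R" "h x \<in> carrier R" "g x \<in> carrier Y" if "x \<in> X" for x
      using c[OF fh(1) that] c[OF fh(2) that] g[OF that] .
    have sum: "free_lift Y X g (f \<oplus>\<^bsub>free_module R X\<^esub> h) = (\<Oplus>\<^bsub>Y\<^esub>x\<in>?Z. (\<lambda>x\<in>X. f x \<oplus> h x) x \<odot>\<^bsub>Y\<^esub> g x)"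
      unfolding free_module_simps
      by (rule free_lift_superset[OF Y g]) (use Z cc in auto)
    also have "\<dots> = (\<Oplus>\<^bsub>Y\<^esub>x\<in>?Z. f x \<odot>\<^bsub>Y\<^esub> g x \<oplus>\<^bsub>Y\<^esub> h x \<odot>\<^bsub>Y\<^esub> g x)"
      using cc by (intro Y.finsum_cong' refl) (auto simp: Y.smult_l_distr)
    also have "\<dots> = (\<Oplus>\<^bsub>Y\<^esub>x\<in>?Z. f x \<odot>\<^bsub>Y\<^esub> g x) \<oplus>\<^bsub>Y\<^esub> (\<Oplus>\<^bsub>Y\<^esub>x\<in>?Z. h x \<odot>\<^bsub>Y\<^esub> g x)"
      using cc by (intro Y.finsum_addf) auto
    also have "(\<Oplus>\<^bsub>Y\<^esub>x\<in>?Z. f x \<odot>\<^bsub>Y\<^esub> g x) = free_lift Y X g f"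
      by (rule free_lift_superset[OF Y g, symmetric]) (use Z cc in auto)
    also have "(\<Oplus>\<^bsub>Y\<^esub>x\<in>?Z. h x \<odot>\<^bsub>Y\<^esub> g x) = free_lift Y X g h"
      by (rule free_lift_superset[OF Y g, symmetric]) (use Z cc in auto)
    finally show "free_lift Y X g (f \<oplus>\<^bsub>free_module R X\<^esub> h) = free_lift Y X g f \<oplus>\<^bsub>Y\<^esub> free_lift Y X g h" .
  next
    fix a f assume a: "a \<in> carrier R" and f: "f \<in> carrier (free_module R X)"
    let ?Z = "{x \<in> X. f x \<noteq> \<zero>}"
    have cc: "f x \<in> carrier R" "g x \<in> carrier Y" if "x \<in> X" for x
      using c[OF f that] g[OF that] .
    have "free_lift Y X g (a \<odot>\<^bsub>free_module R X\<^esub> f) = (\<Oplus>\<^bsub>Y\<^esub>x\<in>?Z. (\<lambda>x\<in>X. a \<otimes> f x) x \<odot>\<^bsub>Y\<^esub> g x)"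
      unfolding free_module_simps
      by (rule free_lift_superset[OF Y g]) (use fin[OF f] a cc in auto)
    also have "\<dots> = (\<Oplus>\<^bsub>Y\<^esub>x\<in>?Z. a \<odot>\<^bsub>Y\<^esub> (f x \<odot>\<^bsub>Y\<^esub> g x))"
      using a cc by (intro Y.finsum_cong' refl) (auto simp: Y.smult_assoc1)
    also have "\<dots> = a \<odot>\<^bsub>Y\<^esub> free_lift Y X g f"
      unfolding free_lift_def using a cc fin[OF f] by (intro Y.finsum_smult_ldistr[symmetric]) auto
    finally show "free_lift Y X g (a \<odot>\<^bsub>free_module R X\<^esub> f) = a \<odot>\<^bsub>Y\<^esub> free_lift Y X g f" .
  qed
qed

lemma free_lift_gen:
  assumes Y: "Module.module R Y" and g: "\<And>x. x \<in> X \<Longrightarrow> g x \<in> carrier Y" and x: "x \<in> X"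
  shows "free_lift Y X g (free_gen R X x) = g x"
proof -
  interpret Y: Module.module R Y by fact
  have "free_lift Y X g (free_gen R X x) = (\<Oplus>\<^bsub>Y\<^esub>y\<in>{x}. free_gen R X x y \<odot>\<^bsub>Y\<^esub> g y)"
    by (rule free_lift_superset[OF Y g]) (use x in \<open>auto simp: free_gen_def\<close>)
  then show ?thesis using x g[OF x] by (simp add: free_gen_def)
qed

lemma free_module_induct:
  assumes sub: "submodule U R (free_module R X)" and gen: "\<And>x. x \<in> X \<Longrightarrow> free_gen R X x \<in> U"
  shows "U = carrier (free_module R X)"
proof
  show "U \<subseteq> carrier (free_module R X)" by (rule submodule_sub[OF free_module_module sub])
  show "carrier (free_module R X) \<subseteq> U"
  proof
    fix f assume f: "f \<in> carrier (free_module R X)"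
    let ?F = "free_module R X"
    let ?Z = "{x \<in> X. f x \<noteq> \<zero>}"
    interpret F: Module.module R ?F by (rule free_module_module)
    have fc: "f x \<in> carrier R" if "x \<in> X" for x using f that by (auto simp: free_module_carrier)
    have fin: "finite ?Z" using f by (simp add: free_module_carrier)
    let ?s = "\<Oplus>\<^bsub>?F\<^esub>x\<in>?Z. f x \<odot>\<^bsub>?F\<^esub> free_gen R X x"
    have summand: "f x \<odot>\<^bsub>?F\<^esub> free_gen R X x \<in> carrier ?F" if "x \<in> X" for x
      by (intro F.smult_closed fc that free_gen_closed)
    have "?s y = f y" if y: "y \<in> X" for y
    proof -
      interpret RM: Module.module R "ring_module R" by (rule ring_module)
      have "(\<lambda>f. f y) \<in> lin_hom R ?F (ring_module R)"
        using y by (intro lin_homI) (auto simp: free_module_simps free_module_carrier)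
      from lin_hom_finsum[OF free_module_module ring_module this fin, of "\<lambda>x. f x \<odot>\<^bsub>?F\<^esub> free_gen R X x"] summand
      have "?s y = (\<Oplus>\<^bsub>ring_module R\<^esub>x\<in>?Z. (f x \<odot>\<^bsub>?F\<^esub> free_gen R X x) y)" by (simp add: Pi_def)
      also have "\<dots> = (\<Oplus>\<^bsub>ring_module R\<^esub>x\<in>?Z. if x = y then f y else \<zero>\<^bsub>ring_module R\<^esub>)"
        using fc y by (intro RM.finsum_cong' refl) (simp_all add: free_module_simps free_gen_def)
      also have "\<dots> = f y"
      proof (cases "f y = \<zero>")
        case True
        then have "(\<Oplus>\<^bsub>ring_module R\<^esub>x\<in>?Z. if x = y then f y else \<zero>\<^bsub>ring_module R\<^esub>) = (\<Oplus>\<^bsub>ring_module R\<^esub>x\<in>?Z. \<zero>\<^bsub>ring_module R\<^esub>)"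
          by (intro RM.finsum_cong' refl) auto
        then show ?thesis using True RM.finsum_zero by simp
      next
        case False
        then show ?thesis using fc[OF y] y fin by (intro finsum_single ring_module) simp_all
      qed
      finally show ?thesis .
    qed
    moreover have "?s \<in> carrier ?F" using summand by (intro F.finsum_closed) (simp add: Pi_def)
    ultimately have "?s = f"
      using f by (intro extensionalityI[of _ X]) (simp_all add: free_module_carrier PiE_def)
    moreover have "?s \<in> U"
      using fin fc gen by (intro submodule_finsum[OF free_module_module sub]
          submodule_smult[OF free_module_module sub]) auto
    ultimately show "f \<in> U" by simp
  qed
qed

context
  fixes M :: "('a, 'e, 'm) module_scheme" and N :: "('a, 'c, 'n) module_scheme"
  assumes M: "Module.module R M" and N: "Module.module R N"
begin

interpretation M: Module.module R M by (rule M)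
interpretation N: Module.module R N by (rule N)

private abbreviation "FMN \<equiv> free_module R (carrier M \<times> carrier N)"
private abbreviation "eMN \<equiv> free_gen R (carrier M \<times> carrier N)"

interpretation F: Module.module R FMN by (rule free_module_module)

lemma pure_tensor_eq: "pure_tensor R M N x y = tensor_kernel R M N +>\<^bsub>FMN\<^esub> eMN (x, y)"
  by (simp add: pure_tensor_def Let_def)

lemma tensor_gen_closed: "x \<in> carrier M \<Longrightarrow> y \<in> carrier N \<Longrightarrow> eMN (x, y) \<in> carrier FMN"
  by (rule free_gen_closed) simp

lemma tensor_rels_closed: "tensor_rels R M N \<subseteq> carrier FMN"
  unfolding tensor_rels_def Let_def
  by (intro Un_least subsetI; elim CollectE exE conjE; simp add: tensor_gen_closed)

lemma tensor_kernel_submodule: "submodule (tensor_kernel R M N) R FMN"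
  unfolding tensor_kernel_def by (rule gen_submodule_submodule[OF free_module_module tensor_rels_closed])

lemma tensor_module: "Module.module R (tensor R M N)"
  unfolding tensor_def by (rule quot_module_module[OF free_module_module tensor_kernel_submodule])

lemma pure_tensor_closed: "x \<in> carrier M \<Longrightarrow> y \<in> carrier N \<Longrightarrow> pure_tensor R M N x y \<in> carrier (tensor R M N)"
  using lin_hom_closed[OF quot_map_lin_hom[OF free_module_module tensor_kernel_submodule] tensor_gen_closed]
  by (simp add: pure_tensor_eq tensor_def)

lemma pure_tensor_lin:
  shows "x \<in> carrier M \<Longrightarrow> x' \<in> carrier M \<Longrightarrow> y \<in> carrier N \<Longrightarrow>
      pure_tensor R M N (x \<oplus>\<^bsub>M\<^esub> x') y = pure_tensor R M N x y \<oplus>\<^bsub>tensor R M N\<^esub> pure_tensor R M N x' y"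
    and "x \<in> carrier M \<Longrightarrow> y \<in> carrier N \<Longrightarrow> y' \<in> carrier N \<Longrightarrow>
      pure_tensor R M N x (y \<oplus>\<^bsub>N\<^esub> y') = pure_tensor R M N x y \<oplus>\<^bsub>tensor R M N\<^esub> pure_tensor R M N x y'"
    and "a \<in> carrier R \<Longrightarrow> x \<in> carrier M \<Longrightarrow> y \<in> carrier N \<Longrightarrow>
      pure_tensor R M N (a \<odot>\<^bsub>M\<^esub> x) y = a \<odot>\<^bsub>tensor R M N\<^esub> pure_tensor R M N x y"
    and "a \<in> carrier R \<Longrightarrow> x \<in> carrier M \<Longrightarrow> y \<in> carrier N \<Longrightarrow>
      pure_tensor R M N x (a \<odot>\<^bsub>N\<^esub> y) = a \<odot>\<^bsub>tensor R M N\<^esub> pure_tensor R M N x y"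
proof -
  let ?K = "tensor_kernel R M N"
  note K = tensor_kernel_submodule
  note q = quot_map_lin_hom[OF free_module_module K]
  have rels: "r \<in> ?K" if "r \<in> tensor_rels R M N" for r
    using that gen_submodule_upper unfolding tensor_kernel_def by (rule rev_subsetD)
  note eq = iffD2[OF quot_map_eq_iff[OF free_module_module K]]
  note qs = quot_map_add[OF free_module_module K] quot_map_smult[OF free_module_module K]
  {
    assume *: "x \<in> carrier M" "x' \<in> carrier M" "y \<in> carrier N"
    have "?K +>\<^bsub>FMN\<^esub> eMN (x \<oplus>\<^bsub>M\<^esub> x', y) = ?K +>\<^bsub>FMN\<^esub> (eMN (x, y) \<oplus>\<^bsub>FMN\<^esub> eMN (x', y))"
    proof (rule eq)
      show "eMN (x \<oplus>\<^bsub>M\<^esub> x', y) \<ominus>\<^bsub>FMN\<^esub> (eMN (x, y) \<oplus>\<^bsub>FMN\<^esub> eMN (x', y)) \<in> ?K"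
        by (rule rels) (unfold tensor_rels_def Let_def, use * in blast)
    qed (use * in \<open>simp_all add: tensor_gen_closed\<close>)
    then show "pure_tensor R M N (x \<oplus>\<^bsub>M\<^esub> x') y = pure_tensor R M N x y \<oplus>\<^bsub>tensor R M N\<^esub> pure_tensor R M N x' y"
      using * by (simp add: pure_tensor_eq tensor_def qs tensor_gen_closed)
  next
    assume *: "x \<in> carrier M" "y \<in> carrier N" "y' \<in> carrier N"
    have "?K +>\<^bsub>FMN\<^esub> eMN (x, y \<oplus>\<^bsub>N\<^esub> y') = ?K +>\<^bsub>FMN\<^esub> (eMN (x, y) \<oplus>\<^bsub>FMN\<^esub> eMN (x, y'))"
    proof (rule eq)
      show "eMN (x, y \<oplus>\<^bsub>N\<^esub> y') \<ominus>\<^bsub>FMN\<^esub> (eMN (x, y) \<oplus>\<^bsub>FMN\<^esub> eMN (x, y')) \<in> ?K"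
        by (rule rels) (unfold tensor_rels_def Let_def, use * in blast)
    qed (use * in \<open>simp_all add: tensor_gen_closed\<close>)
    then show "pure_tensor R M N x (y \<oplus>\<^bsub>N\<^esub> y') = pure_tensor R M N x y \<oplus>\<^bsub>tensor R M N\<^esub> pure_tensor R M N x y'"
      using * by (simp add: pure_tensor_eq tensor_def qs tensor_gen_closed)
  next
    assume *: "a \<in> carrier R" "x \<in> carrier M" "y \<in> carrier N"
    have "?K +>\<^bsub>FMN\<^esub> eMN (a \<odot>\<^bsub>M\<^esub> x, y) = ?K +>\<^bsub>FMN\<^esub> (a \<odot>\<^bsub>FMN\<^esub> eMN (x, y))"
    proof (rule eq)
      show "eMN (a \<odot>\<^bsub>M\<^esub> x, y) \<ominus>\<^bsub>FMN\<^esub> (a \<odot>\<^bsub>FMN\<^esub> eMN (x, y)) \<in> ?K"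
        by (rule rels) (unfold tensor_rels_def Let_def, use * in blast)
    qed (use * in \<open>simp_all add: tensor_gen_closed\<close>)
    then show "pure_tensor R M N (a \<odot>\<^bsub>M\<^esub> x) y = a \<odot>\<^bsub>tensor R M N\<^esub> pure_tensor R M N x y"
      using * by (simp add: pure_tensor_eq tensor_def qs tensor_gen_closed)
  next
    assume *: "a \<in> carrier R" "x \<in> carrier M" "y \<in> carrier N"
    have "?K +>\<^bsub>FMN\<^esub> eMN (x, a \<odot>\<^bsub>N\<^esub> y) = ?K +>\<^bsub>FMN\<^esub> (a \<odot>\<^bsub>FMN\<^esub> eMN (x, y))"
    proof (rule eq)
      show "eMN (x, a \<odot>\<^bsub>N\<^esub> y) \<ominus>\<^bsub>FMN\<^esub> (a \<odot>\<^bsub>FMN\<^esub> eMN (x, y)) \<in> ?K"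
        by (rule rels) (unfold tensor_rels_def Let_def, use * in blast)
    qed (use * in \<open>simp_all add: tensor_gen_closed\<close>)
    then show "pure_tensor R M N x (a \<odot>\<^bsub>N\<^esub> y) = a \<odot>\<^bsub>tensor R M N\<^esub> pure_tensor R M N x y"
      using * by (simp add: pure_tensor_eq tensor_def qs tensor_gen_closed)
  }
qed

lemma pure_tensor_lin_hom_left:
  "y \<in> carrier N \<Longrightarrow> (\<lambda>x. pure_tensor R M N x y) \<in> lin_hom R M (tensor R M N)"
  by (rule lin_homI) (simp_all add: pure_tensor_closed pure_tensor_lin)

lemma tensor_induct:
  assumes U: "submodule U R (tensor R M N)"
    and pure: "\<And>x y. x \<in> carrier M \<Longrightarrow> y \<in> carrier N \<Longrightarrow> pure_tensor R M N x y \<in> U"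
  shows "U = carrier (tensor R M N)"
proof
  show "U \<subseteq> carrier (tensor R M N)" by (rule submodule_sub[OF tensor_module U])
  let ?q = "\<lambda>f. tensor_kernel R M N +>\<^bsub>FMN\<^esub> f"
  have q: "?q \<in> lin_hom R FMN (tensor R M N)" "?q ` carrier FMN = carrier (tensor R M N)"
    unfolding tensor_def by (intro quot_map_lin_hom quot_map_surj free_module_module tensor_kernel_submodule)+
  have "{f \<in> carrier FMN. ?q f \<in> U} = carrier FMN"
    using pure
    by (intro free_module_induct submodule_preimage[OF free_module_module tensor_module q(1) U])
      (auto simp: pure_tensor_eq intro: tensor_gen_closed)
  then show "carrier (tensor R M N) \<subseteq> U" unfolding q(2)[symmetric] by auto
qed

text \<open>
  The linear extension of \<open>\<phi>\<close> to the free module on pairs kills the defining relations, so it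
  descends to the quotient.
\<close>

lemma tensor_universal:
  assumes Q: "Module.module R Q"
    and c: "\<And>x y. x \<in> carrier M \<Longrightarrow> y \<in> carrier N \<Longrightarrow> \<phi> x y \<in> carrier Q"
    and add1: "\<And>x x' y. x \<in> carrier M \<Longrightarrow> x' \<in> carrier M \<Longrightarrow> y \<in> carrier N \<Longrightarrow>
      \<phi> (x \<oplus>\<^bsub>M\<^esub> x') y = \<phi> x y \<oplus>\<^bsub>Q\<^esub> \<phi> x' y"
    and add2: "\<And>x y y'. x \<in> carrier M \<Longrightarrow> y \<in> carrier N \<Longrightarrow> y' \<in> carrier N \<Longrightarrow>
      \<phi> x (y \<oplus>\<^bsub>N\<^esub> y') = \<phi> x y \<oplus>\<^bsub>Q\<^esub> \<phi> x y'"
    and smult1: "\<And>a x y. a \<in> carrier R \<Longrightarrow> x \<in> carrier M \<Longrightarrow> y \<in> carrier N \<Longrightarrow>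
      \<phi> (a \<odot>\<^bsub>M\<^esub> x) y = a \<odot>\<^bsub>Q\<^esub> \<phi> x y"
    and smult2: "\<And>a x y. a \<in> carrier R \<Longrightarrow> x \<in> carrier M \<Longrightarrow> y \<in> carrier N \<Longrightarrow>
      \<phi> x (a \<odot>\<^bsub>N\<^esub> y) = a \<odot>\<^bsub>Q\<^esub> \<phi> x y"
  obtains h where "h \<in> lin_hom R (tensor R M N) Q"
    and "\<And>x y. x \<in> carrier M \<Longrightarrow> y \<in> carrier N \<Longrightarrow> h (pure_tensor R M N x y) = \<phi> x y"
proof -
  interpret Q: Module.module R Q by fact
  let ?K = "tensor_kernel R M N"
  let ?q = "\<lambda>f. ?K +>\<^bsub>FMN\<^esub> f"
  define g where "g = free_lift Q (carrier M \<times> carrier N) (\<lambda>(x, y). \<phi> x y)"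
  have g: "g \<in> lin_hom R FMN Q" unfolding g_def using c by (intro free_lift_lin_hom Q) auto
  have ge: "g (eMN (x, y)) = \<phi> x y" if "x \<in> carrier M" "y \<in> carrier N" for x y
    unfolding g_def using c that by (subst free_lift_gen[OF Q]) auto
  note gs = lin_hom_minus[OF free_module_module Q g] lin_hom_uminus[OF free_module_module Q g] lin_hom_add[OF g] lin_hom_smult[OF g]
  have "tensor_rels R M N \<subseteq> lin_kernel FMN Q g"
    unfolding tensor_rels_def Let_def
    by (intro Un_least subsetI; elim CollectE exE conjE;
        simp add: lin_kernel_def tensor_gen_closed gs ge add1 add2 smult1 smult2 c a_minus_def Q.r_neg)
  then have K: "?K \<subseteq> lin_kernel FMN Q g"
    unfolding tensor_kernel_def
    by (intro gen_submodule_least submodule_lin_kernel free_module_module Q g)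
  have q: "?q \<in> lin_hom R FMN (tensor R M N)" "?q ` carrier FMN = carrier (tensor R M N)"
    unfolding tensor_def by (intro quot_map_lin_hom quot_map_surj free_module_module tensor_kernel_submodule)+
  define h where "h C = g (SOME f. f \<in> carrier FMN \<and> ?q f = C)" for C
  have hq: "h (?q f) = g f" if f: "f \<in> carrier FMN" for f
  proof -
    define f' where "f' = (SOME f'. f' \<in> carrier FMN \<and> ?q f' = ?q f)"
    have f': "f' \<in> carrier FMN" "?q f' = ?q f"
      using someI[of "\<lambda>f'. f' \<in> carrier FMN \<and> ?q f' = ?q f" f] f unfolding f'_def by auto
    then have "f' \<ominus>\<^bsub>FMN\<^esub> f \<in> ?K"
      using quot_map_eq_iff[OF free_module_module tensor_kernel_submodule f'(1) f] by simp
    then have "g (f' \<ominus>\<^bsub>FMN\<^esub> f) = \<zero>\<^bsub>Q\<^esub>" using K by (auto simp: lin_kernel_def)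
    then have "g f' \<ominus>\<^bsub>Q\<^esub> g f = \<zero>\<^bsub>Q\<^esub>" using f f' by (simp add: gs)
    then have "g f' = g f" by (rule module_minus_eq_zero[OF Q lin_hom_closed[OF g f'(1)] lin_hom_closed[OF g f]])
    then show ?thesis by (simp add: h_def f'_def)
  qed
  have "h \<in> lin_hom R (tensor R M N) Q"
  proof (rule lin_homI)
    fix u assume "u \<in> carrier (tensor R M N)"
    then obtain f where "f \<in> carrier FMN" "u = ?q f" unfolding q(2)[symmetric] by auto
    then show "h u \<in> carrier Q" using hq lin_hom_closed[OF g] by simp
  next
    fix u v assume "u \<in> carrier (tensor R M N)" "v \<in> carrier (tensor R M N)"
    then obtain f f' where *: "f \<in> carrier FMN" "u = ?q f" "f' \<in> carrier FMN" "v = ?q f'"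
      unfolding q(2)[symmetric] by auto
    then have "h (u \<oplus>\<^bsub>tensor R M N\<^esub> v) = h (?q (f \<oplus>\<^bsub>FMN\<^esub> f'))" using lin_hom_add[OF q(1)] by simp
    then show "h (u \<oplus>\<^bsub>tensor R M N\<^esub> v) = h u \<oplus>\<^bsub>Q\<^esub> h v" using * by (simp add: hq gs)
  next
    fix a u assume a: "a \<in> carrier R" and "u \<in> carrier (tensor R M N)"
    then obtain f where *: "f \<in> carrier FMN" "u = ?q f" unfolding q(2)[symmetric] by auto
    then have "h (a \<odot>\<^bsub>tensor R M N\<^esub> u) = h (?q (a \<odot>\<^bsub>FMN\<^esub> f))" using a lin_hom_smult[OF q(1)] by simp
    then show "h (a \<odot>\<^bsub>tensor R M N\<^esub> u) = a \<odot>\<^bsub>Q\<^esub> h u" using a * by (simp add: hq gs)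
  qed
  moreover have "h (pure_tensor R M N x y) = \<phi> x y" if "x \<in> carrier M" "y \<in> carrier N" for x y
    using that by (simp add: pure_tensor_eq hq ge tensor_gen_closed)
  ultimately show ?thesis by (rule that)
qed

lemma tensor_hom_eqI:
  assumes Q: "Module.module R Q"
    and h: "h \<in> lin_hom R (tensor R M N) Q" "h' \<in> lin_hom R (tensor R M N) Q"
    and eq: "\<And>x y. x \<in> carrier M \<Longrightarrow> y \<in> carrier N \<Longrightarrow> h (pure_tensor R M N x y) = h' (pure_tensor R M N x y)"
    and t: "t \<in> carrier (tensor R M N)"
  shows "h t = h' t"
proof -
  interpret Q: Module.module R Q by fact
  interpret T: Module.module R "tensor R M N" by (rule tensor_module)
  have "{t \<in> carrier (tensor R M N). h t = h' t} = carrier (tensor R M N)"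
  proof (rule tensor_induct)
    show "submodule {t \<in> carrier (tensor R M N). h t = h' t} R (tensor R M N)"
      unfolding submodule_iff[OF tensor_module]
      by (auto simp: lin_hom_zero[OF tensor_module Q] h lin_hom_add[OF h(1)] lin_hom_add[OF h(2)]
          lin_hom_smult[OF h(1)] lin_hom_smult[OF h(2)])
  qed (simp add: pure_tensor_closed eq)
  then show ?thesis using t by blast
qed

end

text \<open>
  The definite description in \<open>tensor_map\<close> denotes: existence is the universal property, and
  uniqueness holds because pure tensors generate.
\<close>

lemma tensor_map_pure_tensor:
  assumes M: "Module.module R M" and M': "Module.module R M'" and N: "Module.module R N"
    and f: "f \<in> lin_hom R M M'"
  shows "tensor_map R M M' N f \<in> lin_hom R (tensor R M N) (tensor R M' N)"
    and "x \<in> carrier M \<Longrightarrow> y \<in> carrier N \<Longrightarrow>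
      tensor_map R M M' N f (pure_tensor R M N x y) = pure_tensor R M' N (f x) y"
proof -
  interpret N: Module.module R N by (rule N)
  let ?T = "tensor R M N" and ?T' = "tensor R M' N"
  let ?P = "\<lambda>h. h \<in> carrier (Hom_module R ?T ?T') \<and>
      (\<forall>x \<in> carrier M. \<forall>y \<in> carrier N. h (pure_tensor R M N x y) = pure_tensor R M' N (f x) y)"
  note fc = lin_hom_closed[OF f]
  obtain h where h: "h \<in> lin_hom R ?T ?T'"
    "\<And>x y. x \<in> carrier M \<Longrightarrow> y \<in> carrier N \<Longrightarrow> h (pure_tensor R M N x y) = pure_tensor R M' N (f x) y"
    by (rule tensor_universal[OF M N tensor_module[OF M' N], of "\<lambda>x y. pure_tensor R M' N (f x) y"])
      (simp_all add: pure_tensor_closed[OF M' N] pure_tensor_lin[OF M' N] lin_hom_add[OF f] lin_hom_smult[OF f] fc)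
  have "restrict h (carrier ?T) \<in> lin_hom R ?T ?T'"
    by (rule lin_hom_cong[OF tensor_module[OF M N] h(1)]) simp
  then have ex: "?P (restrict h (carrier ?T))"
    using h(2) by (simp add: Hom_module_simps pure_tensor_closed[OF M N])
  have uniq: "\<exists>!h. ?P h"
  proof (rule ex1I, rule ex)
    fix h' assume h': "?P h'"
    show "h' = restrict h (carrier ?T)"
    proof (rule extensionalityI[of _ "carrier ?T"])
      fix t assume t: "t \<in> carrier ?T"
      show "h' t = restrict h (carrier ?T) t"
      proof (rule tensor_hom_eqI[OF M N tensor_module[OF M' N] _ _ _ t])
        show "h' \<in> lin_hom R ?T ?T'" using h' by (simp add: Hom_module_simps)
        show "restrict h (carrier ?T) \<in> lin_hom R ?T ?T'" using ex by (simp add: Hom_module_simps)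
      qed (use h' ex in simp)
    qed (use h' in \<open>simp_all add: Hom_module_simps\<close>)
  qed
  have "?P (tensor_map R M M' N f)" unfolding tensor_map_def by (rule theI'[OF uniq])
  then show "tensor_map R M M' N f \<in> lin_hom R ?T ?T'"
    "x \<in> carrier M \<Longrightarrow> y \<in> carrier N \<Longrightarrow>
      tensor_map R M M' N f (pure_tensor R M N x y) = pure_tensor R M' N (f x) y"
    by (simp_all add: Hom_module_simps)
qed

section \<open>Tensor products and homomorphisms from a presentation\<close>

abbreviation Rpow :: "nat \<Rightarrow> ('a, nat \<Rightarrow> 'a) module"
  where "Rpow k \<equiv> direct_power (ring_module R) k"

lemma Rpow_module: "Module.module R (Rpow k)"
  by (intro direct_power_module ring_module)

lemma smult_lin_hom: "Module.module R X \<Longrightarrow> x \<in> carrier X \<Longrightarrow> (\<lambda>a. a \<odot>\<^bsub>X\<^esub> x) \<in> lin_hom R (ring_module R) X"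
  by (rule lin_homI) (simp_all add: module.smult_closed module.smult_l_distr module.smult_assoc1)

text \<open>The image of \<open>f \<otimes> x\<close> under \<open>R\<^sup>k \<otimes> X \<cong> X\<^sup>k\<close>.\<close>

definition scale :: "('a, 'c, 'm) module_scheme \<Rightarrow> nat \<Rightarrow> (nat \<Rightarrow> 'a) \<Rightarrow> 'c \<Rightarrow> nat \<Rightarrow> 'c"
  where "scale X k f x = (\<lambda>i\<in>{..<k}. f i \<odot>\<^bsub>X\<^esub> x)"

context
  fixes X :: "('a, 'c, 'm) module_scheme"
  assumes X: "Module.module R X"
begin

interpretation X: Module.module R X by (rule X)

lemma scale_closed: "f \<in> {..<k} \<rightarrow>\<^sub>E carrier R \<Longrightarrow> x \<in> carrier X \<Longrightarrow> scale X k f x \<in> {..<k} \<rightarrow>\<^sub>E carrier X"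
  by (auto simp: scale_def PiE_mem)

lemma scale_lin_hom_left: "x \<in> carrier X \<Longrightarrow> (\<lambda>f. scale X k f x) \<in> lin_hom R (Rpow k) (direct_power X k)"
proof -
  assume x: "x \<in> carrier X"
  have c: "f i \<in> carrier R" if "f \<in> {..<k} \<rightarrow>\<^sub>E carrier R" "i < k" for f i
    using that by (auto simp: PiE_mem)
  show ?thesis
    by (rule lin_homI) (simp_all add: scale_def c x X.smult_l_distr X.smult_assoc1 cong: restrict_cong)
qed

lemma scale_lin_hom_right: "f \<in> {..<k} \<rightarrow>\<^sub>E carrier R \<Longrightarrow> scale X k f \<in> lin_hom R X (direct_power X k)"
proof -
  assume f: "f \<in> {..<k} \<rightarrow>\<^sub>E carrier R"
  have c: "f i \<in> carrier R" if "i < k" for i using that f by (auto simp: PiE_mem)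
  show ?thesis
    by (rule lin_homI)
      (simp_all add: scale_def c X.smult_r_distr X.smult_assoc1[symmetric] m_comm cong: restrict_cong)
qed

lemma act_scale:
  assumes A: "mat q p A" and f: "f \<in> {..<p} \<rightarrow>\<^sub>E carrier R" and x: "x \<in> carrier X"
  shows "act X q p A (scale X p f x) = scale X q (act (ring_module R) q p A f) x"
  using act_natural[OF ring_module X smult_lin_hom[OF X x] A, of f] f
  by (simp add: scale_def compose_def)

lemma vec_eq_sum_scale:
  assumes x: "x \<in> {..<k} \<rightarrow>\<^sub>E carrier X"
  shows "x = (\<Oplus>\<^bsub>direct_power X k\<^esub>j\<in>{..<k}. scale X k (unit_vec k j) (x j))" (is "x = finsum ?P ?g _")
proof -
  interpret P: Module.module R ?P by (intro direct_power_module X)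
  have xc: "x j \<in> carrier X" if "j < k" for j using x that by (auto simp: PiE_mem)
  have g: "?g j \<in> {..<k} \<rightarrow>\<^sub>E carrier X" if "j < k" for j
    by (intro scale_closed unit_vec_closed xc that)
  have sum: "finsum ?P ?g {..<k} \<in> {..<k} \<rightarrow>\<^sub>E carrier X"
    using P.finsum_closed[of ?g "{..<k}"] g by simp
  have "finsum ?P ?g {..<k} i = x i" if i: "i < k" for i
  proof -
    have "finsum ?P ?g {..<k} i = (\<Oplus>\<^bsub>X\<^esub>j\<in>{..<k}. ?g j i)"
      using g by (intro lin_combination_nth X i) auto
    also have "\<dots> = (\<Oplus>\<^bsub>X\<^esub>j\<in>{..<k}. if j = i then x i else \<zero>\<^bsub>X\<^esub>)"
      using i xc by (intro X.finsum_cong' refl) (simp_all add: scale_def free_gen_def)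
    also have "\<dots> = x i" using i xc by (intro finsum_single X) simp_all
    finally show ?thesis .
  qed
  then show ?thesis using x sum by (intro extensionalityI[of _ "{..<k}"]) (simp_all add: PiE_def)
qed

lemma act_eq_sum_scale:
  assumes A: "mat q p A" and x: "x \<in> {..<p} \<rightarrow>\<^sub>E carrier X"
  shows "act X q p A x =
    (\<Oplus>\<^bsub>direct_power X q\<^esub>j\<in>{..<p}. scale X q (act (ring_module R) q p A (unit_vec p j)) (x j))"
proof -
  interpret P: Module.module R "direct_power X q" by (intro direct_power_module X)
  have xc: "x j \<in> carrier X" if "j < p" for j using x that by (auto simp: PiE_mem)
  have "act X q p A x = act X q p A (\<Oplus>\<^bsub>direct_power X p\<^esub>j\<in>{..<p}. scale X p (unit_vec p j) (x j))"
    by (simp only: vec_eq_sum_scale[OF x, symmetric])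
  also have "\<dots> = (\<Oplus>\<^bsub>direct_power X q\<^esub>j\<in>{..<p}. act X q p A (scale X p (unit_vec p j) (x j)))"
    by (intro lin_hom_finsum[OF direct_power_module[OF X] direct_power_module[OF X] act_lin_hom[OF X A]])
      (simp_all add: Pi_def scale_closed unit_vec_closed xc)
  also have "\<dots> = (\<Oplus>\<^bsub>direct_power X q\<^esub>j\<in>{..<p}. scale X q (act (ring_module R) q p A (unit_vec p j)) (x j))"
  proof (rule P.finsum_cong'[OF refl])
    show "(\<lambda>j. scale X q (act (ring_module R) q p A (unit_vec p j)) (x j)) \<in> {..<p} \<rightarrow> carrier (direct_power X q)"
      using scale_closed[OF _ xc] act_closed[OF ring_module A] unit_vec_closed by simp
  qed (simp add: act_scale[OF A unit_vec_closed xc])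
  finally show ?thesis .
qed

end

text \<open>
  For \<open>\<epsilon> : R\<^sup>k \<rightarrow> N\<close> this is \<open>\<epsilon> \<otimes> X\<close>, read on \<open>X\<^sup>k\<close> instead of \<open>R\<^sup>k \<otimes> X\<close>.
\<close>

definition tensor_vec ::
    "('a, 'd, 'n) module_scheme \<Rightarrow> ('a, 'c, 'm) module_scheme \<Rightarrow> nat \<Rightarrow> ((nat \<Rightarrow> 'a) \<Rightarrow> 'd)
      \<Rightarrow> (nat \<Rightarrow> 'c) \<Rightarrow> ('d \<times> 'c \<Rightarrow> 'a) set"
  where "tensor_vec N X k \<epsilon> x = (\<Oplus>\<^bsub>tensor R N X\<^esub>i\<in>{..<k}. pure_tensor R N X (\<epsilon> (unit_vec k i)) (x i))"

context
  fixes X :: "('a, 'c, 'm) module_scheme" and N :: "('a, 'd, 'n) module_scheme"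
    and k :: nat and \<epsilon> :: "(nat \<Rightarrow> 'a) \<Rightarrow> 'd"
  assumes X: "Module.module R X" and N: "Module.module R N" and \<epsilon>: "\<epsilon> \<in> lin_hom R (Rpow k) N"
begin

interpretation X: Module.module R X by (rule X)
interpretation N: Module.module R N by (rule N)
interpretation T: Module.module R "tensor R N X" by (rule tensor_module[OF N X])

lemma eps_gen_closed: "i < k \<Longrightarrow> \<epsilon> (unit_vec k i) \<in> carrier N"
  using lin_hom_closed[OF \<epsilon>] unit_vec_closed by simp

lemma tensor_vec_lin_hom: "tensor_vec N X k \<epsilon> \<in> lin_hom R (direct_power X k) (tensor R N X)"
proof -
  have c: "x i \<in> carrier X" if "x \<in> {..<k} \<rightarrow>\<^sub>E carrier X" "i < k" for x i
    using that by (auto simp: PiE_mem)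
  note pc = pure_tensor_closed[OF N X eps_gen_closed]
  note pl = pure_tensor_lin[OF N X]
  show ?thesis
  proof (rule lin_homI)
    fix x assume "x \<in> carrier (direct_power X k)"
    then show "tensor_vec N X k \<epsilon> x \<in> carrier (tensor R N X)"
      unfolding tensor_vec_def by (intro T.finsum_closed) (simp add: c pc)
  next
    fix x y assume "x \<in> carrier (direct_power X k)" "y \<in> carrier (direct_power X k)"
    then have *: "x i \<in> carrier X" "y i \<in> carrier X" if "i < k" for i using c that by simp_all
    have "tensor_vec N X k \<epsilon> (x \<oplus>\<^bsub>direct_power X k\<^esub> y) = (\<Oplus>\<^bsub>tensor R N X\<^esub>i\<in>{..<k}.
        pure_tensor R N X (\<epsilon> (unit_vec k i)) (x i) \<oplus>\<^bsub>tensor R N X\<^esub> pure_tensor R N X (\<epsilon> (unit_vec k i)) (y i))"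
      unfolding tensor_vec_def by (intro T.finsum_cong' refl) (simp_all add: * pc pl eps_gen_closed)
    also have "\<dots> = tensor_vec N X k \<epsilon> x \<oplus>\<^bsub>tensor R N X\<^esub> tensor_vec N X k \<epsilon> y"
      unfolding tensor_vec_def by (intro T.finsum_addf) (simp_all add: * pc)
    finally show "tensor_vec N X k \<epsilon> (x \<oplus>\<^bsub>direct_power X k\<^esub> y) =
      tensor_vec N X k \<epsilon> x \<oplus>\<^bsub>tensor R N X\<^esub> tensor_vec N X k \<epsilon> y" .
  next
    fix a x assume a: "a \<in> carrier R" and "x \<in> carrier (direct_power X k)"
    then have *: "x i \<in> carrier X" if "i < k" for i using c that by simp_all
    have "tensor_vec N X k \<epsilon> (a \<odot>\<^bsub>direct_power X k\<^esub> x) = (\<Oplus>\<^bsub>tensor R N X\<^esub>i\<in>{..<k}.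
        a \<odot>\<^bsub>tensor R N X\<^esub> pure_tensor R N X (\<epsilon> (unit_vec k i)) (x i))"
      unfolding tensor_vec_def by (intro T.finsum_cong' refl) (simp_all add: a * pc pl eps_gen_closed)
    also have "\<dots> = a \<odot>\<^bsub>tensor R N X\<^esub> tensor_vec N X k \<epsilon> x"
      unfolding tensor_vec_def by (intro T.finsum_smult_ldistr[symmetric]) (simp_all add: a * pc)
    finally show "tensor_vec N X k \<epsilon> (a \<odot>\<^bsub>direct_power X k\<^esub> x) = a \<odot>\<^bsub>tensor R N X\<^esub> tensor_vec N X k \<epsilon> x" .
  qed
qed

lemma tensor_vec_scale:
  assumes f: "f \<in> {..<k} \<rightarrow>\<^sub>E carrier R" and x: "x \<in> carrier X"
  shows "tensor_vec N X k \<epsilon> (scale X k f x) = pure_tensor R N X (\<epsilon> f) x"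
proof -
  have c: "f i \<in> carrier R" if "i < k" for i using that f by (auto simp: PiE_mem)
  note pc = pure_tensor_closed[OF N X eps_gen_closed]
  have "pure_tensor R N X (\<epsilon> f) x = pure_tensor R N X (\<Oplus>\<^bsub>N\<^esub>i\<in>{..<k}. f i \<odot>\<^bsub>N\<^esub> \<epsilon> (unit_vec k i)) x"
    by (simp only: lin_hom_vec[OF N \<epsilon> f])
  also have "\<dots> = (\<Oplus>\<^bsub>tensor R N X\<^esub>i\<in>{..<k}. pure_tensor R N X (f i \<odot>\<^bsub>N\<^esub> \<epsilon> (unit_vec k i)) x)"
    by (intro lin_hom_finsum[OF N tensor_module[OF N X] pure_tensor_lin_hom_left[OF N X x]])
      (simp_all add: c eps_gen_closed)
  also have "\<dots> = tensor_vec N X k \<epsilon> (scale X k f x)"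
    unfolding tensor_vec_def
    by (intro T.finsum_cong' refl) (simp_all add: c x pc scale_def pure_tensor_lin[OF N X] eps_gen_closed)
  finally show ?thesis ..
qed

lemma tensor_vec_act:
  assumes A: "mat k p A" and x: "x \<in> {..<p} \<rightarrow>\<^sub>E carrier X"
  shows "tensor_vec N X k \<epsilon> (act X k p A x) =
    (\<Oplus>\<^bsub>tensor R N X\<^esub>j\<in>{..<p}. pure_tensor R N X (\<epsilon> (act (ring_module R) k p A (unit_vec p j))) (x j))"
proof -
  have c: "x i \<in> carrier X" if "i < p" for i using that x by (auto simp: PiE_mem)
  have uc: "act (ring_module R) k p A (unit_vec p j) \<in> {..<k} \<rightarrow>\<^sub>E carrier R" if "j < p" for j
    using act_closed[OF ring_module A] unit_vec_closed[OF that] by simp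
  have "tensor_vec N X k \<epsilon> (act X k p A x) = (\<Oplus>\<^bsub>tensor R N X\<^esub>j\<in>{..<p}.
      tensor_vec N X k \<epsilon> (scale X k (act (ring_module R) k p A (unit_vec p j)) (x j)))"
    unfolding act_eq_sum_scale[OF X A x]
    by (intro lin_hom_finsum[OF direct_power_module[OF X] T.module_axioms tensor_vec_lin_hom])
      (simp_all add: scale_closed[OF X uc c])
  also have "\<dots> = (\<Oplus>\<^bsub>tensor R N X\<^esub>j\<in>{..<p}. pure_tensor R N X (\<epsilon> (act (ring_module R) k p A (unit_vec p j))) (x j))"
    using lin_hom_closed[OF \<epsilon>] uc c
    by (intro T.finsum_cong' refl) (simp_all add: tensor_vec_scale pure_tensor_closed[OF N X])
  finally show ?thesis .
qed

context
  fixes p :: nat and A :: "nat \<Rightarrow> nat \<Rightarrow> 'a"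
  assumes surj: "\<epsilon> ` carrier (Rpow k) = carrier N" and A: "mat k p A"
    and ker: "lin_kernel (Rpow k) N \<epsilon> = act (ring_module R) k p A ` ({..<p} \<rightarrow>\<^sub>E carrier R)"
begin

lemma tensor_vec_surj: "tensor_vec N X k \<epsilon> ` ({..<k} \<rightarrow>\<^sub>E carrier X) = carrier (tensor R N X)"
proof (rule tensor_induct[OF N X])
  show "submodule (tensor_vec N X k \<epsilon> ` ({..<k} \<rightarrow>\<^sub>E carrier X)) R (tensor R N X)"
    using submodule_image[OF direct_power_module[OF X] T.module_axioms tensor_vec_lin_hom
        submodule_carrier[OF direct_power_module[OF X]]] by simp
  fix y x assume y: "y \<in> carrier N" and x: "x \<in> carrier X"
  then obtain f where f: "f \<in> {..<k} \<rightarrow>\<^sub>E carrier R" "y = \<epsilon> f" using surj by auto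
  show "pure_tensor R N X y x \<in> tensor_vec N X k \<epsilon> ` ({..<k} \<rightarrow>\<^sub>E carrier X)"
    unfolding f(2) tensor_vec_scale[OF f(1) x, symmetric] by (intro imageI scale_closed X f x)
qed

lemma eps_act_zero: "y \<in> {..<p} \<rightarrow>\<^sub>E carrier R \<Longrightarrow> \<epsilon> (act (ring_module R) k p A y) = \<zero>\<^bsub>N\<^esub>"
proof -
  assume "y \<in> {..<p} \<rightarrow>\<^sub>E carrier R"
  then have "act (ring_module R) k p A y \<in> lin_kernel (Rpow k) N \<epsilon>" unfolding ker by (rule imageI)
  then show ?thesis by (simp add: lin_kernel_def)
qed

text \<open>
  For the kernel, right exactness is made explicit: \<open>\<epsilon> f \<otimes> x\<close> determines the class of \<open>f \<cdot> x\<close>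
  modulo the relations, which gives a map back from the tensor product.
\<close>

lemma tensor_vec_kernel:
  "lin_kernel (direct_power X k) (tensor R N X) (tensor_vec N X k \<epsilon>) = act X k p A ` ({..<p} \<rightarrow>\<^sub>E carrier X)"
proof
  let ?U = "act X k p A ` ({..<p} \<rightarrow>\<^sub>E carrier X)" and ?P = "direct_power X k"
  note P = direct_power_module[OF X, of k]
  interpret P: Module.module R ?P by (rule P)
  have U: "submodule ?U R ?P"
    using submodule_image[OF direct_power_module[OF X] P act_lin_hom[OF X A]
        submodule_carrier[OF direct_power_module[OF X]]] by simp
  show "?U \<subseteq> lin_kernel ?P (tensor R N X) (tensor_vec N X k \<epsilon>)"
  proof
    fix u assume "u \<in> ?U"
    then obtain y where y: "y \<in> {..<p} \<rightarrow>\<^sub>E carrier X" "u = act X k p A y" by auto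
    have c: "y i \<in> carrier X" if "i < p" for i using that y by (auto simp: PiE_mem)
    have "pure_tensor R N X \<zero>\<^bsub>N\<^esub> x = \<zero>\<^bsub>tensor R N X\<^esub>" if "x \<in> carrier X" for x
      by (rule lin_hom_zero[OF N T.module_axioms pure_tensor_lin_hom_left[OF N X that]])
    then have "tensor_vec N X k \<epsilon> u = (\<Oplus>\<^bsub>tensor R N X\<^esub>j\<in>{..<p}. \<zero>\<^bsub>tensor R N X\<^esub>)"
      unfolding y(2) tensor_vec_act[OF A y(1)]
      by (intro T.finsum_cong' refl) (simp_all add: eps_act_zero unit_vec_closed c)
    then show "u \<in> lin_kernel ?P (tensor R N X) (tensor_vec N X k \<epsilon>)"
      using act_closed[OF X A y(1)] by (simp add: lin_kernel_def y T.finsum_zero)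
  qed
  let ?Q = "quot_module ?P ?U" and ?q = "\<lambda>x. ?U +>\<^bsub>?P\<^esub> x"
  note Q = quot_module_module[OF P U]
  note q = quot_map_lin_hom[OF P U]
  interpret Q: Module.module R ?Q by (rule Q)
  define pre where "pre y = (SOME f. f \<in> {..<k} \<rightarrow>\<^sub>E carrier R \<and> \<epsilon> f = y)" for y
  define b where "b y x = ?q (scale X k (pre y) x)" for y x
  have b: "b (\<epsilon> f) x = ?q (scale X k f x)" if f: "f \<in> {..<k} \<rightarrow>\<^sub>E carrier R" and x: "x \<in> carrier X" for f x
  proof -
    have g: "pre (\<epsilon> f) \<in> {..<k} \<rightarrow>\<^sub>E carrier R" "\<epsilon> (pre (\<epsilon> f)) = \<epsilon> f"
      unfolding pre_def using someI[of "\<lambda>g. g \<in> {..<k} \<rightarrow>\<^sub>E carrier R \<and> \<epsilon> g = \<epsilon> f" f] f by auto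
    have "pre (\<epsilon> f) \<ominus>\<^bsub>Rpow k\<^esub> f \<in> lin_kernel (Rpow k) N \<epsilon>"
      using lin_kernel_eqI[OF Rpow_module N \<epsilon>] g f by simp
    then obtain y where y: "y \<in> {..<p} \<rightarrow>\<^sub>E carrier R" "pre (\<epsilon> f) \<ominus>\<^bsub>Rpow k\<^esub> f = act (ring_module R) k p A y"
      unfolding ker by auto
    have "scale X k (pre (\<epsilon> f)) x \<ominus>\<^bsub>?P\<^esub> scale X k f x = scale X k (pre (\<epsilon> f) \<ominus>\<^bsub>Rpow k\<^esub> f) x"
      using lin_hom_minus[OF Rpow_module P scale_lin_hom_left[OF X x]] g f by simp
    also have "\<dots> = act X k p A (scale X p y x)"
      unfolding y(2) by (rule act_scale[OF X A y(1) x, symmetric])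
    also have "\<dots> \<in> ?U" by (intro imageI scale_closed X y x)
    finally have "scale X k (pre (\<epsilon> f)) x \<ominus>\<^bsub>?P\<^esub> scale X k f x \<in> ?U" .
    then show ?thesis unfolding b_def
      using scale_closed[OF X g(1) x] scale_closed[OF X f x] by (subst quot_map_eq_iff[OF P U]) simp_all
  qed
  have lift: "\<exists>f\<in>{..<k} \<rightarrow>\<^sub>E carrier R. y = \<epsilon> f" if "y \<in> carrier N" for y using surj that by auto
  have sc: "scale X k f x \<in> carrier ?P" if "f \<in> {..<k} \<rightarrow>\<^sub>E carrier R" "x \<in> carrier X" for f x
    using scale_closed[OF X that] by simp
  obtain h where h: "h \<in> lin_hom R (tensor R N X) ?Q"
    "\<And>y x. y \<in> carrier N \<Longrightarrow> x \<in> carrier X \<Longrightarrow> h (pure_tensor R N X y x) = b y x"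
  proof (rule tensor_universal[OF N X Q, of b])
    fix y x assume y: "y \<in> carrier N" and x: "x \<in> carrier X"
    obtain f where f: "f \<in> {..<k} \<rightarrow>\<^sub>E carrier R" "y = \<epsilon> f" using lift[OF y] by auto
    show "b y x \<in> carrier ?Q" unfolding f b[OF f(1) x] by (intro lin_hom_closed[OF q] sc f x)
    fix x' assume x': "x' \<in> carrier X"
    show "b y (x \<oplus>\<^bsub>X\<^esub> x') = b y x \<oplus>\<^bsub>?Q\<^esub> b y x'"
      unfolding f b[OF f(1) x] b[OF f(1) x'] b[OF f(1) X.a_closed[OF x x']]
      by (simp only: lin_hom_add[OF scale_lin_hom_right[OF X f(1)] x x'] lin_hom_add[OF q] sc f x x')
  next
    fix a y x assume a: "a \<in> carrier R" and y: "y \<in> carrier N" and x: "x \<in> carrier X"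
    obtain f where f: "f \<in> {..<k} \<rightarrow>\<^sub>E carrier R" "y = \<epsilon> f" using lift[OF y] by auto
    have af: "a \<odot>\<^bsub>Rpow k\<^esub> f \<in> {..<k} \<rightarrow>\<^sub>E carrier R" using f a by (auto simp: PiE_mem)
    show "b y (a \<odot>\<^bsub>X\<^esub> x) = a \<odot>\<^bsub>?Q\<^esub> b y x"
      unfolding f b[OF f(1) x] b[OF f(1) X.smult_closed[OF a x]]
      by (simp only: lin_hom_smult[OF scale_lin_hom_right[OF X f(1)] a x] lin_hom_smult[OF q] sc a f x)
    have "a \<odot>\<^bsub>N\<^esub> y = \<epsilon> (a \<odot>\<^bsub>Rpow k\<^esub> f)" using lin_hom_smult[OF \<epsilon> a, of f] f by simp
    moreover have "scale X k (a \<odot>\<^bsub>Rpow k\<^esub> f) x = a \<odot>\<^bsub>?P\<^esub> scale X k f x"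
      by (rule lin_hom_smult[OF scale_lin_hom_left[OF X x] a]) (use f in simp)
    ultimately show "b (a \<odot>\<^bsub>N\<^esub> y) x = a \<odot>\<^bsub>?Q\<^esub> b y x"
      using b[OF af x] b[OF f(1) x] lin_hom_smult[OF q a sc[OF f(1) x]] f(2) by simp
  next
    fix y y' x assume y: "y \<in> carrier N" "y' \<in> carrier N" and x: "x \<in> carrier X"
    obtain f f' where f: "f \<in> {..<k} \<rightarrow>\<^sub>E carrier R" "y = \<epsilon> f" "f' \<in> {..<k} \<rightarrow>\<^sub>E carrier R" "y' = \<epsilon> f'"
      using lift[OF y(1)] lift[OF y(2)] by auto
    have af: "f \<oplus>\<^bsub>Rpow k\<^esub> f' \<in> {..<k} \<rightarrow>\<^sub>E carrier R" using f by (auto simp: PiE_mem)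
    have "y \<oplus>\<^bsub>N\<^esub> y' = \<epsilon> (f \<oplus>\<^bsub>Rpow k\<^esub> f')" using lin_hom_add[OF \<epsilon>, of f f'] f by simp
    moreover have "scale X k (f \<oplus>\<^bsub>Rpow k\<^esub> f') x = scale X k f x \<oplus>\<^bsub>?P\<^esub> scale X k f' x"
      by (rule lin_hom_add[OF scale_lin_hom_left[OF X x]]) (use f in simp_all)
    ultimately show "b (y \<oplus>\<^bsub>N\<^esub> y') x = b y x \<oplus>\<^bsub>?Q\<^esub> b y' x"
      using b[OF af x] b[OF f(1) x] b[OF f(3) x] lin_hom_add[OF q sc[OF f(1) x] sc[OF f(3) x]] f(2,4) by simp
  qed blast
  have hphi: "h (tensor_vec N X k \<epsilon> x) = ?q x" if x: "x \<in> {..<k} \<rightarrow>\<^sub>E carrier X" for x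
  proof -
    have c: "x i \<in> carrier X" if "i < k" for i using that x by (auto simp: PiE_mem)
    note pc = pure_tensor_closed[OF N X eps_gen_closed]
    have "h (tensor_vec N X k \<epsilon> x) = (\<Oplus>\<^bsub>?Q\<^esub>i\<in>{..<k}. h (pure_tensor R N X (\<epsilon> (unit_vec k i)) (x i)))"
      unfolding tensor_vec_def by (intro lin_hom_finsum[OF T.module_axioms Q h(1)]) (simp_all add: pc c)
    also have "\<dots> = (\<Oplus>\<^bsub>?Q\<^esub>i\<in>{..<k}. ?q (scale X k (unit_vec k i) (x i)))"
    proof (rule Q.finsum_cong'[OF refl])
      show "(\<lambda>i. ?q (scale X k (unit_vec k i) (x i))) \<in> {..<k} \<rightarrow> carrier ?Q"
        by (intro funcsetI lin_hom_closed[OF q] sc unit_vec_closed c) simp_all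
      fix i assume "i \<in> {..<k}"
      then have i: "i < k" by simp
      show "h (pure_tensor R N X (\<epsilon> (unit_vec k i)) (x i)) = ?q (scale X k (unit_vec k i) (x i))"
        unfolding h(2)[OF eps_gen_closed[OF i] c[OF i]] by (rule b[OF unit_vec_closed[OF i] c[OF i]])
    qed
    also have "\<dots> = ?q (\<Oplus>\<^bsub>?P\<^esub>i\<in>{..<k}. scale X k (unit_vec k i) (x i))"
      by (rule lin_hom_finsum[OF P Q q, symmetric]) (use sc[OF unit_vec_closed c] in \<open>simp_all add: Pi_def\<close>)
    also have "\<dots> = ?q x" by (simp only: vec_eq_sum_scale[OF X x, symmetric])
    finally show ?thesis .
  qed
  show "lin_kernel ?P (tensor R N X) (tensor_vec N X k \<epsilon>) \<subseteq> ?U"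
  proof
    fix x assume "x \<in> lin_kernel ?P (tensor R N X) (tensor_vec N X k \<epsilon>)"
    then have x: "x \<in> carrier ?P" "tensor_vec N X k \<epsilon> x = \<zero>\<^bsub>tensor R N X\<^esub>" by (simp_all add: lin_kernel_def)
    then have "?q x = \<zero>\<^bsub>?Q\<^esub>" using hphi[of x] lin_hom_zero[OF T.module_axioms Q h(1)] by simp
    then show "x \<in> ?U" using quot_map_zero_iff[OF P U x(1)] by simp
  qed
qed

end

end

text \<open>On a free module the identification \<open>X\<^sup>k \<cong> R\<^sup>k \<otimes> X\<close> is natural.\<close>

definition free_tensor :: "('a, 'c, 'm) module_scheme \<Rightarrow> nat \<Rightarrow> (nat \<Rightarrow> 'c) \<Rightarrow> ((nat \<Rightarrow> 'a) \<times> 'c \<Rightarrow> 'a) set"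
  where "free_tensor X k = tensor_vec (Rpow k) X k (\<lambda>f. f)"

lemma PiE_lessThan_0: "{..<0::nat} \<rightarrow>\<^sub>E S = {\<lambda>_. undefined}"
  by simp

lemma free_presentation: "lin_kernel (Rpow k) (Rpow k) (\<lambda>f. f) = act (ring_module R) k 0 (\<lambda>_ _. \<zero>) ` ({..<0} \<rightarrow>\<^sub>E carrier R)"
proof -
  interpret RM: Module.module R "ring_module R" by (rule ring_module)
  interpret F: Module.module R "Rpow k" by (rule Rpow_module)
  have "act (ring_module R) k 0 (\<lambda>_ _. \<zero>) (\<lambda>_. undefined) = \<zero>\<^bsub>Rpow k\<^esub>"
    by (simp add: act_def)
  moreover have "lin_kernel (Rpow k) (Rpow k) (\<lambda>f. f) = {\<zero>\<^bsub>Rpow k\<^esub>}"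
    using F.zero_closed unfolding lin_kernel_def by (auto simp del: direct_power_simps)
  ultimately show ?thesis by (simp add: PiE_lessThan_0)
qed

context
  fixes X :: "('a, 'c, 'm) module_scheme"
  assumes X: "Module.module R X"
begin

lemma free_tensor_lin_hom: "free_tensor X k \<in> lin_hom R (direct_power X k) (tensor R (Rpow k) X)"
  unfolding free_tensor_def by (rule tensor_vec_lin_hom[OF X Rpow_module id_lin_hom])

lemma free_tensor_bij: "bij_betw (free_tensor X k) (carrier (direct_power X k)) (carrier (tensor R (Rpow k) X))"
proof -
  have mat0: "mat k 0 (\<lambda>_ _. \<zero>)" by (simp add: mat_def)
  interpret P: Module.module R "direct_power X k" by (rule direct_power_module[OF X])
  have surj: "free_tensor X k ` carrier (direct_power X k) = carrier (tensor R (Rpow k) X)"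
    using tensor_vec_surj[OF X Rpow_module id_lin_hom _ mat0 free_presentation] by (simp add: free_tensor_def)
  have "lin_kernel (direct_power X k) (tensor R (Rpow k) X) (free_tensor X k) =
      act X k 0 (\<lambda>_ _. \<zero>) ` ({..<0} \<rightarrow>\<^sub>E carrier X)"
    unfolding free_tensor_def
    by (rule tensor_vec_kernel[OF X Rpow_module id_lin_hom _ mat0 free_presentation]) simp
  also have "\<dots> = {\<zero>\<^bsub>direct_power X k\<^esub>}"
    using module.axioms(2)[OF X] by (simp add: PiE_lessThan_0 act_def abelian_monoid.finsum_empty abelian_group.axioms)
  finally have ker: "lin_kernel (direct_power X k) (tensor R (Rpow k) X) (free_tensor X k) = {\<zero>\<^bsub>direct_power X k\<^esub>}" .
  have "inj_on (free_tensor X k) (carrier (direct_power X k))"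
  proof (rule inj_onI)
    fix x y assume xy: "x \<in> carrier (direct_power X k)" "y \<in> carrier (direct_power X k)" "free_tensor X k x = free_tensor X k y"
    then have "x \<ominus>\<^bsub>direct_power X k\<^esub> y \<in> {\<zero>\<^bsub>direct_power X k\<^esub>}"
      unfolding ker[symmetric]
      by (rule lin_kernel_eqI[OF direct_power_module[OF X] tensor_module[OF Rpow_module X] free_tensor_lin_hom])
    then show "x = y" using module_minus_eq_zero[OF direct_power_module[OF X] xy(1,2)] by simp
  qed
  then show ?thesis using surj by (simp add: bij_betw_def)
qed

lemma tensor_map_free_tensor:
  assumes d: "d \<in> lin_hom R (Rpow p) (Rpow q)" and A: "A = (\<lambda>i j. d (unit_vec p j) i)"
    and x: "x \<in> {..<p} \<rightarrow>\<^sub>E carrier X"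
  shows "tensor_map R (Rpow p) (Rpow q) X d (free_tensor X p x) = free_tensor X q (act X q p A x)"
proof -
  interpret T: Module.module R "tensor R (Rpow q) X" by (rule tensor_module[OF Rpow_module X])
  note tm = tensor_map_pure_tensor[OF Rpow_module Rpow_module X d]
  have mA: "mat q p A" unfolding A by (rule lin_hom_matrix(1)[OF d])
  have dA: "d (unit_vec p j) = act (ring_module R) q p A (unit_vec p j)" if "j < p" for j
    unfolding A by (rule lin_hom_matrix(2)[OF d unit_vec_closed[OF that]])
  have c: "x i \<in> carrier X" if "i < p" for i using that x by (auto simp: PiE_mem)
  have uc: "unit_vec p j \<in> carrier (Rpow p)" if "j < p" for j using unit_vec_closed[OF that] by simp
  have "tensor_map R (Rpow p) (Rpow q) X d (free_tensor X p x) =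
      (\<Oplus>\<^bsub>tensor R (Rpow q) X\<^esub>j\<in>{..<p}. tensor_map R (Rpow p) (Rpow q) X d (pure_tensor R (Rpow p) X (unit_vec p j) (x j)))"
    unfolding free_tensor_def tensor_vec_def
    by (rule lin_hom_finsum[OF tensor_module[OF Rpow_module X] T.module_axioms tm(1)])
      (use pure_tensor_closed[OF Rpow_module X uc c] in \<open>simp_all add: Pi_def\<close>)
  also have "\<dots> = (\<Oplus>\<^bsub>tensor R (Rpow q) X\<^esub>j\<in>{..<p}. pure_tensor R (Rpow q) X (act (ring_module R) q p A (unit_vec p j)) (x j))"
  proof (rule T.finsum_cong'[OF refl])
    show "(\<lambda>j. pure_tensor R (Rpow q) X (act (ring_module R) q p A (unit_vec p j)) (x j)) \<in> {..<p} \<rightarrow> carrier (tensor R (Rpow q) X)"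
      using pure_tensor_closed[OF Rpow_module X lin_hom_closed[OF d uc] c] by (simp add: dA Pi_def)
    fix j assume "j \<in> {..<p}"
    then have j: "j < p" by simp
    show "tensor_map R (Rpow p) (Rpow q) X d (pure_tensor R (Rpow p) X (unit_vec p j) (x j)) =
        pure_tensor R (Rpow q) X (act (ring_module R) q p A (unit_vec p j)) (x j)"
      unfolding tm(2)[OF uc[OF j] c[OF j]] dA[OF j] ..
  qed
  also have "\<dots> = free_tensor X q (act X q p A x)"
    unfolding free_tensor_def by (rule tensor_vec_act[OF X Rpow_module id_lin_hom mA x, symmetric])
  finally show ?thesis .
qed

end

text \<open>A homomorphism out of \<open>N\<close> is given by the images of the generators, subject to the relations.\<close>

definition hom_vec :: "nat \<Rightarrow> ((nat \<Rightarrow> 'a) \<Rightarrow> 'd) \<Rightarrow> ('d \<Rightarrow> 'c) \<Rightarrow> nat \<Rightarrow> 'c"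
  where "hom_vec k \<epsilon> h = (\<lambda>i\<in>{..<k}. h (\<epsilon> (unit_vec k i)))"

lemma act_transp_lin_hom:
  assumes X: "Module.module R X" and g: "g \<in> lin_hom R (Rpow k) X"
    and A: "mat k p A" and j: "j < p"
  shows "act X p k (mtransp A) (\<lambda>i\<in>{..<k}. g (unit_vec k i)) j = g (act (ring_module R) k p A (unit_vec p j))"
proof -
  interpret X: Module.module R X by (rule X)
  have "g (act (ring_module R) k p A (unit_vec p j)) = (\<Oplus>\<^bsub>X\<^esub>i\<in>{..<k}. act (ring_module R) k p A (unit_vec p j) i \<odot>\<^bsub>X\<^esub> g (unit_vec k i))"
    by (rule lin_hom_vec[OF X g act_closed[OF ring_module A, simplified]]) (rule unit_vec_closed[OF j])
  also have "\<dots> = (\<Oplus>\<^bsub>X\<^esub>i\<in>{..<k}. A i j \<odot>\<^bsub>X\<^esub> g (unit_vec k i))"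
    using lin_hom_closed[OF g] unit_vec_closed matD[OF A _ j]
    by (intro X.finsum_cong' refl) (simp_all add: act_unit_vec[OF A j])
  also have "\<dots> = act X p k (mtransp A) (\<lambda>i\<in>{..<k}. g (unit_vec k i)) j"
    unfolding act_nth[OF j] using lin_hom_closed[OF g] unit_vec_closed matD[OF A _ j]
    by (intro X.finsum_cong' refl) (simp_all add: mtransp_nth)
  finally show ?thesis ..
qed

lemma free_hom_exists:
  assumes X: "Module.module R X" and x: "x \<in> {..<k} \<rightarrow>\<^sub>E carrier X"
  obtains g where "g \<in> lin_hom R (Rpow k) X" "\<And>i. i < k \<Longrightarrow> g (unit_vec k i) = x i"
proof
  interpret X: Module.module R X by (rule X)
  have xc: "x i \<in> carrier X" if "i < k" for i using x that by (auto simp: PiE_mem)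
  show "free_lift X {..<k} x \<in> lin_hom R (Rpow k) X"
    using free_lift_lin_hom[OF X, of "{..<k}" x] xc by (simp add: free_module_direct_power)
  show "free_lift X {..<k} x (unit_vec k i) = x i" if "i < k" for i
    using that xc by (intro free_lift_gen X) simp_all
qed

context
  fixes X :: "('a, 'c, 'm) module_scheme" and N :: "('a, 'd, 'n) module_scheme"
    and k :: nat and \<epsilon> :: "(nat \<Rightarrow> 'a) \<Rightarrow> 'd" and p :: nat and A :: "nat \<Rightarrow> nat \<Rightarrow> 'a"
  assumes X: "Module.module R X" and N: "Module.module R N" and \<epsilon>: "\<epsilon> \<in> lin_hom R (Rpow k) N"
    and surj: "\<epsilon> ` carrier (Rpow k) = carrier N" and A: "mat k p A"
    and ker: "lin_kernel (Rpow k) N \<epsilon> = act (ring_module R) k p A ` ({..<p} \<rightarrow>\<^sub>E carrier R)"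
begin

interpretation X: Module.module R X by (rule X)
interpretation N: Module.module R N by (rule N)

lemma hom_vec_lin_hom: "hom_vec k \<epsilon> \<in> lin_hom R (Hom_module R N X) (direct_power X k)"
proof -
  note ec = eps_gen_closed[OF X N \<epsilon>]
  have c: "h y \<in> carrier X" if "h \<in> carrier (Hom_module R N X)" "y \<in> carrier N" for h y
    using that lin_hom_closed by (auto simp: Hom_module_simps)
  show ?thesis
    by (rule lin_homI) (simp_all add: hom_vec_def Hom_module_simps(2-4) c ec cong: restrict_cong)
qed

lemma hom_vec_inj: "inj_on (hom_vec k \<epsilon>) (carrier (Hom_module R N X))"
proof (rule inj_onI)
  fix h h' assume *: "h \<in> carrier (Hom_module R N X)" "h' \<in> carrier (Hom_module R N X)" "hom_vec k \<epsilon> h = hom_vec k \<epsilon> h'"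
  then have h: "h \<in> lin_hom R N X" "h' \<in> lin_hom R N X" "h \<in> extensional (carrier N)" "h' \<in> extensional (carrier N)"
    by (auto simp: Hom_module_simps)
  have gen: "h (\<epsilon> (unit_vec k i)) = h' (\<epsilon> (unit_vec k i))" if "i < k" for i
    using fun_cong[OF *(3), of i] that by (simp add: hom_vec_def)
  have "h (\<epsilon> f) = h' (\<epsilon> f)" if f: "f \<in> {..<k} \<rightarrow>\<^sub>E carrier R" for f
    using lin_hom_vec[OF X lin_hom_comp[OF \<epsilon> h(1)] f] lin_hom_vec[OF X lin_hom_comp[OF \<epsilon> h(2)] f] gen
      X.finsum_cong'[OF refl, of "\<lambda>j. f j \<odot>\<^bsub>X\<^esub> h' (\<epsilon> (unit_vec k j))" "{..<k}" "\<lambda>j. f j \<odot>\<^bsub>X\<^esub> h (\<epsilon> (unit_vec k j))"]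
      lin_hom_closed[OF h(2) eps_gen_closed[OF X N \<epsilon>]] PiE_mem[OF f] by (simp add: Pi_def)
  then have "h y = h' y" if "y \<in> carrier N" for y
    using that unfolding surj[symmetric] by auto
  then show "h = h'" using h(3,4) by (intro extensionalityI[of _ "carrier N"])
qed

text \<open>
  A vector \<open>x\<close> defines the map \<open>e\<^sub>i \<mapsto> x\<^sub>i\<close> on \<open>R\<^sup>k\<close>.  The equation \<open>A\<^sup>T x = 0\<close> says that this map kills the
  columns of \<open>A\<close>, hence the kernel of \<open>\<epsilon>\<close>, so that it factors through \<open>N\<close>.
\<close>

lemma hom_vec_image:
  "hom_vec k \<epsilon> ` carrier (Hom_module R N X) =
    lin_kernel (direct_power X k) (direct_power X p) (act X p k (mtransp A))"
proof
  show "hom_vec k \<epsilon> ` carrier (Hom_module R N X) \<subseteq> lin_kernel (direct_power X k) (direct_power X p) (act X p k (mtransp A))"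
  proof
    fix v assume "v \<in> hom_vec k \<epsilon> ` carrier (Hom_module R N X)"
    then obtain h where h0: "h \<in> carrier (Hom_module R N X)" "v = hom_vec k \<epsilon> h" by blast
    then have h: "h \<in> lin_hom R N X" by (simp add: Hom_module_simps)
    have vc: "v \<in> carrier (direct_power X k)" unfolding h0(2) by (rule lin_hom_closed[OF hom_vec_lin_hom h0(1)])
    have "act X p k (mtransp A) v j = \<zero>\<^bsub>X\<^esub>" if j: "j < p" for j
    proof -
      have "act X p k (mtransp A) v j = h (\<epsilon> (act (ring_module R) k p A (unit_vec p j)))"
        unfolding h0(2) hom_vec_def by (rule act_transp_lin_hom[OF X lin_hom_comp[OF \<epsilon> h] A j])
      also have "\<epsilon> (act (ring_module R) k p A (unit_vec p j)) = \<zero>\<^bsub>N\<^esub>"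
        by (rule eps_act_zero[OF X N \<epsilon> surj A ker unit_vec_closed[OF j]])
      finally show ?thesis using lin_hom_zero[OF N X h] by simp
    qed
    then have "act X p k (mtransp A) v = \<zero>\<^bsub>direct_power X p\<^esub>"
      by (intro extensionalityI[of _ "{..<p}"]) (simp_all add: act_def)
    then show "v \<in> lin_kernel (direct_power X k) (direct_power X p) (act X p k (mtransp A))"
      using vc by (simp add: lin_kernel_def)
  qed
  show "lin_kernel (direct_power X k) (direct_power X p) (act X p k (mtransp A)) \<subseteq> hom_vec k \<epsilon> ` carrier (Hom_module R N X)"
  proof
    fix x assume "x \<in> lin_kernel (direct_power X k) (direct_power X p) (act X p k (mtransp A))"
    then have x: "x \<in> {..<k} \<rightarrow>\<^sub>E carrier X" and x0: "act X p k (mtransp A) x = \<zero>\<^bsub>direct_power X p\<^esub>"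
      by (simp_all add: lin_kernel_def)
    obtain g where g: "g \<in> lin_hom R (Rpow k) X" "\<And>i. i < k \<Longrightarrow> g (unit_vec k i) = x i"
      by (rule free_hom_exists[OF X x]) blast
    have xg: "(\<lambda>i\<in>{..<k}. g (unit_vec k i)) = x"
      using x g(2) by (intro extensionalityI[of _ "{..<k}"]) (simp_all add: PiE_def)
    have g0: "g (act (ring_module R) k p A (unit_vec p j)) = \<zero>\<^bsub>X\<^esub>" if j: "j < p" for j
      using act_transp_lin_hom[OF X g(1) A j] x0 j by (simp add: xg)
    have gA: "g (act (ring_module R) k p A y) = \<zero>\<^bsub>X\<^esub>" if y: "y \<in> {..<p} \<rightarrow>\<^sub>E carrier R" for y
    proof -
      have "g (act (ring_module R) k p A y) = (\<Oplus>\<^bsub>X\<^esub>j\<in>{..<p}. y j \<odot>\<^bsub>X\<^esub> g (act (ring_module R) k p A (unit_vec p j)))"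
        by (rule lin_hom_vec[OF X lin_hom_comp[OF act_lin_hom[OF ring_module A] g(1)] y])
      also have "\<dots> = (\<Oplus>\<^bsub>X\<^esub>j\<in>{..<p}. \<zero>\<^bsub>X\<^esub>)"
        using PiE_mem[OF y] by (intro X.finsum_cong' refl) (simp_all add: g0)
      finally show ?thesis by (simp add: X.finsum_zero)
    qed
    have ker_g: "g f = g f'" if f: "f \<in> {..<k} \<rightarrow>\<^sub>E carrier R" "f' \<in> {..<k} \<rightarrow>\<^sub>E carrier R" "\<epsilon> f = \<epsilon> f'" for f f'
    proof -
      have "f \<ominus>\<^bsub>Rpow k\<^esub> f' \<in> lin_kernel (Rpow k) N \<epsilon>" using f by (intro lin_kernel_eqI[OF Rpow_module N \<epsilon>]) simp_all
      then obtain y where y: "y \<in> {..<p} \<rightarrow>\<^sub>E carrier R" "f \<ominus>\<^bsub>Rpow k\<^esub> f' = act (ring_module R) k p A y"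
        unfolding ker by blast
      have "g f \<ominus>\<^bsub>X\<^esub> g f' = \<zero>\<^bsub>X\<^esub>"
        using gA[OF y(1)] lin_hom_minus[OF Rpow_module X g(1), of f f'] f y(2) by simp
      then show ?thesis using module_minus_eq_zero[OF X] lin_hom_closed[OF g(1)] f by simp
    qed
    define h where "h = (\<lambda>y\<in>carrier N. g (SOME f. f \<in> {..<k} \<rightarrow>\<^sub>E carrier R \<and> \<epsilon> f = y))"
    have ec: "\<epsilon> f \<in> carrier N" if "f \<in> {..<k} \<rightarrow>\<^sub>E carrier R" for f using lin_hom_closed[OF \<epsilon>] that by simp
    have he: "h (\<epsilon> f) = g f" if f: "f \<in> {..<k} \<rightarrow>\<^sub>E carrier R" for f
    proof -
      have "(SOME f'. f' \<in> {..<k} \<rightarrow>\<^sub>E carrier R \<and> \<epsilon> f' = \<epsilon> f) \<in> {..<k} \<rightarrow>\<^sub>E carrier R \<and>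
        \<epsilon> (SOME f'. f' \<in> {..<k} \<rightarrow>\<^sub>E carrier R \<and> \<epsilon> f' = \<epsilon> f) = \<epsilon> f"
        by (rule someI[of _ f]) (simp add: f)
      then show ?thesis using f ec[OF f] by (auto simp: h_def intro: ker_g)
    qed
    have lift: "\<exists>f\<in>{..<k} \<rightarrow>\<^sub>E carrier R. y = \<epsilon> f" if "y \<in> carrier N" for y using surj that by auto
    have "h \<in> lin_hom R N X"
    proof (rule lin_homI)
      fix y assume "y \<in> carrier N"
      then obtain f where f: "f \<in> {..<k} \<rightarrow>\<^sub>E carrier R" "y = \<epsilon> f" using lift by blast
      then show "h y \<in> carrier X" using lin_hom_closed[OF g(1)] by (simp add: he)
    next
      fix y y' assume "y \<in> carrier N" "y' \<in> carrier N"
      then obtain f f' where f: "f \<in> {..<k} \<rightarrow>\<^sub>E carrier R" "y = \<epsilon> f" "f' \<in> {..<k} \<rightarrow>\<^sub>E carrier R" "y' = \<epsilon> f'"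
        using lift by metis
      have af: "f \<oplus>\<^bsub>Rpow k\<^esub> f' \<in> {..<k} \<rightarrow>\<^sub>E carrier R" using f by (auto simp: PiE_mem)
      have "h (y \<oplus>\<^bsub>N\<^esub> y') = h (\<epsilon> (f \<oplus>\<^bsub>Rpow k\<^esub> f'))" using lin_hom_add[OF \<epsilon>, of f f'] f by simp
      also have "\<dots> = g f \<oplus>\<^bsub>X\<^esub> g f'" using lin_hom_add[OF g(1), of f f'] f by (simp only: he[OF af]) simp
      finally show "h (y \<oplus>\<^bsub>N\<^esub> y') = h y \<oplus>\<^bsub>X\<^esub> h y'" using f by (simp add: he)
    next
      fix a y assume a: "a \<in> carrier R" and "y \<in> carrier N"
      then obtain f where f: "f \<in> {..<k} \<rightarrow>\<^sub>E carrier R" "y = \<epsilon> f" using lift by blast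
      have af: "a \<odot>\<^bsub>Rpow k\<^esub> f \<in> {..<k} \<rightarrow>\<^sub>E carrier R" using f a by (auto simp: PiE_mem)
      have "h (a \<odot>\<^bsub>N\<^esub> y) = h (\<epsilon> (a \<odot>\<^bsub>Rpow k\<^esub> f))" using lin_hom_smult[OF \<epsilon> a, of f] f by simp
      also have "\<dots> = a \<odot>\<^bsub>X\<^esub> g f" using lin_hom_smult[OF g(1) a, of f] f by (simp only: he[OF af]) simp
      finally show "h (a \<odot>\<^bsub>N\<^esub> y) = a \<odot>\<^bsub>X\<^esub> h y" using f by (simp add: he)
    qed
    then have "h \<in> carrier (Hom_module R N X)" by (simp add: Hom_module_simps h_def)
    moreover have "hom_vec k \<epsilon> h = x"
      unfolding xg[symmetric] by (simp add: hom_vec_def he unit_vec_closed cong: restrict_cong)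
    ultimately show "x \<in> hom_vec k \<epsilon> ` carrier (Hom_module R N X)" by blast
  qed
qed

end

definition free_hom :: "nat \<Rightarrow> ((nat \<Rightarrow> 'a) \<Rightarrow> 'c) \<Rightarrow> nat \<Rightarrow> 'c"
  where "free_hom k = hom_vec k (\<lambda>f. f)"

context
  fixes X :: "('a, 'c, 'm) module_scheme"
  assumes X: "Module.module R X"
begin

interpretation X: Module.module R X by (rule X)

lemma free_presentation_data:
  "(\<lambda>f. f) ` carrier (Rpow k) = carrier (Rpow k)" "mat k 0 (\<lambda>_ _. \<zero>)"
  by (simp_all add: mat_def)

lemma free_hom_lin_hom: "free_hom k \<in> lin_hom R (Hom_module R (Rpow k) X) (direct_power X k)"
  unfolding free_hom_def by (rule hom_vec_lin_hom[OF X Rpow_module id_lin_hom free_presentation_data free_presentation])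

lemma free_hom_bij: "bij_betw (free_hom k) (carrier (Hom_module R (Rpow k) X)) (carrier (direct_power X k))"
proof -
  note pres = X Rpow_module id_lin_hom free_presentation_data free_presentation
  have "act X 0 k B x = \<zero>\<^bsub>direct_power X 0\<^esub>" for B x
    by (auto simp: act_def fun_eq_iff)
  then have "lin_kernel (direct_power X k) (direct_power X 0) (act X 0 k (mtransp (\<lambda>_ _. \<zero>))) = carrier (direct_power X k)"
    by (simp add: lin_kernel_def)
  then have "free_hom k ` carrier (Hom_module R (Rpow k) X) = carrier (direct_power X k)"
    unfolding free_hom_def hom_vec_image[OF pres] .
  then show ?thesis using hom_vec_inj[OF pres] by (simp add: bij_betw_def free_hom_def)
qed

lemma free_hom_compose:
  assumes d: "d \<in> lin_hom R (Rpow p) (Rpow q)" and A: "A = (\<lambda>i j. d (unit_vec p j) i)"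
    and h: "h \<in> carrier (Hom_module R (Rpow q) X)"
  shows "free_hom p (compose (carrier (Rpow p)) h d) = act X p q (mtransp A) (free_hom q h)"
proof -
  have mA: "mat q p A" unfolding A by (rule lin_hom_matrix(1)[OF d])
  have dA: "d (unit_vec p j) = act (ring_module R) q p A (unit_vec p j)" if "j < p" for j
    unfolding A by (rule lin_hom_matrix(2)[OF d unit_vec_closed[OF that]])
  have hl: "h \<in> lin_hom R (Rpow q) X" using h by (simp add: Hom_module_simps)
  have "free_hom p (compose (carrier (Rpow p)) h d) j = act X p q (mtransp A) (free_hom q h) j" if j: "j < p" for j
    using act_transp_lin_hom[OF X hl mA j] unit_vec_closed[OF j] j
    by (simp add: free_hom_def hom_vec_def compose_def dA)
  then show ?thesis by (intro extensionalityI[of _ "{..<p}"]) (simp_all add: free_hom_def hom_vec_def act_def)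
qed

end

lemma lin_kernel_image:
  assumes X: "Module.module R X" and Y: "Module.module R Y" and f: "f \<in> lin_hom R X Y"
  shows "f ` lin_kernel X Y f = {\<zero>\<^bsub>Y\<^esub>}"
proof
  show "f ` lin_kernel X Y f \<subseteq> {\<zero>\<^bsub>Y\<^esub>}" by (auto simp: lin_kernel_def)
  show "{\<zero>\<^bsub>Y\<^esub>} \<subseteq> f ` lin_kernel X Y f"
    using imageI[OF submodule_zero[OF X submodule_lin_kernel[OF X Y f]], of f] lin_hom_zero[OF X Y f] by simp
qed

lemma slen_surj:
  assumes X: "Module.module R X" and Y: "Module.module R Y" and f: "f \<in> lin_hom R X Y"
    and surj: "f ` carrier X = carrier Y"
  shows "slen Y {\<zero>\<^bsub>Y\<^esub>} (carrier Y) = slen X (lin_kernel X Y f) (carrier X)"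
proof -
  have "slen Y (f ` lin_kernel X Y f) (f ` carrier X) = slen X (lin_kernel X Y f) (carrier X)"
    by (rule slen_image[OF X Y f submodule_lin_kernel[OF X Y f] submodule_carrier[OF X]])
      (auto simp: lin_kernel_def)
  then show ?thesis by (simp only: surj lin_kernel_image[OF X Y f])
qed

end

section \<open>Ranks of matrices modulo the maximal ideal\<close>

context noetherian_local_ring
begin

text \<open>
  Otherwise, by the ascending chain condition, some ideal is maximal among those containing \<open>a\<close> but
  not \<open>1\<close>; it is then a maximal ideal of the ring, different from \<open>\<nn>\<close>.
\<close>

lemma unit_if_not_max:
  assumes a: "a \<in> carrier R" "a \<notin> \<nn>"
  shows "a \<in> Units R"
proof (rule ccontr)
  assume nu: "a \<notin> Units R"
  let ?S = "{I. ideal I R \<and> a \<in> I \<and> \<one> \<notin> I}"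
  have "PIdl a \<in> ?S"
    using cgenideal_ideal[OF a(1)] cgenideal_self[OF a(1)] nu a(1)
    by (auto simp: cgenideal_def Units_def m_comm)
  then have ne: "?S \<noteq> {}" by blast
  have "\<exists>J\<in>?S. \<forall>I\<in>?S. J \<subseteq> I \<longrightarrow> I = J"
  proof (rule subset_Zorn_nonempty[OF ne])
    fix C assume C: "C \<noteq> {}" "subset.chain ?S C"
    then have "subset.chain {I. ideal I R} C" by (auto simp: subset.chain_def)
    then have "\<Union>C \<in> C" by (rule ideal_chain_is_trivial[OF C(1)])
    then show "\<Union>C \<in> ?S" using C(2) by (auto simp: subset.chain_def)
  qed
  then obtain J where J: "ideal J R" "a \<in> J" "\<one> \<notin> J" and max: "\<And>I. I \<in> ?S \<Longrightarrow> J \<subseteq> I \<Longrightarrow> I = J"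
    by blast
  have "maximalideal J R"
  proof (rule maximalidealI[OF J(1)])
    show "carrier R \<noteq> J" using J(3) one_closed by blast
    fix I assume I: "ideal I R" "J \<subseteq> I" "I \<subseteq> carrier R"
    show "I = J \<or> I = carrier R"
    proof (cases "\<one> \<in> I")
      case True
      then show ?thesis using ideal.one_imp_carrier[OF I(1)] by simp
    next
      case False
      then show ?thesis using max[of I] I J by auto
    qed
  qed
  then show False using maximal_unique J(2) a(2) by blast
qed

lemma one_not_max: "\<one> \<notin> \<nn>"
  using I_notcarr one_imp_carrier by blast

lemma one_neq_zero: "\<one> \<noteq> \<zero>"
  using one_not_max additive_subgroup.zero_closed[OF is_additive_subgroup] by auto

lemma max_submodule: "submodule \<nn> R (ring_module R)"
  unfolding submodule_iff[OF ring_module] using a_subset I_l_closed by auto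

lemma ring_submodule_ideal: "submodule J R (ring_module R) \<Longrightarrow> ideal J R"
proof (rule idealI[OF ring_axioms])
  assume J: "submodule J R (ring_module R)"
  have "subgroup J (add_monoid (ring_module R))" by (rule submodule.axioms(1)[OF J])
  moreover have "a \<ominus>\<^bsub>ring_module R\<^esub> b = a \<ominus> b" for a b
    by (simp add: a_minus_def a_inv_def m_inv_def)
  ultimately show "subgroup J (add_monoid R)"
    unfolding subgroup_def by (simp add: m_inv_def)
  show "x \<otimes> a \<in> J" if "a \<in> J" "x \<in> carrier R" for a x
    using submodule_smult[OF ring_module J] that by simp
  then show "a \<otimes> x \<in> J" if "a \<in> J" "x \<in> carrier R" for a x
    using that submodule_carrierD[OF ring_module J] by (simp add: m_comm)
qed

lemma slen_residue: "slen (ring_module R) \<nn> (carrier R) = 1"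
proof (rule antisym)
  show "slen (ring_module R) \<nn> (carrier R) \<ge> 1"
  proof (rule slen_pos[OF max_submodule])
    show "submodule (carrier R) R (ring_module R)" using submodule_carrier[OF ring_module] by simp
    show "\<nn> \<subset> carrier R" using a_subset I_notcarr by auto
  qed
  show "slen (ring_module R) \<nn> (carrier R) \<le> 1"
  proof (rule slen_leI)
    fix k U assume U: "strict_chain (ring_module R) \<nn> (carrier R) k U"
    have dich: "U i = \<nn> \<or> U i = carrier R" if "i \<le> k" for i
      using I_maximal[OF ring_submodule_ideal] strict_chainD[OF U that] by metis
    have "\<not> 2 \<le> k"
    proof
      assume k: "2 \<le> k"
      have "U 0 \<subset> U 1" "U 1 \<subset> U 2"
        using strict_chain_step[OF U, of 0] strict_chain_step[OF U, of 1] k by (simp_all add: numeral_2_eq_2)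
      then show False using dich[of 0] dich[of 1] dich[of 2] k strict_chainD[OF U, of 0] strict_chainD[OF U, of 2] by auto
    qed
    then show "enat k \<le> 1" by (simp add: one_enat_def)
  qed
qed

definition killed :: "('a, 'c, 'm) module_scheme \<Rightarrow> 'c set \<Rightarrow> bool"
  where "killed X Y \<longleftrightarrow> (\<forall>a\<in>\<nn>. \<forall>y\<in>Y. a \<odot>\<^bsub>X\<^esub> y = \<zero>\<^bsub>X\<^esub>)"

definition mcong :: "nat \<Rightarrow> nat \<Rightarrow> (nat \<Rightarrow> nat \<Rightarrow> 'a) \<Rightarrow> (nat \<Rightarrow> nat \<Rightarrow> 'a) \<Rightarrow> bool"
  where "mcong q p A B \<longleftrightarrow> (\<forall>i<q. \<forall>j<p. A i j \<ominus> B i j \<in> \<nn>)"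

lemma residue_module_module: "Module.module R (residue_module R \<nn>)"
  unfolding residue_module_def by (rule quot_module_module[OF ring_module max_submodule])

lemma residue_module_slen: "slen (residue_module R \<nn>) {\<zero>\<^bsub>residue_module R \<nn>\<^esub>} (carrier (residue_module R \<nn>)) = 1"
  unfolding residue_module_def using slen_quot_module[OF ring_module max_submodule] slen_residue by simp

lemma residue_module_killed: "killed (residue_module R \<nn>) (carrier (residue_module R \<nn>))"
  unfolding killed_def
proof (intro ballI)
  let ?l = "quot_module (ring_module R) \<nn>" and ?q = "\<lambda>x. \<nn> +>\<^bsub>ring_module R\<^esub> x"
  fix a y assume a: "a \<in> \<nn>" and y: "y \<in> carrier (residue_module R \<nn>)"
  then obtain x where x: "x \<in> carrier R" "y = ?q x"
    using quot_map_surj[OF ring_module max_submodule] by (auto simp: residue_module_def)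
  have ac: "a \<in> carrier R" using a a_subset by auto
  have "a \<odot>\<^bsub>?l\<^esub> y = ?q (a \<otimes> x)"
    using lin_hom_smult[OF quot_map_lin_hom[OF ring_module max_submodule] ac, of x] x by simp
  also have "\<dots> = \<zero>\<^bsub>?l\<^esub>"
    using quot_map_zero_iff[OF ring_module max_submodule, of "a \<otimes> x"] ac x I_r_closed[OF a x(1)] by simp
  finally show "a \<odot>\<^bsub>residue_module R \<nn>\<^esub> y = \<zero>\<^bsub>residue_module R \<nn>\<^esub>" by (simp add: residue_module_def)
qed

lemma killed_power: "killed X Y \<Longrightarrow> killed (direct_power X k) ({..<k} \<rightarrow>\<^sub>E Y)"
  by (auto simp: killed_def PiE_mem intro!: restrict_ext)

lemma killed_subset: "killed X Y \<Longrightarrow> Z \<subseteq> Y \<Longrightarrow> killed X Z"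
  by (auto simp: killed_def)

lemma killed_image:
  assumes X: "Module.module R X" and Y: "Module.module R Y" and f: "f \<in> lin_hom R X Y"
    and B: "B \<subseteq> carrier X" and k: "killed X B"
  shows "killed Y (f ` B)"
  unfolding killed_def
proof (intro ballI)
  fix a y assume a: "a \<in> \<nn>" and "y \<in> f ` B"
  then obtain x where x: "x \<in> B" "y = f x" by blast
  then have "a \<odot>\<^bsub>Y\<^esub> y = f (a \<odot>\<^bsub>X\<^esub> x)" using a a_subset B lin_hom_smult[OF f] by auto
  then show "a \<odot>\<^bsub>Y\<^esub> y = \<zero>\<^bsub>Y\<^esub>" using k a x lin_hom_zero[OF X Y f] by (auto simp: killed_def)
qed

lemma killed_smult_eq:
  assumes X: "Module.module R X" and k: "killed X Y" "Y \<subseteq> carrier X" and y: "y \<in> Y"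
    and ab: "a \<in> carrier R" "b \<in> carrier R" "a \<ominus> b \<in> \<nn>"
  shows "a \<odot>\<^bsub>X\<^esub> y = b \<odot>\<^bsub>X\<^esub> y"
proof -
  interpret X: Module.module R X by (rule X)
  have yc: "y \<in> carrier X" using k y by auto
  have "a = b \<oplus> (a \<ominus> b)" using ab by algebra
  then have "a \<odot>\<^bsub>X\<^esub> y = b \<odot>\<^bsub>X\<^esub> y \<oplus>\<^bsub>X\<^esub> (a \<ominus> b) \<odot>\<^bsub>X\<^esub> y"
    using X.smult_l_distr[of b "a \<ominus> b" y] ab yc by simp
  then show ?thesis using k y ab yc by (simp add: killed_def)
qed

lemma act_mcong:
  assumes X: "Module.module R X" and k: "killed X Y" "Y \<subseteq> carrier X"
    and A: "mat q p A" and B: "mat q p B" and c: "mcong q p A B" and x: "x \<in> {..<p} \<rightarrow>\<^sub>E Y"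
  shows "act X q p A x = act X q p B x"
proof -
  interpret X: Module.module R X by (rule X)
  have xc: "x j \<in> Y" "x j \<in> carrier X" if "j < p" for j using PiE_mem[OF x, of j] that k by auto
  have "(\<Oplus>\<^bsub>X\<^esub>j\<in>{..<p}. A i j \<odot>\<^bsub>X\<^esub> x j) = (\<Oplus>\<^bsub>X\<^esub>j\<in>{..<p}. B i j \<odot>\<^bsub>X\<^esub> x j)" if i: "i < q" for i
    using c i by (intro X.finsum_cong' refl)
      (simp_all add: mcong_def xc matD[OF B] matD[OF A] killed_smult_eq[OF X k xc(1)])
  then show ?thesis unfolding act_def by (intro restrict_ext) simp
qed

lemma mmult_assoc:
  assumes A: "mat q p A" and B: "mat p s B" and C: "mat s t C" and i: "i < q" and j: "j < t"
  shows "mmult p A (mmult s B C) i j = mmult s (mmult p A B) C i j"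
proof -
  let ?S = "ring_module R"
  have u: "unit_vec t j \<in> {..<t} \<rightarrow>\<^sub>E carrier ?S" using unit_vec_closed[OF j] by simp
  note BC = mat_mmult[OF B C] and AB = mat_mmult[OF A B]
  have eq: "act ?S q t (mmult p A (mmult s B C)) (unit_vec t j) = act ?S q t (mmult s (mmult p A B) C) (unit_vec t j)"
    using act_mmult[OF ring_module A BC u] act_mmult[OF ring_module B C u]
      act_mmult[OF ring_module AB C u] act_mmult[OF ring_module A B act_closed[OF ring_module C u]]
    by simp
  show ?thesis
    using fun_cong[OF eq, of i] i
    by (simp add: act_unit_vec[OF mat_mmult[OF A BC] j] act_unit_vec[OF mat_mmult[OF AB C] j])
qed

text \<open>
  The data \<open>V\<close>, \<open>D\<close> say that over the residue field \<open>A\<close> is the composite of the surjection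
  \<open>V A\<close> onto an \<open>r\<close>-dimensional space and the injection \<open>A D\<close>.  The condition is symmetric under
  transposition, and it is about matrices, so that it can be used on every module killed by the
  maximal ideal.
\<close>

definition rank_fact ::
    "nat \<Rightarrow> nat \<Rightarrow> (nat \<Rightarrow> nat \<Rightarrow> 'a) \<Rightarrow> nat \<Rightarrow> (nat \<Rightarrow> nat \<Rightarrow> 'a) \<Rightarrow> (nat \<Rightarrow> nat \<Rightarrow> 'a) \<Rightarrow> bool"
  where "rank_fact q p A r V D \<longleftrightarrow> mat q p A \<and> mat r q V \<and> mat p r D \<and>
    mcong r r (mmult q V (mmult p A D)) mid \<and>
    mcong q p (mmult r (mmult p A D) (mmult q V A)) A"

lemma rank_fact_transp:
  assumes "rank_fact q p A r V D"
  shows "rank_fact p q (mtransp A) r (mtransp D) (mtransp V)"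
proof -
  have A: "mat q p A" and V: "mat r q V" and D: "mat p r D"
    and 1: "mcong r r (mmult q V (mmult p A D)) mid"
    and 2: "mcong q p (mmult r (mmult p A D) (mmult q V A)) A"
    using assms by (simp_all add: rank_fact_def)
  note At = mat_transp[OF A] and Vt = mat_transp[OF V] and Dt = mat_transp[OF D]
  note AD = mat_mmult[OF A D] and VA = mat_mmult[OF V A]
  have AD': "mmult p A D i j = mmult p (mtransp D) (mtransp A) j i" if "i < q" "j < r" for i j
    using transp_mmult[OF A D that(2,1)] .
  have VA': "mmult q V A i j = mmult q (mtransp A) (mtransp V) j i" if "i < r" "j < p" for i j
    using transp_mmult[OF V A that(2,1)] .
  have "mmult p (mtransp D) (mmult q (mtransp A) (mtransp V)) i j = mmult q V (mmult p A D) j i"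
    if ij: "i < r" "j < r" for i j
  proof -
    have "mmult p (mtransp D) (mmult q (mtransp A) (mtransp V)) i j = mmult p (mmult q V A) D j i"
      unfolding mmult_def[of p] using ij VA' matD[OF D] matD[OF VA] 
      by (intro finsum_cong') (simp_all add: mtransp_nth m_comm)
    then show ?thesis using mmult_assoc[OF V A D ij(2,1)] by simp
  qed
  moreover have "mid i j = mid j i" for i j by (simp add: mid_def)
  ultimately have c1: "mcong r r (mmult p (mtransp D) (mmult q (mtransp A) (mtransp V))) mid"
    using 1 unfolding mcong_def by metis
  have "mmult r (mmult q (mtransp A) (mtransp V)) (mmult p (mtransp D) (mtransp A)) i j =
      mmult r (mmult p A D) (mmult q V A) j i" if ij: "i < p" "j < q" for i j
    unfolding mmult_def[of r] using ij VA' AD' matD[OF AD] matD[OF VA]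
    by (intro finsum_cong') (simp_all add: m_comm)
  then have c2: "mcong p q (mmult r (mmult q (mtransp A) (mtransp V)) (mmult p (mtransp D) (mtransp A))) (mtransp A)"
    using 2 by (simp add: mcong_def mtransp_nth)
  show ?thesis unfolding rank_fact_def using At Vt Dt c1 c2 by simp
qed

lemma rank_fact_act:
  assumes rf: "rank_fact q p A r V D"
    and X: "Module.module R X" and Y: "submodule Y R X" and k: "killed X Y"
  shows "x \<in> {..<r} \<rightarrow>\<^sub>E Y \<Longrightarrow> act X r q V (act X q p A (act X p r D x)) = x"
    and "y \<in> {..<p} \<rightarrow>\<^sub>E Y \<Longrightarrow> act X q p A (act X p r D (act X r q V (act X q p A y))) = act X q p A y"
proof -
  have A: "mat q p A" and V: "mat r q V" and D: "mat p r D"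
    and 1: "mcong r r (mmult q V (mmult p A D)) mid"
    and 2: "mcong q p (mmult r (mmult p A D) (mmult q V A)) A"
    using rf by (simp_all add: rank_fact_def)
  have Yc: "Y \<subseteq> carrier X" by (rule submodule_sub[OF X Y])
  have lift: "z \<in> {..<t} \<rightarrow>\<^sub>E carrier X" if "z \<in> {..<t} \<rightarrow>\<^sub>E Y" for z t
    using that Yc by (auto simp: PiE_def Pi_def)
  note AD = mat_mmult[OF A D] and VA = mat_mmult[OF V A]
  {
    assume x: "x \<in> {..<r} \<rightarrow>\<^sub>E Y"
    have "act X r q V (act X q p A (act X p r D x)) = act X r r (mmult q V (mmult p A D)) x"
      using act_mmult[OF X A D lift[OF x]] act_mmult[OF X V AD lift[OF x]] by simp
    also have "\<dots> = act X r r mid x" by (rule act_mcong[OF X k Yc mat_mmult[OF V AD] mat_mid 1 x])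
    also have "\<dots> = x" by (rule act_mid[OF X lift[OF x]])
    finally show "act X r q V (act X q p A (act X p r D x)) = x" .
  next
    assume y: "y \<in> {..<p} \<rightarrow>\<^sub>E Y"
    have "act X q p A (act X p r D (act X r q V (act X q p A y))) = act X q p (mmult r (mmult p A D) (mmult q V A)) y"
      using act_mmult[OF X V A lift[OF y]] act_mmult[OF X A D act_closed[OF X VA lift[OF y]]]
        act_mmult[OF X AD VA lift[OF y]] by simp
    also have "\<dots> = act X q p A y" by (rule act_mcong[OF X k Yc mat_mmult[OF AD VA] A 2 y])
    finally show "act X q p A (act X p r D (act X r q V (act X q p A y))) = act X q p A y" .
  }
qed

text \<open>
  On the powers of \<open>Y\<close>, the matrix \<open>V\<close> maps the image of \<open>A\<close> bijectively onto \<open>Y\<^sup>r\<close>, with inverse \<open>A D\<close>.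
\<close>

lemma slen_act_rank_fact:
  assumes rf: "rank_fact q p A r V D"
    and X: "Module.module R X" and Y: "submodule Y R X" and k: "killed X Y"
  shows "slen (direct_power X q) {\<zero>\<^bsub>direct_power X q\<^esub>} (act X q p A ` ({..<p} \<rightarrow>\<^sub>E Y)) = enat r * slen X {\<zero>\<^bsub>X\<^esub>} Y"
proof -
  have A: "mat q p A" and V: "mat r q V" and D: "mat p r D"
    using rf by (simp_all add: rank_fact_def)
  note rfa = rank_fact_act[OF rf X Y k]
  let ?P = "direct_power X"
  note P = direct_power_module[OF X]
  let ?B = "act X q p A ` ({..<p} \<rightarrow>\<^sub>E Y)"
  have B: "submodule ?B R (?P q)"
    by (rule submodule_image[OF P P act_lin_hom[OF X A] submodule_power[OF X Y]])
  have im: "act X r q V ` ?B = {..<r} \<rightarrow>\<^sub>E Y"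
  proof
    show "act X r q V ` ?B \<subseteq> {..<r} \<rightarrow>\<^sub>E Y"
      using act_mem[OF X Y V act_mem[OF X Y A]] by auto
    show "{..<r} \<rightarrow>\<^sub>E Y \<subseteq> act X r q V ` ?B"
    proof
      fix x assume x: "x \<in> {..<r} \<rightarrow>\<^sub>E Y"
      have "x = act X r q V (act X q p A (act X p r D x))" using rfa(1)[OF x] by simp
      then show "x \<in> act X r q V ` ?B" using act_mem[OF X Y D x] by blast
    qed
  qed
  have "slen (?P r) (act X r q V ` {\<zero>\<^bsub>?P q\<^esub>}) (act X r q V ` ?B) = slen (?P q) {\<zero>\<^bsub>?P q\<^esub>} ?B"
  proof (rule slen_image[OF P P act_lin_hom[OF X V] submodule_zero_set[OF P] B])
    show "{\<zero>\<^bsub>?P q\<^esub>} \<subseteq> ?B" using submodule_zero[OF P B] by simp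
    fix z assume "z \<in> ?B" and z0: "act X r q V z = \<zero>\<^bsub>?P r\<^esub>"
    then obtain y where y: "y \<in> {..<p} \<rightarrow>\<^sub>E Y" "z = act X q p A y" by blast
    have "z = act X q p A (act X p r D (act X r q V z))" using rfa(2)[OF y(1)] y(2) by simp
    also have "\<dots> = \<zero>\<^bsub>?P q\<^esub>"
      unfolding z0 using lin_hom_zero[OF P P act_lin_hom[OF X D]] lin_hom_zero[OF P P act_lin_hom[OF X A]] by simp
    finally show "z \<in> {\<zero>\<^bsub>?P q\<^esub>}" by simp
  qed
  moreover have "act X r q V ` {\<zero>\<^bsub>?P q\<^esub>} = {\<zero>\<^bsub>?P r\<^esub>}"
    using lin_hom_zero[OF P P act_lin_hom[OF X V]] by simp
  ultimately show ?thesis using slen_power_zero[OF X Y, of r] im by simp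
qed

lemma ring_module_minus: "a \<ominus>\<^bsub>ring_module R\<^esub> b = a \<ominus> b"
  by (simp add: a_minus_def a_inv_def m_inv_def)

lemma Rpow_minus_nth:
  "x \<in> carrier (Rpow k) \<Longrightarrow> y \<in> carrier (Rpow k) \<Longrightarrow> i < k \<Longrightarrow> (x \<ominus>\<^bsub>Rpow k\<^esub> y) i = x i \<ominus> y i"
  using lin_hom_minus[OF Rpow_module ring_module proj_lin_hom, of i k x y] ring_module_minus by simp

definition max_vec :: "nat \<Rightarrow> (nat \<Rightarrow> 'a) set"
  where "max_vec k = {..<k} \<rightarrow>\<^sub>E \<nn>"

lemma max_vec_submodule: "submodule (max_vec k) R (Rpow k)"
  unfolding max_vec_def by (rule submodule_power[OF ring_module max_submodule])

lemma max_vec_image: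
  assumes f: "f \<in> lin_hom R (Rpow p) (Rpow q)" and x: "x \<in> max_vec p"
  shows "f x \<in> max_vec q"
proof -
  have xc: "x \<in> {..<p} \<rightarrow>\<^sub>E carrier R" using x a_subset unfolding max_vec_def by (auto simp: PiE_def Pi_def)
  show ?thesis
    unfolding lin_hom_matrix(2)[OF f xc] max_vec_def
    by (rule act_mem[OF ring_module max_submodule lin_hom_matrix(1)[OF f] x[unfolded max_vec_def]])
qed

lemma slen_max_vec: "slen (Rpow k) (max_vec k) (carrier (Rpow k)) = enat k"
  using slen_power[OF ring_module max_submodule, of "carrier R" k] submodule_carrier[OF ring_module] a_subset
  by (simp add: max_vec_def slen_residue)

text \<open>
  Reducing modulo the maximal ideal makes \<open>v\<close> onto, so the lengths \<open>r\<close> and \<open>q\<close> can be compared.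
\<close>

lemma rank_bound:
  assumes v: "v \<in> lin_hom R (Rpow q) (Rpow r)"
    and onto: "\<And>y. y \<in> carrier (Rpow r) \<Longrightarrow> \<exists>z\<in>carrier (Rpow q). v z \<ominus>\<^bsub>Rpow r\<^esub> y \<in> max_vec r"
  shows "r \<le> q"
proof -
  let ?Q = "quot_module (Rpow r) (max_vec r)" and ?\<pi> = "\<lambda>x. max_vec r +>\<^bsub>Rpow r\<^esub> x"
  note Q = quot_module_module[OF Rpow_module max_vec_submodule, of r]
  define g where "g z = ?\<pi> (v z)" for z
  have g: "g \<in> lin_hom R (Rpow q) ?Q"
    unfolding g_def by (rule lin_hom_comp[OF v quot_map_lin_hom[OF Rpow_module max_vec_submodule]])
  let ?K = "lin_kernel (Rpow q) ?Q g"
  have vc: "v z \<in> carrier (Rpow r)" if "z \<in> carrier (Rpow q)" for z using lin_hom_closed[OF v that] .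
  have "g ` carrier (Rpow q) = carrier ?Q"
  proof
    show "g ` carrier (Rpow q) \<subseteq> carrier ?Q" using lin_hom_closed[OF g] by auto
    show "carrier ?Q \<subseteq> g ` carrier (Rpow q)"
    proof
      fix u assume "u \<in> carrier ?Q"
      then obtain y where y: "y \<in> carrier (Rpow r)" "u = ?\<pi> y"
        using quot_map_surj[OF Rpow_module max_vec_submodule, of r] by blast
      obtain z where z: "z \<in> carrier (Rpow q)" "v z \<ominus>\<^bsub>Rpow r\<^esub> y \<in> max_vec r" using onto[OF y(1)] by blast
      then have "g z = u"
        unfolding g_def y(2) using quot_map_eq_iff[OF Rpow_module max_vec_submodule vc[OF z(1)] y(1)] by simp
      then show "u \<in> g ` carrier (Rpow q)" using z(1) by blast
    qed
  qed
  then have "slen ?Q {\<zero>\<^bsub>?Q\<^esub>} (carrier ?Q) = slen (Rpow q) ?K (carrier (Rpow q))"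
    by (rule slen_surj[OF Rpow_module Q g])
  also have "\<dots> \<le> slen (Rpow q) (max_vec q) (carrier (Rpow q))"
  proof (rule slen_mono)
    show "max_vec q \<subseteq> ?K"
    proof
      fix x assume x: "x \<in> max_vec q"
      have xc: "x \<in> carrier (Rpow q)" by (rule submodule_carrierD[OF Rpow_module max_vec_submodule x])
      have "g x = \<zero>\<^bsub>?Q\<^esub>"
        unfolding g_def using quot_map_zero_iff[OF Rpow_module max_vec_submodule vc[OF xc]] max_vec_image[OF v x] by simp
      then show "x \<in> ?K" using xc by (simp add: lin_kernel_def)
    qed
  qed simp
  finally show ?thesis
    unfolding slen_quot_module[OF Rpow_module max_vec_submodule] slen_max_vec by simp
qed

lemma append_lin_homs:
  assumes Y: "Module.module R Y" and d: "d \<in> lin_hom R (Rpow r) Y" and e: "e \<in> carrier Y"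
  shows "(\<lambda>y. d (restrict y {..<r}) \<oplus>\<^bsub>Y\<^esub> y r \<odot>\<^bsub>Y\<^esub> e) \<in> lin_hom R (Rpow (Suc r)) Y"
proof -
  interpret F: Module.module R Y by (rule Y)
  have res: "(\<lambda>y. restrict y {..<r}) \<in> lin_hom R (Rpow (Suc r)) (Rpow r)"
    by (rule lin_homI) (simp_all add: PiE_iff cong: restrict_cong)
  note 1 = lin_hom_comp[OF res d] and 2 = lin_hom_comp[OF proj_lin_hom[OF lessI] smult_lin_hom[OF Y e]]
  show ?thesis
  proof (rule lin_homI)
    fix x assume x: "x \<in> carrier (Rpow (Suc r))"
    show "d (restrict x {..<r}) \<oplus>\<^bsub>Y\<^esub> x r \<odot>\<^bsub>Y\<^esub> e \<in> carrier Y"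
      using F.a_closed[OF lin_hom_closed[OF 1 x] lin_hom_closed[OF 2 x]] by simp
    fix y assume y: "y \<in> carrier (Rpow (Suc r))"
    have ac: "(a \<oplus>\<^bsub>Y\<^esub> b) \<oplus>\<^bsub>Y\<^esub> (c \<oplus>\<^bsub>Y\<^esub> f) = (a \<oplus>\<^bsub>Y\<^esub> c) \<oplus>\<^bsub>Y\<^esub> (b \<oplus>\<^bsub>Y\<^esub> f)"
      if "a \<in> carrier Y" "b \<in> carrier Y" "c \<in> carrier Y" "f \<in> carrier Y" for a b c f
      using that by (simp only: F.a_ac F.a_closed)
    show "d (restrict (x \<oplus>\<^bsub>Rpow (Suc r)\<^esub> y) {..<r}) \<oplus>\<^bsub>Y\<^esub> (x \<oplus>\<^bsub>Rpow (Suc r)\<^esub> y) r \<odot>\<^bsub>Y\<^esub> e =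
        d (restrict x {..<r}) \<oplus>\<^bsub>Y\<^esub> x r \<odot>\<^bsub>Y\<^esub> e \<oplus>\<^bsub>Y\<^esub>
        (d (restrict y {..<r}) \<oplus>\<^bsub>Y\<^esub> y r \<odot>\<^bsub>Y\<^esub> e)"
      using lin_hom_add[OF 1 x y] lin_hom_add[OF 2 x y]
        ac[OF lin_hom_closed[OF 1 x] lin_hom_closed[OF 2 x] lin_hom_closed[OF 1 y] lin_hom_closed[OF 2 y]]
      by (simp only: TrueI)
  next
    fix a x assume a: "a \<in> carrier R" and x: "x \<in> carrier (Rpow (Suc r))"
    show "d (restrict (a \<odot>\<^bsub>Rpow (Suc r)\<^esub> x) {..<r}) \<oplus>\<^bsub>Y\<^esub> (a \<odot>\<^bsub>Rpow (Suc r)\<^esub> x) r \<odot>\<^bsub>Y\<^esub> e =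
        a \<odot>\<^bsub>Y\<^esub> (d (restrict x {..<r}) \<oplus>\<^bsub>Y\<^esub> x r \<odot>\<^bsub>Y\<^esub> e)"
      using lin_hom_smult[OF 1 a x] lin_hom_smult[OF 2 a x]
        F.smult_r_distr[OF a lin_hom_closed[OF 1 x] lin_hom_closed[OF 2 x]]
      by (simp only: TrueI)
  qed
qed

text \<open>
  A pair \<open>v\<close>, \<open>d\<close> with \<open>v f d = id\<close> modulo the maximal ideal and with maximal \<open>r\<close> satisfies
  \<open>f = f d v f\<close> modulo the maximal ideal: otherwise a coordinate \<open>i\<close> of \<open>(f - f d v f) x\<close> is a unit, and after rescaling \<open>x - d v f x\<close> can
  be added to the image of \<open>d\<close> and the \<open>i\<close>-th coordinate of \<open>id - f d v\<close> to \<open>v\<close>.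
\<close>

lemma rank_extend:
  assumes f: "f \<in> lin_hom R (Rpow p) (Rpow q)"
    and v: "v \<in> lin_hom R (Rpow q) (Rpow r)" and d: "d \<in> lin_hom R (Rpow r) (Rpow p)"
    and vfd: "\<And>y. y \<in> carrier (Rpow r) \<Longrightarrow> v (f (d y)) \<ominus>\<^bsub>Rpow r\<^esub> y \<in> max_vec r"
    and x: "x \<in> carrier (Rpow p)" and i: "i < q" and not: "(f x \<ominus>\<^bsub>Rpow q\<^esub> f (d (v (f x)))) i \<notin> \<nn>"
  shows "\<exists>v' d'. v' \<in> lin_hom R (Rpow q) (Rpow (Suc r)) \<and> d' \<in> lin_hom R (Rpow (Suc r)) (Rpow p) \<and>
    (\<forall>y\<in>carrier (Rpow (Suc r)). v' (f (d' y)) \<ominus>\<^bsub>Rpow (Suc r)\<^esub> y \<in> max_vec (Suc r))"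
proof -
  interpret Fp: Module.module R "Rpow p" by (rule Rpow_module)
  interpret Fq: Module.module R "Rpow q" by (rule Rpow_module)
  interpret Fr: Module.module R "Rpow r" by (rule Rpow_module)
  note fc = lin_hom_closed[OF f] and vc = lin_hom_closed[OF v] and dc = lin_hom_closed[OF d]
  note fl = lin_hom_add[OF f] lin_hom_smult[OF f] lin_hom_minus[OF Rpow_module Rpow_module f]
    and vl = lin_hom_add[OF v] lin_hom_smult[OF v] lin_hom_minus[OF Rpow_module Rpow_module v]
    and dl = lin_hom_add[OF d] lin_hom_smult[OF d] lin_hom_minus[OF Rpow_module Rpow_module d]
  define E where "E z = z \<ominus>\<^bsub>Rpow q\<^esub> f (d (v z))" for z
  have fdv: "(\<lambda>z. f (d (v z))) \<in> lin_hom R (Rpow q) (Rpow q)"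
    using lin_hom_comp[OF lin_hom_comp[OF v d] f] by simp
  have E: "E \<in> lin_hom R (Rpow q) (Rpow q)"
  proof (rule lin_homI)
    fix z assume z: "z \<in> carrier (Rpow q)"
    note fz = lin_hom_closed[OF fdv z]
    show "E z \<in> carrier (Rpow q)" unfolding E_def by (intro Fq.minus_closed z fz)
    fix w assume w: "w \<in> carrier (Rpow q)"
    note fw = lin_hom_closed[OF fdv w]
    have "z \<oplus>\<^bsub>Rpow q\<^esub> w \<ominus>\<^bsub>Rpow q\<^esub> (f (d (v z)) \<oplus>\<^bsub>Rpow q\<^esub> f (d (v w))) =
      (z \<ominus>\<^bsub>Rpow q\<^esub> f (d (v z))) \<oplus>\<^bsub>Rpow q\<^esub> (w \<ominus>\<^bsub>Rpow q\<^esub> f (d (v w)))"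
      unfolding a_minus_def using z w fz fw
      by (simp only: Fq.minus_add Fq.a_ac Fq.a_closed Fq.a_inv_closed)
    then show "E (z \<oplus>\<^bsub>Rpow q\<^esub> w) = E z \<oplus>\<^bsub>Rpow q\<^esub> E w"
      unfolding E_def lin_hom_add[OF fdv z w] .
  next
    fix a z assume a: "a \<in> carrier R" and z: "z \<in> carrier (Rpow q)"
    note fz = lin_hom_closed[OF fdv z]
    show "E (a \<odot>\<^bsub>Rpow q\<^esub> z) = a \<odot>\<^bsub>Rpow q\<^esub> E z"
      unfolding E_def lin_hom_smult[OF fdv a z] a_minus_def
      by (simp only: Fq.smult_r_distr[OF a z Fq.a_inv_closed[OF fz]] Fq.smult_r_minus[OF a fz])
  qed
  have Efd: "E (f (d y)) \<in> max_vec q" if y: "y \<in> carrier (Rpow r)" for y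
  proof -
    have yy: "y \<ominus>\<^bsub>Rpow r\<^esub> v (f (d y)) \<in> max_vec r"
    proof -
      have "y \<ominus>\<^bsub>Rpow r\<^esub> v (f (d y)) = \<ominus>\<^bsub>Rpow r\<^esub> (v (f (d y)) \<ominus>\<^bsub>Rpow r\<^esub> y)"
        unfolding a_minus_def using y vc[OF fc[OF dc[OF y]]]
        by (simp only: Fr.minus_add Fr.minus_minus Fr.a_comm Fr.a_closed Fr.a_inv_closed)
      then show ?thesis using submodule_uminus[OF Rpow_module max_vec_submodule vfd[OF y]] by simp
    qed
    have "E (f (d y)) = f (d (y \<ominus>\<^bsub>Rpow r\<^esub> v (f (d y))))"
      unfolding E_def using y vc[OF fc[OF dc[OF y]]] by (simp only: dl fl dc)
    then show ?thesis using max_vec_image[OF f max_vec_image[OF d yy]] by simp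
  qed
  define w where "w = E (f x)"
  have wc: "w \<in> carrier (Rpow q)" unfolding w_def by (rule lin_hom_closed[OF E fc[OF x]])
  have wi: "w i \<in> carrier R" using wc i by (auto dest: PiE_mem)
  have "w i \<notin> \<nn>" using not unfolding w_def E_def .
  then have unit: "w i \<in> Units R" by (rule unit_if_not_max[OF wi])
  define c where "c = inv (w i)"
  have c: "c \<in> carrier R" "c \<otimes> w i = \<one>" using unit by (simp_all add: c_def Units_l_inv)
  define e where "e = c \<odot>\<^bsub>Rpow p\<^esub> (x \<ominus>\<^bsub>Rpow p\<^esub> d (v (f x)))"
  have xdc: "x \<ominus>\<^bsub>Rpow p\<^esub> d (v (f x)) \<in> carrier (Rpow p)" by (intro Fp.minus_closed x dc vc fc)
  have e: "e \<in> carrier (Rpow p)" unfolding e_def by (rule Fp.smult_closed[OF c(1) xdc])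
  have fe: "f e = c \<odot>\<^bsub>Rpow q\<^esub> w"
    unfolding e_def w_def E_def fl(2)[OF c(1) xdc] fl(3)[OF x dc[OF vc[OF fc[OF x]]]] ..
  have vfe: "v (f e) \<in> max_vec r"
  proof -
    let ?y = "v (f x)"
    have y: "?y \<in> carrier (Rpow r)" by (intro vc fc x)
    have "v w = \<ominus>\<^bsub>Rpow r\<^esub> (v (f (d ?y)) \<ominus>\<^bsub>Rpow r\<^esub> ?y)"
      unfolding w_def E_def vl(3)[OF fc[OF x] fc[OF dc[OF y]]] unfolding a_minus_def
      using y vc[OF fc[OF dc[OF y]]]
      by (simp only: Fr.minus_add Fr.minus_minus Fr.a_comm Fr.a_closed Fr.a_inv_closed)
    then have "v w \<in> max_vec r" using submodule_uminus[OF Rpow_module max_vec_submodule vfd[OF y]] by simp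
    then show ?thesis unfolding fe vl(2)[OF c(1) wc]
      by (rule submodule_smult[OF Rpow_module max_vec_submodule c(1)])
  qed
  have Efe: "E (f e) i \<ominus> \<one> \<in> \<nn>"
  proof -
    have n: "f (d (v (f e))) \<in> max_vec q" by (rule max_vec_image[OF f max_vec_image[OF d vfe]])
    have ni: "f (d (v (f e))) i \<in> \<nn>" using n i by (auto simp: max_vec_def dest: PiE_mem)
    have "E (f e) i = f e i \<ominus> f (d (v (f e))) i"
      unfolding E_def by (rule Rpow_minus_nth[OF fc[OF e] fc[OF dc[OF vc[OF fc[OF e]]]] i])
    also have "f e i = \<one>" unfolding fe using i c by simp
    finally have "E (f e) i \<ominus> \<one> = \<ominus> f (d (v (f e))) i"
      using ni a_subset by (auto simp: a_minus_def a_assoc a_comm r_neg1)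
    then show ?thesis using ni by simp
  qed
  define d' where "d' y = d (restrict y {..<r}) \<oplus>\<^bsub>Rpow p\<^esub> y r \<odot>\<^bsub>Rpow p\<^esub> e" for y
  define v' where "v' z = (\<lambda>j\<in>{..<Suc r}. if j < r then v z j else E z i)" for z
  have d': "d' \<in> lin_hom R (Rpow (Suc r)) (Rpow p)"
    unfolding d'_def by (rule append_lin_homs[OF Rpow_module d e])
  have v': "v' \<in> lin_hom R (Rpow q) (Rpow (Suc r))"
  proof -
    have vj: "(\<lambda>z. v z j) \<in> lin_hom R (Rpow q) (ring_module R)" if "j < r" for j
      by (rule lin_hom_comp[OF v proj_lin_hom[OF that]])
    have Ei: "(\<lambda>z. E z i) \<in> lin_hom R (Rpow q) (ring_module R)"
      by (rule lin_hom_comp[OF E proj_lin_hom[OF i]])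
    have comp: "(\<lambda>z. if j < r then v z j else E z i) \<in> lin_hom R (Rpow q) (ring_module R)" for j
      using vj[of j] Ei by (cases "j < r") simp_all
    show ?thesis
      unfolding v'_def
    proof (rule lin_homI)
      fix z assume z: "z \<in> carrier (Rpow q)"
      show "(\<lambda>j\<in>{..<Suc r}. if j < r then v z j else E z i) \<in> carrier (Rpow (Suc r))"
        using lin_hom_closed[OF comp z] by simp
      fix z' assume z': "z' \<in> carrier (Rpow q)"
      show "(\<lambda>j\<in>{..<Suc r}. if j < r then v (z \<oplus>\<^bsub>Rpow q\<^esub> z') j else E (z \<oplus>\<^bsub>Rpow q\<^esub> z') i) =
        (\<lambda>j\<in>{..<Suc r}. if j < r then v z j else E z i) \<oplus>\<^bsub>Rpow (Suc r)\<^esub> (\<lambda>j\<in>{..<Suc r}. if j < r then v z' j else E z' i)"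
        unfolding direct_power_simps(3)[of "ring_module R" "Suc r"] using lin_hom_add[OF comp z z'] by (intro restrict_ext) (simp del: direct_power_simps)
    next
      fix a z assume a: "a \<in> carrier R" and z: "z \<in> carrier (Rpow q)"
      show "(\<lambda>j\<in>{..<Suc r}. if j < r then v (a \<odot>\<^bsub>Rpow q\<^esub> z) j else E (a \<odot>\<^bsub>Rpow q\<^esub> z) i) =
        a \<odot>\<^bsub>Rpow (Suc r)\<^esub> (\<lambda>j\<in>{..<Suc r}. if j < r then v z j else E z i)"
        unfolding direct_power_simps(4)[of "ring_module R" "Suc r"] using lin_hom_smult[OF comp a z] by (intro restrict_ext) (simp del: direct_power_simps)
    qed
  qed
  have "v' (f (d' y)) \<ominus>\<^bsub>Rpow (Suc r)\<^esub> y \<in> max_vec (Suc r)" if y: "y \<in> carrier (Rpow (Suc r))" for y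
  proof -
    let ?y = "restrict y {..<r}"
    let ?D = "v' (f (d' y)) \<ominus>\<^bsub>Rpow (Suc r)\<^esub> y"
    have y0: "?y \<in> carrier (Rpow r)" and yr: "y r \<in> carrier R" using y by (auto simp: PiE_iff)
    have yj: "y j \<in> carrier R" if "j < Suc r" for j using y that by (auto dest: PiE_mem)
    have vc': "v' (f (d' y)) \<in> carrier (Rpow (Suc r))"
      by (intro lin_hom_closed[OF v'] fc lin_hom_closed[OF d'] y)
    have fd': "f (d' y) = f (d ?y) \<oplus>\<^bsub>Rpow q\<^esub> y r \<odot>\<^bsub>Rpow q\<^esub> f e"
      unfolding d'_def using fl(1)[OF dc[OF y0] Fp.smult_closed[OF yr e]] fl(2)[OF yr e] by simp
    have "?D j \<in> \<nn>" if j: "j < Suc r" for j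
    proof (cases "j < r")
      case True
      have vf: "v (f (d' y)) = v (f (d ?y)) \<oplus>\<^bsub>Rpow r\<^esub> y r \<odot>\<^bsub>Rpow r\<^esub> v (f e)"
        unfolding fd' using vl(1)[OF fc[OF dc[OF y0]] Fq.smult_closed[OF yr fc[OF e]]] vl(2)[OF yr fc[OF e]] by simp
      have vfj: "v (f (d ?y)) j \<in> carrier R" "v (f e) j \<in> carrier R"
        using vc[OF fc[OF dc[OF y0]]] vc[OF fc[OF e]] True by (auto dest: PiE_mem)
      have 1: "v (f (d ?y)) j \<ominus> y j \<in> \<nn>"
      proof -
        have "(v (f (d ?y)) \<ominus>\<^bsub>Rpow r\<^esub> ?y) j \<in> \<nn>"
          using vfd[OF y0] True unfolding max_vec_def by (auto dest: PiE_mem)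
        then show ?thesis using Rpow_minus_nth[OF vc[OF fc[OF dc[OF y0]]] y0 True] True by simp
      qed
      have 2: "y r \<otimes> v (f e) j \<in> \<nn>"
        using vfe True yr I_l_closed unfolding max_vec_def by (auto dest: PiE_mem)
      have "?D j = v (f (d ?y)) j \<oplus> y r \<otimes> v (f e) j \<ominus> y j"
        using Rpow_minus_nth[OF vc' y j] True by (simp add: v'_def vf)
      also have "\<dots> = (v (f (d ?y)) j \<ominus> y j) \<oplus> y r \<otimes> v (f e) j"
        using vfj yr yj[OF j] by algebra
      finally show ?thesis using 1 2 by simp
    next
      case False
      then have jr: "j = r" using j by simp
      have Ef: "E (f (d' y)) = E (f (d ?y)) \<oplus>\<^bsub>Rpow q\<^esub> y r \<odot>\<^bsub>Rpow q\<^esub> E (f e)"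
        unfolding fd' using lin_hom_add[OF E fc[OF dc[OF y0]] Fq.smult_closed[OF yr fc[OF e]]]
          lin_hom_smult[OF E yr fc[OF e]] by simp
      have n1: "E (f (d ?y)) i \<in> \<nn>" using Efd[OF y0] i unfolding max_vec_def by (auto dest: PiE_mem)
      have ec: "E (f e) i \<in> carrier R" using lin_hom_closed[OF E fc[OF e]] i by (auto dest: PiE_mem)
      have n1c: "E (f (d ?y)) i \<in> carrier R" using n1 a_subset by auto
      have "?D j = E (f (d ?y)) i \<oplus> y r \<otimes> E (f e) i \<ominus> y r"
        using Rpow_minus_nth[OF vc' y j] jr i by (simp add: v'_def Ef)
      also have "\<dots> = E (f (d ?y)) i \<oplus> y r \<otimes> (E (f e) i \<ominus> \<one>)"
        using n1c ec yr by algebra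
      finally show ?thesis using n1 Efe yr I_l_closed by simp
    qed
    moreover have "?D \<in> {..<Suc r} \<rightarrow>\<^sub>E carrier R"
    proof -
      interpret Fs: Module.module R "Rpow (Suc r)" by (rule Rpow_module)
      show ?thesis using Fs.minus_closed[OF vc' y] by simp
    qed
    ultimately show ?thesis unfolding max_vec_def by (simp add: PiE_iff)
  qed
  then show ?thesis using v' d' by blast
qed

text \<open>
  Take \<open>r\<close> maximal: \<open>rank_bound\<close> bounds it, and \<open>rank_extend\<close> turns maximality into the second
  congruence.
\<close>

lemma rank_fact_exists:
  assumes A: "mat q p A"
  obtains r V D where "rank_fact q p A r V D"
proof -
  define f where "f = act (ring_module R) q p A"
  have f: "f \<in> lin_hom R (Rpow p) (Rpow q)" unfolding f_def by (rule act_lin_hom[OF ring_module A])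
  define P where "P r \<longleftrightarrow> (\<exists>v d. v \<in> lin_hom R (Rpow q) (Rpow r) \<and> d \<in> lin_hom R (Rpow r) (Rpow p) \<and>
    (\<forall>y\<in>carrier (Rpow r). v (f (d y)) \<ominus>\<^bsub>Rpow r\<^esub> y \<in> max_vec r))" for r
  have P0: "P 0"
  proof -
    interpret F0: Module.module R "Rpow 0" by (rule Rpow_module)
    interpret Fp: Module.module R "Rpow p" by (rule Rpow_module)
    have z: "(\<lambda>_. \<zero>\<^bsub>Rpow k\<^esub>) \<in> lin_hom R (Rpow k') (Rpow k)" for k k'
    proof -
      interpret Fk: Module.module R "Rpow k" by (rule Rpow_module)
      show ?thesis by (rule lin_homI) (simp_all only: Fk.zero_closed Fk.l_zero Fk.smult_r_null)
    qed
    have "x \<in> max_vec 0" if "x \<in> carrier (Rpow 0)" for x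
      using that by (simp add: max_vec_def)
    then have "\<forall>y\<in>carrier (Rpow 0). \<zero>\<^bsub>Rpow 0\<^esub> \<ominus>\<^bsub>Rpow 0\<^esub> y \<in> max_vec 0"
      using F0.minus_closed[OF F0.zero_closed] by blast
    then show ?thesis unfolding P_def using z[of 0 q] z[of p 0] by blast
  qed
  have bound: "r \<le> q" if Pr: "P r" for r
  proof -
    obtain v d where v: "v \<in> lin_hom R (Rpow q) (Rpow r)" and d: "d \<in> lin_hom R (Rpow r) (Rpow p)"
      and vfd: "\<And>y. y \<in> carrier (Rpow r) \<Longrightarrow> v (f (d y)) \<ominus>\<^bsub>Rpow r\<^esub> y \<in> max_vec r"
      using Pr unfolding P_def by blast
    show ?thesis
      by (rule rank_bound[OF v]) (use vfd lin_hom_closed[OF f lin_hom_closed[OF d]] in blast)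
  qed
  define r where "r = (GREATEST r. P r)"
  have Pr: "P r" unfolding r_def by (rule GreatestI_nat[of P 0 q, OF P0]) (rule bound)
  have nP: "\<not> P (Suc r)" using Greatest_le_nat[of P "Suc r" q] bound unfolding r_def by fastforce
  obtain v d where v: "v \<in> lin_hom R (Rpow q) (Rpow r)" and d: "d \<in> lin_hom R (Rpow r) (Rpow p)"
    and vfd: "\<And>y. y \<in> carrier (Rpow r) \<Longrightarrow> v (f (d y)) \<ominus>\<^bsub>Rpow r\<^esub> y \<in> max_vec r"
    using Pr unfolding P_def by blast
  have fdvf: "(f x \<ominus>\<^bsub>Rpow q\<^esub> f (d (v (f x)))) i \<in> \<nn>" if x: "x \<in> carrier (Rpow p)" and i: "i < q" for x i
  proof (rule ccontr)
    assume not: "\<not> ?thesis"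
    have "P (Suc r)" unfolding P_def by (rule rank_extend[OF f v d vfd x i not])
    then show False using nP by simp
  qed
  define V where "V i j = v (unit_vec q j) i" for i j
  define D where "D i j = d (unit_vec r j) i" for i j
  have mV: "mat r q V" unfolding V_def by (rule lin_hom_matrix(1)[OF v])
  have mD: "mat p r D" unfolding D_def by (rule lin_hom_matrix(1)[OF d])
  have va: "v z = act (ring_module R) r q V z" if "z \<in> carrier (Rpow q)" for z
    unfolding V_def using that by (intro lin_hom_matrix(2)[OF v]) simp
  have da: "d z = act (ring_module R) p r D z" if "z \<in> carrier (Rpow r)" for z
    unfolding D_def using that by (intro lin_hom_matrix(2)[OF d]) simp
  note AD = mat_mmult[OF A mD] and VA = mat_mmult[OF mV A]
  note fc = lin_hom_closed[OF f] and vc = lin_hom_closed[OF v] and dc = lin_hom_closed[OF d]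
  have "mcong r r (mmult q V (mmult p A D)) mid"
    unfolding mcong_def
  proof (intro allI impI)
    fix i j assume i: "i < r" and j: "j < r"
    have u: "unit_vec r j \<in> carrier (Rpow r)" using unit_vec_closed[OF j] by simp
    have "v (f (d (unit_vec r j))) = act (ring_module R) r r (mmult q V (mmult p A D)) (unit_vec r j)"
      using act_mmult[OF ring_module A mD, of "unit_vec r j"] act_mmult[OF ring_module mV AD, of "unit_vec r j"] unit_vec_closed[OF j]
      unfolding va[OF fc[OF dc[OF u]]] unfolding da[OF u] f_def by simp
    then have "v (f (d (unit_vec r j))) i = mmult q V (mmult p A D) i j"
      using i by (simp add: act_unit_vec[OF mat_mmult[OF mV AD] j])
    moreover have "(v (f (d (unit_vec r j))) \<ominus>\<^bsub>Rpow r\<^esub> unit_vec r j) i \<in> \<nn>"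
      using vfd[OF u] i unfolding max_vec_def by (auto dest: PiE_mem)
    moreover have "unit_vec r j i = mid i j" using i by (simp add: free_gen_def mid_def)
    ultimately show "mmult q V (mmult p A D) i j \<ominus> mid i j \<in> \<nn>"
      using Rpow_minus_nth[OF vc[OF fc[OF dc[OF u]]] u i] by simp
  qed
  moreover have "mcong q p (mmult r (mmult p A D) (mmult q V A)) A"
    unfolding mcong_def
  proof (intro allI impI)
    fix i j assume i: "i < q" and j: "j < p"
    let ?e = "unit_vec p j" and ?S = "ring_module R"
    have u: "?e \<in> carrier (Rpow p)" and u': "?e \<in> {..<p} \<rightarrow>\<^sub>E carrier ?S" using unit_vec_closed[OF j] by simp_all
    have ve: "v (f ?e) = act ?S r p (mmult q V A) ?e"
      unfolding va[OF fc[OF u]] unfolding f_def by (rule act_mmult[OF ring_module mV A u'])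
    have "f (d (v (f ?e))) = act ?S q r (mmult p A D) (v (f ?e))"
      unfolding da[OF vc[OF fc[OF u]]] unfolding f_def[of]
      by (rule act_mmult[OF ring_module A mD]) (use vc[OF fc[OF u]] in \<open>simp add: f_def\<close>)
    also have "\<dots> = act ?S q p (mmult r (mmult p A D) (mmult q V A)) ?e"
      unfolding ve by (rule act_mmult[OF ring_module AD VA u'])
    finally have "f (d (v (f ?e))) i = mmult r (mmult p A D) (mmult q V A) i j"
      using i by (simp add: act_unit_vec[OF mat_mmult[OF AD VA] j])
    moreover have "f ?e i = A i j" unfolding f_def using i by (simp add: act_unit_vec[OF A j])
    moreover have "f ?e i \<ominus> f (d (v (f ?e))) i \<in> \<nn>"
      using fdvf[OF u i] Rpow_minus_nth[OF fc[OF u] fc[OF dc[OF vc[OF fc[OF u]]]] i] by simp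
    ultimately have *: "A i j \<ominus> mmult r (mmult p A D) (mmult q V A) i j \<in> \<nn>" by simp
    have "mmult r (mmult p A D) (mmult q V A) i j \<ominus> A i j =
        \<ominus> (A i j \<ominus> mmult r (mmult p A D) (mmult q V A) i j)"
      using matD[OF A i j] matD[OF mat_mmult[OF AD VA] i j] by algebra
    then show "mmult r (mmult p A D) (mmult q V A) i j \<ominus> A i j \<in> \<nn>" using * by simp
  qed
  ultimately have "rank_fact q p A r V D" unfolding rank_fact_def using A mV mD by simp
  then show ?thesis by (rule that)
qed

end

context cring
begin

text \<open>
  The connecting homomorphism, as an equality of lengths: \<open>f\<close> induces an isomorphism from
  \<open>f\<^sup>-\<^sup>1(Y\<^sub>0) / (Y\<^sub>1 + ker f)\<close> onto \<open>(Y\<^sub>0 \<inter> im f) / f(Y\<^sub>1)\<close>.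
\<close>

lemma slen_connecting:
  assumes X1: "Module.module R X1" and X0: "Module.module R X0" and f: "f \<in> lin_hom R X1 X0"
    and Y1: "submodule Y1 R X1" and Y0: "submodule Y0 R X0" and sub: "f ` Y1 \<subseteq> Y0"
  shows "slen X0 (f ` Y1) (Y0 \<inter> f ` carrier X1) =
    slen X1 (Y1 <+>\<^bsub>X1\<^esub> lin_kernel X1 X0 f) {x \<in> carrier X1. f x \<in> Y0}"
proof -
  interpret X0: Module.module R X0 by (rule X0)
  let ?K = "lin_kernel X1 X0 f" and ?E = "{x \<in> carrier X1. f x \<in> Y0}"
  have K: "submodule ?K R X1" by (rule submodule_lin_kernel[OF X1 X0 f])
  have E: "submodule ?E R X1" by (rule submodule_preimage[OF X1 X0 f Y0])
  have S: "submodule (Y1 <+>\<^bsub>X1\<^esub> ?K) R X1" by (rule submodule_set_add[OF X1 Y1 K])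
  have Y1c: "Y1 \<subseteq> carrier X1" by (rule submodule_sub[OF X1 Y1])
  have Y1E: "Y1 \<subseteq> ?E" using Y1c sub by auto
  have KE: "?K \<subseteq> ?E" using submodule_zero[OF X0 Y0] by (auto simp: lin_kernel_def)
  have fS: "f ` (Y1 <+>\<^bsub>X1\<^esub> ?K) = f ` Y1"
  proof
    show "f ` (Y1 <+>\<^bsub>X1\<^esub> ?K) \<subseteq> f ` Y1"
    proof
      fix z assume "z \<in> f ` (Y1 <+>\<^bsub>X1\<^esub> ?K)"
      then obtain x where x: "x \<in> Y1 <+>\<^bsub>X1\<^esub> ?K" "z = f x" by blast
      then obtain y u where yu: "y \<in> Y1" "u \<in> ?K" "x = y \<oplus>\<^bsub>X1\<^esub> u" by (elim set_addE)
      then have yc: "y \<in> carrier X1" and uc: "u \<in> carrier X1" and fu: "f u = \<zero>\<^bsub>X0\<^esub>"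
        using Y1c by (auto simp: lin_kernel_def)
      have "z = f y" using x(2) yu(3) lin_hom_add[OF f yc uc] fu lin_hom_closed[OF f yc] by simp
      then show "z \<in> f ` Y1" using yu(1) by simp
    qed
    show "f ` Y1 \<subseteq> f ` (Y1 <+>\<^bsub>X1\<^esub> ?K)" using set_add_upper(1)[OF X1 Y1 K] by (rule image_mono)
  qed
  have fE: "f ` ?E = Y0 \<inter> f ` carrier X1" by auto
  have "slen X0 (f ` (Y1 <+>\<^bsub>X1\<^esub> ?K)) (f ` ?E) = slen X1 (Y1 <+>\<^bsub>X1\<^esub> ?K) ?E"
  proof (rule slen_image[OF X1 X0 f S E set_add_least[OF X1 E Y1E KE]])
    fix x assume "x \<in> ?E" "f x = \<zero>\<^bsub>X0\<^esub>"
    then have "x \<in> ?K" by (simp add: lin_kernel_def)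
    then show "x \<in> Y1 <+>\<^bsub>X1\<^esub> ?K" using set_add_upper(2)[OF X1 Y1 K] by blast
  qed
  then show ?thesis by (simp only: fS fE)
qed

text \<open>The lower end contains the kernel of \<open>q\<close>, so no length is lost in the quotient.\<close>

lemma slen_quotient:
  assumes X: "Module.module R X" and Q: "Module.module R Q" and q: "q \<in> lin_hom R X Q"
    and B: "submodule B R X" and E: "submodule E R X" and sub: "lin_kernel X Q q \<subseteq> E" "B \<subseteq> E"
  shows "slen X (lin_kernel X Q q <+>\<^bsub>X\<^esub> B) E = slen Q (q ` B) (q ` E)"
proof -
  interpret Q: Module.module R Q by (rule Q)
  let ?K = "lin_kernel X Q q"
  have K: "submodule ?K R X" by (rule submodule_lin_kernel[OF X Q q])
  have S: "submodule (?K <+>\<^bsub>X\<^esub> B) R X" by (rule submodule_set_add[OF X K B])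
  have qS: "q ` (?K <+>\<^bsub>X\<^esub> B) = q ` B"
  proof
    show "q ` (?K <+>\<^bsub>X\<^esub> B) \<subseteq> q ` B"
    proof
      fix z assume "z \<in> q ` (?K <+>\<^bsub>X\<^esub> B)"
      then obtain x where x: "x \<in> ?K <+>\<^bsub>X\<^esub> B" "z = q x" by blast
      then obtain u y where yu: "u \<in> ?K" "y \<in> B" "x = u \<oplus>\<^bsub>X\<^esub> y" by (elim set_addE)
      then have uc: "u \<in> carrier X" "q u = \<zero>\<^bsub>Q\<^esub>" and yc: "y \<in> carrier X"
        using submodule_carrierD[OF X B] by (auto simp: lin_kernel_def)
      have "z = q y" using x(2) yu(3) lin_hom_add[OF q uc(1) yc] uc(2) lin_hom_closed[OF q yc] by simp
      then show "z \<in> q ` B" using yu(2) by simp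
    qed
    show "q ` B \<subseteq> q ` (?K <+>\<^bsub>X\<^esub> B)" using set_add_upper(2)[OF X K B] by (rule image_mono)
  qed
  have "slen Q (q ` (?K <+>\<^bsub>X\<^esub> B)) (q ` E) = slen X (?K <+>\<^bsub>X\<^esub> B) E"
  proof (rule slen_image[OF X Q q S E set_add_least[OF X E sub]])
    fix x assume "x \<in> E" "q x = \<zero>\<^bsub>Q\<^esub>"
    then have "x \<in> ?K" using submodule_carrierD[OF X E] by (simp add: lin_kernel_def)
    then show "x \<in> ?K <+>\<^bsub>X\<^esub> B" using set_add_upper(1)[OF X K B] by blast
  qed
  then show ?thesis by (simp only: qS)
qed

lemma set_add_commute:
  assumes X: "Module.module R X" and H: "submodule H R X" and K: "submodule K R X"
  shows "H <+>\<^bsub>X\<^esub> K = K <+>\<^bsub>X\<^esub> H"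
proof -
  have S: "submodule (H <+>\<^bsub>X\<^esub> K) R X" "submodule (K <+>\<^bsub>X\<^esub> H) R X"
    by (intro submodule_set_add X H K)+
  show ?thesis
    using set_add_least[OF X S(2) set_add_upper(2)[OF X K H] set_add_upper(1)[OF X K H]]
      set_add_least[OF X S(1) set_add_upper(2)[OF X H K] set_add_upper(1)[OF X H K]] by simp
qed

lemma compose_kernel:
  assumes q: "q \<in> lin_hom R X Q"
  shows "lin_kernel (direct_power X k) (direct_power Q k) (compose {..<k} q) = {..<k} \<rightarrow>\<^sub>E lin_kernel X Q q"
proof -
  have "compose {..<k} q x = (\<lambda>i\<in>{..<k}. \<zero>\<^bsub>Q\<^esub>) \<longleftrightarrow> (\<forall>i<k. q (x i) = \<zero>\<^bsub>Q\<^esub>)" for x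
    by (auto simp: compose_def fun_eq_iff)
  then show ?thesis by (auto simp: lin_kernel_def PiE_iff extensional_def)
qed

lemma compose_surj:
  assumes "q ` carrier X = carrier Q"
  shows "compose {..<k} q ` carrier (direct_power X k) = carrier (direct_power Q k)"
  using compose_image_PiE[of k q "carrier X"] assms by simp

lemma act_image_natural:
  assumes X: "Module.module R X" and Q: "Module.module R Q" and q: "q \<in> lin_hom R X Q"
    and A: "mat s t A" and B: "B \<subseteq> carrier X"
  shows "compose {..<s} q ` (act X s t A ` ({..<t} \<rightarrow>\<^sub>E B)) = act Q s t A ` ({..<t} \<rightarrow>\<^sub>E q ` B)"
proof -
  have "compose {..<s} q (act X s t A x) = act Q s t A (compose {..<t} q x)" if "x \<in> {..<t} \<rightarrow>\<^sub>E B" for x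
    using act_natural[OF X Q q A subsetD[OF PiE_mono that]] B by simp
  then show ?thesis unfolding compose_image_PiE[symmetric] image_image by (intro image_cong) simp_all
qed

lemma act_kernel_natural:
  assumes X: "Module.module R X" and Q: "Module.module R Q" and q: "q \<in> lin_hom R X Q"
    and surj: "q ` carrier X = carrier Q" and A: "mat s t A"
  shows "compose {..<t} q ` {x \<in> carrier (direct_power X t). act X s t A x \<in> {..<s} \<rightarrow>\<^sub>E lin_kernel X Q q} =
    lin_kernel (direct_power Q t) (direct_power Q s) (act Q s t A)" (is "?q ` ?E = ?K")
proof -
  have eq: "act Q s t A (?q x) = \<zero>\<^bsub>direct_power Q s\<^esub> \<longleftrightarrow> act X s t A x \<in> {..<s} \<rightarrow>\<^sub>E lin_kernel X Q q"
    if x: "x \<in> {..<t} \<rightarrow>\<^sub>E carrier X" for x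
    unfolding act_natural[OF X Q q A x] compose_kernel[OF q, symmetric]
    using act_closed[OF X A x] by (simp add: lin_kernel_def)
  show ?thesis
  proof
    show "?q ` ?E \<subseteq> ?K"
      using eq lin_hom_closed[OF compose_lin_hom[OF q X], of _ t] by (auto simp: lin_kernel_def simp del: direct_power_simps(2))
    show "?K \<subseteq> ?q ` ?E"
    proof
      fix y assume y: "y \<in> ?K"
      then have "y \<in> ?q ` carrier (direct_power X t)"
        unfolding compose_surj[OF surj] by (simp add: lin_kernel_def)
      then obtain x where x: "x \<in> carrier (direct_power X t)" "y = ?q x" by blast
      then have "x \<in> ?E" using y eq[of x] by (simp add: lin_kernel_def)
      then show "y \<in> ?q ` ?E" using x(2) by blast
    qed
  qed
qed

end

context noetherian_local_ring
begin

definition has_rank :: "nat \<Rightarrow> nat \<Rightarrow> (nat \<Rightarrow> nat \<Rightarrow> 'a) \<Rightarrow> nat \<Rightarrow> bool"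
  where "has_rank q p A r \<longleftrightarrow> (\<exists>V D. rank_fact q p A r V D)"

lemma has_rank_exists: "mat q p A \<Longrightarrow> \<exists>r. has_rank q p A r"
  using rank_fact_exists unfolding has_rank_def by metis

lemma has_rank_mat: "has_rank q p A r \<Longrightarrow> mat q p A"
  by (auto simp: has_rank_def rank_fact_def)

lemma has_rank_transp: "has_rank q p A r \<Longrightarrow> has_rank p q (mtransp A) r"
  using rank_fact_transp unfolding has_rank_def by blast

lemma slen_act:
  assumes "has_rank q p A r" "Module.module R X" "submodule Y R X" "killed X Y"
  shows "slen (direct_power X q) {\<zero>\<^bsub>direct_power X q\<^esub>} (act X q p A ` ({..<p} \<rightarrow>\<^sub>E Y)) = enat r * slen X {\<zero>\<^bsub>X\<^esub>} Y"
  using slen_act_rank_fact[OF _ assms(2-4)] assms(1) unfolding has_rank_def by blast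

lemma slen_act_kernel:
  assumes rk: "has_rank q p A r" and X: "Module.module R X" and Y: "submodule Y R X" and k: "killed X Y"
  shows "slen (direct_power X p) {\<zero>\<^bsub>direct_power X p\<^esub>} {x \<in> {..<p} \<rightarrow>\<^sub>E Y. act X q p A x = \<zero>\<^bsub>direct_power X q\<^esub>}
      + enat r * slen X {\<zero>\<^bsub>X\<^esub>} Y = enat p * slen X {\<zero>\<^bsub>X\<^esub>} Y"
  using slen_rank_nullity[OF direct_power_module[OF X] direct_power_module[OF X]
      act_lin_hom[OF X has_rank_mat[OF rk]] submodule_power[OF X Y]]
    slen_act[OF rk X Y k] slen_power_zero[OF X Y, of p] by simp

text \<open>
  Rank and nullity: the kernel has length \<open>(t - a) \<cdot> length Q\<close> and the image \<open>b \<cdot> length Q\<close>.  The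
  subtractions are moved to the other side, here and below, because lengths are natural numbers or
  infinite.
\<close>

lemma slen_homology:
  assumes a: "has_rank s t A a" and b: "has_rank t u B b"
    and Q: "Module.module R Q" and k: "killed Q (carrier Q)"
    and AB: "\<And>x. x \<in> {..<u} \<rightarrow>\<^sub>E carrier Q \<Longrightarrow> act Q s t A (act Q t u B x) = \<zero>\<^bsub>direct_power Q s\<^esub>"
  shows "slen (direct_power Q t) (act Q t u B ` ({..<u} \<rightarrow>\<^sub>E carrier Q)) (lin_kernel (direct_power Q t) (direct_power Q s) (act Q s t A))
    + enat (a + b) * slen Q {\<zero>\<^bsub>Q\<^esub>} (carrier Q) = enat t * slen Q {\<zero>\<^bsub>Q\<^esub>} (carrier Q)"
proof -
  note P = direct_power_module[OF Q]
  let ?B = "act Q t u B ` ({..<u} \<rightarrow>\<^sub>E carrier Q)" and ?K = "lin_kernel (direct_power Q t) (direct_power Q s) (act Q s t A)"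
  note mA = has_rank_mat[OF a] and mB = has_rank_mat[OF b]
  have B: "submodule ?B R (direct_power Q t)"
    by (rule submodule_image[OF P P act_lin_hom[OF Q mB] submodule_power[OF Q submodule_carrier[OF Q]]])
  have K: "submodule ?K R (direct_power Q t)"
    by (rule submodule_lin_kernel[OF P P act_lin_hom[OF Q mA]])
  have BK: "?B \<subseteq> ?K" using AB act_closed[OF Q mB] by (auto simp: lin_kernel_def)
  have "slen (direct_power Q t) {\<zero>\<^bsub>direct_power Q t\<^esub>} ?K = slen (direct_power Q t) {\<zero>\<^bsub>direct_power Q t\<^esub>} ?B + slen (direct_power Q t) ?B ?K"
    using submodule_zero[OF P B] by (intro slen_add P submodule_zero_set B K BK) simp
  moreover have "?K = {x \<in> {..<t} \<rightarrow>\<^sub>E carrier Q. act Q s t A x = \<zero>\<^bsub>direct_power Q s\<^esub>}"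
    by (simp add: lin_kernel_def)
  ultimately have "enat b * slen Q {\<zero>\<^bsub>Q\<^esub>} (carrier Q) + slen (direct_power Q t) ?B ?K + enat a * slen Q {\<zero>\<^bsub>Q\<^esub>} (carrier Q)
      = enat t * slen Q {\<zero>\<^bsub>Q\<^esub>} (carrier Q)"
    using slen_act[OF b Q submodule_carrier[OF Q] k] slen_act_kernel[OF a Q submodule_carrier[OF Q] k] by simp
  moreover have "enat (a + b) = enat a + enat b" by simp
  ultimately show ?thesis by (simp only: distrib_right ac_simps)
qed

text \<open>
  Let \<open>Y\<close> be the kernel of \<open>q\<close>.  The connecting map \<open>H\<^sub>t(Q) \<rightarrow> H\<^sub>s(Y)\<close> has the cycles that become
  boundaries in \<open>X\<^sup>s\<close> as its image, and it is injective by exactness in \<open>X\<^sup>t\<close>; so the length of the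
  image is that of the homology of \<open>Q\<close>.
\<close>

lemma connecting_length:
  assumes a: "has_rank s t A a" and b: "has_rank t u B b"
    and X: "Module.module R X" and Q: "Module.module R Q" and q: "q \<in> lin_hom R X Q"
    and surj: "q ` carrier X = carrier Q" and k: "killed Q (carrier Q)"
    and exact: "lin_kernel (direct_power X t) (direct_power X s) (act X s t A) = act X t u B ` ({..<u} \<rightarrow>\<^sub>E carrier X)"
  shows "slen (direct_power X s) (act X s t A ` ({..<t} \<rightarrow>\<^sub>E lin_kernel X Q q))
      (({..<s} \<rightarrow>\<^sub>E lin_kernel X Q q) \<inter> act X s t A ` ({..<t} \<rightarrow>\<^sub>E carrier X))
    + enat (a + b) * slen Q {\<zero>\<^bsub>Q\<^esub>} (carrier Q) = enat t * slen Q {\<zero>\<^bsub>Q\<^esub>} (carrier Q)"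
proof -
  note P = direct_power_module[OF X] and PQ = direct_power_module[OF Q]
  note mA = has_rank_mat[OF a] and mB = has_rank_mat[OF b]
  let ?Y = "lin_kernel X Q q" and ?f = "act X s t A" and ?q = "compose {..<t} q"
  have Y: "submodule ?Y R X" by (rule submodule_lin_kernel[OF X Q q])
  note Yp = submodule_power[OF X Y]
  note f = act_lin_hom[OF X mA] and ql = compose_lin_hom[OF q X]
  let ?E = "{x \<in> carrier (direct_power X t). ?f x \<in> {..<s} \<rightarrow>\<^sub>E ?Y}"
  have E: "submodule ?E R (direct_power X t)" by (rule submodule_preimage[OF P P f Yp])
  have Ker: "submodule (lin_kernel (direct_power X t) (direct_power X s) ?f) R (direct_power X t)"
    by (rule submodule_lin_kernel[OF P P f])
  have subE: "lin_kernel (direct_power X t) (direct_power X s) ?f \<subseteq> ?E"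
  proof
    fix x assume "x \<in> lin_kernel (direct_power X t) (direct_power X s) ?f"
    then have x: "x \<in> carrier (direct_power X t)" "?f x = \<zero>\<^bsub>direct_power X s\<^esub>"
      by (simp_all only: lin_kernel_def mem_Collect_eq)
    then show "x \<in> ?E" using submodule_zero[OF P Yp, of s] by (simp only: mem_Collect_eq)
  qed
  have kq: "lin_kernel (direct_power X t) (direct_power Q t) ?q = {..<t} \<rightarrow>\<^sub>E ?Y" by (rule compose_kernel[OF q])
  have YE: "lin_kernel (direct_power X t) (direct_power Q t) ?q \<subseteq> ?E"
    unfolding kq
  proof
    fix x assume x: "x \<in> {..<t} \<rightarrow>\<^sub>E ?Y"
    then show "x \<in> ?E"
      using act_mem[OF X Y mA x] subsetD[OF submodule_sub[OF P Yp] x] by (simp only: mem_Collect_eq)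
  qed
  have AB: "act Q s t A (act Q t u B y) = \<zero>\<^bsub>direct_power Q s\<^esub>" if y: "y \<in> {..<u} \<rightarrow>\<^sub>E carrier Q" for y
  proof -
    have "y \<in> compose {..<u} q ` ({..<u} \<rightarrow>\<^sub>E carrier X)"
      using compose_surj[OF surj, of u] y by simp
    then obtain x where x: "x \<in> {..<u} \<rightarrow>\<^sub>E carrier X" "y = compose {..<u} q x" by (elim imageE)
    have "?f (act X t u B x) = \<zero>\<^bsub>direct_power X s\<^esub>"
      using exact x(1) by (auto simp: lin_kernel_def)
    moreover have "act Q s t A (act Q t u B y) = compose {..<s} q (?f (act X t u B x))"
      unfolding x(2) act_natural[OF X Q q mB x(1)] by (rule act_natural[OF X Q q mA act_closed[OF X mB x(1)]])
    ultimately show ?thesis using lin_hom_zero[OF P PQ ql] by simp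
  qed
  have "slen (direct_power X s) (?f ` ({..<t} \<rightarrow>\<^sub>E ?Y)) (({..<s} \<rightarrow>\<^sub>E ?Y) \<inter> ?f ` carrier (direct_power X t)) =
      slen (direct_power X t) (({..<t} \<rightarrow>\<^sub>E ?Y) <+>\<^bsub>direct_power X t\<^esub> lin_kernel (direct_power X t) (direct_power X s) ?f) ?E"
    by (rule slen_connecting[OF P P f Yp Yp]) (use act_mem[OF X Y mA] in blast)
  also have "\<dots> = slen (direct_power Q t) (?q ` lin_kernel (direct_power X t) (direct_power X s) ?f) (?q ` ?E)"
    unfolding kq[symmetric] by (rule slen_quotient[OF P PQ ql Ker E YE subE])
  also have "?q ` lin_kernel (direct_power X t) (direct_power X s) ?f = act Q t u B ` ({..<u} \<rightarrow>\<^sub>E carrier Q)"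
    unfolding exact using act_image_natural[OF X Q q mB order_refl] surj by simp
  also have "?q ` ?E = lin_kernel (direct_power Q t) (direct_power Q s) (act Q s t A)"
    by (rule act_kernel_natural[OF X Q q surj mA])
  finally show ?thesis using slen_homology[OF a b Q k AB] by simp
qed

section \<open>Lengths forced by exactness\<close>

lemma ker_in_submodule:
  assumes X: "Module.module R X" and Y: "submodule Y R X"
  shows "({..<t} \<rightarrow>\<^sub>E Y) \<inter> lin_kernel (direct_power X t) Z f = {x \<in> {..<t} \<rightarrow>\<^sub>E Y. f x = \<zero>\<^bsub>Z\<^esub>}"
  using submodule_sub[OF direct_power_module[OF X] submodule_power[OF X Y], of t] by (auto simp: lin_kernel_def)

text \<open>
  With coefficients in \<open>X\<close> the homology vanishes at two consecutive spots, so the homology with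
  coefficients in \<open>Q = X/Y\<close> at the second one is that with coefficients in \<open>Y\<close> at the first one.  As
  the maximal ideal kills both \<open>Y\<close> and \<open>Q\<close>, this is \<open>y (t - c - a) = w (u - a - b)\<close>.
\<close>

lemma shift_length:
  assumes c: "has_rank t0 t A c" and a: "has_rank t u B a" and b: "has_rank u v C b"
    and X: "Module.module R X" and Q: "Module.module R Q" and q: "q \<in> lin_hom R X Q"
    and surj: "q ` carrier X = carrier Q" and kQ: "killed Q (carrier Q)"
    and kY: "killed X (lin_kernel X Q q)"
    and y: "slen X {\<zero>\<^bsub>X\<^esub>} (lin_kernel X Q q) = enat y" and w: "slen Q {\<zero>\<^bsub>Q\<^esub>} (carrier Q) = enat w"
    and ex1: "lin_kernel (direct_power X t) (direct_power X t0) (act X t0 t A) = act X t u B ` ({..<u} \<rightarrow>\<^sub>E carrier X)"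
    and ex2: "lin_kernel (direct_power X u) (direct_power X t) (act X t u B) = act X u v C ` ({..<v} \<rightarrow>\<^sub>E carrier X)"
  shows "y * t + w * (a + b) = y * (c + a) + w * u"
proof -
  let ?Y = "lin_kernel X Q q" and ?P = "direct_power X t"
  note P = direct_power_module[OF X]
  have Y: "submodule ?Y R X" by (rule submodule_lin_kernel[OF X Q q])
  let ?BY = "act X t u B ` ({..<u} \<rightarrow>\<^sub>E ?Y)" and ?K = "{x \<in> {..<t} \<rightarrow>\<^sub>E ?Y. act X t0 t A x = \<zero>\<^bsub>direct_power X t0\<^esub>}"
  note mA = has_rank_mat[OF c] and mB = has_rank_mat[OF a]
  have KB: "({..<t} \<rightarrow>\<^sub>E ?Y) \<inter> act X t u B ` ({..<u} \<rightarrow>\<^sub>E carrier X) = ?K"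
    unfolding ex1[symmetric] by (rule ker_in_submodule[OF X Y])
  have BY: "submodule ?BY R ?P"
    by (rule submodule_image[OF P P act_lin_hom[OF X mB] submodule_power[OF X Y]])
  have K: "submodule ?K R ?P"
    unfolding KB[symmetric] ex1[symmetric]
    by (intro submodule_Int P submodule_power X Y submodule_lin_kernel[OF P P act_lin_hom[OF X mA]])
  have sub: "?BY \<subseteq> ?K"
    unfolding KB[symmetric] using act_mem[OF X Y mB] PiE_mono[of "{..<u}" "\<lambda>_. ?Y" "\<lambda>_. carrier X"] submodule_sub[OF X Y]
    by blast
  define h where "h = slen ?P ?BY ?K"
  have 1: "h + enat (a + b) * enat w = enat u * enat w"
    using connecting_length[OF a b X Q q surj kQ ex2] unfolding KB w h_def .
  have 2: "slen ?P {\<zero>\<^bsub>?P\<^esub>} ?K = slen ?P {\<zero>\<^bsub>?P\<^esub>} ?BY + h"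
    unfolding h_def using submodule_zero[OF P BY] by (intro slen_add P submodule_zero_set BY K sub) simp
  have 3: "slen ?P {\<zero>\<^bsub>?P\<^esub>} ?BY = enat a * enat y" using slen_act[OF a X Y kY] unfolding y .
  have 4: "slen ?P {\<zero>\<^bsub>?P\<^esub>} ?K + enat c * enat y = enat t * enat y"
    using slen_act_kernel[OF c X Y kY] unfolding y .
  from 1 obtain h' where h': "h = enat h'" by (cases h) auto
  have "h' + (a + b) * w = u * w" using 1 unfolding h' by simp
  moreover have "a * y + h' + c * y = t * y" using 4 unfolding 2 3 h' by simp
  ultimately show ?thesis by (simp add: algebra_simps)
qed

text \<open>
  Here \<open>V\<close> is \<open>M\<^sup>s / A M\<^sup>t\<close>, which is \<open>N \<otimes> M\<close> when \<open>A\<close> presents \<open>N\<close>.  The kernel \<open>Y\<close> of \<open>\<tau>\<close> cuts \<open>V\<close> into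
  the image of \<open>Y\<^sup>s\<close> and the quotient by it.
\<close>

context
  fixes M :: "('a, 'c, 'm) module_scheme" and Q :: "('a, 'd, 'n) module_scheme" and \<tau> :: "'c \<Rightarrow> 'd"
    and V :: "('a, 'e, 'k) module_scheme" and \<phi> :: "(nat \<Rightarrow> 'c) \<Rightarrow> 'e"
    and s t u a b :: nat and A B :: "nat \<Rightarrow> nat \<Rightarrow> 'a" and y w :: nat
  assumes a: "has_rank s t A a" and b: "has_rank t u B b"
    and M: "Module.module R M" and Q: "Module.module R Q" and \<tau>: "\<tau> \<in> lin_hom R M Q"
    and surj: "\<tau> ` carrier M = carrier Q" and kQ: "killed Q (carrier Q)"
    and kY: "killed M (lin_kernel M Q \<tau>)"
    and y: "slen M {\<zero>\<^bsub>M\<^esub>} (lin_kernel M Q \<tau>) = enat y" and w: "slen Q {\<zero>\<^bsub>Q\<^esub>} (carrier Q) = enat w"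
    and exact: "lin_kernel (direct_power M t) (direct_power M s) (act M s t A) = act M t u B ` ({..<u} \<rightarrow>\<^sub>E carrier M)"
    and V: "Module.module R V" and \<phi>: "\<phi> \<in> lin_hom R (direct_power M s) V"
    and \<phi>_surj: "\<phi> ` carrier (direct_power M s) = carrier V"
    and \<phi>_ker: "lin_kernel (direct_power M s) V \<phi> = act M s t A ` ({..<t} \<rightarrow>\<^sub>E carrier M)"
begin

abbreviation "YM \<equiv> lin_kernel M Q \<tau>"
abbreviation "KV \<equiv> \<phi> ` ({..<s} \<rightarrow>\<^sub>E YM)"

lemma YM_submodule: "submodule YM R M"
  by (rule submodule_lin_kernel[OF M Q \<tau>])

lemma KV_submodule: "submodule KV R V"
  by (rule submodule_image[OF direct_power_module[OF M] V \<phi> submodule_power[OF M YM_submodule]])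

lemma KV_killed: "killed V KV"
  using submodule_sub[OF direct_power_module[OF M] submodule_power[OF M YM_submodule]]
  by (intro killed_image[OF direct_power_module[OF M] V \<phi>] killed_power kY)

lemma act_image_submodule: "submodule (act M s t A ` ({..<t} \<rightarrow>\<^sub>E carrier M)) R (direct_power M s)"
  by (rule submodule_image[OF direct_power_module[OF M] direct_power_module[OF M]
      act_lin_hom[OF M has_rank_mat[OF a]] submodule_power[OF M submodule_carrier[OF M]]])

text \<open>
  The image of \<open>Y\<^sup>s\<close> is \<open>Y\<^sup>s / (Y\<^sup>s \<inter> A M\<^sup>t)\<close>, and \<open>Y\<^sup>s \<inter> A M\<^sup>t\<close> exceeds \<open>A Y\<^sup>t\<close>, of length \<open>a y\<close>, by
  the length in \<open>connecting_length\<close>.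
\<close>

lemma KV_length: "slen V {\<zero>\<^bsub>V\<^esub>} KV + enat (a * y + t * w) = enat (s * y + (a + b) * w)"
proof -
  let ?P = "direct_power M s"
  note P = direct_power_module[OF M]
  let ?AY = "act M s t A ` ({..<t} \<rightarrow>\<^sub>E YM)" and ?Y = "{..<s} \<rightarrow>\<^sub>E YM" and ?AM = "act M s t A ` ({..<t} \<rightarrow>\<^sub>E carrier M)"
  note mA = has_rank_mat[OF a]
  have Y: "submodule ?Y R ?P" by (rule submodule_power[OF M YM_submodule])
  have I: "submodule (?Y \<inter> ?AM) R ?P" by (rule submodule_Int[OF P Y act_image_submodule])
  have AY: "submodule ?AY R ?P"
    by (rule submodule_image[OF P P act_lin_hom[OF M mA] submodule_power[OF M YM_submodule]])
  have AYI: "?AY \<subseteq> ?Y \<inter> ?AM"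
    using act_mem[OF M YM_submodule mA] PiE_mono[of "{..<t}" "\<lambda>_. YM" "\<lambda>_. carrier M"] submodule_sub[OF M YM_submodule]
    by blast
  have "\<phi> ` (?Y \<inter> ?AM) = {\<zero>\<^bsub>V\<^esub>}"
  proof
    show "\<phi> ` (?Y \<inter> ?AM) \<subseteq> {\<zero>\<^bsub>V\<^esub>}" unfolding \<phi>_ker[symmetric] by (auto simp: lin_kernel_def)
    show "{\<zero>\<^bsub>V\<^esub>} \<subseteq> \<phi> ` (?Y \<inter> ?AM)"
      using imageI[OF submodule_zero[OF P I], of \<phi>] lin_hom_zero[OF P V \<phi>] by simp
  qed
  moreover have "slen V (\<phi> ` (?Y \<inter> ?AM)) KV = slen ?P (?Y \<inter> ?AM) ?Y"
  proof (rule slen_image[OF P V \<phi> I Y])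
    fix x assume x: "x \<in> ?Y" "\<phi> x = \<zero>\<^bsub>V\<^esub>"
    then have "x \<in> lin_kernel ?P V \<phi>" using submodule_carrierD[OF P Y] by (simp add: lin_kernel_def)
    then show "x \<in> ?Y \<inter> ?AM" using x(1) unfolding \<phi>_ker by simp
  qed simp
  ultimately have 1: "slen V {\<zero>\<^bsub>V\<^esub>} KV = slen ?P (?Y \<inter> ?AM) ?Y" by simp
  have 2: "slen ?P {\<zero>\<^bsub>?P\<^esub>} ?Y = slen ?P {\<zero>\<^bsub>?P\<^esub>} ?AY + (slen ?P ?AY (?Y \<inter> ?AM) + slen ?P (?Y \<inter> ?AM) ?Y)"
    using slen_add[OF P submodule_zero_set[OF P] AY Y] slen_add[OF P AY I Y AYI] submodule_zero[OF P AY] AYI by auto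
  have 3: "slen ?P {\<zero>\<^bsub>?P\<^esub>} ?AY = enat a * enat y" using slen_act[OF a M YM_submodule kY] unfolding y .
  have 4: "slen ?P {\<zero>\<^bsub>?P\<^esub>} ?Y = enat s * enat y" using slen_power_zero[OF M YM_submodule] unfolding y .
  define h where "h = slen ?P ?AY (?Y \<inter> ?AM)"
  have 5: "h + enat (a + b) * enat w = enat t * enat w"
    using connecting_length[OF a b M Q \<tau> surj kQ exact] unfolding w h_def .
  from 5 obtain h' where h': "h = enat h'" by (cases h) auto
  from 2[unfolded 3 4] obtain k' where k': "slen ?P (?Y \<inter> ?AM) ?Y = enat k'"
    by (cases "slen ?P (?Y \<inter> ?AM) ?Y") auto
  have "h' + (a + b) * w = t * w" using 5 unfolding h' by simp
  moreover have "s * y = a * y + (h' + k')" using 2 unfolding 3 4 k' h_def[symmetric] h' by simp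
  ultimately show ?thesis unfolding 1 k' by simp
qed

text \<open>
  The quotient is \<open>M\<^sup>s / (Y\<^sup>s + A M\<^sup>t) = Q\<^sup>s / A Q\<^sup>t\<close>.
\<close>

lemma WV_length: "slen V KV (carrier V) + enat (a * w) = enat (s * w)"
proof -
  let ?P = "direct_power M s"
  note P = direct_power_module[OF M] and PQ = direct_power_module[OF Q]
  let ?Y = "{..<s} \<rightarrow>\<^sub>E YM" and ?AM = "act M s t A ` ({..<t} \<rightarrow>\<^sub>E carrier M)" and ?q = "compose {..<s} \<tau>"
  note mA = has_rank_mat[OF a]
  note ql = compose_lin_hom[OF \<tau> M]
  have Y: "submodule ?Y R ?P" by (rule submodule_power[OF M YM_submodule])
  note AM = act_image_submodule
  have kq: "lin_kernel ?P (direct_power Q s) ?q = ?Y" by (rule compose_kernel[OF \<tau>])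
  have subs: "?Y \<subseteq> carrier ?P" "?AM \<subseteq> carrier ?P" by (rule submodule_sub[OF P Y], rule submodule_sub[OF P AM])
  have "slen V KV (carrier V) = slen ?P (?AM <+>\<^bsub>?P\<^esub> ?Y) (carrier ?P)"
    using slen_quotient[OF P V \<phi> Y submodule_carrier[OF P]] subs unfolding \<phi>_ker \<phi>_surj by simp
  also have "\<dots> = slen ?P (?Y <+>\<^bsub>?P\<^esub> ?AM) (carrier ?P)" by (simp only: set_add_commute[OF P AM Y])
  also have "\<dots> = slen (direct_power Q s) (?q ` ?AM) (?q ` carrier ?P)"
    using slen_quotient[OF P PQ ql AM submodule_carrier[OF P]] subs unfolding kq by simp
  also have "?q ` ?AM = act Q s t A ` ({..<t} \<rightarrow>\<^sub>E carrier Q)"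
    using act_image_natural[OF M Q \<tau> mA order_refl] surj by simp
  also have "?q ` carrier ?P = carrier (direct_power Q s)" by (rule compose_surj[OF surj])
  finally have 1: "slen V KV (carrier V) = slen (direct_power Q s) (act Q s t A ` ({..<t} \<rightarrow>\<^sub>E carrier Q)) (carrier (direct_power Q s))" .
  have AQ: "submodule (act Q s t A ` ({..<t} \<rightarrow>\<^sub>E carrier Q)) R (direct_power Q s)"
    by (rule submodule_image[OF PQ PQ act_lin_hom[OF Q mA] submodule_power[OF Q submodule_carrier[OF Q]]])
  have "slen (direct_power Q s) {\<zero>\<^bsub>direct_power Q s\<^esub>} (carrier (direct_power Q s)) =
      slen (direct_power Q s) {\<zero>\<^bsub>direct_power Q s\<^esub>} (act Q s t A ` ({..<t} \<rightarrow>\<^sub>E carrier Q)) + slen V KV (carrier V)"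
    unfolding 1 using submodule_zero[OF PQ AQ] submodule_sub[OF PQ AQ]
    by (intro slen_add PQ submodule_zero_set AQ submodule_carrier) simp_all
  then have "enat s * enat w = enat a * enat w + slen V KV (carrier V)"
    using slen_power_zero[OF Q submodule_carrier[OF Q], of s] slen_act[OF a Q submodule_carrier[OF Q] kQ] by (simp add: w)
  then show ?thesis by (simp add: add.commute)
qed

lemma WV_killed: "killed (quot_module V KV) (carrier (quot_module V KV))"
  unfolding killed_def
proof (intro ballI)
  let ?q = "\<lambda>x. KV +>\<^bsub>V\<^esub> x" and ?P = "direct_power M s"
  note P = direct_power_module[OF M]
  fix c z assume c: "c \<in> \<nn>" and "z \<in> carrier (quot_module V KV)"
  then obtain v where v: "v \<in> carrier V" "z = ?q v" using quot_map_surj[OF V KV_submodule] by blast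
  then obtain x where x: "x \<in> carrier ?P" "v = \<phi> x" using \<phi>_surj by blast
  have cc: "c \<in> carrier R" using c a_subset by auto
  interpret M: Module.module R M by (rule M)
  interpret P: Module.module R ?P by (rule P)
  interpret V: Module.module R V by (rule V)
  have "c \<odot>\<^bsub>M\<^esub> x i \<in> YM" if i: "i < s" for i
  proof -
    have xi: "x i \<in> carrier M" using x(1) i by (auto dest: PiE_mem)
    have "\<tau> (c \<odot>\<^bsub>M\<^esub> x i) = \<zero>\<^bsub>Q\<^esub>"
      using lin_hom_smult[OF \<tau> cc xi] kQ c lin_hom_closed[OF \<tau> xi] by (simp add: killed_def)
    then show ?thesis using cc xi by (simp add: lin_kernel_def)
  qed
  then have cx: "c \<odot>\<^bsub>?P\<^esub> x \<in> {..<s} \<rightarrow>\<^sub>E YM" by simp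
  have "c \<odot>\<^bsub>V\<^esub> v \<in> KV" unfolding x(2) lin_hom_smult[OF \<phi> cc x(1), symmetric] using cx by (rule imageI)
  then have "?q (c \<odot>\<^bsub>V\<^esub> v) = \<zero>\<^bsub>quot_module V KV\<^esub>"
    using quot_map_zero_iff[OF V KV_submodule V.smult_closed[OF cc v(1)]] by simp
  then show "c \<odot>\<^bsub>quot_module V KV\<^esub> z = \<zero>\<^bsub>quot_module V KV\<^esub>"
    unfolding v(2) using lin_hom_smult[OF quot_map_lin_hom[OF V KV_submodule] cc v(1)] by simp
qed

end

lemma quot_map_kernel:
  assumes V: "Module.module R V" and K: "submodule K R V"
  shows "lin_kernel V (quot_module V K) (\<lambda>x. K +>\<^bsub>V\<^esub> x) = K"
  using quot_map_zero_iff[OF V K] submodule_sub[OF V K] by (auto simp: lin_kernel_def)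

text \<open>
  When \<open>A\<close> presents \<open>N\<close>, the kernel of \<open>A\<^sup>T\<close> on \<open>V\<^sup>s\<close> is \<open>Hom(N, V)\<close>, and the exactness assumption is
  \<open>Ext\<^sup>1(N, V) = 0\<close>.  Let \<open>E\<close> be the preimage of \<open>K\<^sup>t\<close> under \<open>A\<^sup>T\<close>.  On the one hand \<open>E / K\<^sup>s\<close> is the kernel of
  \<open>A\<^sup>T\<close> on \<open>(V/K)\<^sup>s\<close>; on the other hand, by exactness, \<open>A\<^sup>T E\<close> is the kernel of \<open>B\<^sup>T\<close> on \<open>K\<^sup>t\<close>.  The ranks
  give both lengths, and their comparison gives the length of the kernel of \<open>A\<^sup>T\<close>.
\<close>

lemma hom_length:
  assumes a: "has_rank s t A a" and b: "has_rank t u B b"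
    and V: "Module.module R V" and K: "submodule K R V" and kK: "killed V K"
    and kW: "killed (quot_module V K) (carrier (quot_module V K))"
    and k: "slen V {\<zero>\<^bsub>V\<^esub>} K = enat k" and w: "slen V K (carrier V) = enat w"
    and exact: "lin_kernel (direct_power V t) (direct_power V u) (act V u t (mtransp B)) =
      act V t s (mtransp A) ` ({..<s} \<rightarrow>\<^sub>E carrier V)"
  shows "slen (direct_power V s) {\<zero>\<^bsub>direct_power V s\<^esub>} (lin_kernel (direct_power V s) (direct_power V t) (act V t s (mtransp A)))
     + enat (t * k + a * w) = enat (s * k + b * k + s * w)"
proof -
  let ?W = "quot_module V K" and ?q = "\<lambda>x. K +>\<^bsub>V\<^esub> x"
  note P = direct_power_module[OF V]
  note W = quot_module_module[OF V K] and q = quot_map_lin_hom[OF V K] and qs = quot_map_surj[OF V K]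
    and qk = quot_map_kernel[OF V K]
  note PW = direct_power_module[OF W]
  have w': "slen ?W {\<zero>\<^bsub>?W\<^esub>} (carrier ?W) = enat w" using slen_quot_module[OF V K] w by simp
  note a' = has_rank_transp[OF a] and b' = has_rank_transp[OF b]
  let ?f = "act V t s (mtransp A)"
  note mA = has_rank_mat[OF a'] and f = act_lin_hom[OF V has_rank_mat[OF a']]
  let ?Pt = "direct_power V t" and ?Ps = "direct_power V s"
  let ?E = "{x \<in> carrier ?Ps. ?f x \<in> {..<t} \<rightarrow>\<^sub>E K}"
  note Kt = submodule_power[OF V K, of t] and Ks = submodule_power[OF V K, of s]
  have E: "submodule ?E R ?Ps" by (rule submodule_preimage[OF P P f Kt])
  have KE: "({..<s} \<rightarrow>\<^sub>E K) \<subseteq> ?E"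
  proof
    fix x assume x: "x \<in> {..<s} \<rightarrow>\<^sub>E K"
    then show "x \<in> ?E" using act_mem[OF V K mA x] submodule_carrierD[OF P Ks x] by (simp only: mem_Collect_eq)
  qed
  let ?qs = "compose {..<s} ?q"
  have kqs: "lin_kernel ?Ps (direct_power ?W s) ?qs = {..<s} \<rightarrow>\<^sub>E K" using compose_kernel[OF q, of s] unfolding qk .
  have "slen (direct_power ?W s) (?qs ` ({..<s} \<rightarrow>\<^sub>E K)) (?qs ` ?E) = slen ?Ps ({..<s} \<rightarrow>\<^sub>E K) ?E"
  proof (rule slen_image[OF P PW compose_lin_hom[OF q V] Ks E KE])
    fix x assume "x \<in> ?E" "?qs x = \<zero>\<^bsub>direct_power ?W s\<^esub>"
    then have "x \<in> lin_kernel ?Ps (direct_power ?W s) ?qs" by (simp add: lin_kernel_def)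
    then show "x \<in> {..<s} \<rightarrow>\<^sub>E K" unfolding kqs .
  qed
  moreover have "?qs ` ({..<s} \<rightarrow>\<^sub>E K) = {\<zero>\<^bsub>direct_power ?W s\<^esub>}"
    unfolding kqs[symmetric] by (rule lin_kernel_image[OF P PW compose_lin_hom[OF q V]])
  moreover have "?qs ` ?E = {x \<in> {..<s} \<rightarrow>\<^sub>E carrier ?W. act ?W t s (mtransp A) x = \<zero>\<^bsub>direct_power ?W t\<^esub>}"
    using act_kernel_natural[OF V W q qs mA] unfolding qk by (simp add: lin_kernel_def)
  ultimately have "slen ?Ps ({..<s} \<rightarrow>\<^sub>E K) ?E + enat a * enat w = enat s * enat w"
    using slen_act_kernel[OF a' W submodule_carrier[OF W] kW] unfolding w' by simp
  moreover have "slen ?Ps {\<zero>\<^bsub>?Ps\<^esub>} ?E = slen ?Ps {\<zero>\<^bsub>?Ps\<^esub>} ({..<s} \<rightarrow>\<^sub>E K) + slen ?Ps ({..<s} \<rightarrow>\<^sub>E K) ?E"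
    using submodule_zero[OF P Ks] by (intro slen_add P submodule_zero_set Ks E KE) simp
  moreover have "slen ?Ps {\<zero>\<^bsub>?Ps\<^esub>} ({..<s} \<rightarrow>\<^sub>E K) = enat s * enat k"
    using slen_power_zero[OF V K, of s] unfolding k .
  ultimately have 1: "slen ?Ps {\<zero>\<^bsub>?Ps\<^esub>} ?E + enat (a * w) = enat (s * k + s * w)"
    by (simp add: add.assoc)
  have fE: "?f ` ?E = {x \<in> {..<t} \<rightarrow>\<^sub>E K. act V u t (mtransp B) x = \<zero>\<^bsub>direct_power V u\<^esub>}"
  proof -
    have "?f ` ?E = ({..<t} \<rightarrow>\<^sub>E K) \<inter> ?f ` ({..<s} \<rightarrow>\<^sub>E carrier V)" by auto
    then show ?thesis unfolding exact[symmetric] by (simp only: ker_in_submodule[OF V K])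
  qed
  have Z: "{x \<in> ?E. ?f x = \<zero>\<^bsub>?Pt\<^esub>} = lin_kernel ?Ps ?Pt ?f"
  proof -
    have z: "\<zero>\<^bsub>?Pt\<^esub> \<in> {..<t} \<rightarrow>\<^sub>E K" by (rule submodule_zero[OF P Kt])
    have "x \<in> ?E \<and> ?f x = \<zero>\<^bsub>?Pt\<^esub> \<longleftrightarrow> x \<in> carrier ?Ps \<and> ?f x = \<zero>\<^bsub>?Pt\<^esub>" for x
    proof (cases "?f x = \<zero>\<^bsub>?Pt\<^esub>")
      case True
      then show ?thesis using z by (simp only: mem_Collect_eq simp_thms)
    next
      case False
      then show ?thesis by (simp only: simp_thms)
    qed
    then show ?thesis unfolding lin_kernel_def by (intro Collect_cong)
  qed
  have "slen ?Ps {\<zero>\<^bsub>?Ps\<^esub>} ?E = slen ?Ps {\<zero>\<^bsub>?Ps\<^esub>} (lin_kernel ?Ps ?Pt ?f) + slen ?Pt {\<zero>\<^bsub>?Pt\<^esub>} (?f ` ?E)"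
    using slen_rank_nullity[OF P P f E] unfolding Z .
  moreover have "slen ?Pt {\<zero>\<^bsub>?Pt\<^esub>} (?f ` ?E) + enat b * enat k = enat t * enat k"
    using slen_act_kernel[OF b' V K kK] unfolding fE k .
  ultimately show ?thesis using 1
    by (cases "slen ?Ps {\<zero>\<^bsub>?Ps\<^esub>} (lin_kernel ?Ps ?Pt ?f)"; cases "slen ?Pt {\<zero>\<^bsub>?Pt\<^esub>} (?f ` ?E)") auto
qed

end

section \<open>Free resolutions\<close>

context cring
begin

text \<open>
  Finite generation of a submodule, in a form that carries no generators.
\<close>

definition fin_gen :: "('a, 'c, 'm) module_scheme \<Rightarrow> 'c set \<Rightarrow> bool"
  where "fin_gen X W \<longleftrightarrow> (\<exists>p g. g \<in> lin_hom R (Rpow p) X \<and> g ` carrier (Rpow p) = W)"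

lemma fin_gen_image:
  assumes f: "f \<in> lin_hom R X Y" and W: "fin_gen X W"
  shows "fin_gen Y (f ` W)"
proof -
  obtain p g where g: "g \<in> lin_hom R (Rpow p) X" "g ` carrier (Rpow p) = W"
    using W unfolding fin_gen_def by blast
  have "(\<lambda>x. f (g x)) \<in> lin_hom R (Rpow p) Y" by (rule lin_hom_comp[OF g(1) f])
  moreover have "(\<lambda>x. f (g x)) ` carrier (Rpow p) = f ` W" unfolding g(2)[symmetric] image_image ..
  ultimately show ?thesis unfolding fin_gen_def by blast
qed

lemma fin_gen_sum:
  assumes X: "Module.module R X" and U: "fin_gen X U" and W: "fin_gen X W"
  shows "fin_gen X (U <+>\<^bsub>X\<^esub> W)"
proof -
  interpret X: Module.module R X by (rule X)
  obtain p g where g: "g \<in> lin_hom R (Rpow p) X" "g ` carrier (Rpow p) = U"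
    using U unfolding fin_gen_def by blast
  obtain s h where h: "h \<in> lin_hom R (Rpow s) X" "h ` carrier (Rpow s) = W"
    using W unfolding fin_gen_def by blast
  define l where "l x = restrict x {..<p}" for x :: "nat \<Rightarrow> 'a"
  define r where "r x = (\<lambda>i\<in>{..<s}. x (p + i))" for x :: "nat \<Rightarrow> 'a"
  have l: "l \<in> lin_hom R (Rpow (p + s)) (Rpow p)"
    unfolding l_def by (rule lin_homI) (simp_all add: PiE_iff cong: restrict_cong)
  have r: "r \<in> lin_hom R (Rpow (p + s)) (Rpow s)"
    unfolding r_def by (rule lin_homI) (simp_all add: PiE_iff cong: restrict_cong)
  note lin = lin_hom_comp[OF l g(1)] lin_hom_comp[OF r h(1)]
  have f: "(\<lambda>x. g (l x) \<oplus>\<^bsub>X\<^esub> h (r x)) \<in> lin_hom R (Rpow (p + s)) X"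
  proof (rule lin_homI)
    fix x assume x: "x \<in> carrier (Rpow (p + s))"
    note xc = lin_hom_closed[OF lin(1) x] lin_hom_closed[OF lin(2) x]
    show "g (l x) \<oplus>\<^bsub>X\<^esub> h (r x) \<in> carrier X" using xc by simp
    fix y assume y: "y \<in> carrier (Rpow (p + s))"
    note yc = lin_hom_closed[OF lin(1) y] lin_hom_closed[OF lin(2) y]
    show "g (l (x \<oplus>\<^bsub>Rpow (p + s)\<^esub> y)) \<oplus>\<^bsub>X\<^esub> h (r (x \<oplus>\<^bsub>Rpow (p + s)\<^esub> y)) =
        g (l x) \<oplus>\<^bsub>X\<^esub> h (r x) \<oplus>\<^bsub>X\<^esub> (g (l y) \<oplus>\<^bsub>X\<^esub> h (r y))"
      unfolding lin_hom_add[OF lin(1) x y] lin_hom_add[OF lin(2) x y] using xc yc by (simp add: X.a_ac)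
  next
    fix a x assume a: "a \<in> carrier R" and x: "x \<in> carrier (Rpow (p + s))"
    note xc = lin_hom_closed[OF lin(1) x] lin_hom_closed[OF lin(2) x]
    show "g (l (a \<odot>\<^bsub>Rpow (p + s)\<^esub> x)) \<oplus>\<^bsub>X\<^esub> h (r (a \<odot>\<^bsub>Rpow (p + s)\<^esub> x)) = a \<odot>\<^bsub>X\<^esub> (g (l x) \<oplus>\<^bsub>X\<^esub> h (r x))"
      unfolding lin_hom_smult[OF lin(1) a x] lin_hom_smult[OF lin(2) a x] using xc a by (simp add: X.smult_r_distr)
  qed
  have "(\<lambda>x. g (l x) \<oplus>\<^bsub>X\<^esub> h (r x)) ` carrier (Rpow (p + s)) = U <+>\<^bsub>X\<^esub> W"
  proof
    show "(\<lambda>x. g (l x) \<oplus>\<^bsub>X\<^esub> h (r x)) ` carrier (Rpow (p + s)) \<subseteq> U <+>\<^bsub>X\<^esub> W"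
    proof
      fix z assume "z \<in> (\<lambda>x. g (l x) \<oplus>\<^bsub>X\<^esub> h (r x)) ` carrier (Rpow (p + s))"
      then obtain x where x: "x \<in> carrier (Rpow (p + s))" "z = g (l x) \<oplus>\<^bsub>X\<^esub> h (r x)" by blast
      have "g (l x) \<in> U" "h (r x) \<in> W"
        unfolding g(2)[symmetric] h(2)[symmetric] by (intro imageI lin_hom_closed[OF l x(1)] lin_hom_closed[OF r x(1)])+
      then show "z \<in> U <+>\<^bsub>X\<^esub> W" using x(2) by (rule set_addI)
    qed
    show "U <+>\<^bsub>X\<^esub> W \<subseteq> (\<lambda>x. g (l x) \<oplus>\<^bsub>X\<^esub> h (r x)) ` carrier (Rpow (p + s))"
    proof
      fix z assume "z \<in> U <+>\<^bsub>X\<^esub> W"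
      then obtain u w where uw: "u \<in> U" "w \<in> W" "z = u \<oplus>\<^bsub>X\<^esub> w" by (elim set_addE)
      obtain x where x: "x \<in> carrier (Rpow p)" "u = g x" using uw(1) unfolding g(2)[symmetric] by (elim imageE)
      obtain y where y: "y \<in> carrier (Rpow s)" "w = h y" using uw(2) unfolding h(2)[symmetric] by (elim imageE)
      let ?v = "\<lambda>i\<in>{..<p + s}. if i < p then x i else y (i - p)"
      have "?v \<in> carrier (Rpow (p + s))" using x(1) y(1) by (simp add: PiE_iff)
      moreover have "l ?v = x"
        using x(1) by (intro extensionalityI[of _ "{..<p}"]) (simp_all add: l_def PiE_def del: restrict_restrict)
      moreover have "r ?v = y"
        using y(1) by (intro extensionalityI[of _ "{..<s}"]) (simp_all add: r_def PiE_def)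
      ultimately show "z \<in> (\<lambda>x. g (l x) \<oplus>\<^bsub>X\<^esub> h (r x)) ` carrier (Rpow (p + s))"
        using uw(3) x(2) y(2) by (intro image_eqI[of _ _ ?v]) simp_all
    qed
  qed
  then show ?thesis using f unfolding fin_gen_def by blast
qed

text \<open>
  Lifts of generators of \<open>f(W)\<close> together with generators of the kernel generate \<open>W\<close>.
\<close>

lemma fin_gen_lift:
  assumes X: "Module.module R X" and Y: "Module.module R Y" and f: "f \<in> lin_hom R X Y"
    and W: "submodule W R X" and fW: "fin_gen Y (f ` W)" and K: "fin_gen X (W \<inter> lin_kernel X Y f)"
  shows "fin_gen X W"
proof -
  obtain p g where g: "g \<in> lin_hom R (Rpow p) Y" "g ` carrier (Rpow p) = f ` W"
    using fW unfolding fin_gen_def by blast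
  have "\<exists>w\<in>W. f w = g (unit_vec p j)" if "j < p" for j
  proof -
    have "g (unit_vec p j) \<in> f ` W" unfolding g(2)[symmetric] using unit_vec_closed[OF that] by (intro imageI) simp
    then show ?thesis by (metis imageE)
  qed
  then obtain w where w: "\<And>j. j < p \<Longrightarrow> w j \<in> W \<and> f (w j) = g (unit_vec p j)" by metis
  have wc: "w j \<in> carrier X" if "j < p" for j using w[OF that] submodule_carrierD[OF X W] by blast
  obtain h where h: "h \<in> lin_hom R (Rpow p) X" "\<And>j. j < p \<Longrightarrow> h (unit_vec p j) = restrict w {..<p} j"
    by (rule free_hom_exists[OF X, of "restrict w {..<p}" p]) (use wc in auto)
  have hW: "h x \<in> W" if x: "x \<in> {..<p} \<rightarrow>\<^sub>E carrier R" for x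
    unfolding lin_hom_vec[OF X h(1) x]
    by (intro submodule_finsum[OF X W] submodule_smult[OF X W]) (use w h(2) PiE_mem[OF x] in auto)
  have fh: "f (h x) = g x" if x: "x \<in> {..<p} \<rightarrow>\<^sub>E carrier R" for x
  proof -
    interpret Y: Module.module R Y by (rule Y)
    show ?thesis
      unfolding lin_hom_vec[OF Y lin_hom_comp[OF h(1) f] x] lin_hom_vec[OF Y g(1) x]
      using w h(2) PiE_mem[OF x] lin_hom_closed[OF g(1)] unit_vec_closed
      by (intro Y.finsum_cong' refl) simp_all
  qed
  interpret X: Module.module R X by (rule X)
  have "W = h ` carrier (Rpow p) <+>\<^bsub>X\<^esub> (W \<inter> lin_kernel X Y f)"
  proof
    show "h ` carrier (Rpow p) <+>\<^bsub>X\<^esub> (W \<inter> lin_kernel X Y f) \<subseteq> W"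
      using hW by (intro set_add_least[OF X W]) auto
    show "W \<subseteq> h ` carrier (Rpow p) <+>\<^bsub>X\<^esub> (W \<inter> lin_kernel X Y f)"
    proof
      fix z assume z: "z \<in> W"
      then have "f z \<in> g ` carrier (Rpow p)" unfolding g(2) by (rule imageI)
      then obtain x where x: "x \<in> carrier (Rpow p)" "f z = g x" by (elim imageE)
      have hx: "h x \<in> W" "f z = f (h x)" using hW fh x by simp_all
      have zc: "z \<in> carrier X" "h x \<in> carrier X" using z hx submodule_carrierD[OF X W] by auto
      have "z \<ominus>\<^bsub>X\<^esub> h x \<in> W \<inter> lin_kernel X Y f"
        using lin_kernel_eqI[OF X Y f zc hx(2)] submodule_minus[OF X W z hx(1)] by simp
      moreover have "z = h x \<oplus>\<^bsub>X\<^esub> (z \<ominus>\<^bsub>X\<^esub> h x)" using zc by (simp add: a_minus_def X.a_lcomm X.r_neg)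
      ultimately show "z \<in> h ` carrier (Rpow p) <+>\<^bsub>X\<^esub> (W \<inter> lin_kernel X Y f)"
        by (rule set_addI[OF imageI[OF x(1)]])
    qed
  qed
  moreover have "fin_gen X (h ` carrier (Rpow p))" using h(1) unfolding fin_gen_def by blast
  ultimately show ?thesis using fin_gen_sum[OF X _ K] by metis
qed

lemma fin_gen_finite:
  assumes X: "Module.module R X" and A: "finite A" "A \<subseteq> carrier X"
  shows "fin_gen X (gen_submodule R X A)"
proof -
  obtain e where e: "bij_betw e {..<card A} A" using ex_bij_betw_nat_finite[OF A(1)] by (auto simp: atLeast0LessThan)
  let ?k = "card A"
  have ec: "e i \<in> A" if "i < ?k" for i using e that by (auto simp: bij_betw_def)
  obtain g where g: "g \<in> lin_hom R (Rpow ?k) X" "\<And>i. i < ?k \<Longrightarrow> g (unit_vec ?k i) = restrict e {..<?k} i"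
    by (rule free_hom_exists[OF X, of "restrict e {..<?k}" ?k]) (use ec A in auto)
  have gs: "submodule (g ` carrier (Rpow ?k)) R X"
    by (rule submodule_image[OF Rpow_module X g(1) submodule_carrier[OF Rpow_module]])
  have "g ` carrier (Rpow ?k) = gen_submodule R X A"
  proof
    show "gen_submodule R X A \<subseteq> g ` carrier (Rpow ?k)"
    proof (rule gen_submodule_least[OF gs])
      show "A \<subseteq> g ` carrier (Rpow ?k)"
      proof
        fix a assume "a \<in> A"
        then obtain i where i: "i < ?k" "a = e i" using e by (auto simp: bij_betw_def)
        then have "a = g (unit_vec ?k i)" using g(2)[OF i(1)] by simp
        then show "a \<in> g ` carrier (Rpow ?k)" using unit_vec_closed[OF i(1)] by (intro image_eqI) simp_all
      qed
    qed
    note S = gen_submodule_submodule[OF X A(2)]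
    show "g ` carrier (Rpow ?k) \<subseteq> gen_submodule R X A"
    proof
      fix z assume "z \<in> g ` carrier (Rpow ?k)"
      then obtain x where x: "x \<in> carrier (Rpow ?k)" "z = g x" by (elim imageE)
      then have x': "x \<in> {..<?k} \<rightarrow>\<^sub>E carrier R" by simp
      show "z \<in> gen_submodule R X A"
        unfolding x(2) lin_hom_vec[OF X g(1) x']
        by (intro submodule_finsum[OF X S] submodule_smult[OF X S])
          (use g(2) ec gen_submodule_upper[of A X] PiE_mem[OF x'] in auto)
    qed
  qed
  then show ?thesis using g(1) unfolding fin_gen_def by blast
qed

end

context noetherian_local_ring
begin

lemma ideal_fin_gen:
  assumes W: "submodule W R (ring_module R)"
  shows "fin_gen (ring_module R) W"
proof -
  obtain A where A: "A \<subseteq> carrier R" "finite A" "W = Idl A"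
    using finetely_gen[OF ring_submodule_ideal[OF W]] by blast
  have "gen_submodule R (ring_module R) A = W"
  proof
    have "A \<subseteq> W" unfolding A(3) by (rule genideal_self[OF A(1)])
    then show "gen_submodule R (ring_module R) A \<subseteq> W" by (rule gen_submodule_least[OF W])
    show "W \<subseteq> gen_submodule R (ring_module R) A"
      unfolding A(3)
      by (intro genideal_minimal ring_submodule_ideal gen_submodule_submodule ring_module gen_submodule_upper)
        (simp add: A(1))
  qed
  then show ?thesis using fin_gen_finite[OF ring_module A(2)] A(1) by simp
qed

text \<open>
  By induction on \<open>k\<close>: the last coordinates of the elements of \<open>W\<close> form an ideal, and the elements with
  last coordinate zero form a submodule of \<open>R\<^sup>k\<close>.
\<close>

lemma submodule_fin_gen: "submodule W R (Rpow k) \<Longrightarrow> fin_gen (Rpow k) W"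
proof (induction k arbitrary: W)
  case 0
  have "W = {\<lambda>_. undefined}"
    using submodule_sub[OF Rpow_module 0] submodule_zero[OF Rpow_module 0] by auto
  moreover have "carrier (Rpow 0) = {\<lambda>_. undefined}" by simp
  ultimately have "(\<lambda>x. x) ` carrier (Rpow 0) = W" by simp
  then show ?case unfolding fin_gen_def using id_lin_hom by blast
next
  case (Suc k)
  let ?f = "\<lambda>x::nat \<Rightarrow> 'a. x k"
  have f: "?f \<in> lin_hom R (Rpow (Suc k)) (ring_module R)" by (rule proj_lin_hom) simp
  define j where "j y = (\<lambda>i\<in>{..<Suc k}. if i < k then y i else \<zero>)" for y :: "nat \<Rightarrow> 'a"
  have j: "j \<in> lin_hom R (Rpow k) (Rpow (Suc k))"
  proof (rule lin_homI)
    fix x assume x: "x \<in> carrier (Rpow k)"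
    then have xc: "x i \<in> carrier R" if "i < k" for i using that by (auto dest: PiE_mem)
    show "j x \<in> carrier (Rpow (Suc k))" using xc by (auto simp: j_def)
    fix y assume y: "y \<in> carrier (Rpow k)"
    show "j (x \<oplus>\<^bsub>Rpow k\<^esub> y) = j x \<oplus>\<^bsub>Rpow (Suc k)\<^esub> j y"
      by (rule extensionalityI[of _ "{..<Suc k}"]) (simp_all add: j_def)
  next
    fix a x assume a: "a \<in> carrier R" and x: "x \<in> carrier (Rpow k)"
    show "j (a \<odot>\<^bsub>Rpow k\<^esub> x) = a \<odot>\<^bsub>Rpow (Suc k)\<^esub> j x"
      using a by (intro extensionalityI[of _ "{..<Suc k}"]) (simp_all add: j_def)
  qed
  let ?V = "{y \<in> carrier (Rpow k). j y \<in> W}"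
  have V: "fin_gen (Rpow k) ?V" by (rule Suc.IH[OF submodule_preimage[OF Rpow_module Rpow_module j Suc.prems]])
  have "j ` ?V = W \<inter> lin_kernel (Rpow (Suc k)) (ring_module R) ?f"
  proof
    show "j ` ?V \<subseteq> W \<inter> lin_kernel (Rpow (Suc k)) (ring_module R) ?f"
      using submodule_carrierD[OF Rpow_module Suc.prems] by (auto simp: lin_kernel_def j_def simp del: direct_power_simps)
    show "W \<inter> lin_kernel (Rpow (Suc k)) (ring_module R) ?f \<subseteq> j ` ?V"
    proof
      fix x assume "x \<in> W \<inter> lin_kernel (Rpow (Suc k)) (ring_module R) ?f"
      then have x: "x \<in> W" "x \<in> {..<Suc k} \<rightarrow>\<^sub>E carrier R" "x k = \<zero>" by (simp_all add: lin_kernel_def)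
      have "x = j (restrict x {..<k})"
        using x(2,3) by (intro extensionalityI[of _ "{..<Suc k}"]) (auto simp: j_def PiE_def less_Suc_eq)
      moreover have "restrict x {..<k} \<in> carrier (Rpow k)" using x(2) by (simp add: PiE_iff)
      ultimately show "x \<in> j ` ?V" using x(1) by (intro image_eqI[of _ _ "restrict x {..<k}"]) simp_all
    qed
  qed
  then have "fin_gen (Rpow (Suc k)) (W \<inter> lin_kernel (Rpow (Suc k)) (ring_module R) ?f)"
    using fin_gen_image[OF j V] by simp
  moreover have "fin_gen (ring_module R) (?f ` W)"
    by (intro ideal_fin_gen submodule_image[OF Rpow_module ring_module f Suc.prems])
  ultimately show ?case by (intro fin_gen_lift[OF Rpow_module ring_module f Suc.prems])
qed

lemma free_resolution_exists:
  assumes N: "fg_module R N"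
  shows "\<exists>(b :: nat \<Rightarrow> nat) d \<epsilon>. resolution R (\<lambda>i. free_module R {..<b i}) d \<epsilon> N"
proof -
  have Nm: "Module.module R N" using N by (simp add: fg_module_def)
  obtain B where B: "finite B" "B \<subseteq> carrier N" "gen_submodule R N B = carrier N"
    using N unfolding fg_module_def by blast
  obtain k \<epsilon> where e: "\<epsilon> \<in> lin_hom R (Rpow k) N" "\<epsilon> ` carrier (Rpow k) = carrier N"
    using fin_gen_finite[OF Nm B(1,2)] unfolding B(3) fin_gen_def by blast
  obtain p0 g0 where g0: "g0 \<in> lin_hom R (Rpow p0) (Rpow k)" "g0 ` carrier (Rpow p0) = lin_kernel (Rpow k) N \<epsilon>"
    using submodule_fin_gen[OF submodule_lin_kernel[OF Rpow_module Nm e(1)]] unfolding fin_gen_def by blast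
  \<comment> \<open>A state \<open>(b, c, g)\<close> stands for the map \<open>g : R\<^sup>c \<rightarrow> R\<^sup>b\<close>; the next map is chosen onto its kernel, and
    the initial map, onto the kernel of \<open>\<epsilon>\<close>, is fixed.\<close>
  define P where "P n s = (case s of (b, c, g) \<Rightarrow> g \<in> lin_hom R (Rpow c) (Rpow b) \<and> (n = 0 \<longrightarrow> s = (k, p0, g0)))"
    for n :: nat and s :: "nat \<times> nat \<times> ((nat \<Rightarrow> 'a) \<Rightarrow> (nat \<Rightarrow> 'a))"
  define Q where "Q s s' = (case s of (b, c, g) \<Rightarrow> case s' of (b', c', g') \<Rightarrow>
      b' = c \<and> g' ` carrier (Rpow c') = lin_kernel (Rpow c) (Rpow b) g)"
    for s s' :: "nat \<times> nat \<times> ((nat \<Rightarrow> 'a) \<Rightarrow> (nat \<Rightarrow> 'a))"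
  have "\<exists>s. \<forall>n. P n (s n) \<and> Q (s n) (s (Suc n))"
  proof (rule dependent_nat_choice)
    show "\<exists>s. P 0 s" using g0(1) by (intro exI[of _ "(k, p0, g0)"]) (simp add: P_def)
    fix s n assume s: "P n s"
    obtain b c g where bcg: "s = (b, c, g)" by (cases s) auto
    have g: "g \<in> lin_hom R (Rpow c) (Rpow b)" using s by (simp add: P_def bcg)
    obtain c' g' where "g' \<in> lin_hom R (Rpow c') (Rpow c)" "g' ` carrier (Rpow c') = lin_kernel (Rpow c) (Rpow b) g"
      using submodule_fin_gen[OF submodule_lin_kernel[OF Rpow_module Rpow_module g]] unfolding fin_gen_def by blast
    then show "\<exists>s'. P (Suc n) s' \<and> Q s s'" by (intro exI[of _ "(c, c', g')"]) (simp add: P_def Q_def bcg)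
  qed
  then obtain s where s: "\<And>n. P n (s n)" "\<And>n. Q (s n) (s (Suc n))" by blast
  define b where "b n = fst (s n)" for n
  define d where "d n = snd (snd (s n))" for n
  have next_rank: "fst (snd (s n)) = b (Suc n)" for n
    using s(2)[of n] unfolding Q_def case_prod_unfold b_def by simp
  have d: "d n \<in> lin_hom R (Rpow (b (Suc n))) (Rpow (b n))" for n
    using s(1)[of n] unfolding P_def case_prod_unfold next_rank b_def[symmetric] d_def[symmetric] by (elim conjE)
  have ex: "d (Suc n) ` carrier (Rpow (b (Suc (Suc n)))) = lin_kernel (Rpow (b (Suc n))) (Rpow (b n)) (d n)" for n
    using s(2)[of n] unfolding Q_def case_prod_unfold next_rank b_def[symmetric] d_def[symmetric] by (elim conjE)
  have s0: "s 0 = (k, p0, g0)" using s(1)[of 0] by (auto simp: P_def split: prod.splits)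
  have "b 0 = k" "b (Suc 0) = p0" "d 0 = g0" using s0 next_rank[of 0] by (simp_all add: b_def d_def)
  then have "resolution R (\<lambda>i. Rpow (b i)) d \<epsilon> N"
    unfolding resolution_def using d ex Rpow_module e g0 by (simp only: One_nat_def simp_thms)
  then have "resolution R (\<lambda>i. free_module R {..<b i}) d \<epsilon> N"
    unfolding free_module_direct_power .
  then show ?thesis by blast
qed

end

section \<open>Tor and Ext by matrices\<close>

context cring
begin

lemma submodule_restrict_iff:
  assumes C: "Module.module R C" and Z: "submodule Z R C"
  shows "submodule H R (C\<lparr>carrier := Z\<rparr>) \<longleftrightarrow> submodule H R C \<and> H \<subseteq> Z"
  unfolding submodule_iff[OF C] submodule_iff[OF submodule.submodule_is_module[OF Z C]]
  using submodule_sub[OF C Z] by auto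

lemma slen_restrict:
  assumes C: "Module.module R C" and Z: "submodule Z R C"
  shows "slen (C\<lparr>carrier := Z\<rparr>) B Z = slen C B Z"
proof -
  have "strict_chain (C\<lparr>carrier := Z\<rparr>) B Z k U \<longleftrightarrow> strict_chain C B Z k U" for k U
    unfolding strict_chain_def submodule_restrict_iff[OF C Z] by auto
  then have "strict_chain (C\<lparr>carrier := Z\<rparr>) B Z = strict_chain C B Z" by (intro ext)
  then show ?thesis unfolding slen_def by simp
qed

lemma lin_hom_restrict:
  assumes f: "f \<in> lin_hom R X Y" and "H \<subseteq> carrier X" "f ` H \<subseteq> K"
  shows "f \<in> lin_hom R (X\<lparr>carrier := H\<rparr>) (Y\<lparr>carrier := K\<rparr>)"
  using assms(2,3) lin_hom_add[OF f] lin_hom_smult[OF f] by (intro lin_homI) (auto simp: subset_iff)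

text \<open>Homology modules are of the form \<open>quot_module (C\<lparr>carrier := Z\<rparr>) B\<close>.\<close>

context
  fixes C :: "('a, 'c, 'm) module_scheme" and Z B :: "'c set"
  assumes C: "Module.module R C" and Z: "submodule Z R C" and B: "submodule B R C" and BZ: "B \<subseteq> Z"
begin

lemma subquotient_base: "Module.module R (C\<lparr>carrier := Z\<rparr>)" "submodule B R (C\<lparr>carrier := Z\<rparr>)"
  using submodule.submodule_is_module[OF Z C] submodule_restrict_iff[OF C Z] B BZ by simp_all

lemma subquotient_module: "Module.module R (quot_module (C\<lparr>carrier := Z\<rparr>) B)"
  by (rule quot_module_module[OF subquotient_base])

lemma subquotient_zero_iff: "zero_module (quot_module (C\<lparr>carrier := Z\<rparr>) B) \<longleftrightarrow> Z = B"
proof -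
  let ?X = "C\<lparr>carrier := Z\<rparr>" and ?q = "\<lambda>x. B +>\<^bsub>C\<lparr>carrier := Z\<rparr>\<^esub> x"
  note X = subquotient_base
  have "zero_module (quot_module ?X B) \<longleftrightarrow> ?q ` Z = {\<zero>\<^bsub>quot_module ?X B\<^esub>}"
    using quot_map_surj[OF X] by (simp add: zero_module_def)
  also have "\<dots> \<longleftrightarrow> (\<forall>x\<in>Z. ?q x = \<zero>\<^bsub>quot_module ?X B\<^esub>)"
    using submodule_zero[OF C Z] by auto
  also have "\<dots> \<longleftrightarrow> (\<forall>x\<in>Z. x \<in> B)" using quot_map_zero_iff[OF X] by simp
  finally show ?thesis using BZ by auto
qed

lemma subquotient_slen:
  "slen (quot_module (C\<lparr>carrier := Z\<rparr>) B) {\<zero>\<^bsub>quot_module (C\<lparr>carrier := Z\<rparr>) B\<^esub>} (carrier (quot_module (C\<lparr>carrier := Z\<rparr>) B)) = slen C B Z"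
  using slen_quot_module[OF subquotient_base] slen_restrict[OF C Z] by simp

end

definition dmat :: "(nat \<Rightarrow> nat) \<Rightarrow> (nat \<Rightarrow> (nat \<Rightarrow> 'a) \<Rightarrow> (nat \<Rightarrow> 'a)) \<Rightarrow> nat \<Rightarrow> nat \<Rightarrow> nat \<Rightarrow> 'a"
  where "dmat p d i = (\<lambda>k j. d i (unit_vec (p (Suc i)) j) k)"

context
  fixes p :: "nat \<Rightarrow> nat" and d :: "nat \<Rightarrow> (nat \<Rightarrow> 'a) \<Rightarrow> (nat \<Rightarrow> 'a)" and X :: "('a, 'c, 'm) module_scheme"
  assumes d: "\<And>i. d i \<in> lin_hom R (Rpow (p (Suc i))) (Rpow (p i))"
    and dd: "\<And>i x. x \<in> carrier (Rpow (p (Suc (Suc i)))) \<Longrightarrow> d i (d (Suc i) x) = \<zero>\<^bsub>Rpow (p i)\<^esub>"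
    and X: "Module.module R X"
begin

interpretation X: Module.module R X by (rule X)

lemma dmat_mat: "mat (p i) (p (Suc i)) (dmat p d i)"
  unfolding dmat_def by (rule lin_hom_matrix(1)[OF d])

lemma dmat_act: "x \<in> {..<p (Suc i)} \<rightarrow>\<^sub>E carrier R \<Longrightarrow> d i x = act (ring_module R) (p i) (p (Suc i)) (dmat p d i) x"
  unfolding dmat_def by (rule lin_hom_matrix(2)[OF d])

lemma dmat_product_zero:
  assumes i: "k < p i" "j < p (Suc (Suc i))"
  shows "mmult (p (Suc i)) (dmat p d i) (dmat p d (Suc i)) k j = \<zero>"
proof -
  let ?S = "ring_module R" and ?u = "unit_vec (p (Suc (Suc i))) j"
  have u: "?u \<in> {..<p (Suc (Suc i))} \<rightarrow>\<^sub>E carrier R" by (rule unit_vec_closed[OF i(2)])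
  have du: "d (Suc i) ?u \<in> {..<p (Suc i)} \<rightarrow>\<^sub>E carrier R" using lin_hom_closed[OF d] u by simp
  have "act ?S (p i) (p (Suc (Suc i))) (mmult (p (Suc i)) (dmat p d i) (dmat p d (Suc i))) ?u = d i (d (Suc i) ?u)"
    unfolding dmat_act[OF du] unfolding dmat_act[OF u]
    using act_mmult[OF ring_module dmat_mat dmat_mat, of ?u i] u by simp
  also have "\<dots> = \<zero>\<^bsub>Rpow (p i)\<^esub>" using dd u by simp
  finally have eq: "act ?S (p i) (p (Suc (Suc i))) (mmult (p (Suc i)) (dmat p d i) (dmat p d (Suc i))) ?u = \<zero>\<^bsub>Rpow (p i)\<^esub>" .
  show ?thesis
    using fun_cong[OF eq, of k] i by (simp add: act_unit_vec[OF mat_mmult[OF dmat_mat dmat_mat] i(2)])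
qed

lemma act_zero_matrix:
  assumes "\<And>i j. i < q \<Longrightarrow> j < s \<Longrightarrow> A i j = \<zero>" "x \<in> {..<s} \<rightarrow>\<^sub>E carrier X"
  shows "act X q s A x = \<zero>\<^bsub>direct_power X q\<^esub>"
proof -
  have "(\<Oplus>\<^bsub>X\<^esub>j\<in>{..<s}. A i j \<odot>\<^bsub>X\<^esub> x j) = (\<Oplus>\<^bsub>X\<^esub>j\<in>{..<s}. \<zero>\<^bsub>X\<^esub>)" if "i < q" for i
    using assms(1)[OF that] PiE_mem[OF assms(2)] by (intro X.finsum_cong' refl) simp_all
  then show ?thesis by (intro extensionalityI[of _ "{..<q}"]) (simp_all add: act_def X.finsum_zero)
qed

lemma act_dmat_complex:
  assumes "x \<in> {..<p (Suc (Suc i))} \<rightarrow>\<^sub>E carrier X"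
  shows "act X (p i) (p (Suc i)) (dmat p d i) (act X (p (Suc i)) (p (Suc (Suc i))) (dmat p d (Suc i)) x) = \<zero>\<^bsub>direct_power X (p i)\<^esub>"
  unfolding act_mmult[OF X dmat_mat dmat_mat assms] by (rule act_zero_matrix[OF dmat_product_zero assms])

lemma act_dmat_cocomplex:
  assumes x: "x \<in> {..<p i} \<rightarrow>\<^sub>E carrier X"
  shows "act X (p (Suc (Suc i))) (p (Suc i)) (mtransp (dmat p d (Suc i))) (act X (p (Suc i)) (p i) (mtransp (dmat p d i)) x)
    = \<zero>\<^bsub>direct_power X (p (Suc (Suc i)))\<^esub>"
  unfolding act_mmult[OF X mat_transp[OF dmat_mat] mat_transp[OF dmat_mat] x]
proof (rule act_zero_matrix[OF _ x])
  fix j k assume "j < p (Suc (Suc i))" "k < p i"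
  then show "mmult (p (Suc i)) (mtransp (dmat p d (Suc i))) (mtransp (dmat p d i)) j k = \<zero>"
    using transp_mmult[OF dmat_mat dmat_mat, of j i k] dmat_product_zero[of k i j] by simp
qed

abbreviation "Xp i \<equiv> direct_power X (p i)"
abbreviation "Tp i \<equiv> tensor R (Rpow (p i)) X"
abbreviation "dX i \<equiv> act X (p i) (p (Suc i)) (dmat p d i)"
abbreviation "dT i \<equiv> tensor_map R (Rpow (p (Suc i))) (Rpow (p i)) X (d i)"
abbreviation "\<theta> i \<equiv> free_tensor X (p i)"

lemma dX_lin_hom: "dX i \<in> lin_hom R (Xp (Suc i)) (Xp i)"
  by (rule act_lin_hom[OF X dmat_mat])

lemma dX_image_submodule: "submodule (dX i ` carrier (Xp (Suc i))) R (Xp i)"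
  by (rule submodule_image[OF direct_power_module[OF X] direct_power_module[OF X] dX_lin_hom
      submodule_carrier[OF direct_power_module[OF X]]])

lemma dT_theta: "x \<in> carrier (Xp (Suc i)) \<Longrightarrow> dT i (\<theta> (Suc i) x) = \<theta> i (dX i x)"
  using tensor_map_free_tensor[OF X d refl] by (simp add: dmat_def)

lemma theta_surj: "\<theta> i ` carrier (Xp i) = carrier (Tp i)"
  using free_tensor_bij[OF X] by (simp only: bij_betw_def)

lemma theta_zero_iff: "x \<in> carrier (Xp i) \<Longrightarrow> \<theta> i x = \<zero>\<^bsub>Tp i\<^esub> \<longleftrightarrow> x = \<zero>\<^bsub>Xp i\<^esub>"
proof -
  assume x: "x \<in> carrier (Xp i)"
  have z: "\<theta> i \<zero>\<^bsub>Xp i\<^esub> = \<zero>\<^bsub>Tp i\<^esub>"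
    by (rule lin_hom_zero[OF direct_power_module[OF X] tensor_module[OF Rpow_module X] free_tensor_lin_hom[OF X]])
  have inj: "inj_on (\<theta> i) (carrier (Xp i))" using free_tensor_bij[OF X] by (simp only: bij_betw_def)
  show ?thesis
    using inj_on_eq_iff[OF inj x submodule_zero[OF direct_power_module[OF X] submodule_carrier[OF direct_power_module[OF X]]]]
    unfolding z .
qed

lemma dT_image: "dT i ` carrier (Tp (Suc i)) = \<theta> i ` dX i ` carrier (Xp (Suc i))"
  unfolding theta_surj[symmetric] image_image by (intro image_cong refl dT_theta)

lemma dT_kernel: "lin_kernel (Tp (Suc i)) (Tp i) (dT i) = \<theta> (Suc i) ` lin_kernel (Xp (Suc i)) (Xp i) (dX i)"
proof -
  have eq: "dT i (\<theta> (Suc i) x) = \<zero>\<^bsub>Tp i\<^esub> \<longleftrightarrow> dX i x = \<zero>\<^bsub>Xp i\<^esub>" if x: "x \<in> carrier (Xp (Suc i))" for x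
    unfolding dT_theta[OF x] by (rule theta_zero_iff[OF lin_hom_closed[OF dX_lin_hom x]])
  show ?thesis
  proof
    show "lin_kernel (Tp (Suc i)) (Tp i) (dT i) \<subseteq> \<theta> (Suc i) ` lin_kernel (Xp (Suc i)) (Xp i) (dX i)"
    proof
      fix t assume "t \<in> lin_kernel (Tp (Suc i)) (Tp i) (dT i)"
      then have t: "t \<in> carrier (Tp (Suc i))" "dT i t = \<zero>\<^bsub>Tp i\<^esub>" by (simp_all only: lin_kernel_def mem_Collect_eq)
      obtain x where x: "x \<in> carrier (Xp (Suc i))" "t = \<theta> (Suc i) x"
        using t(1) unfolding theta_surj[symmetric] by (elim imageE)
      have "x \<in> lin_kernel (Xp (Suc i)) (Xp i) (dX i)"
        using eq[OF x(1)] t(2) x by (simp only: lin_kernel_def mem_Collect_eq simp_thms)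
      then show "t \<in> \<theta> (Suc i) ` lin_kernel (Xp (Suc i)) (Xp i) (dX i)" using x(2) by (intro image_eqI)
    qed
    show "\<theta> (Suc i) ` lin_kernel (Xp (Suc i)) (Xp i) (dX i) \<subseteq> lin_kernel (Tp (Suc i)) (Tp i) (dT i)"
    proof
      fix t assume "t \<in> \<theta> (Suc i) ` lin_kernel (Xp (Suc i)) (Xp i) (dX i)"
      then obtain x where x: "x \<in> lin_kernel (Xp (Suc i)) (Xp i) (dX i)" "t = \<theta> (Suc i) x" by (elim imageE)
      then have xc: "x \<in> carrier (Xp (Suc i))" "dX i x = \<zero>\<^bsub>Xp i\<^esub>" by (simp_all only: lin_kernel_def mem_Collect_eq)
      have "t \<in> carrier (Tp (Suc i))" unfolding x(2) theta_surj[symmetric] by (rule imageI[OF xc(1)])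
      then show "t \<in> lin_kernel (Tp (Suc i)) (Tp i) (dT i)"
        using eq[OF xc(1)] xc(2) x(2) by (simp only: lin_kernel_def mem_Collect_eq simp_thms)
    qed
  qed
qed

abbreviation "cycT i \<equiv> (case i of 0 \<Rightarrow> carrier (Tp 0) | Suc j \<Rightarrow> lin_kernel (Tp (Suc j)) (Tp j) (dT j))"
abbreviation "cycX i \<equiv> (case i of 0 \<Rightarrow> carrier (Xp 0) | Suc j \<Rightarrow> lin_kernel (Xp (Suc j)) (Xp j) (dX j))"

lemma cycX_submodule: "submodule (cycX i) R (Xp i)"
  by (cases i) (simp_all only: nat.case submodule_carrier[OF direct_power_module[OF X]]
      submodule_lin_kernel[OF direct_power_module[OF X] direct_power_module[OF X] dX_lin_hom])

lemma cycT_eq: "cycT i = \<theta> i ` cycX i"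
  by (cases i) (simp_all only: nat.case theta_surj dT_kernel)

lemma boundary_cycle: "dX i ` carrier (Xp (Suc i)) \<subseteq> cycX i"
proof (cases i)
  case 0
  then show ?thesis using lin_hom_closed[OF dX_lin_hom[of 0]] by (auto simp only: nat.case)
next
  case (Suc j)
  have "dX (Suc j) x \<in> lin_kernel (Xp (Suc j)) (Xp j) (dX j)" if x: "x \<in> carrier (Xp (Suc (Suc j)))" for x
    using act_dmat_complex[of x j] lin_hom_closed[OF dX_lin_hom x] x
    by (simp only: lin_kernel_def mem_Collect_eq direct_power_simps(1) simp_thms)
  then show ?thesis unfolding Suc by (auto simp only: nat.case)
qed

text \<open>
  The isomorphisms \<open>X\<^sup>p\<^sup>(\<^sup>i\<^sup>) \<cong> R\<^sup>p\<^sup>(\<^sup>i\<^sup>) \<otimes> X\<close> carry the action of the matrices to the tensored differentials, so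
  cycles and boundaries correspond.  The last part records that the homology is a quotient of the
  cycles; through it the homology inherits being killed by the maximal ideal.
\<close>

lemma tensor_homology:
  defines "H \<equiv> \<lambda>i. homology Tp dT i"
  shows "Module.module R (H i)"
    and "slen (H i) {\<zero>\<^bsub>H i\<^esub>} (carrier (H i)) = slen (Xp i) (dX i ` carrier (Xp (Suc i))) (cycX i)"
    and "zero_module (H i) \<longleftrightarrow> cycX i = dX i ` carrier (Xp (Suc i))"
    and "\<exists>g. g \<in> lin_hom R ((Xp i)\<lparr>carrier := cycX i\<rparr>) (H i) \<and> g ` cycX i = carrier (H i)"
proof -
  note XM = direct_power_module[OF X] and T = tensor_module[OF Rpow_module X] and th = free_tensor_lin_hom[OF X]
  have H: "H i = quot_module ((Tp i)\<lparr>carrier := cycT i\<rparr>) (dT i ` carrier (Tp (Suc i)))"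
    unfolding H_def homology_def ..
  have inj: "inj_on (\<theta> i) (carrier (Xp i))" using free_tensor_bij[OF X] by (simp only: bij_betw_def)
  have Z: "submodule (cycT i) R (Tp i)" unfolding cycT_eq by (rule submodule_image[OF XM T th cycX_submodule])
  have B: "submodule (dT i ` carrier (Tp (Suc i))) R (Tp i)"
    unfolding dT_image by (rule submodule_image[OF XM T th dX_image_submodule])
  have BZ: "dT i ` carrier (Tp (Suc i)) \<subseteq> cycT i"
    unfolding dT_image cycT_eq by (rule image_mono[OF boundary_cycle])
  note sq = T Z B BZ
  show "Module.module R (H i)" unfolding H by (rule subquotient_module[OF sq])
  have cyc_c: "cycX i \<subseteq> carrier (Xp i)" by (rule submodule_sub[OF XM cycX_submodule])
  have "slen (Tp i) (\<theta> i ` dX i ` carrier (Xp (Suc i))) (\<theta> i ` cycX i) = slen (Xp i) (dX i ` carrier (Xp (Suc i))) (cycX i)"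
  proof (rule slen_image[OF XM T th dX_image_submodule cycX_submodule boundary_cycle])
    fix x assume x: "x \<in> cycX i" "\<theta> i x = \<zero>\<^bsub>Tp i\<^esub>"
    have "x = \<zero>\<^bsub>Xp i\<^esub>" by (rule iffD1[OF theta_zero_iff[OF subsetD[OF cyc_c x(1)]] x(2)])
    then show "x \<in> dX i ` carrier (Xp (Suc i))" using submodule_zero[OF XM dX_image_submodule] by simp
  qed
  then show "slen (H i) {\<zero>\<^bsub>H i\<^esub>} (carrier (H i)) = slen (Xp i) (dX i ` carrier (Xp (Suc i))) (cycX i)"
    unfolding H subquotient_slen[OF sq] unfolding dT_image cycT_eq .
  have "zero_module (H i) \<longleftrightarrow> \<theta> i ` cycX i = \<theta> i ` dX i ` carrier (Xp (Suc i))"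
    unfolding H subquotient_zero_iff[OF sq] unfolding dT_image cycT_eq ..
  also have "\<dots> \<longleftrightarrow> cycX i = dX i ` carrier (Xp (Suc i))"
    by (rule inj_on_image_eq_iff[OF inj cyc_c submodule_sub[OF XM dX_image_submodule]])
  finally show "zero_module (H i) \<longleftrightarrow> cycX i = dX i ` carrier (Xp (Suc i))" .
  let ?T' = "(Tp i)\<lparr>carrier := cycT i\<rparr>" and ?X' = "(Xp i)\<lparr>carrier := cycX i\<rparr>"
  have th': "\<theta> i \<in> lin_hom R ?X' ?T'"
    by (rule lin_hom_restrict[OF th cyc_c]) (simp only: cycT_eq order_refl)
  have q: "(\<lambda>x. dT i ` carrier (Tp (Suc i)) +>\<^bsub>?T'\<^esub> x) \<in> lin_hom R ?T' (H i)"
    unfolding H by (rule quot_map_lin_hom[OF subquotient_base[OF sq]])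
  have "(\<lambda>x. dT i ` carrier (Tp (Suc i)) +>\<^bsub>?T'\<^esub> \<theta> i x) ` cycX i = carrier (H i)"
    unfolding H quot_map_surj[OF subquotient_base[OF sq], symmetric] by (simp add: image_image cycT_eq)
  then show "\<exists>g. g \<in> lin_hom R ?X' (H i) \<and> g ` cycX i = carrier (H i)"
    using lin_hom_comp[OF th' q] by (intro exI conjI)
qed

abbreviation "Hp i \<equiv> Hom_module R (Rpow (p i)) X"
abbreviation "dH i \<equiv> (\<lambda>h. compose (carrier (Rpow (p (Suc i)))) h (d i))"
abbreviation "dXt i \<equiv> act X (p (Suc i)) (p i) (mtransp (dmat p d i))"
abbreviation "\<psi> i \<equiv> free_hom (p i)"

lemma dXt_lin_hom: "dXt i \<in> lin_hom R (Xp i) (Xp (Suc i))"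
  by (rule act_lin_hom[OF X mat_transp[OF dmat_mat]])

lemma Hp_module: "Module.module R (Hp i)"
  by (rule Hom_module_module[OF Rpow_module X])

lemma dH_lin_hom: "dH i \<in> lin_hom R (Hp i) (Hp (Suc i))"
proof (rule lin_homI)
  fix h assume h: "h \<in> carrier (Hp i)"
  then have hl: "h \<in> lin_hom R (Rpow (p i)) X" by (simp add: Hom_module_simps)
  have "dH i h \<in> lin_hom R (Rpow (p (Suc i))) X"
    by (rule lin_hom_cong[OF Rpow_module lin_hom_comp[OF d hl]]) (simp only: compose_def restrict_apply if_True)
  then show "dH i h \<in> carrier (Hp (Suc i))"
    by (simp add: Hom_module_simps compose_def)
next
  fix h h'
  show "dH i (h \<oplus>\<^bsub>Hp i\<^esub> h') = dH i h \<oplus>\<^bsub>Hp (Suc i)\<^esub> dH i h'"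
    using lin_hom_closed[OF d[of i]]
    by (intro extensionalityI[of _ "carrier (Rpow (p (Suc i)))"])
      (simp_all add: Hom_module_simps compose_def del: direct_power_simps)
next
  fix a h
  show "dH i (a \<odot>\<^bsub>Hp i\<^esub> h) = a \<odot>\<^bsub>Hp (Suc i)\<^esub> dH i h"
    using lin_hom_closed[OF d[of i]]
    by (intro extensionalityI[of _ "carrier (Rpow (p (Suc i)))"])
      (simp_all add: Hom_module_simps compose_def del: direct_power_simps)
qed

lemma psi_dH: "h \<in> carrier (Hp i) \<Longrightarrow> \<psi> (Suc i) (dH i h) = dXt i (\<psi> i h)"
  by (rule free_hom_compose[OF X d]) (simp_all only: dmat_def)

lemma psi_surj: "\<psi> i ` carrier (Hp i) = carrier (Xp i)"
  using free_hom_bij[OF X] by (simp only: bij_betw_def)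

lemma psi_inj: "inj_on (\<psi> i) (carrier (Hp i))"
  using free_hom_bij[OF X] by (simp only: bij_betw_def)

lemma psi_zero_iff: "h \<in> carrier (Hp i) \<Longrightarrow> \<psi> i h = \<zero>\<^bsub>Xp i\<^esub> \<longleftrightarrow> h = \<zero>\<^bsub>Hp i\<^esub>"
proof -
  assume h: "h \<in> carrier (Hp i)"
  have z: "\<psi> i \<zero>\<^bsub>Hp i\<^esub> = \<zero>\<^bsub>Xp i\<^esub>"
    by (rule lin_hom_zero[OF Hp_module direct_power_module[OF X] free_hom_lin_hom[OF X]])
  show ?thesis
    using inj_on_eq_iff[OF psi_inj h submodule_zero[OF Hp_module submodule_carrier[OF Hp_module]]]
    unfolding z .
qed

lemma psi_kernel: "\<psi> i ` lin_kernel (Hp i) (Hp (Suc i)) (dH i) = lin_kernel (Xp i) (Xp (Suc i)) (dXt i)"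
proof -
  have eq: "dH i h = \<zero>\<^bsub>Hp (Suc i)\<^esub> \<longleftrightarrow> dXt i (\<psi> i h) = \<zero>\<^bsub>Xp (Suc i)\<^esub>" if h: "h \<in> carrier (Hp i)" for h
    unfolding psi_dH[OF h, symmetric] psi_zero_iff[OF lin_hom_closed[OF dH_lin_hom h]] ..
  show ?thesis
  proof
    show "\<psi> i ` lin_kernel (Hp i) (Hp (Suc i)) (dH i) \<subseteq> lin_kernel (Xp i) (Xp (Suc i)) (dXt i)"
    proof
      fix x assume "x \<in> \<psi> i ` lin_kernel (Hp i) (Hp (Suc i)) (dH i)"
      then obtain h where h: "h \<in> lin_kernel (Hp i) (Hp (Suc i)) (dH i)" "x = \<psi> i h" by (elim imageE)
      then have hc: "h \<in> carrier (Hp i)" "dH i h = \<zero>\<^bsub>Hp (Suc i)\<^esub>" by (simp_all only: lin_kernel_def mem_Collect_eq)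
      have "x \<in> carrier (Xp i)" unfolding h(2) psi_surj[symmetric] by (rule imageI[OF hc(1)])
      then show "x \<in> lin_kernel (Xp i) (Xp (Suc i)) (dXt i)"
        using eq[OF hc(1)] hc(2) h(2) by (simp only: lin_kernel_def mem_Collect_eq simp_thms)
    qed
    show "lin_kernel (Xp i) (Xp (Suc i)) (dXt i) \<subseteq> \<psi> i ` lin_kernel (Hp i) (Hp (Suc i)) (dH i)"
    proof
      fix x assume "x \<in> lin_kernel (Xp i) (Xp (Suc i)) (dXt i)"
      then have x: "x \<in> carrier (Xp i)" "dXt i x = \<zero>\<^bsub>Xp (Suc i)\<^esub>" by (simp_all only: lin_kernel_def mem_Collect_eq)
      obtain h where h: "h \<in> carrier (Hp i)" "x = \<psi> i h"
        using x(1) unfolding psi_surj[symmetric] by (elim imageE)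
      have "h \<in> lin_kernel (Hp i) (Hp (Suc i)) (dH i)"
        using eq[OF h(1)] x(2) h by (simp only: lin_kernel_def mem_Collect_eq simp_thms)
      then show "x \<in> \<psi> i ` lin_kernel (Hp i) (Hp (Suc i)) (dH i)" using h(2) by (intro image_eqI)
    qed
  qed
qed

text \<open>
  Under \<open>Hom(R\<^sup>p\<^sup>(\<^sup>i\<^sup>), X) \<cong> X\<^sup>p\<^sup>(\<^sup>i\<^sup>)\<close>, composition with a differential is the action of the transposed matrix.
\<close>

lemma hom_cohomology_zero_iff:
  "zero_module (cohomology Hp dH (Suc j)) \<longleftrightarrow>
    lin_kernel (Xp (Suc j)) (Xp (Suc (Suc j))) (dXt (Suc j)) = dXt j ` carrier (Xp j)"
proof -
  have H: "cohomology Hp dH (Suc j) = quot_module ((Hp (Suc j))\<lparr>carrier :=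
      lin_kernel (Hp (Suc j)) (Hp (Suc (Suc j))) (dH (Suc j))\<rparr>) (dH j ` carrier (Hp j))"
    unfolding cohomology_def nat.case ..
  have Z: "submodule (lin_kernel (Hp (Suc j)) (Hp (Suc (Suc j))) (dH (Suc j))) R (Hp (Suc j))"
    by (rule submodule_lin_kernel[OF Hp_module Hp_module dH_lin_hom])
  have B: "submodule (dH j ` carrier (Hp j)) R (Hp (Suc j))"
    by (rule submodule_image[OF Hp_module Hp_module dH_lin_hom submodule_carrier[OF Hp_module]])
  have psi_B: "\<psi> (Suc j) ` dH j ` carrier (Hp j) = dXt j ` carrier (Xp j)"
    unfolding psi_surj[symmetric] image_image by (intro image_cong refl psi_dH)
  have BZ: "dH j ` carrier (Hp j) \<subseteq> lin_kernel (Hp (Suc j)) (Hp (Suc (Suc j))) (dH (Suc j))"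
  proof -
    have "dXt (Suc j) (dXt j x) = \<zero>\<^bsub>Xp (Suc (Suc j))\<^esub>" if "x \<in> carrier (Xp j)" for x
      using act_dmat_cocomplex[of x j] that by simp
    then have "dXt j ` carrier (Xp j) \<subseteq> lin_kernel (Xp (Suc j)) (Xp (Suc (Suc j))) (dXt (Suc j))"
      using lin_hom_closed[OF dXt_lin_hom[of j]] by (auto simp: lin_kernel_def simp del: direct_power_simps)
    then have "\<psi> (Suc j) ` dH j ` carrier (Hp j) \<subseteq> \<psi> (Suc j) ` lin_kernel (Hp (Suc j)) (Hp (Suc (Suc j))) (dH (Suc j))"
      unfolding psi_B psi_kernel .
    then have sub: "\<psi> (Suc j) h \<in> \<psi> (Suc j) ` lin_kernel (Hp (Suc j)) (Hp (Suc (Suc j))) (dH (Suc j))"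
      if "h \<in> dH j ` carrier (Hp j)" for h
      by (rule subsetD) (rule imageI[OF that])
    show ?thesis
    proof
      fix h assume h: "h \<in> dH j ` carrier (Hp j)"
      show "h \<in> lin_kernel (Hp (Suc j)) (Hp (Suc (Suc j))) (dH (Suc j))"
        by (rule iffD1[OF inj_on_image_mem_iff[OF psi_inj submodule_carrierD[OF Hp_module B h]
              submodule_sub[OF Hp_module Z]] sub[OF h]])
    qed
  qed
  have "zero_module (cohomology Hp dH (Suc j)) \<longleftrightarrow>
      lin_kernel (Hp (Suc j)) (Hp (Suc (Suc j))) (dH (Suc j)) = dH j ` carrier (Hp j)"
    unfolding H by (rule subquotient_zero_iff[OF Hp_module Z B BZ])
  also have "\<dots> \<longleftrightarrow> \<psi> (Suc j) ` lin_kernel (Hp (Suc j)) (Hp (Suc (Suc j))) (dH (Suc j)) = \<psi> (Suc j) ` dH j ` carrier (Hp j)"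
    by (rule inj_on_image_eq_iff[OF psi_inj submodule_sub[OF Hp_module Z] submodule_sub[OF Hp_module B], symmetric])
  finally show ?thesis unfolding psi_B psi_kernel .
qed

end

end

section \<open>Dimension over the residue field\<close>

context noetherian_local_ring
begin

lemma killed_kernel:
  assumes H: "Module.module R H" and k: "killed H (carrier H)" and g: "g \<in> lin_hom R (Rpow j) H"
    and x: "x \<in> max_vec j"
  shows "g x = \<zero>\<^bsub>H\<^esub>"
proof -
  interpret H: Module.module R H by (rule H)
  have xc: "x \<in> {..<j} \<rightarrow>\<^sub>E carrier R" using submodule_carrierD[OF Rpow_module max_vec_submodule x] by simp
  have xn: "x i \<in> \<nn>" if "i < j" for i using PiE_mem[OF x[unfolded max_vec_def]] that by simp
  have "g x = (\<Oplus>\<^bsub>H\<^esub>i\<in>{..<j}. \<zero>\<^bsub>H\<^esub>)"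
    unfolding lin_hom_vec[OF H g xc]
    using k xn lin_hom_closed[OF g] unit_vec_closed by (intro H.finsum_cong' refl) (simp_all add: killed_def)
  then show ?thesis by (simp add: H.finsum_zero)
qed

lemma slen_max_vec_quotient:
  assumes H: "Module.module R H" and k: "killed H (carrier H)" and g: "g \<in> lin_hom R (Rpow j) H"
    and ker: "\<And>x. x \<in> carrier (Rpow j) \<Longrightarrow> g x = \<zero>\<^bsub>H\<^esub> \<Longrightarrow> x \<in> max_vec j"
  shows "slen H {\<zero>\<^bsub>H\<^esub>} (g ` carrier (Rpow j)) = enat j"
proof -
  have K: "g ` max_vec j = {\<zero>\<^bsub>H\<^esub>}"
    using killed_kernel[OF H k g] submodule_zero[OF Rpow_module max_vec_submodule, of j] by force
  have "slen H (g ` max_vec j) (g ` carrier (Rpow j)) = slen (Rpow j) (max_vec j) (carrier (Rpow j))"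
    by (rule slen_image[OF Rpow_module H g max_vec_submodule submodule_carrier[OF Rpow_module]
        submodule_sub[OF Rpow_module max_vec_submodule] ker])
  then show ?thesis unfolding K slen_max_vec .
qed

text \<open>
  A module of finite length that is killed by the maximal ideal is the reduction of a free module:
  take a map from \<open>R\<^sup>j\<close> that is injective modulo the maximal ideal, with \<open>j\<close> maximal.
\<close>

lemma residue_coordinates:
  assumes H: "Module.module R H" and k: "killed H (carrier H)" and len: "slen H {\<zero>\<^bsub>H\<^esub>} (carrier H) = enat k"
  obtains g where "g \<in> lin_hom R (Rpow k) H" "g ` carrier (Rpow k) = carrier H"
    and "\<And>x. x \<in> carrier (Rpow k) \<Longrightarrow> g x = \<zero>\<^bsub>H\<^esub> \<Longrightarrow> x \<in> max_vec k"
proof -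
  interpret H: Module.module R H by (rule H)
  define P where "P j \<longleftrightarrow> (\<exists>g. g \<in> lin_hom R (Rpow j) H \<and> (\<forall>x\<in>carrier (Rpow j). g x = \<zero>\<^bsub>H\<^esub> \<longrightarrow> x \<in> max_vec j))" for j
  have "(\<lambda>_. \<zero>\<^bsub>H\<^esub>) \<in> lin_hom R (Rpow 0) H" by (rule lin_homI) simp_all
  moreover have "x \<in> max_vec 0" if "x \<in> carrier (Rpow 0)" for x using that by (simp add: max_vec_def)
  ultimately have P0: "P 0" unfolding P_def by blast
  have bound: "j \<le> k" if Pj: "P j" for j
  proof -
    obtain g where g: "g \<in> lin_hom R (Rpow j) H" "\<And>x. x \<in> carrier (Rpow j) \<Longrightarrow> g x = \<zero>\<^bsub>H\<^esub> \<Longrightarrow> x \<in> max_vec j"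
      using Pj unfolding P_def by blast
    have "slen H {\<zero>\<^bsub>H\<^esub>} (g ` carrier (Rpow j)) \<le> slen H {\<zero>\<^bsub>H\<^esub>} (carrier H)"
      using lin_hom_closed[OF g(1)] by (intro slen_mono) auto
    then show ?thesis using slen_max_vec_quotient[OF H k g] len by simp
  qed
  define j where "j = (GREATEST j. P j)"
  have Pj: "P j" unfolding j_def by (rule GreatestI_nat[of P 0 k, OF P0]) (rule bound)
  have nP: "\<not> P (Suc j)" using Greatest_le_nat[of P "Suc j" k] bound unfolding j_def by fastforce
  obtain g where g: "g \<in> lin_hom R (Rpow j) H" and ker: "\<And>x. x \<in> carrier (Rpow j) \<Longrightarrow> g x = \<zero>\<^bsub>H\<^esub> \<Longrightarrow> x \<in> max_vec j"
    using Pj unfolding P_def by blast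
  have surj: "g ` carrier (Rpow j) = carrier H"
  proof (rule ccontr)
    assume "g ` carrier (Rpow j) \<noteq> carrier H"
    moreover have "g ` carrier (Rpow j) \<subseteq> carrier H" using lin_hom_closed[OF g] by auto
    ultimately obtain v where v: "v \<in> carrier H" "v \<notin> g ` carrier (Rpow j)" by blast
    define g' where "g' y = g (restrict y {..<j}) \<oplus>\<^bsub>H\<^esub> y j \<odot>\<^bsub>H\<^esub> v" for y
    have g': "g' \<in> lin_hom R (Rpow (Suc j)) H" unfolding g'_def by (rule append_lin_homs[OF H g v(1)])
    have "x \<in> max_vec (Suc j)" if x: "x \<in> carrier (Rpow (Suc j))" and x0: "g' x = \<zero>\<^bsub>H\<^esub>" for x
    proof -
      let ?y = "restrict x {..<j}"
      have y: "?y \<in> carrier (Rpow j)" and xj: "x j \<in> carrier R" using x by (auto simp: PiE_iff)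
      have gy: "g ?y \<in> carrier H" by (rule lin_hom_closed[OF g y])
      have "x j \<in> \<nn>"
      proof (rule ccontr)
        assume "x j \<notin> \<nn>"
        then have u: "x j \<in> Units R" by (rule unit_if_not_max[OF xj])
        let ?c = "\<ominus> (inv (x j))"
        have ic: "inv (x j) \<in> carrier R" using u by simp
        have "x j \<odot>\<^bsub>H\<^esub> v = \<ominus>\<^bsub>H\<^esub> g ?y"
          using x0 gy v(1) xj unfolding g'_def by (intro H.minus_equality[symmetric]) (simp_all add: H.a_comm)
        then have "v = inv (x j) \<odot>\<^bsub>H\<^esub> (\<ominus>\<^bsub>H\<^esub> g ?y)"
          using H.smult_assoc1[OF ic xj v(1)] u v(1) by simp
        also have "\<dots> = ?c \<odot>\<^bsub>H\<^esub> g ?y" using ic gy by (simp add: H.smult_r_minus H.smult_l_minus)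
        also have "\<dots> = g (?c \<odot>\<^bsub>Rpow j\<^esub> ?y)" using lin_hom_smult[OF g _ y, of ?c] ic by simp
        finally have "v = g (?c \<odot>\<^bsub>Rpow j\<^esub> ?y)" .
        moreover have "?c \<odot>\<^bsub>Rpow j\<^esub> ?y \<in> carrier (Rpow j)"
          using ic y by (intro submodule_smult[OF Rpow_module submodule_carrier[OF Rpow_module]]) simp_all
        ultimately show False using v(2) by (metis imageI)
      qed
      then have "x j \<odot>\<^bsub>H\<^esub> v = \<zero>\<^bsub>H\<^esub>" using k v(1) by (simp add: killed_def)
      then have "g ?y = \<zero>\<^bsub>H\<^esub>" using x0 gy by (simp add: g'_def)
      then have "?y \<in> max_vec j" by (rule ker[OF y])
      then have "x i \<in> \<nn>" if "i < j" for i using that PiE_mem[of ?y "{..<j}" "\<lambda>_. \<nn>" i] by (simp add: max_vec_def)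
      then have "x i \<in> \<nn>" if "i < Suc j" for i using that \<open>x j \<in> \<nn>\<close> by (cases "i = j") simp_all
      then show ?thesis using x by (simp add: max_vec_def PiE_iff)
    qed
    then have "P (Suc j)" unfolding P_def using g' by blast
    then show False using nP by simp
  qed
  have "j = k" using slen_max_vec_quotient[OF H k g ker] len unfolding surj by simp
  then show ?thesis using that g surj ker by blast
qed

lemma residue_space_smult:
  assumes H: "Module.module R H" and k: "killed H (carrier H)" and a: "a \<in> carrier R" and v: "v \<in> carrier H"
  shows "(\<nn> +> a) \<odot>\<^bsub>residue_space H\<^esub> v = a \<odot>\<^bsub>H\<^esub> v"
proof -
  have eq: "b \<odot>\<^bsub>H\<^esub> v = a \<odot>\<^bsub>H\<^esub> v" if b: "b \<in> \<nn> +> a" for b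
  proof -
    have bc: "b \<in> carrier R" using b a_r_coset_subset_G[OF a_subset a] by blast
    have "b \<ominus> a \<in> \<nn>" using a_rcos_module[OF a bc] b by (simp add: a_minus_def)
    then show ?thesis by (rule killed_smult_eq[OF H k order_refl v bc a])
  qed
  have "(THE w. \<forall>b\<in>\<nn> +> a. w = b \<odot>\<^bsub>H\<^esub> v) = a \<odot>\<^bsub>H\<^esub> v"
  proof (rule the_equality)
    show "\<forall>b\<in>\<nn> +> a. a \<odot>\<^bsub>H\<^esub> v = b \<odot>\<^bsub>H\<^esub> v" by (intro ballI sym[OF eq])
    fix w assume w: "\<forall>b\<in>\<nn> +> a. w = b \<odot>\<^bsub>H\<^esub> v"
    show "w = a \<odot>\<^bsub>H\<^esub> v" by (rule bspec[OF w a_rcos_self[OF a]])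
  qed
  then show ?thesis by (simp add: residue_space_def)
qed

lemma residue_space_finsum: "finsum (residue_space H) f B = finsum H f B"
  by (simp add: finsum_def finprod_def residue_space_def)

text \<open>
  Bases over the residue field are the images of the unit vectors under a map as in
  \<open>residue_coordinates\<close>.
\<close>

context
  fixes H :: "('a, 'c, 'm) module_scheme" and k :: nat and g :: "(nat \<Rightarrow> 'a) \<Rightarrow> 'c" and e :: "nat \<Rightarrow> 'c"
  assumes H: "Module.module R H" and kH: "killed H (carrier H)" and g: "g \<in> lin_hom R (Rpow k) H"
    and ge: "\<And>i. i < k \<Longrightarrow> g (unit_vec k i) = e i" and inj: "inj_on e {..<k}"
begin

interpretation H: Module.module R H by (rule H)

lemma coord_sum:
  assumes x: "x \<in> carrier (Rpow k)" and c: "c = (\<lambda>b\<in>e ` {..<k}. \<nn> +> x (inv_into {..<k} e b))"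
  shows "(\<Oplus>\<^bsub>residue_space H\<^esub>b\<in>e ` {..<k}. c b \<odot>\<^bsub>residue_space H\<^esub> b) = g x"
proof -
  have ec: "e i \<in> carrier H" if "i < k" for i
    using lin_hom_closed[OF g, of "unit_vec k i"] unit_vec_closed[OF that] ge[OF that] by simp
  have xc: "x i \<in> carrier R" if "i < k" for i using PiE_mem[of x "{..<k}" "\<lambda>_. carrier R" i] x that by simp
  have ce: "c (e i) \<odot>\<^bsub>residue_space H\<^esub> e i = x i \<odot>\<^bsub>H\<^esub> e i" if "i < k" for i
    using that inj by (simp add: c residue_space_smult[OF H kH xc ec])
  have "(\<Oplus>\<^bsub>H\<^esub>b\<in>e ` {..<k}. c b \<odot>\<^bsub>residue_space H\<^esub> b) = (\<Oplus>\<^bsub>H\<^esub>i\<in>{..<k}. c (e i) \<odot>\<^bsub>residue_space H\<^esub> e i)"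
    using inj ce xc ec by (intro H.add.finprod_reindex) auto
  also have "\<dots> = (\<Oplus>\<^bsub>H\<^esub>i\<in>{..<k}. x i \<odot>\<^bsub>H\<^esub> g (unit_vec k i))"
    using ce xc ec ge by (intro H.finsum_cong' refl) simp_all
  also have "\<dots> = g x" using lin_hom_vec[OF H g] x by simp
  finally show ?thesis unfolding residue_space_finsum .
qed

lemma coord_exists:
  assumes c: "c \<in> e ` {..<k} \<rightarrow>\<^sub>E carrier (R Quot \<nn>)"
  obtains x where "x \<in> carrier (Rpow k)" "c = (\<lambda>b\<in>e ` {..<k}. \<nn> +> x (inv_into {..<k} e b))"
proof -
  have "\<exists>a\<in>carrier R. c (e i) = \<nn> +> a" if "i < k" for i
    using PiE_mem[OF c, of "e i"] that by (auto simp: FactRing_def A_RCOSETS_def')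
  then obtain y where y: "\<And>i. i < k \<Longrightarrow> y i \<in> carrier R \<and> c (e i) = \<nn> +> y i" by metis
  let ?x = "restrict y {..<k}"
  have "c = (\<lambda>b\<in>e ` {..<k}. \<nn> +> ?x (inv_into {..<k} e b))"
  proof (rule extensionalityI[of _ "e ` {..<k}"])
    show "c \<in> extensional (e ` {..<k})" using c by (simp add: PiE_def)
    fix b assume "b \<in> e ` {..<k}"
    then obtain i where "i < k" "b = e i" by auto
    then show "c b = (\<lambda>b\<in>e ` {..<k}. \<nn> +> ?x (inv_into {..<k} e b)) b" using y inj by simp
  qed simp
  moreover have "?x \<in> carrier (Rpow k)" using y by simp
  ultimately show ?thesis using that by blast
qed

lemma coord_eq_iff:
  assumes x: "x \<in> carrier (Rpow k)" and y: "y \<in> carrier (Rpow k)"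
  shows "(\<lambda>b\<in>e ` {..<k}. \<nn> +> x (inv_into {..<k} e b)) = (\<lambda>b\<in>e ` {..<k}. \<nn> +> y (inv_into {..<k} e b))
    \<longleftrightarrow> x \<ominus>\<^bsub>Rpow k\<^esub> y \<in> max_vec k"
proof -
  interpret F: Module.module R "Rpow k" by (rule Rpow_module)
  have xc: "x i \<in> carrier R" "y i \<in> carrier R" if "i < k" for i
    using PiE_mem[of x "{..<k}" "\<lambda>_. carrier R" i] PiE_mem[of y "{..<k}" "\<lambda>_. carrier R" i] x y that by simp_all
  have cos: "\<nn> +> x i = \<nn> +> y i \<longleftrightarrow> x i \<ominus> y i \<in> \<nn>" if i: "i < k" for i
    using a_repr_independence'[of "x i" "y i"] a_rcos_self[OF xc(1)[OF i]] a_rcos_module[OF xc(2)[OF i] xc(1)[OF i]] xc[OF i]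
    by (auto simp: a_minus_def)
  have "(\<lambda>b\<in>e ` {..<k}. \<nn> +> x (inv_into {..<k} e b)) = (\<lambda>b\<in>e ` {..<k}. \<nn> +> y (inv_into {..<k} e b))
      \<longleftrightarrow> (\<forall>i<k. \<nn> +> x i = \<nn> +> y i)" (is "?l = ?r \<longleftrightarrow> _")
  proof
    assume eq: "?l = ?r"
    have "\<nn> +> x i = \<nn> +> y i" if "i < k" for i using fun_cong[OF eq, of "e i"] that inj by simp
    then show "\<forall>i<k. \<nn> +> x i = \<nn> +> y i" by blast
  next
    assume "\<forall>i<k. \<nn> +> x i = \<nn> +> y i"
    then show "?l = ?r" using inj by (intro restrict_ext) auto
  qed
  also have "\<dots> \<longleftrightarrow> (\<forall>i<k. (x \<ominus>\<^bsub>Rpow k\<^esub> y) i \<in> \<nn>)" using cos Rpow_minus_nth[OF x y] by simp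
  also have "\<dots> \<longleftrightarrow> x \<ominus>\<^bsub>Rpow k\<^esub> y \<in> max_vec k"
  proof -
    have "x \<ominus>\<^bsub>Rpow k\<^esub> y \<in> extensional {..<k}" using F.minus_closed[OF x y] by (simp add: PiE_def)
    then show ?thesis unfolding max_vec_def PiE_iff by (simp only: Ball_def lessThan_iff simp_thms)
  qed
  finally show ?thesis .
qed

lemma finite_basis_iff:
  "finite_basis (R Quot \<nn>) (residue_space H) (e ` {..<k}) \<longleftrightarrow>
    g ` carrier (Rpow k) = carrier H \<and> (\<forall>x\<in>carrier (Rpow k). g x = \<zero>\<^bsub>H\<^esub> \<longrightarrow> x \<in> max_vec k)"
proof -
  interpret F: Module.module R "Rpow k" by (rule Rpow_module)
  let ?B = "e ` {..<k}" and ?V = "residue_space H" and ?K = "R Quot \<nn>"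
  \<comment> \<open>The coordinate function of \<open>g x\<close> over the residue field.\<close>
  define c where "c x = (\<lambda>b\<in>?B. \<nn> +> x (inv_into {..<k} e b))" for x :: "nat \<Rightarrow> 'a"
  define rep where "rep v c \<longleftrightarrow> c \<in> ?B \<rightarrow>\<^sub>E carrier ?K \<and> v = (\<Oplus>\<^bsub>?V\<^esub>b\<in>?B. c b \<odot>\<^bsub>?V\<^esub> b)" for v c
  have cV: "carrier ?V = carrier H" by (simp add: residue_space_def)
  have "e i \<in> carrier H" if "i < k" for i
    using lin_hom_closed[OF g, of "unit_vec k i"] unit_vec_closed[OF that] ge[OF that] by simp
  then have B: "finite ?B" "?B \<subseteq> carrier H" by auto
  have c_closed: "c x \<in> ?B \<rightarrow>\<^sub>E carrier ?K" if x: "x \<in> carrier (Rpow k)" for x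
  proof -
    have "x (inv_into {..<k} e b) \<in> carrier R" if "b \<in> ?B" for b
      using PiE_mem[of x "{..<k}" "\<lambda>_. carrier R"] x inv_into_into[OF that] by simp
    then show ?thesis by (auto simp: c_def FactRing_def A_RCOSETS_def')
  qed
  have c_rep: "rep (g x) (c x)" if x: "x \<in> carrier (Rpow k)" for x
    using c_closed[OF x] coord_sum[OF x c_def] unfolding rep_def by simp
  have rep_c: "\<exists>x\<in>carrier (Rpow k). c' = c x \<and> v = g x" if r: "rep v c'" for v c'
  proof -
    obtain x where x: "x \<in> carrier (Rpow k)" "c' = c x" by (rule coord_exists[of c']) (use r in \<open>auto simp: c_def rep_def\<close>)
    then show ?thesis using r coord_sum[OF x(1) c_def] unfolding rep_def by auto
  qed
  have fb: "finite_basis ?K ?V ?B \<longleftrightarrow> (\<forall>v\<in>carrier H. \<exists>!c. rep v c)"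
    unfolding finite_basis_def cV rep_def using B by simp
  show ?thesis
    unfolding fb
  proof (intro iffI conjI ballI impI)
    assume ex1: "\<forall>v\<in>carrier H. \<exists>!c. rep v c"
    show "g ` carrier (Rpow k) = carrier H"
    proof
      show "g ` carrier (Rpow k) \<subseteq> carrier H" using lin_hom_closed[OF g] by auto
      show "carrier H \<subseteq> g ` carrier (Rpow k)"
      proof
        fix v assume "v \<in> carrier H"
        then obtain c' where "rep v c'" using ex1 by blast
        then show "v \<in> g ` carrier (Rpow k)" using rep_c by blast
      qed
    qed
    fix x assume x: "x \<in> carrier (Rpow k)" "g x = \<zero>\<^bsub>H\<^esub>"
    have z: "g \<zero>\<^bsub>Rpow k\<^esub> = \<zero>\<^bsub>H\<^esub>" by (rule lin_hom_zero[OF Rpow_module H g])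
    have "c x = c \<zero>\<^bsub>Rpow k\<^esub>"
      using ex1 H.zero_closed c_rep[OF x(1)] c_rep[OF F.zero_closed] unfolding x(2) z by blast
    then have "x \<ominus>\<^bsub>Rpow k\<^esub> \<zero>\<^bsub>Rpow k\<^esub> \<in> max_vec k"
      using coord_eq_iff[OF x(1) F.zero_closed] by (simp only: c_def)
    moreover have "x \<ominus>\<^bsub>Rpow k\<^esub> \<zero>\<^bsub>Rpow k\<^esub> = x"
      using F.r_neg[OF F.zero_closed] F.l_zero[OF F.a_inv_closed[OF F.zero_closed]] F.r_zero[OF x(1)]
      unfolding a_minus_def by (simp only:)
    ultimately show "x \<in> max_vec k" by simp
  next
    assume *: "g ` carrier (Rpow k) = carrier H \<and> (\<forall>x\<in>carrier (Rpow k). g x = \<zero>\<^bsub>H\<^esub> \<longrightarrow> x \<in> max_vec k)"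
    fix v assume "v \<in> carrier H"
    then obtain x where x: "x \<in> carrier (Rpow k)" "v = g x" using * by blast
    show "\<exists>!c. rep v c"
    proof (rule ex1I[of _ "c x"])
      show "rep v (c x)" unfolding x(2) by (rule c_rep[OF x(1)])
      fix c' assume "rep v c'"
      then obtain y where y: "y \<in> carrier (Rpow k)" "c' = c y" "v = g y" using rep_c by blast
      have "g (y \<ominus>\<^bsub>Rpow k\<^esub> x) = \<zero>\<^bsub>H\<^esub>"
        using lin_kernel_eqI[OF Rpow_module H g y(1) x(1)] x(2) y(3) by (simp add: lin_kernel_def)
      then have "y \<ominus>\<^bsub>Rpow k\<^esub> x \<in> max_vec k" using * F.minus_closed[OF y(1) x(1)] by blast
      then show "c' = c x" using coord_eq_iff[OF y(1) x(1)] unfolding y(2) c_def by (simp only: simp_thms)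
    qed
  qed
qed

end

text \<open>
  A basis exists by \<open>residue_coordinates\<close>, and every basis has \<open>n\<close> elements because, again by
  \<open>finite_basis_iff\<close>, its size is the length of \<open>H\<close>.
\<close>

lemma vdim_slen:
  assumes H: "Module.module R H" and k: "killed H (carrier H)" and len: "slen H {\<zero>\<^bsub>H\<^esub>} (carrier H) = enat n"
  shows "vdim (R Quot \<nn>) (residue_space H) = n"
  unfolding vdim_def
proof (rule the_equality)
  obtain g where g: "g \<in> lin_hom R (Rpow n) H" "g ` carrier (Rpow n) = carrier H"
    and ker: "\<And>x. x \<in> carrier (Rpow n) \<Longrightarrow> g x = \<zero>\<^bsub>H\<^esub> \<Longrightarrow> x \<in> max_vec n"
    by (rule residue_coordinates[OF H k len]) blast
  let ?e = "\<lambda>i. g (unit_vec n i)"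
  have inj: "inj_on ?e {..<n}"
  proof (rule inj_onI, rule ccontr)
    fix i j assume ij: "i \<in> {..<n}" "j \<in> {..<n}" "?e i = ?e j" "i \<noteq> j"
    have u: "unit_vec n i \<in> carrier (Rpow n)" "unit_vec n j \<in> carrier (Rpow n)"
      using ij unit_vec_closed by simp_all
    interpret F: Module.module R "Rpow n" by (rule Rpow_module)
    have "g (unit_vec n i \<ominus>\<^bsub>Rpow n\<^esub> unit_vec n j) = \<zero>\<^bsub>H\<^esub>"
      using lin_kernel_eqI[OF Rpow_module H g(1) u] ij(3) by (simp add: lin_kernel_def)
    then have "unit_vec n i \<ominus>\<^bsub>Rpow n\<^esub> unit_vec n j \<in> max_vec n" by (rule ker[OF F.minus_closed[OF u]])
    then have "(unit_vec n i \<ominus>\<^bsub>Rpow n\<^esub> unit_vec n j) i \<in> \<nn>" using ij(1) unfolding max_vec_def by (rule PiE_mem)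
    moreover have "(unit_vec n i \<ominus>\<^bsub>Rpow n\<^esub> unit_vec n j) i = \<one>"
      using ij Rpow_minus_nth[OF u, of i] by (simp add: free_gen_def a_minus_def)
    ultimately show False using one_not_max by simp
  qed
  have "finite_basis (R Quot \<nn>) (residue_space H) (?e ` {..<n})"
    using finite_basis_iff[OF H k g(1) refl inj] g(2) ker by simp
  moreover have "card (?e ` {..<n}) = n" using card_image[OF inj] by simp
  ultimately show "\<exists>B. finite_basis (R Quot \<nn>) (residue_space H) B \<and> card B = n" by blast
next
  fix j assume "\<exists>B. finite_basis (R Quot \<nn>) (residue_space H) B \<and> card B = j"
  then obtain B where B: "finite_basis (R Quot \<nn>) (residue_space H) B" "card B = j" by blast
  have Bc: "finite B" "B \<subseteq> carrier H" using B(1) by (simp_all add: finite_basis_def residue_space_def)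
  obtain e where e: "bij_betw e {..<j} B"
    using ex_bij_betw_nat_finite[OF Bc(1)] B(2) by (auto simp: atLeast0LessThan)
  have img: "e ` {..<j} = B" and inj: "inj_on e {..<j}" using e by (simp_all add: bij_betw_def)
  obtain g where g: "g \<in> lin_hom R (Rpow j) H" "\<And>i. i < j \<Longrightarrow> g (unit_vec j i) = restrict e {..<j} i"
    by (rule free_hom_exists[OF H, of "restrict e {..<j}" j]) (use img Bc in auto)
  have ge: "g (unit_vec j i) = e i" if "i < j" for i using g(2)[OF that] that by simp
  have "g ` carrier (Rpow j) = carrier H \<and> (\<forall>x\<in>carrier (Rpow j). g x = \<zero>\<^bsub>H\<^esub> \<longrightarrow> x \<in> max_vec j)"
    using finite_basis_iff[OF H k g(1) ge inj] B(1) img by simp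
  then show "j = n" using slen_max_vec_quotient[OF H k g(1)] len by auto
qed

section \<open>Vanishing of the first Betti number\<close>

lemma module_add_diff:
  assumes X: "Module.module R X" and "x \<in> carrier X" "y \<in> carrier X"
  shows "x = y \<oplus>\<^bsub>X\<^esub> (x \<ominus>\<^bsub>X\<^esub> y)"
proof -
  interpret X: Module.module R X by (rule X)
  show ?thesis using assms(2,3) by (simp add: a_minus_def X.a_lcomm X.r_neg)
qed

lemma lin_hom_split_last:
  assumes X: "Module.module R X" and f: "f \<in> lin_hom R (Rpow (Suc p)) X" and h: "h \<in> lin_hom R (Rpow p) X"
    and hf: "\<And>i. i < p \<Longrightarrow> h (unit_vec p i) = f (unit_vec (Suc p) i)" and x: "x \<in> carrier (Rpow (Suc p))"
  shows "f x = h (restrict x {..<p}) \<oplus>\<^bsub>X\<^esub> x p \<odot>\<^bsub>X\<^esub> f (unit_vec (Suc p) p)"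
proof -
  interpret X: Module.module R X by (rule X)
  have x': "x \<in> {..<Suc p} \<rightarrow>\<^sub>E carrier R" using x by simp
  have r: "restrict x {..<p} \<in> {..<p} \<rightarrow>\<^sub>E carrier R" using x by (simp add: PiE_iff)
  have xc: "x i \<in> carrier R" if "i < Suc p" for i using PiE_mem[OF x'] that by simp
  have fc: "f (unit_vec (Suc p) i) \<in> carrier X" if "i < Suc p" for i
    using lin_hom_closed[OF f, of "unit_vec (Suc p) i"] unit_vec_closed[OF that] by simp
  have "f x = (\<Oplus>\<^bsub>X\<^esub>i\<in>insert p {..<p}. x i \<odot>\<^bsub>X\<^esub> f (unit_vec (Suc p) i))"
    using lin_hom_vec[OF X f x'] by (simp add: lessThan_Suc)
  also have "\<dots> = x p \<odot>\<^bsub>X\<^esub> f (unit_vec (Suc p) p) \<oplus>\<^bsub>X\<^esub> (\<Oplus>\<^bsub>X\<^esub>i\<in>{..<p}. x i \<odot>\<^bsub>X\<^esub> f (unit_vec (Suc p) i))"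
    using xc fc by (intro X.finsum_insert) auto
  also have "(\<Oplus>\<^bsub>X\<^esub>i\<in>{..<p}. x i \<odot>\<^bsub>X\<^esub> f (unit_vec (Suc p) i)) = h (restrict x {..<p})"
    unfolding lin_hom_vec[OF X h r] using xc fc by (intro X.finsum_cong' refl) (simp_all add: hf)
  finally show ?thesis
    using lin_hom_closed[OF h, of "restrict x {..<p}"] r xc fc by (simp add: X.a_comm)
qed

text \<open>
  Nakayama's lemma, by induction on the number of generators: modulo \<open>W\<close> the last one is a
  combination of the others, because \<open>1 - a\<close> is a unit for \<open>a\<close> in the maximal ideal.
\<close>

lemma nakayama:
  assumes X: "Module.module R X" and W: "submodule W R X"
  shows "f \<in> lin_hom R (Rpow p) X \<Longrightarrow>
    (\<And>x. x \<in> carrier (Rpow p) \<Longrightarrow> \<exists>w\<in>W. \<exists>u\<in>max_vec p. f x = w \<oplus>\<^bsub>X\<^esub> f u) \<Longrightarrow> f ` carrier (Rpow p) \<subseteq> W"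
proof (induction p arbitrary: f)
  case 0
  have "x = \<zero>\<^bsub>Rpow 0\<^esub>" if "x \<in> carrier (Rpow 0)" for x using that by (auto simp: fun_eq_iff)
  then show ?case using lin_hom_zero[OF Rpow_module X 0(1)] submodule_zero[OF X W] by auto
next
  case (Suc p)
  interpret X: Module.module R X by (rule X)
  let ?e = "unit_vec (Suc p)"
  have ec: "?e i \<in> carrier (Rpow (Suc p))" if "i < Suc p" for i using unit_vec_closed[OF that] by simp
  have fe: "f (?e i) \<in> carrier X" if "i < Suc p" for i by (rule lin_hom_closed[OF Suc.prems(1) ec[OF that]])
  obtain h where h: "h \<in> lin_hom R (Rpow p) X" and h': "\<And>i. i < p \<Longrightarrow> h (unit_vec p i) = restrict (\<lambda>i. f (?e i)) {..<p} i"
    by (rule free_hom_exists[OF X, of "restrict (\<lambda>i. f (?e i)) {..<p}" p]) (use fe in auto)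
  have hf: "h (unit_vec p i) = f (?e i)" if "i < p" for i using h'[OF that] that by simp
  have split: "f x = h (restrict x {..<p}) \<oplus>\<^bsub>X\<^esub> x p \<odot>\<^bsub>X\<^esub> f (?e p)" if x: "x \<in> carrier (Rpow (Suc p))" for x
    by (rule lin_hom_split_last[OF X Suc.prems(1) h _ x]) (rule hf)
  let ?v = "f (?e p)"
  have vc: "?v \<in> carrier X" by (rule fe) simp
  note hc = lin_hom_closed[OF h]
  have Wc: "w \<in> carrier X" if "w \<in> W" for w by (rule submodule_carrierD[OF X W that])
  have nsplit: "restrict u {..<p} \<in> max_vec p" "u p \<in> \<nn>" "u \<in> carrier (Rpow (Suc p))" "restrict u {..<p} \<in> carrier (Rpow p)"
    if "u \<in> max_vec (Suc p)" for u
    using that a_subset by (auto simp: max_vec_def PiE_iff)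
  obtain w u where wu: "w \<in> W" "u \<in> max_vec (Suc p)" "?v = w \<oplus>\<^bsub>X\<^esub> f u" using Suc.prems(2)[OF ec[of p]] by auto
  note u = nsplit[OF wu(2)]
  let ?u = "restrict u {..<p}"
  have upc: "u p \<in> carrier R" using u(2) a_subset by auto
  have "\<one> \<ominus> u p \<notin> \<nn>"
  proof
    assume "\<one> \<ominus> u p \<in> \<nn>"
    then have "(\<one> \<ominus> u p) \<oplus> u p \<in> \<nn>" using u(2) by simp
    moreover have "(\<one> \<ominus> u p) \<oplus> u p = \<one>" using upc by algebra
    ultimately show False using one_not_max by simp
  qed
  then have unit: "\<one> \<ominus> u p \<in> Units R" using upc by (intro unit_if_not_max) simp_all
  define c where "c = inv (\<one> \<ominus> u p)"
  have c: "c \<in> carrier R" "c \<otimes> (\<one> \<ominus> u p) = \<one>" using unit by (simp_all add: c_def Units_l_inv)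
  have v: "?v = c \<odot>\<^bsub>X\<^esub> w \<oplus>\<^bsub>X\<^esub> h (c \<odot>\<^bsub>Rpow p\<^esub> ?u)"
  proof -
    have "?v = w \<oplus>\<^bsub>X\<^esub> (h ?u \<oplus>\<^bsub>X\<^esub> u p \<odot>\<^bsub>X\<^esub> ?v)" using wu(3) split[OF u(3)] by simp
    then have "?v \<ominus>\<^bsub>X\<^esub> u p \<odot>\<^bsub>X\<^esub> ?v = w \<oplus>\<^bsub>X\<^esub> h ?u \<oplus>\<^bsub>X\<^esub> u p \<odot>\<^bsub>X\<^esub> ?v \<ominus>\<^bsub>X\<^esub> u p \<odot>\<^bsub>X\<^esub> ?v"
      using Wc[OF wu(1)] hc[OF u(4)] vc upc by (simp add: X.a_assoc)
    also have "\<dots> = w \<oplus>\<^bsub>X\<^esub> h ?u"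
      using Wc[OF wu(1)] hc[OF u(4)] vc upc by (simp add: a_minus_def X.a_assoc X.r_neg)
    finally have 1: "?v \<ominus>\<^bsub>X\<^esub> u p \<odot>\<^bsub>X\<^esub> ?v = w \<oplus>\<^bsub>X\<^esub> h ?u" .
    have "(\<one> \<ominus> u p) \<odot>\<^bsub>X\<^esub> ?v = ?v \<ominus>\<^bsub>X\<^esub> u p \<odot>\<^bsub>X\<^esub> ?v"
      using vc upc by (simp add: a_minus_def X.smult_l_distr X.smult_l_minus)
    then have "c \<odot>\<^bsub>X\<^esub> ((\<one> \<ominus> u p) \<odot>\<^bsub>X\<^esub> ?v) = c \<odot>\<^bsub>X\<^esub> (w \<oplus>\<^bsub>X\<^esub> h ?u)" using 1 by simp
    moreover have "c \<odot>\<^bsub>X\<^esub> ((\<one> \<ominus> u p) \<odot>\<^bsub>X\<^esub> ?v) = ?v"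
      using X.smult_assoc1[OF c(1) _ vc, of "\<one> \<ominus> u p"] c(2) upc vc by simp
    ultimately show ?thesis
      using Wc[OF wu(1)] hc[OF u(4)] c(1) lin_hom_smult[OF h c(1) u(4)] by (simp add: X.smult_r_distr)
  qed
  have cu: "c \<odot>\<^bsub>Rpow p\<^esub> ?u \<in> max_vec p" by (rule submodule_smult[OF Rpow_module max_vec_submodule c(1) u(1)])
  have cuc: "c \<odot>\<^bsub>Rpow p\<^esub> ?u \<in> carrier (Rpow p)" by (rule submodule_carrierD[OF Rpow_module max_vec_submodule cu])
  have cw: "c \<odot>\<^bsub>X\<^esub> w \<in> W" by (rule submodule_smult[OF X W c(1) wu(1)])
  have sub: "h ` carrier (Rpow p) \<subseteq> W"
  proof (rule Suc.IH[OF h])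
    fix x assume x: "x \<in> carrier (Rpow p)"
    let ?x = "\<lambda>i\<in>{..<Suc p}. if i < p then x i else \<zero>"
    have xe: "?x \<in> carrier (Rpow (Suc p))" using x by (auto simp: PiE_iff)
    have rx: "restrict ?x {..<p} = x"
      using x by (intro extensionalityI[of _ "{..<p}"]) (simp_all add: PiE_def del: restrict_restrict)
    have hx: "f ?x = h x" using split[OF xe] rx hc[OF x] vc by simp
    obtain w' u' where wu': "w' \<in> W" "u' \<in> max_vec (Suc p)" "f ?x = w' \<oplus>\<^bsub>X\<^esub> f u'" using Suc.prems(2)[OF xe] by blast
    note u' = nsplit[OF wu'(2)]
    have upc': "u' p \<in> carrier R" using u'(2) a_subset by auto
    let ?t = "u' p \<odot>\<^bsub>Rpow p\<^esub> (c \<odot>\<^bsub>Rpow p\<^esub> ?u)"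
    have t: "?t \<in> max_vec p" by (rule submodule_smult[OF Rpow_module max_vec_submodule upc' cu])
    have tc: "?t \<in> carrier (Rpow p)" by (rule submodule_carrierD[OF Rpow_module max_vec_submodule t])
    have "h x = w' \<oplus>\<^bsub>X\<^esub> (h (restrict u' {..<p}) \<oplus>\<^bsub>X\<^esub> u' p \<odot>\<^bsub>X\<^esub> ?v)"
      using wu'(3) hx split[OF u'(3)] by simp
    also have "u' p \<odot>\<^bsub>X\<^esub> ?v = u' p \<odot>\<^bsub>X\<^esub> (c \<odot>\<^bsub>X\<^esub> w) \<oplus>\<^bsub>X\<^esub> h ?t"
      using arg_cong[OF v, of "\<lambda>z. u' p \<odot>\<^bsub>X\<^esub> z"] X.smult_r_distr[OF upc' Wc[OF cw] hc[OF cuc]] lin_hom_smult[OF h upc' cuc]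
      by simp
    also have "w' \<oplus>\<^bsub>X\<^esub> (h (restrict u' {..<p}) \<oplus>\<^bsub>X\<^esub> (u' p \<odot>\<^bsub>X\<^esub> (c \<odot>\<^bsub>X\<^esub> w) \<oplus>\<^bsub>X\<^esub> h ?t)) =
        (w' \<oplus>\<^bsub>X\<^esub> u' p \<odot>\<^bsub>X\<^esub> (c \<odot>\<^bsub>X\<^esub> w)) \<oplus>\<^bsub>X\<^esub> (h (restrict u' {..<p}) \<oplus>\<^bsub>X\<^esub> h ?t)"
      using Wc[OF wu'(1)] Wc[OF cw] hc[OF u'(4)] hc[OF tc] upc'
      by (simp only: X.a_ac X.a_closed X.smult_closed)
    also have "h (restrict u' {..<p}) \<oplus>\<^bsub>X\<^esub> h ?t = h (restrict u' {..<p} \<oplus>\<^bsub>Rpow p\<^esub> ?t)"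
      by (rule lin_hom_add[OF h u'(4) tc, symmetric])
    finally have "h x = (w' \<oplus>\<^bsub>X\<^esub> u' p \<odot>\<^bsub>X\<^esub> (c \<odot>\<^bsub>X\<^esub> w)) \<oplus>\<^bsub>X\<^esub> h (restrict u' {..<p} \<oplus>\<^bsub>Rpow p\<^esub> ?t)" .
    then show "\<exists>w\<in>W. \<exists>u\<in>max_vec p. h x = w \<oplus>\<^bsub>X\<^esub> h u"
      by (intro bexI[of _ "restrict u' {..<p} \<oplus>\<^bsub>Rpow p\<^esub> ?t"] bexI[of _ "w' \<oplus>\<^bsub>X\<^esub> u' p \<odot>\<^bsub>X\<^esub> (c \<odot>\<^bsub>X\<^esub> w)"]
          submodule_add[OF X W wu'(1) submodule_smult[OF X W upc' cw]]
          submodule_add[OF Rpow_module max_vec_submodule u'(1) t])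
  qed
  have vW: "?v \<in> W" unfolding v by (rule submodule_add[OF X W cw subsetD[OF sub imageI[OF cuc]]])
  show ?case
  proof
    fix z assume "z \<in> f ` carrier (Rpow (Suc p))"
    then obtain x where x: "x \<in> carrier (Rpow (Suc p))" "z = f x" by (elim imageE)
    have "restrict x {..<p} \<in> carrier (Rpow p)" "x p \<in> carrier R" using x(1) by (auto simp: PiE_iff)
    then show "z \<in> W"
      unfolding x(2) split[OF x(1)] using sub vW by (intro submodule_add[OF X W] submodule_smult[OF X W]) auto
  qed
qed

lemma act_entries_cong:
  assumes "\<And>i j. i < q \<Longrightarrow> j < p \<Longrightarrow> A i j = B i j"
    and X: "Module.module R X" and B: "mat q p B" and x: "x \<in> {..<p} \<rightarrow>\<^sub>E carrier X"
  shows "act X q p A x = act X q p B x"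
proof -
  interpret X: Module.module R X by (rule X)
  have "(\<Oplus>\<^bsub>X\<^esub>j\<in>{..<p}. A i j \<odot>\<^bsub>X\<^esub> x j) = (\<Oplus>\<^bsub>X\<^esub>j\<in>{..<p}. B i j \<odot>\<^bsub>X\<^esub> x j)" if "i < q" for i
    using that assms(1) matD[OF B] PiE_mem[OF x] by (intro X.finsum_cong' refl) simp_all
  then show ?thesis unfolding act_def by (intro restrict_ext) simp
qed

abbreviation residue_map :: "'a \<Rightarrow> 'a set"
  where "residue_map \<equiv> (\<lambda>x. \<nn> +>\<^bsub>ring_module R\<^esub> x)"

lemma residue_map:
  "residue_map \<in> lin_hom R (ring_module R) (residue_module R \<nn>)"
  "residue_map ` carrier (ring_module R) = carrier (residue_module R \<nn>)"
  "lin_kernel (ring_module R) (residue_module R \<nn>) residue_map = \<nn>"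
  unfolding residue_module_def
  by (rule quot_map_lin_hom[OF ring_module max_submodule], rule quot_map_surj[OF ring_module max_submodule],
      rule quot_map_kernel[OF ring_module max_submodule])

abbreviation vec_residue :: "nat \<Rightarrow> (nat \<Rightarrow> 'a) \<Rightarrow> nat \<Rightarrow> 'a set"
  where "vec_residue k \<equiv> compose {..<k} residue_map"

lemma vec_residue_lin_hom: "vec_residue k \<in> lin_hom R (Rpow k) (direct_power (residue_module R \<nn>) k)"
  by (rule compose_lin_hom[OF residue_map(1) ring_module])

lemma vec_residue_kernel: "lin_kernel (Rpow k) (direct_power (residue_module R \<nn>) k) (vec_residue k) = max_vec k"
  unfolding compose_kernel[OF residue_map(1)] residue_map(3) max_vec_def ..

lemma vec_residue_eq_iff:
  assumes x: "x \<in> carrier (Rpow k)" and y: "y \<in> carrier (Rpow k)"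
  shows "vec_residue k x = vec_residue k y \<longleftrightarrow> x \<ominus>\<^bsub>Rpow k\<^esub> y \<in> max_vec k"
proof -
  let ?l = "direct_power (residue_module R \<nn>) k"
  interpret F: Module.module R "Rpow k" by (rule Rpow_module)
  note l = direct_power_module[OF residue_module_module, of k]
  interpret L: Module.module R ?l by (rule l)
  note ker = vec_residue_kernel[of k]
  show ?thesis
  proof
    assume "vec_residue k x = vec_residue k y"
    then show "x \<ominus>\<^bsub>Rpow k\<^esub> y \<in> max_vec k"
      unfolding ker[symmetric] by (rule lin_kernel_eqI[OF Rpow_module l vec_residue_lin_hom x y])
  next
    assume "x \<ominus>\<^bsub>Rpow k\<^esub> y \<in> max_vec k"
    then have "vec_residue k (x \<ominus>\<^bsub>Rpow k\<^esub> y) = \<zero>\<^bsub>?l\<^esub>" unfolding ker[symmetric] by (simp add: lin_kernel_def)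
    then have "vec_residue k x \<ominus>\<^bsub>?l\<^esub> vec_residue k y = \<zero>\<^bsub>?l\<^esub>"
      unfolding lin_hom_minus[OF Rpow_module l vec_residue_lin_hom x y] .
    then show "vec_residue k x = vec_residue k y"
      by (rule module_minus_eq_zero[OF l lin_hom_closed[OF vec_residue_lin_hom x] lin_hom_closed[OF vec_residue_lin_hom y]])
  qed
qed

lemma vec_residue_surj: "vec_residue k ` carrier (Rpow k) = carrier (direct_power (residue_module R \<nn>) k)"
  by (rule compose_surj[OF residue_map(2)])

lemma vec_residue_act:
  assumes A: "mat q p A" and x: "x \<in> carrier (Rpow p)"
  shows "vec_residue q (act (ring_module R) q p A x) = act (residue_module R \<nn>) q p A (vec_residue p x)"
  using act_natural[OF ring_module residue_module_module residue_map(1) A, of x] x by simp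

lemma act_mcong_ring:
  assumes A: "mat q p A" and B: "mat q p B" and c: "mcong q p A B" and x: "x \<in> carrier (Rpow p)"
  shows "act (ring_module R) q p A x \<ominus>\<^bsub>Rpow q\<^esub> act (ring_module R) q p B x \<in> max_vec q"
proof -
  note ac = lin_hom_closed[OF act_lin_hom[OF ring_module A] x] and bc = lin_hom_closed[OF act_lin_hom[OF ring_module B] x]
  have "vec_residue p x \<in> {..<p} \<rightarrow>\<^sub>E carrier (residue_module R \<nn>)"
    using lin_hom_closed[OF vec_residue_lin_hom x] by simp
  then have "vec_residue q (act (ring_module R) q p A x) = vec_residue q (act (ring_module R) q p B x)"
    unfolding vec_residue_act[OF A x] vec_residue_act[OF B x]
    by (rule act_mcong[OF residue_module_module residue_module_killed order_refl A B c])
  then show ?thesis using vec_residue_eq_iff[OF ac bc] by simp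
qed

text \<open>
  A square matrix congruent to the identity has a left inverse: its transpose is onto by
  Nakayama's lemma, hence has a right inverse.
\<close>

lemma left_inverse:
  assumes T: "mat r r T" and c: "mcong r r T mid"
  obtains C where "mat r r C" "\<And>x. x \<in> carrier (Rpow r) \<Longrightarrow> act (ring_module R) r r C (act (ring_module R) r r T x) = x"
proof -
  let ?S = "ring_module R" and ?t = "act (ring_module R) r r (mtransp T)"
  interpret F: Module.module R "Rpow r" by (rule Rpow_module)
  note Tt = mat_transp[OF T]
  have ct: "mcong r r (mtransp T) mid"
  proof -
    have "mid i j = mid j i" for i j by (simp add: mid_def)
    then show ?thesis using c unfolding mcong_def mtransp_nth by metis
  qed
  note tl = act_lin_hom[OF ring_module Tt]
  have W: "submodule (?t ` carrier (Rpow r)) R (Rpow r)"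
    by (rule submodule_image[OF Rpow_module Rpow_module tl submodule_carrier[OF Rpow_module]])
  have "(\<lambda>x. x) ` carrier (Rpow r) \<subseteq> ?t ` carrier (Rpow r)"
  proof (rule nakayama[OF Rpow_module W id_lin_hom])
    fix x assume x: "x \<in> carrier (Rpow r)"
    note tx = lin_hom_closed[OF tl x]
    have "?t x \<ominus>\<^bsub>Rpow r\<^esub> act ?S r r mid x \<in> max_vec r" by (rule act_mcong_ring[OF Tt mat_mid ct x])
    moreover have "act ?S r r mid x = x" using act_mid[OF ring_module, of x r] x by simp
    ultimately have "\<ominus>\<^bsub>Rpow r\<^esub> (?t x \<ominus>\<^bsub>Rpow r\<^esub> x) \<in> max_vec r"
      using submodule_uminus[OF Rpow_module max_vec_submodule] by simp
    moreover have "x = ?t x \<oplus>\<^bsub>Rpow r\<^esub> (\<ominus>\<^bsub>Rpow r\<^esub> (?t x \<ominus>\<^bsub>Rpow r\<^esub> x))"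
      unfolding a_minus_def F.minus_add[OF tx F.a_inv_closed[OF x]] F.minus_minus[OF x]
      using x tx by (simp only: F.a_assoc[symmetric] F.a_inv_closed F.r_neg F.l_zero)
    ultimately show "\<exists>w\<in>?t ` carrier (Rpow r). \<exists>u\<in>max_vec r. x = w \<oplus>\<^bsub>Rpow r\<^esub> u"
      using imageI[OF x, of ?t] by blast
  qed
  then have onto: "carrier (Rpow r) \<subseteq> ?t ` carrier (Rpow r)" by simp
  have "\<exists>y\<in>carrier (Rpow r). ?t y = unit_vec r j" if "j < r" for j
  proof -
    have "unit_vec r j \<in> carrier (Rpow r)" using unit_vec_closed[OF that] by simp
    then have "unit_vec r j \<in> ?t ` carrier (Rpow r)" using onto by (rule rev_subsetD)
    then show ?thesis by (elim imageE) (intro bexI, simp_all)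
  qed
  then obtain y where y: "\<And>j. j < r \<Longrightarrow> y j \<in> carrier (Rpow r) \<and> ?t (y j) = unit_vec r j" by metis
  define C where "C j i = y j i" for j i
  have C: "mat r r C" unfolding mat_def C_def
  proof (intro allI impI)
    fix j i assume "j < r" "i < r"
    then show "y j i \<in> carrier R" using y[of j] PiE_mem[of "y j" "{..<r}" "\<lambda>_. carrier R" i] by simp
  qed
  have "mmult r C T j i = mid j i" if ji: "j < r" "i < r" for j i
  proof -
    have "mmult r C T j i = (\<Oplus>\<^bsub>?S\<^esub>l\<in>{..<r}. mtransp T i l \<odot>\<^bsub>?S\<^esub> y j l)"
      unfolding mmult_def finsum_ring_module using matD[OF C ji(1)] matD[OF T _ ji(2)]
      by (intro finsum_cong') (simp_all add: mtransp_nth C_def m_comm)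
    also have "\<dots> = ?t (y j) i" by (rule act_nth[OF ji(2), symmetric])
    also have "\<dots> = mid j i" using y[OF ji(1)] ji by (simp add: free_gen_def mid_def)
    finally show ?thesis .
  qed
  then have "act ?S r r C (act ?S r r T x) = x" if x: "x \<in> carrier (Rpow r)" for x
  proof -
    have x': "x \<in> {..<r} \<rightarrow>\<^sub>E carrier ?S" using x by simp
    have "act ?S r r C (act ?S r r T x) = act ?S r r (mmult r C T) x" by (rule act_mmult[OF ring_module C T x'])
    also have "\<dots> = act ?S r r mid x"
      using \<open>\<And>j i. j < r \<Longrightarrow> i < r \<Longrightarrow> mmult r C T j i = mid j i\<close> by (intro act_entries_cong ring_module mat_mid x')
    also have "\<dots> = x" by (rule act_mid[OF ring_module x'])
    finally show ?thesis .
  qed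
  then show ?thesis using that C by blast
qed

lemma unit_vec_inj: "inj_on (unit_vec k) {..<k}"
proof (rule inj_onI, rule ccontr)
  fix i j assume ij: "i \<in> {..<k}" "j \<in> {..<k}" "unit_vec k i = unit_vec k j" "i \<noteq> j"
  have "unit_vec k i i = unit_vec k j i" by (simp only: ij(3))
  then show False using ij(1,2,4) one_neq_zero by (simp add: free_gen_def)
qed

text \<open>
  The free modules in the definition of projectivity are indexed by subsets of the type of the
  module; the unit vectors serve as index set.
\<close>

lemma Rpow_projective: "projective_module R (Rpow k)"
proof -
  let ?B = "unit_vec k ` {..<k}"
  define s where "s x = (\<lambda>u\<in>?B. x (inv_into {..<k} (unit_vec k) u))" for x :: "nat \<Rightarrow> 'a"
  define t where "t f = (\<lambda>i\<in>{..<k}. f (unit_vec k i))" for f :: "(nat \<Rightarrow> 'a) \<Rightarrow> 'a"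
  have inv: "inv_into {..<k} (unit_vec k) u < k" if "u \<in> ?B" for u using inv_into_into[OF that] by simp
  have xc: "x i \<in> carrier R" if "x \<in> carrier (Rpow k)" "i < k" for x i
    using PiE_mem[of x "{..<k}" "\<lambda>_. carrier R" i] that by simp
  have s: "s \<in> lin_hom R (Rpow k) (free_module R ?B)"
  proof (rule lin_homI)
    fix x assume x: "x \<in> carrier (Rpow k)"
    show "s x \<in> carrier (free_module R ?B)"
      unfolding free_module_carrier s_def using xc[OF x inv] by simp
  next
    fix x y assume "x \<in> carrier (Rpow k)" "y \<in> carrier (Rpow k)"
    show "s (x \<oplus>\<^bsub>Rpow k\<^esub> y) = s x \<oplus>\<^bsub>free_module R ?B\<^esub> s y"
      unfolding s_def free_module_simps by (rule restrict_ext) (use inv in simp)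
  next
    fix a x assume "a \<in> carrier R" "x \<in> carrier (Rpow k)"
    show "s (a \<odot>\<^bsub>Rpow k\<^esub> x) = a \<odot>\<^bsub>free_module R ?B\<^esub> s x"
      unfolding s_def free_module_simps by (rule restrict_ext) (use inv in simp)
  qed
  have t: "t \<in> lin_hom R (free_module R ?B) (Rpow k)"
  proof (rule lin_homI)
    fix f assume f: "f \<in> carrier (free_module R ?B)"
    show "t f \<in> carrier (Rpow k)"
      using PiE_mem[of f ?B "\<lambda>_. carrier R"] f unfolding free_module_carrier t_def by simp
  next
    fix f g
    show "t (f \<oplus>\<^bsub>free_module R ?B\<^esub> g) = t f \<oplus>\<^bsub>Rpow k\<^esub> t g"
      unfolding t_def free_module_simps direct_power_simps(3) by (rule restrict_ext) simp
  next
    fix a f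
    show "t (a \<odot>\<^bsub>free_module R ?B\<^esub> f) = a \<odot>\<^bsub>Rpow k\<^esub> t f"
      unfolding t_def free_module_simps direct_power_simps(4) by (rule restrict_ext) simp
  qed
  have "t (s x) = x" if x: "x \<in> carrier (Rpow k)" for x
    using x unit_vec_inj by (intro extensionalityI[of _ "{..<k}"]) (simp_all add: t_def s_def PiE_def)
  then show ?thesis unfolding projective_module_def using Rpow_module s t by blast
qed

lemma Rpow_0: "carrier (Rpow 0) = {\<zero>\<^bsub>Rpow 0\<^esub>}"
  by (auto simp: fun_eq_iff)

lemma proj_dim_le_one:
  assumes N: "Module.module R N" and e: "\<epsilon> \<in> lin_hom R (Rpow k) N" "\<epsilon> ` carrier (Rpow k) = carrier N"
    and g: "g \<in> lin_hom R (Rpow a) (Rpow k)" "g ` carrier (Rpow a) = lin_kernel (Rpow k) N \<epsilon>"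
    and inj: "\<And>x. x \<in> carrier (Rpow a) \<Longrightarrow> g x = \<zero>\<^bsub>Rpow k\<^esub> \<Longrightarrow> x = \<zero>\<^bsub>Rpow a\<^esub>"
  shows "proj_dim R N \<le> 1"
proof -
  define b where "b i = (if i = 0 then k else if i = 1 then a else 0)" for i :: nat
  define d where "d i = (if i = 0 then g else (\<lambda>_. \<zero>\<^bsub>Rpow (b i)\<^esub>))" for i
  have zero: "(\<lambda>_. \<zero>\<^bsub>Rpow q\<^esub>) \<in> lin_hom R (Rpow p) (Rpow q)" for p q
  proof -
    interpret F: Module.module R "Rpow q" by (rule Rpow_module)
    show ?thesis by (rule lin_homI) (simp_all only: F.zero_closed F.l_zero F.smult_r_null)
  qed
  have d: "d i \<in> lin_hom R (Rpow (b (Suc i))) (Rpow (b i))" for i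
    using g(1) zero by (simp add: d_def b_def)
  have zk: "\<zero>\<^bsub>Rpow p\<^esub> \<in> carrier (Rpow p)" for p by (rule submodule_zero[OF Rpow_module submodule_carrier[OF Rpow_module]])
  have ex: "d (Suc i) ` carrier (Rpow (b (Suc (Suc i)))) = lin_kernel (Rpow (b (Suc i))) (Rpow (b i)) (d i)" for i
  proof -
    have "d (Suc i) ` carrier (Rpow (b (Suc (Suc i)))) = {\<zero>\<^bsub>Rpow (b (Suc i))\<^esub>}"
      using zk by (auto simp: d_def simp del: direct_power_simps)
    moreover have "lin_kernel (Rpow (b (Suc i))) (Rpow (b i)) (d i) = {\<zero>\<^bsub>Rpow (b (Suc i))\<^esub>}"
    proof (cases "i = 0")
      case True
      have "lin_kernel (Rpow a) (Rpow k) g = {\<zero>\<^bsub>Rpow a\<^esub>}"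
      proof
        show "lin_kernel (Rpow a) (Rpow k) g \<subseteq> {\<zero>\<^bsub>Rpow a\<^esub>}"
          by (rule subsetI) (simp only: lin_kernel_def mem_Collect_eq singleton_iff inj)
        show "{\<zero>\<^bsub>Rpow a\<^esub>} \<subseteq> lin_kernel (Rpow a) (Rpow k) g"
          by (simp only: insert_subset empty_subsetI lin_kernel_def mem_Collect_eq zk
              lin_hom_zero[OF Rpow_module Rpow_module g(1)] simp_thms)
      qed
      then show ?thesis using True by (simp add: b_def d_def)
    next
      case False
      then have "b (Suc i) = 0" by (simp add: b_def)
      then show ?thesis
        using lin_hom_zero[OF Rpow_module Rpow_module d[of i]]
          submodule_zero[OF Rpow_module submodule_lin_kernel[OF Rpow_module Rpow_module d[of i]]]
          submodule_sub[OF Rpow_module submodule_lin_kernel[OF Rpow_module Rpow_module d[of i]]]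
        by (simp only: Rpow_0) (rule equalityI, assumption, simp only: insert_subset empty_subsetI simp_thms)
    qed
    ultimately show ?thesis by simp
  qed
  have "resolution R (\<lambda>i. Rpow (b i)) d \<epsilon> N"
    unfolding resolution_def using d ex Rpow_module e g by (simp add: b_def d_def del: direct_power_simps)
  moreover have "\<forall>i>1. zero_module (Rpow (b i))"
    using Rpow_0 unfolding zero_module_def by (simp add: b_def)
  ultimately have "enat 1 \<in> {enat k |k. \<exists>(P :: nat \<Rightarrow> ('a, nat \<Rightarrow> 'a) module) d \<epsilon>.
      resolution R P d \<epsilon> N \<and> (\<forall>i. projective_module R (P i)) \<and> (\<forall>i>k. zero_module (P i))}"
    using Rpow_projective by blast
  then have "proj_dim R N \<le> enat 1" unfolding proj_dim_def by (rule Inf_lower)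
  then show ?thesis by (simp add: one_enat_def)
qed

text \<open>
  If \<open>A\<close>, \<open>B\<close> form an exact sequence modulo the maximal ideal, a basis of the image of \<open>A\<close> modulo
  the maximal ideal lifts to a basis of the image of \<open>A\<close>: with the matrices \<open>V\<close>, \<open>D\<close> of a rank
  factorization, \<open>A D\<close> is injective because \<open>V A D\<close> has a left inverse, and it has the same image as
  \<open>A\<close> by Nakayama's lemma.
\<close>

lemma proj_dim_le_one_if_residue_exact:
  assumes N: "Module.module R N" and e: "\<epsilon> \<in> lin_hom R (Rpow k) N" "\<epsilon> ` carrier (Rpow k) = carrier N"
    and a: "has_rank k p A a" and B: "mat p u B"
    and ker: "lin_kernel (Rpow k) N \<epsilon> = act (ring_module R) k p A ` carrier (Rpow p)"
    and AB: "\<And>w. w \<in> carrier (Rpow u) \<Longrightarrow> act (ring_module R) k p A (act (ring_module R) p u B w) = \<zero>\<^bsub>Rpow k\<^esub>"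
    and exact: "lin_kernel (direct_power (residue_module R \<nn>) p) (direct_power (residue_module R \<nn>) k) (act (residue_module R \<nn>) k p A)
      = act (residue_module R \<nn>) p u B ` carrier (direct_power (residue_module R \<nn>) u)"
  shows "proj_dim R N \<le> 1"
proof -
  let ?S = "ring_module R" and ?l = "residue_module R \<nn>"
  obtain V D where rf: "rank_fact k p A a V D" using a unfolding has_rank_def by blast
  have A: "mat k p A" and V: "mat a k V" and D: "mat p a D"
    and 1: "mcong a a (mmult k V (mmult p A D)) mid"
    and 2: "mcong k p (mmult a (mmult p A D) (mmult k V A)) A"
    using rf by (simp_all add: rank_fact_def)
  note AD = mat_mmult[OF A D] and VA = mat_mmult[OF V A]
  interpret Fk: Module.module R "Rpow k" by (rule Rpow_module)
  interpret Fp: Module.module R "Rpow p" by (rule Rpow_module)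
  define g where "g = act ?S k a (mmult p A D)"
  have g: "g \<in> lin_hom R (Rpow a) (Rpow k)" unfolding g_def by (rule act_lin_hom[OF ring_module AD])
  have Al: "act ?S k p A \<in> lin_hom R (Rpow p) (Rpow k)" by (rule act_lin_hom[OF ring_module A])
  have gA: "g x = act ?S k p A (act ?S p a D x)" if "x \<in> carrier (Rpow a)" for x
    unfolding g_def using act_mmult[OF ring_module A D, of x] that by simp
  note Dc = lin_hom_closed[OF act_lin_hom[OF ring_module D]]
  have inj: "x = \<zero>\<^bsub>Rpow a\<^esub>" if x: "x \<in> carrier (Rpow a)" and x0: "g x = \<zero>\<^bsub>Rpow k\<^esub>" for x
  proof -
    obtain C where C: "mat a a C" "\<And>x. x \<in> carrier (Rpow a) \<Longrightarrow> act ?S a a C (act ?S a a (mmult k V (mmult p A D)) x) = x"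
      by (rule left_inverse[OF mat_mmult[OF V AD] 1]) blast
    have "act ?S a a (mmult k V (mmult p A D)) x = act ?S a k V (g x)"
      unfolding g_def using act_mmult[OF ring_module V AD, of x] x by simp
    also have "\<dots> = \<zero>\<^bsub>Rpow a\<^esub>" unfolding x0 by (rule lin_hom_zero[OF Rpow_module Rpow_module act_lin_hom[OF ring_module V]])
    finally show ?thesis
      using C(2)[OF x] lin_hom_zero[OF Rpow_module Rpow_module act_lin_hom[OF ring_module C(1)]] by simp
  qed
  have gsub: "submodule (g ` carrier (Rpow a)) R (Rpow k)"
    by (rule submodule_image[OF Rpow_module Rpow_module g submodule_carrier[OF Rpow_module]])
  have sub1: "act ?S k p A ` carrier (Rpow p) \<subseteq> g ` carrier (Rpow a)"
  proof (rule nakayama[OF Rpow_module gsub Al])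
    fix x assume x: "x \<in> carrier (Rpow p)"
    \<comment> \<open>Modulo the maximal ideal, \<open>y = x - D V A x\<close> lies in the kernel of \<open>A\<close>, so by exactness \<open>y\<close> is
      congruent to some \<open>B w\<close>.  As \<open>A B = 0\<close>, the difference \<open>y - B w\<close> shows that \<open>A x\<close> and \<open>A D V A x\<close>
      differ by the image of a vector with entries in the maximal ideal.\<close>
    define z where "z = act ?S a p (mmult k V A) x"
    have z: "z \<in> carrier (Rpow a)" unfolding z_def by (rule lin_hom_closed[OF act_lin_hom[OF ring_module VA] x])
    define y where "y = x \<ominus>\<^bsub>Rpow p\<^esub> act ?S p a D z"
    have y: "y \<in> carrier (Rpow p)" unfolding y_def by (rule Fp.minus_closed[OF x Dc[OF z]])
    have Ay: "act ?S k p A y = act ?S k p A x \<ominus>\<^bsub>Rpow k\<^esub> g z"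
      unfolding y_def gA[OF z] by (rule lin_hom_minus[OF Rpow_module Rpow_module Al x Dc[OF z]])
    have gz: "g z = act ?S k p (mmult a (mmult p A D) (mmult k V A)) x"
      unfolding g_def z_def using act_mmult[OF ring_module AD VA, of x] x by simp
    have "vec_residue k (act ?S k p A x) = vec_residue k (g z)"
      using act_mcong_ring[OF mat_mmult[OF AD VA] A 2 x]
        vec_residue_eq_iff[OF lin_hom_closed[OF g z] lin_hom_closed[OF Al x]] unfolding gz by simp
    then have "act ?S k p A y \<in> max_vec k"
      unfolding Ay using vec_residue_eq_iff[OF lin_hom_closed[OF Al x] lin_hom_closed[OF g z]] by simp
    then have "vec_residue k (act ?S k p A y) = \<zero>\<^bsub>direct_power ?l k\<^esub>"
      unfolding vec_residue_kernel[symmetric] by (simp only: lin_kernel_def mem_Collect_eq)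
    then have "vec_residue p y \<in> lin_kernel (direct_power ?l p) (direct_power ?l k) (act ?l k p A)"
      unfolding vec_residue_act[OF A y] lin_kernel_def
      using lin_hom_closed[OF vec_residue_lin_hom y] by (simp only: mem_Collect_eq simp_thms)
    then obtain w' where w': "w' \<in> carrier (direct_power ?l u)" "vec_residue p y = act ?l p u B w'"
      unfolding exact by (elim imageE)
    obtain w where w: "w \<in> carrier (Rpow u)" "w' = vec_residue u w"
      using w'(1) unfolding vec_residue_surj[symmetric] by (elim imageE)
    let ?Bw = "act ?S p u B w"
    have Bw: "?Bw \<in> carrier (Rpow p)" by (rule lin_hom_closed[OF act_lin_hom[OF ring_module B] w(1)])
    have "vec_residue p y = vec_residue p ?Bw" unfolding w'(2) w(2) vec_residue_act[OF B w(1)] ..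
    then have nu: "y \<ominus>\<^bsub>Rpow p\<^esub> ?Bw \<in> max_vec p" using vec_residue_eq_iff[OF y Bw] by simp
    have "act ?S k p A (y \<ominus>\<^bsub>Rpow p\<^esub> ?Bw) = act ?S k p A y \<ominus>\<^bsub>Rpow k\<^esub> \<zero>\<^bsub>Rpow k\<^esub>"
      unfolding lin_hom_minus[OF Rpow_module Rpow_module Al y Bw] AB[OF w(1)] ..
    also have "\<dots> = act ?S k p A y"
      using Fk.r_neg[OF Fk.zero_closed] Fk.l_zero[OF Fk.a_inv_closed[OF Fk.zero_closed]]
        Fk.r_zero[OF lin_hom_closed[OF Al y]]
      unfolding a_minus_def by (simp only:)
    finally have An: "act ?S k p A (y \<ominus>\<^bsub>Rpow p\<^esub> ?Bw) = act ?S k p A x \<ominus>\<^bsub>Rpow k\<^esub> g z" unfolding Ay .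
    have "act ?S k p A x = g z \<oplus>\<^bsub>Rpow k\<^esub> act ?S k p A (y \<ominus>\<^bsub>Rpow p\<^esub> ?Bw)"
      unfolding An by (rule module_add_diff[OF Rpow_module lin_hom_closed[OF Al x] lin_hom_closed[OF g z]])
    then show "\<exists>w\<in>g ` carrier (Rpow a). \<exists>u\<in>max_vec p. act ?S k p A x = w \<oplus>\<^bsub>Rpow k\<^esub> act ?S k p A u"
      using nu imageI[OF z, of g] by blast
  qed
  have sub2: "g ` carrier (Rpow a) \<subseteq> act ?S k p A ` carrier (Rpow p)"
  proof
    fix v assume "v \<in> g ` carrier (Rpow a)"
    then obtain x where x: "x \<in> carrier (Rpow a)" "v = g x" by (elim imageE)
    show "v \<in> act ?S k p A ` carrier (Rpow p)" unfolding x(2) gA[OF x(1)] by (intro imageI Dc x)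
  qed
  have "g ` carrier (Rpow a) = lin_kernel (Rpow k) N \<epsilon>" unfolding ker using sub1 sub2 by (rule equalityI[rotated])
  from proj_dim_le_one[OF N e g this inj] show ?thesis .
qed

end

section \<open>Betti numbers from the chosen resolution\<close>

text \<open>
  In lowest terms \<open>n'/m'\<close>, every power of \<open>m'\<close> divides \<open>b 1\<close>, so \<open>m' = 1\<close>.
\<close>

lemma dvd_if_geometric:
  fixes b :: "nat \<Rightarrow> nat" and m n :: nat
  assumes m: "m \<ge> 1" and b1: "b 1 \<noteq> 0" and step: "\<And>i. n * b (Suc i) = m * b (Suc (Suc i))"
  shows "m dvd n"
proof -
  define g where "g = gcd n m"
  have g0: "g \<noteq> 0" using m by (auto simp: g_def)
  obtain m' n' where mn: "m = m' * g" "n = n' * g" "coprime n' m'"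
    using gcd_coprime_exists[of n m] g0 unfolding g_def by (metis gcd.commute)
  have st: "n' * b (Suc i) = m' * b (Suc (Suc i))" for i
    using step[of i] g0 by (simp add: mn(1,2))
  have pow: "n' ^ k * b 1 = m' ^ k * b (Suc k)" for k
  proof (induction k)
    case (Suc k)
    have "n' ^ Suc k * b 1 = n' * (m' ^ k * b (Suc k))" using Suc by (simp add: mult.assoc)
    also have "\<dots> = m' ^ k * (n' * b (Suc k))" by simp
    also have "\<dots> = m' ^ Suc k * b (Suc (Suc k))" by (simp add: st)
    finally show ?case .
  qed simp
  have "m' ^ k dvd b 1" for k
  proof -
    have "m' ^ k dvd n' ^ k * b 1" unfolding pow by (rule dvd_triv_left)
    moreover have "coprime (m' ^ k) (n' ^ k)" using mn(3) by (simp add: coprime_commute)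
    ultimately show ?thesis by (simp add: coprime_dvd_mult_right_iff)
  qed
  then have "m' ^ b 1 \<le> b 1" using b1 by (intro dvd_imp_le) auto
  moreover have "b 1 < m' ^ b 1" if "m' \<ge> 2"
  proof -
    have "b 1 < 2 ^ b 1" by (rule less_exp)
    also have "(2::nat) ^ b 1 \<le> m' ^ b 1" using that by (rule power_mono) simp
    finally show ?thesis .
  qed
  ultimately have "m' < 2" by (meson not_less)
  moreover have "m' \<noteq> 0" using m mn(1) by auto
  ultimately have "m' = 1" by simp
  then show ?thesis using mn(1,2) by simp
qed

context noetherian_local_ring
begin

lemma chosen_resolution:
  assumes N: "fg_module R N"
  obtains p d \<epsilon> where "p = fst (fg_free_resolution R N)" "d = res_diff R N"
    and "\<And>i. res_module R N i = Rpow (p i)"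
    and "\<And>i. d i \<in> lin_hom R (Rpow (p (Suc i))) (Rpow (p i))"
    and "\<epsilon> \<in> lin_hom R (Rpow (p 0)) N" "\<epsilon> ` carrier (Rpow (p 0)) = carrier N"
    and "d 0 ` carrier (Rpow (p 1)) = lin_kernel (Rpow (p 0)) N \<epsilon>"
    and "\<And>i. d (Suc i) ` carrier (Rpow (p (Suc (Suc i)))) = lin_kernel (Rpow (p (Suc i))) (Rpow (p i)) (d i)"
proof -
  define p where "p = fst (fg_free_resolution R N)"
  define d where "d = res_diff R N"
  obtain b0 :: "nat \<Rightarrow> nat" and d0 \<epsilon>0 where "resolution R (\<lambda>i. free_module R {..<b0 i}) d0 \<epsilon>0 N"
    using free_resolution_exists[OF N] by blast
  then have "\<exists>bd :: (nat \<Rightarrow> nat) \<times> _. case bd of (b, d) \<Rightarrow> \<exists>\<epsilon>. resolution R (\<lambda>i. free_module R {..<b i}) d \<epsilon> N"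
    by (intro exI[of _ "(b0, d0)"]) auto
  from someI_ex[OF this] have "\<exists>\<epsilon>. resolution R (\<lambda>i. free_module R {..<p i}) d \<epsilon> N"
    unfolding p_def d_def res_diff_def fg_free_resolution_def[symmetric] by (simp add: case_prod_unfold fun_eq_iff)
  then obtain \<epsilon> where res: "resolution R (\<lambda>i. Rpow (p i)) d \<epsilon> N" unfolding free_module_direct_power by blast
  show ?thesis
    using res unfolding resolution_def
    by (intro that[of p d \<epsilon>] p_def d_def) (simp_all only: res_module_def p_def free_module_direct_power)
qed

lemma residue_power_slen:
  "slen (direct_power (residue_module R \<nn>) k) {\<zero>\<^bsub>direct_power (residue_module R \<nn>) k\<^esub>}
    (carrier (direct_power (residue_module R \<nn>) k)) = enat k"
  using slen_power_zero[OF residue_module_module submodule_carrier[OF residue_module_module], of k]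
  by (simp add: residue_module_slen)

lemma residue_power_killed:
  "killed (direct_power (residue_module R \<nn>) k) (carrier (direct_power (residue_module R \<nn>) k))"
  using killed_power[OF residue_module_killed] by simp

context
  fixes N :: "('a, 'c, 'v) module_scheme" and p rk :: "nat \<Rightarrow> nat" and d :: "nat \<Rightarrow> (nat \<Rightarrow> 'a) \<Rightarrow> (nat \<Rightarrow> 'a)"
  assumes p: "p = fst (fg_free_resolution R N)" and d_res: "d = res_diff R N"
    and res_mod: "\<And>i. res_module R N i = Rpow (p i)"
    and d: "\<And>i. d i \<in> lin_hom R (Rpow (p (Suc i))) (Rpow (p i))"
    and dd: "\<And>i x. x \<in> carrier (Rpow (p (Suc (Suc i)))) \<Longrightarrow> d i (d (Suc i) x) = \<zero>\<^bsub>Rpow (p i)\<^esub>"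
    and rk: "\<And>i. has_rank (p i) (p (Suc i)) (dmat p d i) (rk i)"
begin

lemma Tor_eq: "Tor R i N X = homology (\<lambda>i. tensor R (Rpow (p i)) X)
    (\<lambda>i. tensor_map R (Rpow (p (Suc i))) (Rpow (p i)) X (d i)) i"
  unfolding Tor_def res_mod d_res ..

lemma Ext_eq: "Ext R i N X = cohomology (\<lambda>i. Hom_module R (Rpow (p i)) X)
    (\<lambda>i h. compose (carrier (Rpow (p (Suc i)))) h (d i)) i"
  unfolding Ext_def res_mod d_res ..

lemma Tor_zero_iff:
  assumes X: "Module.module R X"
  shows "zero_module (Tor R (Suc j) N X) \<longleftrightarrow>
    lin_kernel (direct_power X (p (Suc j))) (direct_power X (p j)) (act X (p j) (p (Suc j)) (dmat p d j)) =
    act X (p (Suc j)) (p (Suc (Suc j))) (dmat p d (Suc j)) ` ({..<p (Suc (Suc j))} \<rightarrow>\<^sub>E carrier X)"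
  using tensor_homology(3)[of d p, OF d dd X, of "Suc j"] unfolding Tor_eq by simp

lemma Ext_zero_iff:
  assumes X: "Module.module R X"
  shows "zero_module (Ext R (Suc j) N X) \<longleftrightarrow>
    lin_kernel (direct_power X (p (Suc j))) (direct_power X (p (Suc (Suc j))))
      (act X (p (Suc (Suc j))) (p (Suc j)) (mtransp (dmat p d (Suc j)))) =
    act X (p (Suc j)) (p j) (mtransp (dmat p d j)) ` ({..<p j} \<rightarrow>\<^sub>E carrier X)"
  using hom_cohomology_zero_iff[of d p, OF d dd X, of j] unfolding Ext_eq by simp

text \<open>
  The case distinction is that of the cycles in the definition of homology.
\<close>

lemma betti_of_slen:
  assumes "slen (direct_power (residue_module R \<nn>) (p i))
      (act (residue_module R \<nn>) (p i) (p (Suc i)) (dmat p d i) ` carrier (direct_power (residue_module R \<nn>) (p (Suc i))))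
      (case i of 0 \<Rightarrow> carrier (direct_power (residue_module R \<nn>) (p 0))
        | Suc j \<Rightarrow> lin_kernel (direct_power (residue_module R \<nn>) (p (Suc j))) (direct_power (residue_module R \<nn>) (p j))
            (act (residue_module R \<nn>) (p j) (p (Suc j)) (dmat p d j))) = enat b"
  shows "betti R \<nn> N i = b"
proof -
  let ?l = "residue_module R \<nn>"
  let ?H = "Tor R i N ?l"
  note l = residue_module_module
  note th = tensor_homology[of d p, OF d dd l, of i, folded Tor_eq]
  let ?cyc = "case i of 0 \<Rightarrow> carrier (direct_power ?l (p 0))
        | Suc j \<Rightarrow> lin_kernel (direct_power ?l (p (Suc j))) (direct_power ?l (p j)) (act ?l (p j) (p (Suc j)) (dmat p d j))"
  have cyc: "submodule ?cyc R (direct_power ?l (p i))" by (rule cycX_submodule[of d p, OF d dd l])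
  have kcyc: "killed ((direct_power ?l (p i))\<lparr>carrier := ?cyc\<rparr>) ?cyc"
    using killed_subset[OF residue_power_killed submodule_sub[OF direct_power_module[OF l] cyc]]
    by (simp add: killed_def)
  obtain g where g: "g \<in> lin_hom R ((direct_power ?l (p i))\<lparr>carrier := ?cyc\<rparr>) ?H" "g ` ?cyc = carrier ?H"
    using th(4) by blast
  have csub: "Z \<subseteq> carrier ((direct_power ?l (p i))\<lparr>carrier := Z\<rparr>)" for Z by simp
  have "killed ?H (carrier ?H)"
    unfolding g(2)[symmetric]
    by (rule killed_image[OF submodule.submodule_is_module[OF cyc direct_power_module[OF l]] th(1) g(1) csub kcyc])
  then have "vdim (R Quot \<nn>) (residue_space ?H) = b"
    using th(2) assms by (intro vdim_slen th(1)) simp_all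
  then show ?thesis by (simp add: betti_def)
qed

lemma betti_0: "betti R \<nn> N 0 + rk 0 = p 0"
proof -
  let ?l = "residue_module R \<nn>" and ?A = "act (residue_module R \<nn>) (p 0) (p (Suc 0)) (dmat p d 0)"
  note l = residue_module_module and P = direct_power_module[OF residue_module_module]
  let ?B = "?A ` carrier (direct_power ?l (p (Suc 0)))" and ?P = "direct_power ?l (p 0)"
  have B: "submodule ?B R ?P"
    by (rule submodule_image[OF P P act_lin_hom[OF l has_rank_mat[OF rk]] submodule_carrier[OF P]])
  have "slen ?P {\<zero>\<^bsub>?P\<^esub>} ?B = enat (rk 0)"
    using slen_act[OF rk[of 0] l submodule_carrier[OF l] residue_module_killed] by (simp add: residue_module_slen)
  then have "enat (p 0) = enat (rk 0) + slen ?P ?B (carrier ?P)"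
    using slen_add[OF P submodule_zero_set[OF P] B submodule_carrier[OF P]] submodule_zero[OF P B] submodule_sub[OF P B]
      residue_power_slen[of "p 0"] by (simp del: direct_power_simps)
  then obtain b where b: "slen ?P ?B (carrier ?P) = enat b" "p 0 = rk 0 + b"
    by (cases "slen ?P ?B (carrier ?P)") auto
  have "betti R \<nn> N 0 = b" by (rule betti_of_slen) (simp only: nat.case b(1))
  then show ?thesis using b(2) by simp
qed

lemma residue_complex:
  assumes "x \<in> {..<p (Suc (Suc i))} \<rightarrow>\<^sub>E carrier (residue_module R \<nn>)"
  shows "act (residue_module R \<nn>) (p i) (p (Suc i)) (dmat p d i)
      (act (residue_module R \<nn>) (p (Suc i)) (p (Suc (Suc i))) (dmat p d (Suc i)) x)
    = \<zero>\<^bsub>direct_power (residue_module R \<nn>) (p i)\<^esub>"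
  by (rule act_dmat_complex[of d p, OF d dd residue_module_module assms])

lemma residue_homology:
  "slen (direct_power (residue_module R \<nn>) (p (Suc i)))
      (act (residue_module R \<nn>) (p (Suc i)) (p (Suc (Suc i))) (dmat p d (Suc i)) ` ({..<p (Suc (Suc i))} \<rightarrow>\<^sub>E carrier (residue_module R \<nn>)))
      (lin_kernel (direct_power (residue_module R \<nn>) (p (Suc i))) (direct_power (residue_module R \<nn>) (p i))
        (act (residue_module R \<nn>) (p i) (p (Suc i)) (dmat p d i))) + enat (rk i + rk (Suc i)) = enat (p (Suc i))"
  using slen_homology[OF rk[of i] rk[of "Suc i"] residue_module_module residue_module_killed residue_complex]
  by (simp add: residue_module_slen)

lemma betti_Suc: "betti R \<nn> N (Suc i) + (rk i + rk (Suc i)) = p (Suc i)"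
proof -
  obtain b where b: "slen (direct_power (residue_module R \<nn>) (p (Suc i)))
      (act (residue_module R \<nn>) (p (Suc i)) (p (Suc (Suc i))) (dmat p d (Suc i)) ` ({..<p (Suc (Suc i))} \<rightarrow>\<^sub>E carrier (residue_module R \<nn>)))
      (lin_kernel (direct_power (residue_module R \<nn>) (p (Suc i))) (direct_power (residue_module R \<nn>) (p i))
        (act (residue_module R \<nn>) (p i) (p (Suc i)) (dmat p d i))) = enat b" (is "?s = _")
    using residue_homology[of i] by (cases ?s) auto
  have "betti R \<nn> N (Suc i) = b"
    by (rule betti_of_slen) (simp only: nat.case b direct_power_simps)
  then show ?thesis using residue_homology[of i] unfolding b by simp
qed

text \<open>
  If \<open>\<beta>\<^sub>1 = 0\<close>, the resolution is exact modulo the maximal ideal at its first step, and the projective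
  dimension is at most one.
\<close>

lemma betti_1_nonzero:
  assumes N: "Module.module R N" and pd: "proj_dim R N = \<infinity>"
    and e: "\<epsilon> \<in> lin_hom R (Rpow (p 0)) N" "\<epsilon> ` carrier (Rpow (p 0)) = carrier N"
    and ker: "d 0 ` carrier (Rpow (p 1)) = lin_kernel (Rpow (p 0)) N \<epsilon>"
  shows "betti R \<nn> N 1 \<noteq> 0"
proof
  assume b: "betti R \<nn> N 1 = 0"
  let ?l = "residue_module R \<nn>"
  note l = residue_module_module and P = direct_power_module[OF residue_module_module]
  let ?B = "act ?l (p (Suc 0)) (p (Suc (Suc 0))) (dmat p d (Suc 0)) ` ({..<p (Suc (Suc 0))} \<rightarrow>\<^sub>E carrier ?l)"
    and ?K = "lin_kernel (direct_power ?l (p (Suc 0))) (direct_power ?l (p 0)) (act ?l (p 0) (p (Suc 0)) (dmat p d 0))"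
  have B: "submodule ?B R (direct_power ?l (p (Suc 0)))"
    by (rule submodule_image[OF P P act_lin_hom[OF l has_rank_mat[OF rk]] submodule_power[OF l submodule_carrier[OF l]]])
  have K: "submodule ?K R (direct_power ?l (p (Suc 0)))"
    by (rule submodule_lin_kernel[OF P P act_lin_hom[OF l has_rank_mat[OF rk]]])
  have BK: "?B \<subseteq> ?K"
  proof
    fix z assume "z \<in> ?B"
    then obtain x where x: "x \<in> {..<p (Suc (Suc 0))} \<rightarrow>\<^sub>E carrier ?l" "z = act ?l (p (Suc 0)) (p (Suc (Suc 0))) (dmat p d (Suc 0)) x"
      by (elim imageE)
    show "z \<in> ?K" unfolding x(2) lin_kernel_def
      using act_closed[OF l has_rank_mat[OF rk] x(1)] residue_complex[OF x(1)]
      by (simp only: mem_Collect_eq direct_power_simps(1) simp_thms)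
  qed
  have "slen (direct_power ?l (p (Suc 0))) ?B ?K + enat (p (Suc 0)) = enat (p (Suc 0))"
    using residue_homology[of 0] betti_Suc[of 0] b by simp
  then have "slen (direct_power ?l (p (Suc 0))) ?B ?K = 0"
    by (cases "slen (direct_power ?l (p (Suc 0))) ?B ?K") (auto simp: zero_enat_def)
  then have "?B = ?K" using slen_zero_iff[OF B K BK] by simp
  then have exact: "?K = act ?l (p (Suc 0)) (p (Suc (Suc 0))) (dmat p d (Suc 0)) ` carrier (direct_power ?l (p (Suc (Suc 0))))"
    by simp
  have dact: "d i x = act (ring_module R) (p i) (p (Suc i)) (dmat p d i) x" if "x \<in> carrier (Rpow (p (Suc i)))" for i x
    using dmat_act[of d p, OF d dd ring_module] that by simp
  have k0: "lin_kernel (Rpow (p 0)) N \<epsilon> = act (ring_module R) (p 0) (p (Suc 0)) (dmat p d 0) ` carrier (Rpow (p (Suc 0)))"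
    unfolding ker[symmetric] One_nat_def by (intro image_cong refl dact)
  have AB: "act (ring_module R) (p 0) (p (Suc 0)) (dmat p d 0) (act (ring_module R) (p (Suc 0)) (p (Suc (Suc 0))) (dmat p d (Suc 0)) w)
      = \<zero>\<^bsub>Rpow (p 0)\<^esub>" if "w \<in> carrier (Rpow (p (Suc (Suc 0))))" for w
    using act_dmat_complex[of d p, OF d dd ring_module, of w 0] that by simp
  have "proj_dim R N \<le> 1"
    by (rule proj_dim_le_one_if_residue_exact[OF N e rk[of 0] has_rank_mat[OF rk[of "Suc 0"]] k0 AB exact])
  then show False using pd by simp
qed

end

section \<open>Relations between the Betti numbers\<close>

text \<open>
  From here on \<open>M\<close> is an extension of \<open>l\<^sup>m\<close> by \<open>l\<^sup>n\<close>, and \<open>V = N \<otimes> M\<close> is an extension of \<open>V/K\<close> by \<open>K\<close>,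
  both of them vector spaces over the residue field.
\<close>

context
  fixes N :: "('a, 'c, 'v) module_scheme" and M :: "('a, 'd, 'u) module_scheme"
    and p rk :: "nat \<Rightarrow> nat" and d :: "nat \<Rightarrow> (nat \<Rightarrow> 'a) \<Rightarrow> (nat \<Rightarrow> 'a)" and \<epsilon> :: "(nat \<Rightarrow> 'a) \<Rightarrow> 'c"
    and m n :: nat and \<iota> :: "(nat \<Rightarrow> 'a set) \<Rightarrow> 'd" and \<tau> :: "'d \<Rightarrow> (nat \<Rightarrow> 'a set)"
  assumes p: "p = fst (fg_free_resolution R N)" and d_res: "d = res_diff R N"
    and res_mod: "\<And>i. res_module R N i = Rpow (p i)"
    and d: "\<And>i. d i \<in> lin_hom R (Rpow (p (Suc i))) (Rpow (p i))"
    and dd: "\<And>i x. x \<in> carrier (Rpow (p (Suc (Suc i)))) \<Longrightarrow> d i (d (Suc i) x) = \<zero>\<^bsub>Rpow (p i)\<^esub>"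
    and rk: "\<And>i. has_rank (p i) (p (Suc i)) (dmat p d i) (rk i)"
    and N: "Module.module R N"
    and e: "\<epsilon> \<in> lin_hom R (Rpow (p 0)) N" "\<epsilon> ` carrier (Rpow (p 0)) = carrier N"
    and ker: "d 0 ` carrier (Rpow (p 1)) = lin_kernel (Rpow (p 0)) N \<epsilon>"
    and pd: "proj_dim R N = \<infinity>"
    and M: "Module.module R M" and m: "m \<ge> 1"
    and exact: "short_exact R (direct_power (residue_module R \<nn>) n) \<iota> M \<tau> (direct_power (residue_module R \<nn>) m)"
    and tor: "\<And>i. i \<ge> 1 \<Longrightarrow> zero_module (Tor R i N M)"
begin

abbreviation "l_m \<equiv> direct_power (residue_module R \<nn>) m"
abbreviation "l_n \<equiv> direct_power (residue_module R \<nn>) n"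
abbreviation "PM \<equiv> lin_kernel M l_m \<tau>"
abbreviation "VV \<equiv> tensor R N M"
abbreviation "\<phi> \<equiv> tensor_vec N M (p 0) \<epsilon>"
abbreviation "KK \<equiv> \<phi> ` ({..<p 0} \<rightarrow>\<^sub>E PM)"
abbreviation "b \<equiv> betti R \<nn> N"

lemmas resolution_data = p d_res res_mod d dd rk

lemma l_m_module: "Module.module R l_m" and l_n_module: "Module.module R l_n"
  by (rule direct_power_module[OF residue_module_module])+

lemma tau: "\<tau> \<in> lin_hom R M l_m" "\<tau> ` carrier M = carrier l_m"
  and iota: "\<iota> \<in> lin_hom R l_n M" "inj_on \<iota> (carrier l_n)" "\<iota> ` carrier l_n = PM"
  using exact by (simp_all add: short_exact_def)

lemma PM_submodule: "submodule PM R M"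
  by (rule submodule_lin_kernel[OF M l_m_module tau(1)])

lemma PM_killed: "killed M PM"
  unfolding iota(3)[symmetric] by (rule killed_image[OF l_n_module M iota(1) order_refl residue_power_killed])

lemma PM_slen: "slen M {\<zero>\<^bsub>M\<^esub>} PM = enat n"
proof -
  have z: "\<iota> \<zero>\<^bsub>l_n\<^esub> = \<zero>\<^bsub>M\<^esub>" by (rule lin_hom_zero[OF l_n_module M iota(1)])
  have zc: "\<zero>\<^bsub>l_n\<^esub> \<in> carrier l_n" by (rule submodule_zero[OF l_n_module submodule_carrier[OF l_n_module]])
  have "slen M (\<iota> ` {\<zero>\<^bsub>l_n\<^esub>}) (\<iota> ` carrier l_n) = slen l_n {\<zero>\<^bsub>l_n\<^esub>} (carrier l_n)"
  proof (rule slen_image[OF l_n_module M iota(1) submodule_zero_set[OF l_n_module] submodule_carrier[OF l_n_module]])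
    show "{\<zero>\<^bsub>l_n\<^esub>} \<subseteq> carrier l_n" using zc by simp
    fix x assume x: "x \<in> carrier l_n" "\<iota> x = \<zero>\<^bsub>M\<^esub>"
    have "x = \<zero>\<^bsub>l_n\<^esub>" by (rule inj_onD[OF iota(2) _ x(1) zc]) (simp only: x(2) z)
    then show "x \<in> {\<zero>\<^bsub>l_n\<^esub>}" by simp
  qed
  then show ?thesis unfolding iota(3) residue_power_slen by (simp only: image_insert image_empty z)
qed

lemma M_slen: "slen M {\<zero>\<^bsub>M\<^esub>} (carrier M) = enat (n + m)"
proof -
  have "slen M {\<zero>\<^bsub>M\<^esub>} (carrier M) = slen M {\<zero>\<^bsub>M\<^esub>} PM + slen M PM (carrier M)"
    using submodule_zero[OF M PM_submodule] submodule_sub[OF M PM_submodule]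
    by (intro slen_add M submodule_zero_set PM_submodule submodule_carrier) simp_all
  also have "slen M PM (carrier M) = enat m"
    using slen_surj[OF M l_m_module tau] by (simp only: residue_power_slen)
  finally show ?thesis by (simp add: PM_slen)
qed

lemma M_exact: "lin_kernel (direct_power M (p (Suc j))) (direct_power M (p j)) (act M (p j) (p (Suc j)) (dmat p d j)) =
    act M (p (Suc j)) (p (Suc (Suc j))) (dmat p d (Suc j)) ` ({..<p (Suc (Suc j))} \<rightarrow>\<^sub>E carrier M)"
  using tor[of "Suc j"] Tor_zero_iff[OF resolution_data M, of j] by simp

lemmas betti_eq = betti_0[OF resolution_data] betti_Suc[OF resolution_data]

lemma betti_step: "n * b (Suc i) = m * b (Suc (Suc i))"
proof -
  have "n * p (Suc i) + m * (rk (Suc i) + rk (Suc (Suc i))) = n * (rk i + rk (Suc i)) + m * p (Suc (Suc i))"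
    by (rule shift_length[OF rk rk rk M l_m_module tau residue_power_killed PM_killed PM_slen residue_power_slen M_exact M_exact])
  moreover have "p (Suc i) = b (Suc i) + (rk i + rk (Suc i))" "p (Suc (Suc i)) = b (Suc (Suc i)) + (rk (Suc i) + rk (Suc (Suc i)))"
    using betti_eq(2)[of i] betti_eq(2)[of "Suc i"] by simp_all
  ultimately show ?thesis by (simp add: algebra_simps)
qed

lemma b1_nonzero: "b 1 \<noteq> 0"
  by (rule betti_1_nonzero[OF resolution_data N pd e ker])

lemma eps_ker: "lin_kernel (Rpow (p 0)) N \<epsilon> = act (ring_module R) (p 0) (p (Suc 0)) (dmat p d 0) ` ({..<p (Suc 0)} \<rightarrow>\<^sub>E carrier R)"
proof -
  have "d 0 x = act (ring_module R) (p 0) (p (Suc 0)) (dmat p d 0) x" if "x \<in> carrier (Rpow (p (Suc 0)))" for x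
    using dmat_act[of d p, OF d dd ring_module] that by simp
  then have "d 0 ` carrier (Rpow (p (Suc 0))) = act (ring_module R) (p 0) (p (Suc 0)) (dmat p d 0) ` carrier (Rpow (p (Suc 0)))"
    by (intro image_cong refl)
  then show ?thesis unfolding ker[symmetric] by simp
qed

lemma VV_module: "Module.module R VV"
  by (rule tensor_module[OF N M])

lemma phi:
  "\<phi> \<in> lin_hom R (direct_power M (p 0)) VV" "\<phi> ` carrier (direct_power M (p 0)) = carrier VV"
  "lin_kernel (direct_power M (p 0)) VV \<phi> = act M (p 0) (p (Suc 0)) (dmat p d 0) ` ({..<p (Suc 0)} \<rightarrow>\<^sub>E carrier M)"
  using tensor_vec_lin_hom[OF M N e(1)] tensor_vec_surj[OF M N e has_rank_mat[OF rk] eps_ker]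
    tensor_vec_kernel[OF M N e has_rank_mat[OF rk] eps_ker] by simp_all

lemmas V_data = rk[of 0] rk[of "Suc 0"] M l_m_module tau residue_power_killed PM_killed PM_slen
  residue_power_slen M_exact[of 0] VV_module phi

lemma KK_slen: "\<exists>k. slen VV {\<zero>\<^bsub>VV\<^esub>} KK = enat k \<and> k + m * b 1 = n * b 0"
proof -
  have *: "slen VV {\<zero>\<^bsub>VV\<^esub>} KK + enat (rk 0 * n + p (Suc 0) * m) = enat (p 0 * n + (rk 0 + rk (Suc 0)) * m)"
    by (rule KV_length[OF V_data])
  then obtain k where k: "slen VV {\<zero>\<^bsub>VV\<^esub>} KK = enat k" by (cases "slen VV {\<zero>\<^bsub>VV\<^esub>} KK") auto
  have "p 0 = b 0 + rk 0" "p (Suc 0) = b 1 + (rk 0 + rk (Suc 0))" using betti_eq(1) betti_eq(2)[of 0] by simp_all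
  then have "k + m * b 1 = n * b 0" using * unfolding k by (simp add: algebra_simps)
  then show ?thesis using k by blast
qed

lemma WW_slen: "slen VV KK (carrier VV) = enat (m * b 0)"
proof -
  have *: "slen VV KK (carrier VV) + enat (rk 0 * m) = enat (p 0 * m)" by (rule WV_length[OF V_data])
  then obtain w where w: "slen VV KK (carrier VV) = enat w" by (cases "slen VV KK (carrier VV)") auto
  have "p 0 = b 0 + rk 0" using betti_eq(1) by simp
  then have "w = m * b 0" using * unfolding w by (simp add: algebra_simps)
  then show ?thesis using w by simp
qed

lemmas KK_submodule = KV_submodule[OF V_data] and KK_killed = KV_killed[OF V_data] and WW_killed = WV_killed[OF V_data]

text \<open>
  Otherwise \<open>K = 0\<close>, and the maximal ideal kills \<open>V\<close>, hence \<open>Hom(N, V)\<close> and \<open>M\<close>.  Then \<open>Tor\<^sub>1(N, M)\<close> has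
  length \<open>\<beta>\<^sub>1 (n + m)\<close>; but it vanishes, and \<open>\<beta>\<^sub>1\<close> does not.
\<close>

lemma betti_1_less_if_isomorphic:
  assumes iso: "lin_isomorphic R M (Hom_module R N VV)"
  shows "m * b 1 < n * b 0"
proof (rule ccontr)
  assume not: "\<not> m * b 1 < n * b 0"
  obtain k where k: "slen VV {\<zero>\<^bsub>VV\<^esub>} KK = enat k" "k + m * b 1 = n * b 0" using KK_slen by blast
  then have "slen VV {\<zero>\<^bsub>VV\<^esub>} KK = 0" using not by (simp add: zero_enat_def)
  then have K0: "KK = {\<zero>\<^bsub>VV\<^esub>}"
    using slen_zero_iff[OF submodule_zero_set[OF VV_module] KK_submodule] submodule_zero[OF VV_module KK_submodule] by simp
  interpret V: Module.module R VV by (rule VV_module)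
  interpret H: Module.module R "Hom_module R N VV" by (rule Hom_module_module[OF N VV_module])
  have Vk: "c \<odot>\<^bsub>VV\<^esub> v = \<zero>\<^bsub>VV\<^esub>" if c: "c \<in> \<nn>" and v: "v \<in> carrier VV" for c v
  proof -
    have cc: "c \<in> carrier R" using c a_subset by auto
    note q = quot_map_lin_hom[OF VV_module KK_submodule]
    have "KK +>\<^bsub>VV\<^esub> (c \<odot>\<^bsub>VV\<^esub> v) = c \<odot>\<^bsub>quot_module VV KK\<^esub> (KK +>\<^bsub>VV\<^esub> v)"
      by (rule lin_hom_smult[OF q cc v])
    also have "\<dots> = \<zero>\<^bsub>quot_module VV KK\<^esub>"
      using WW_killed c lin_hom_closed[OF q v] unfolding killed_def by blast
    finally have "c \<odot>\<^bsub>VV\<^esub> v \<in> KK"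
      using quot_map_zero_iff[OF VV_module KK_submodule V.smult_closed[OF cc v]] by simp
    then show ?thesis unfolding K0 by simp
  qed
  obtain f where f: "f \<in> lin_hom R M (Hom_module R N VV)" "inj_on f (carrier M)"
    using iso unfolding lin_isomorphic_def bij_betw_def by blast
  have kM: "killed M (carrier M)"
    unfolding killed_def
  proof (intro ballI)
    fix c x assume c: "c \<in> \<nn>" and x: "x \<in> carrier M"
    have cc: "c \<in> carrier R" using c a_subset by auto
    interpret M: Module.module R M by (rule M)
    have fx: "f x \<in> lin_hom R N VV" using lin_hom_closed[OF f(1) x] by (simp add: Hom_module_simps)
    have "f (c \<odot>\<^bsub>M\<^esub> x) = (\<lambda>y\<in>carrier N. c \<odot>\<^bsub>VV\<^esub> f x y)"
      using lin_hom_smult[OF f(1) cc x] by (simp add: Hom_module_simps)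
    also have "\<dots> = (\<lambda>y\<in>carrier N. \<zero>\<^bsub>VV\<^esub>)" by (intro restrict_ext Vk c lin_hom_closed[OF fx])
    also have "\<dots> = f \<zero>\<^bsub>M\<^esub>"
      using lin_hom_zero[OF M Hom_module_module[OF N VV_module] f(1)] by (simp add: Hom_module_simps)
    finally show "c \<odot>\<^bsub>M\<^esub> x = \<zero>\<^bsub>M\<^esub>"
      by (rule inj_onD[OF f(2)]) (simp_all add: cc x)
  qed
  have "slen (direct_power M (p (Suc 0))) (act M (p (Suc 0)) (p (Suc (Suc 0))) (dmat p d (Suc 0)) ` ({..<p (Suc (Suc 0))} \<rightarrow>\<^sub>E carrier M))
      (lin_kernel (direct_power M (p (Suc 0))) (direct_power M (p 0)) (act M (p 0) (p (Suc 0)) (dmat p d 0)))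
    + enat (rk 0 + rk (Suc 0)) * slen M {\<zero>\<^bsub>M\<^esub>} (carrier M) = enat (p (Suc 0)) * slen M {\<zero>\<^bsub>M\<^esub>} (carrier M)"
    by (rule slen_homology[OF rk rk M kM act_dmat_complex[of d p, OF d dd M]])
  then have "(rk 0 + rk (Suc 0)) * (n + m) = p (Suc 0) * (n + m)"
    unfolding M_exact slen_refl M_slen by simp
  then have "rk 0 + rk (Suc 0) = p (Suc 0)" using m by simp
  then have "b 1 = 0" using betti_eq(2)[of 0] by simp
  then show False using b1_nonzero by simp
qed

text \<open>
  By \<open>hom_length\<close> the length of \<open>Hom(N, V)\<close> is \<open>m \<beta>\<^sub>0\<^sup>2 + k (\<beta>\<^sub>0 - \<beta>\<^sub>1)\<close>, and that of \<open>M\<close> is \<open>m + n\<close>.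
\<close>

lemma betti_relation_if_Ext_1_zero:
  assumes ext: "zero_module (Ext R 1 N VV)" and len: "module_length R (Hom_module R N VV) = module_length R M"
    and k: "k + m * b 1 = n * b 0"
  shows "m + n + b 1 * k = b 0 * k + m * b 0 * b 0"
proof -
  note H = Hom_module_module[OF N VV_module]
  let ?\<psi> = "hom_vec (p 0) \<epsilon>" and ?P = "direct_power VV (p 0)"
  let ?K = "lin_kernel ?P (direct_power VV (p (Suc 0))) (act VV (p (Suc 0)) (p 0) (mtransp (dmat p d 0)))"
  note P = direct_power_module[OF VV_module]
  note pres = VV_module N e has_rank_mat[OF rk[of 0]] eps_ker
  have psi: "?\<psi> \<in> lin_hom R (Hom_module R N VV) ?P" by (rule hom_vec_lin_hom[OF pres])
  have z: "?\<psi> \<zero>\<^bsub>Hom_module R N VV\<^esub> = \<zero>\<^bsub>?P\<^esub>" by (rule lin_hom_zero[OF H P psi])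
  have zc: "\<zero>\<^bsub>Hom_module R N VV\<^esub> \<in> carrier (Hom_module R N VV)" by (rule submodule_zero[OF H submodule_carrier[OF H]])
  have "slen ?P (?\<psi> ` {\<zero>\<^bsub>Hom_module R N VV\<^esub>}) (?\<psi> ` carrier (Hom_module R N VV)) =
      slen (Hom_module R N VV) {\<zero>\<^bsub>Hom_module R N VV\<^esub>} (carrier (Hom_module R N VV))"
  proof (rule slen_image[OF H P psi submodule_zero_set[OF H] submodule_carrier[OF H]])
    show "{\<zero>\<^bsub>Hom_module R N VV\<^esub>} \<subseteq> carrier (Hom_module R N VV)" using zc by simp
    fix h assume h: "h \<in> carrier (Hom_module R N VV)" "?\<psi> h = \<zero>\<^bsub>?P\<^esub>"
    have "h = \<zero>\<^bsub>Hom_module R N VV\<^esub>" by (rule inj_onD[OF hom_vec_inj[OF pres] _ h(1) zc]) (simp only: h(2) z)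
    then show "h \<in> {\<zero>\<^bsub>Hom_module R N VV\<^esub>}" by simp
  qed
  then have "slen ?P {\<zero>\<^bsub>?P\<^esub>} ?K = module_length R (Hom_module R N VV)"
    unfolding hom_vec_image[OF pres] module_length_slen[OF H] by (simp only: image_insert image_empty z)
  also have "\<dots> = enat (n + m)" unfolding len module_length_slen[OF M] by (rule M_slen)
  finally have 1: "slen ?P {\<zero>\<^bsub>?P\<^esub>} ?K = enat (n + m)" .
  have k': "slen VV {\<zero>\<^bsub>VV\<^esub>} KK = enat k" using KK_slen k by auto
  have ex: "lin_kernel (direct_power VV (p (Suc 0))) (direct_power VV (p (Suc (Suc 0))))
      (act VV (p (Suc (Suc 0))) (p (Suc 0)) (mtransp (dmat p d (Suc 0)))) =
    act VV (p (Suc 0)) (p 0) (mtransp (dmat p d 0)) ` ({..<p 0} \<rightarrow>\<^sub>E carrier VV)"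
    using Ext_zero_iff[OF resolution_data VV_module, of 0] ext by simp
  have "slen ?P {\<zero>\<^bsub>?P\<^esub>} ?K + enat (p (Suc 0) * k + rk 0 * (m * b 0)) = enat (p 0 * k + rk (Suc 0) * k + p 0 * (m * b 0))"
    by (rule hom_length[OF rk rk VV_module KK_submodule KK_killed WW_killed k' WW_slen ex])
  then have "n + m + (p (Suc 0) * k + rk 0 * (m * b 0)) = p 0 * k + rk (Suc 0) * k + p 0 * (m * b 0)"
    unfolding 1 by simp
  moreover have "p 0 = b 0 + rk 0" "p (Suc 0) = b 1 + (rk 0 + rk (Suc 0))" using betti_eq(1) betti_eq(2)[of 0] by simp_all
  ultimately show ?thesis by (simp add: algebra_simps)
qed

text \<open>
  The shift argument for the transposed matrices and the extension \<open>V\<close> of \<open>V/K\<close> by \<open>K\<close>; exactness in the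
  degrees \<open>1\<close> and \<open>2\<close> is the vanishing of \<open>Ext\<^sup>1\<close> and \<open>Ext\<^sup>2\<close>.
\<close>

lemma betti_relation_if_Ext_zero:
  assumes ext: "\<And>i. i \<ge> 1 \<Longrightarrow> zero_module (Ext R i N VV)" and k: "k + m * b 1 = n * b 0"
  shows "k * b 2 = m * b 0 * b 1"
proof -
  let ?W = "quot_module VV KK" and ?q = "\<lambda>x. KK +>\<^bsub>VV\<^esub> x"
  note V = VV_module and K = KK_submodule
  have k': "slen VV {\<zero>\<^bsub>VV\<^esub>} (lin_kernel VV ?W ?q) = enat k" using KK_slen k unfolding quot_map_kernel[OF V K] by auto
  have kK: "killed VV (lin_kernel VV ?W ?q)" unfolding quot_map_kernel[OF V K] by (rule KK_killed)
  have w: "slen ?W {\<zero>\<^bsub>?W\<^esub>} (carrier ?W) = enat (m * b 0)" unfolding slen_quot_module[OF V K] by (rule WW_slen)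
  have ex: "lin_kernel (direct_power VV (p (Suc j))) (direct_power VV (p (Suc (Suc j))))
      (act VV (p (Suc (Suc j))) (p (Suc j)) (mtransp (dmat p d (Suc j)))) =
    act VV (p (Suc j)) (p j) (mtransp (dmat p d j)) ` ({..<p j} \<rightarrow>\<^sub>E carrier VV)" for j
    using Ext_zero_iff[OF resolution_data V, of j] ext[of "Suc j"] by simp
  note rt = has_rank_transp[OF rk]
  have "k * p (Suc (Suc 0)) + (m * b 0) * (rk (Suc 0) + rk 0) =
      k * (rk (Suc (Suc 0)) + rk (Suc 0)) + (m * b 0) * p (Suc 0)"
    by (rule shift_length[OF rt rt rt V quot_module_module[OF V K] quot_map_lin_hom[OF V K] quot_map_surj[OF V K]
          WW_killed kK k' w ex ex])
  moreover have "p (Suc 0) = b 1 + (rk 0 + rk (Suc 0))" "p (Suc (Suc 0)) = b 2 + (rk (Suc 0) + rk (Suc (Suc 0)))"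
    using betti_eq(2)[of 0] betti_eq(2)[of "Suc 0"] by (simp_all add: numeral_2_eq_2)
  ultimately show ?thesis by (simp add: algebra_simps)
qed

end

text \<open>
  The number \<open>k\<close> is the length of the image \<open>K\<close> of \<open>N \<otimes> l\<^sup>n\<close> in \<open>N \<otimes> M\<close>.
\<close>

lemma betti_relations:
  fixes N :: "('a, 'c, 'v) module_scheme" and M :: "('a, 'd, 'u) module_scheme"
  assumes N: "fg_module R N" and M: "fg_module R M" and pd: "proj_dim R N = \<infinity>" and m: "m \<ge> 1"
    and exact: "short_exact R (direct_power (residue_module R \<nn>) n) \<iota> M \<tau> (direct_power (residue_module R \<nn>) m)"
    and tor: "\<And>i. i \<ge> 1 \<Longrightarrow> zero_module (Tor R i N M)"
  obtains k where "k + m * betti R \<nn> N 1 = n * betti R \<nn> N 0"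
    and "betti R \<nn> N 1 \<noteq> 0"
    and "\<And>i. n * betti R \<nn> N (Suc i) = m * betti R \<nn> N (Suc (Suc i))"
    and "lin_isomorphic R M (Hom_module R N (tensor R N M)) \<Longrightarrow> m * betti R \<nn> N 1 < n * betti R \<nn> N 0"
    and "\<lbrakk>zero_module (Ext R 1 N (tensor R N M)); module_length R (Hom_module R N (tensor R N M)) = module_length R M\<rbrakk>
      \<Longrightarrow> m + n + betti R \<nn> N 1 * k = betti R \<nn> N 0 * k + m * betti R \<nn> N 0 * betti R \<nn> N 0"
    and "(\<And>i. i \<ge> 1 \<Longrightarrow> zero_module (Ext R i N (tensor R N M)))
      \<Longrightarrow> k * betti R \<nn> N 2 = m * betti R \<nn> N 0 * betti R \<nn> N 1"
proof -
  have Nm: "Module.module R N" and Mm: "Module.module R M" using N M by (simp_all add: fg_module_def)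
  obtain p d \<epsilon> where res: "p = fst (fg_free_resolution R N)" "d = res_diff R N"
      "\<And>i. res_module R N i = Rpow (p i)"
      "\<And>i. d i \<in> lin_hom R (Rpow (p (Suc i))) (Rpow (p i))"
    and e: "\<epsilon> \<in> lin_hom R (Rpow (p 0)) N" "\<epsilon> ` carrier (Rpow (p 0)) = carrier N"
    and ker: "d 0 ` carrier (Rpow (p 1)) = lin_kernel (Rpow (p 0)) N \<epsilon>"
    and ex: "\<And>i. d (Suc i) ` carrier (Rpow (p (Suc (Suc i)))) = lin_kernel (Rpow (p (Suc i))) (Rpow (p i)) (d i)"
    apply (rule chosen_resolution[OF N])
    subgoal premises prems for p d \<epsilon> by (rule prems(1)) (fact prems(2-9))+
    done
  have dd: "d i (d (Suc i) x) = \<zero>\<^bsub>Rpow (p i)\<^esub>" if x: "x \<in> carrier (Rpow (p (Suc (Suc i))))" for i x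
  proof -
    have "d (Suc i) x \<in> lin_kernel (Rpow (p (Suc i))) (Rpow (p i)) (d i)"
      unfolding ex[symmetric] by (rule imageI[OF x])
    then show ?thesis by (simp only: lin_kernel_def mem_Collect_eq)
  qed
  have "\<exists>r. has_rank (p i) (p (Suc i)) (dmat p d i) r" for i
    by (rule has_rank_exists, rule dmat_mat[of d p, OF res(4) _ ring_module], rule dd)
  then obtain rk where rk: "\<And>i. has_rank (p i) (p (Suc i)) (dmat p d i) (rk i)" by metis
  note data = res dd rk Nm e ker pd Mm m exact tor
  obtain k where k: "k + m * betti R \<nn> N 1 = n * betti R \<nn> N 0" using KK_slen[OF data] by blast
  show ?thesis
    by (rule that[OF k b1_nonzero[OF data] betti_step[OF data] betti_1_less_if_isomorphic[OF data] betti_relation_if_Ext_1_zero[OF data _ _ k] betti_relation_if_Ext_zero[OF data _ k]])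
qed

end

lemma quadratic_root_sign:
  fixes x p D :: real
  assumes "D = (2 * x - p)\<^sup>2"
  shows "\<exists>\<sigma> \<in> {1, -1 :: real}. x = 1/2 * (p + \<sigma> * sqrt D)"
proof (cases "2 * x \<ge> p")
  case True
  then show ?thesis using assms by (intro bexI[of _ 1]) simp_all
next
  case False
  then show ?thesis using assms by (intro bexI[of _ "-1"]) simp_all
qed

theorem theorem3p10:
  fixes S :: "('a, 's) ring_scheme"
    and \<nn> :: "'a set"
    and M :: "('a, 'b, 'u) module_scheme"
    and N :: "('a, 'c, 'v) module_scheme"
    and m n :: nat
    and \<iota> :: "(nat \<Rightarrow> 'a set) \<Rightarrow> 'b"
    and \<tau> :: "'b \<Rightarrow> (nat \<Rightarrow> 'a set)"
    and r :: real
    and \<beta> :: "nat \<Rightarrow> real"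
  assumes local: "noetherian_local_ring S \<nn>"
    and M: "fg_module S M"
    and N: "fg_module S N"
    and pd: "proj_dim S N = \<infinity>"
    and m: "m \<ge> 1"
    and exact: "short_exact S (direct_power (residue_module S \<nn>) n) \<iota> M \<tau>
                  (direct_power (residue_module S \<nn>) m)"
    and tor: "\<And>i. i \<ge> 1 \<Longrightarrow> zero_module (Tor S i N M)"
    and r: "r = real n / real m"
    and \<beta>: "\<And>i. \<beta> i = real (betti S \<nn> N i)"
  shows
    "(lin_isomorphic S M (Hom_module S N (tensor S N M)) \<longrightarrow> \<beta> 1 < \<beta> 0 * r) \<and>
     (zero_module (Ext S 1 N (tensor S N M)) \<and>
     module_length S (Hom_module S N (tensor S N M)) = module_length S M \<longrightarrow>
       (\<exists>\<sigma> \<in> {1, -1 :: real}.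
          \<beta> 1 = 1/2 * (\<beta> 0 * (r + 1)
                  + \<sigma> * sqrt ((\<beta> 0)\<^sup>2 * (r + 1)\<^sup>2 - 4 * ((\<beta> 0)\<^sup>2 - 1) * (r + 1))) \<and>
          \<beta> 1 = 1/2 * (\<beta> 0 * (r + 1)
                  + \<sigma> * sqrt ((r + 1) * ((\<beta> 0)\<^sup>2 * (r - 3) + 4)))) \<and>
       (\<beta> 0)\<^sup>2 * (r + 1)\<^sup>2 - 4 * ((\<beta> 0)\<^sup>2 - 1) * (r + 1)
          = (r + 1) * ((\<beta> 0)\<^sup>2 * (r - 3) + 4) \<and>
       (\<exists>k :: int. (\<beta> 0)\<^sup>2 * (r + 1)\<^sup>2 - 4 * ((\<beta> 0)\<^sup>2 - 1) * (r + 1) = (of_int k)\<^sup>2)) \<and>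
     (cohen_macaulay S \<nn> \<and> canonical_module S \<nn> N \<and>
     \<not> lin_isomorphic S N (ring_module S) \<and> in_auslander_class S N M \<longrightarrow>
       \<beta> 1 = \<beta> 0 * (r\<^sup>2 - 1) / r \<and>
       r = (\<beta> 1 + sqrt ((\<beta> 1)\<^sup>2 + 4 * (\<beta> 0)\<^sup>2)) / (2 * \<beta> 0))"
proof -
  interpret noetherian_local_ring S \<nn> by (rule local)
  define b where "b = betti S \<nn> N"
  obtain k where k: "k + m * b 1 = n * b 0" and b1: "b 1 \<noteq> 0"
    and step: "\<And>i. n * b (Suc i) = m * b (Suc (Suc i))"
    and a: "lin_isomorphic S M (Hom_module S N (tensor S N M)) \<Longrightarrow> m * b 1 < n * b 0"
    and b: "\<lbrakk>zero_module (Ext S 1 N (tensor S N M)); module_length S (Hom_module S N (tensor S N M)) = module_length S M\<rbrakk>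
      \<Longrightarrow> m + n + b 1 * k = b 0 * k + m * b 0 * b 0"
    and c: "(\<And>i. i \<ge> 1 \<Longrightarrow> zero_module (Ext S i N (tensor S N M))) \<Longrightarrow> k * b 2 = m * b 0 * b 1"
    by (rule betti_relations[OF N M pd m exact tor, folded b_def]) blast+
  have \<beta>b: "\<beta> i = real (b i)" for i by (simp add: \<beta> b_def)
  have m0: "real m > 0" using m by simp
  have mr: "real n = r * real m" using r m0 by simp
  have "real k + real m * \<beta> 1 = real n * \<beta> 0"
    unfolding \<beta>b of_nat_mult[symmetric] of_nat_add[symmetric] k ..
  \<comment> \<open>The relations are homogeneous in \<open>m\<close>, \<open>n\<close>, \<open>k\<close>; dividing by \<open>m\<close> leaves \<open>r\<close> and the Betti numbers.\<close>
  then have kr: "real k = real m * (r * \<beta> 0 - \<beta> 1)" unfolding mr by (simp add: algebra_simps)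
  have \<beta>1: "\<beta> 1 > 0" using b1 by (simp add: \<beta>b)

  have A: "\<beta> 1 < \<beta> 0 * r" if iso: "lin_isomorphic S M (Hom_module S N (tensor S N M))"
  proof -
    have "real (m * b 1) < real (n * b 0)" using a[OF iso] by (simp only: of_nat_less_iff)
    then show ?thesis using m0 unfolding of_nat_mult mr \<beta>b by (simp add: algebra_simps)
  qed

  let ?D = "(\<beta> 0)\<^sup>2 * (r + 1)\<^sup>2 - 4 * ((\<beta> 0)\<^sup>2 - 1) * (r + 1)"
  have D: "?D = (r + 1) * ((\<beta> 0)\<^sup>2 * (r - 3) + 4)" by (simp add: algebra_simps power2_eq_square)
  have B: "?D = (2 * \<beta> 1 - \<beta> 0 * (r + 1))\<^sup>2"
    if ext: "zero_module (Ext S 1 N (tensor S N M))"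
      and len: "module_length S (Hom_module S N (tensor S N M)) = module_length S M"
  proof -
    have "real (m + n + b 1 * k) = real (b 0 * k + m * b 0 * b 0)" using b[OF ext len] by simp
    then have "real m * (1 + r + \<beta> 1 * (r * \<beta> 0 - \<beta> 1)) = real m * (\<beta> 0 * (r * \<beta> 0 - \<beta> 1) + \<beta> 0 * \<beta> 0)"
      unfolding of_nat_add of_nat_mult \<beta>b[symmetric] kr mr by (simp add: algebra_simps)
    then have "1 + r + \<beta> 1 * (r * \<beta> 0 - \<beta> 1) = \<beta> 0 * (r * \<beta> 0 - \<beta> 1) + \<beta> 0 * \<beta> 0" using m0 by simp
    then show ?thesis by (simp add: power2_eq_square algebra_simps)
  qed
  have "m dvd n" by (rule dvd_if_geometric[OF m b1 step])
  then obtain q where q: "n = m * q" ..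
  have rq: "r = real q" using m0 by (simp add: r q)
  have square: "(2 * \<beta> 1 - \<beta> 0 * (r + 1))\<^sup>2 = (of_int (2 * int (b 1) - int (b 0) * (int q + 1)))\<^sup>2"
    by (simp add: rq \<beta>b)

  have C: "\<beta> 1 = \<beta> 0 * (r\<^sup>2 - 1) / r \<and> r = (\<beta> 1 + sqrt ((\<beta> 1)\<^sup>2 + 4 * (\<beta> 0)\<^sup>2)) / (2 * \<beta> 0)"
    if aus: "in_auslander_class S N M"
  proof -
    have "zero_module (Ext S i N (tensor S N M))" if "i \<ge> 1" for i
      using aus that unfolding in_auslander_class_def by blast
    then have "k * b 2 = m * b 0 * b 1" by (rule c)
    moreover have "n * b 1 = m * b 2" using step[of 0] by (simp add: numeral_2_eq_2)
    ultimately have "b 1 * (k * n) = b 1 * (m * m * b 0)" by (simp add: algebra_simps)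
    then have "k * n = m * m * b 0" using b1 by simp
    then have "real (k * n) = real (m * m * b 0)" by simp
    then have "real m * real m * ((r * \<beta> 0 - \<beta> 1) * r) = real m * real m * \<beta> 0"
      unfolding of_nat_mult kr mr \<beta>b[symmetric] by (simp add: algebra_simps)
    then have quad: "(r * \<beta> 0 - \<beta> 1) * r = \<beta> 0" using m0 by simp
    have "n * b 0 \<noteq> 0" using k b1 m by (metis add_is_0 mult_is_0 not_one_le_zero)
    then have r0: "r > 0" and \<beta>0: "\<beta> 0 > 0" using m0 by (simp_all add: \<beta>b r)
    have "\<beta> 1 = \<beta> 0 * (r\<^sup>2 - 1) / r" using quad r0 by (simp add: field_simps power2_eq_square)
    moreover have "(\<beta> 1)\<^sup>2 + 4 * (\<beta> 0)\<^sup>2 = (2 * \<beta> 0 * r - \<beta> 1)\<^sup>2"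
    proof -
      have "(2 * \<beta> 0 * r - \<beta> 1)\<^sup>2 = (\<beta> 1)\<^sup>2 + 4 * \<beta> 0 * ((r * \<beta> 0 - \<beta> 1) * r)"
        by (simp add: power2_eq_square algebra_simps)
      then show ?thesis unfolding quad by (simp add: power2_eq_square)
    qed
    moreover have "2 * \<beta> 0 * r - \<beta> 1 \<ge> 0"
    proof -
      have "r * \<beta> 0 - \<beta> 1 \<ge> 0" using kr m0 by (metis of_nat_0_le_iff zero_le_mult_iff not_less)
      moreover have "\<beta> 0 * r > 0" using r0 \<beta>0 by simp
      ultimately show ?thesis by (simp add: algebra_simps)
    qed
    ultimately show ?thesis using \<beta>0 by simp
  qed

  show ?thesis
  proof (intro conjI impI; (elim conjE)?)
    assume "lin_isomorphic S M (Hom_module S N (tensor S N M))" then show "\<beta> 1 < \<beta> 0 * r" by (rule A)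
  next
    assume "zero_module (Ext S 1 N (tensor S N M))"
      "module_length S (Hom_module S N (tensor S N M)) = module_length S M"
    then obtain \<sigma> where "\<sigma> \<in> {1, -1 :: real}" "\<beta> 1 = 1/2 * (\<beta> 0 * (r + 1) + \<sigma> * sqrt ?D)"
      using quadratic_root_sign[OF B] by blast
    then show "\<exists>\<sigma> \<in> {1, -1 :: real}.
          \<beta> 1 = 1/2 * (\<beta> 0 * (r + 1) + \<sigma> * sqrt ?D) \<and>
          \<beta> 1 = 1/2 * (\<beta> 0 * (r + 1) + \<sigma> * sqrt ((r + 1) * ((\<beta> 0)\<^sup>2 * (r - 3) + 4)))"
      unfolding D by blast
  next
    show "?D = (r + 1) * ((\<beta> 0)\<^sup>2 * (r - 3) + 4)" by (rule D)
  next
    assume "zero_module (Ext S 1 N (tensor S N M))"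
      "module_length S (Hom_module S N (tensor S N M)) = module_length S M"
    then show "\<exists>k :: int. ?D = (of_int k)\<^sup>2" using B square by metis
  next
    assume "in_auslander_class S N M"
    from C[OF this] show "\<beta> 1 = \<beta> 0 * (r\<^sup>2 - 1) / r" ..
  next
    assume "in_auslander_class S N M"
    from C[OF this] show "r = (\<beta> 1 + sqrt ((\<beta> 1)\<^sup>2 + 4 * (\<beta> 0)\<^sup>2)) / (2 * \<beta> 0)" ..
  qed
qed

end
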